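(* Let $X$ be the transient homogeneous diffusion with coefficients $a,b$ described in the context. Let $x,y\in\mathbb{R}$ and put $$\psi_y(0)=\frac12\left(\frac{1}{\Phi(y,+\infty)}-\frac{1}{\Phi(y,-\infty)}\right),\qquad \frac1{\pm\infty}:=0.$$ 1. In each of the cases: (i) $x=y$; (ii) $x<y$ and $-\Phi(0,-\infty)=+\infty$; (iii) $x>y$ and $\Phi(0,+\infty)=+\infty$, the local time $L^x_\infty(y)$ is exponentially distributed with parameter (rate) $\psi_y(0)$. 2. If $x<y$ and $-\Phi(0,-\infty)<+\infty$, then $L^x_\infty(y)$ is distributed as $\kappa\xi$, where $\xi$ is exponentially distributed with parameter $\psi_y(0)$ and $\kappa$ is a Bernoulli random variable independent of $\xi$ with $$\mathsf{P}(\kappa=0)=1-\mathsf{P}(\kappa=1)=\frac{\Phi(y,x)}{\Phi(y,-\infty)}.$$ 3. If $x>y$ and $\Phi(0,+\infty)<+\infty$, then $L^x_\infty(y)$ is distributed as $\kappa\xi$, where $\xi$ is exponentially distributed with parameter $\psi_y(0)$ and $\kappa$ is a Bernoulli random variable independent of $\xi$ with $$\mathsf{P}(\kappa=0)=1-\mathsf{P}(\kappa=1)=\frac{\Phi(y,x)}{\Phi(y,+\infty)}.$$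
   Context: On a complete filtered probability space $(\Omega,\mathcal{F},\{\mathcal{F}_t\}_{t\ge0},\mathsf{P})$ with a standard $\mathcal{F}_t$-Wiener process $W$, consider the family $\{X^x_t,\,t\ge 0,\,x\in\mathbb{R}\}$ of one-dimensional homogeneous diffusion processes $$dX^x_t=b(X^x_t)\,dt+a(X^x_t)\,dW_t,\quad t\ge 0,\qquad X_0^x=x.$$ The coefficients $a,b:\mathbb{R}\to\mathbb{R}$ are continuous, $a(x)\ne 0$ for all $x\in\mathbb{R}$, and they are such that a non-explosive weak solution on $\mathbb{R}$ exists. Define $\varphi(x_0,x)=\exp\left\{-2\int_{x_0}^{x}\frac{b(u)}{a(u)^2}\,du\right\}$ and $\Phi(x_0,x)=\int_{x_0}^x\varphi(x_0,z)\,dz$ for $x_0,x\in\mathbb{R}$, and $\Phi(x_0,\pm\infty)=\lim_{x\to\pm\infty}\Phi(x_0,x)$, so that $\Phi(x_0,+\infty)\in(0,+\infty]$ and $\Phi(x_0,-\infty)\in[-\infty,0)$. Transience assumption: at least one of $\Phi(x_0,+\infty)$, $\Phi(x_0,-\infty)$ is finite (for some, equivalently all, $x_0\in\mathbb{R}$). Local time: $L^x_t(y)=a(y)^2\lim_{\varepsilon\downarrow 0}\frac{1}{2\varepsilon}\int_0^t\mathbb{I}\{|X^x_s-y|\le\varepsilon\}\,ds$ (the limit exists almost surely), and $L^x_\infty(y)=\lim_{t\to+\infty}L^x_t(y)$. A random variable $\xi$ is exponentially distributed with parameter $\psi$ if $\mathsf{P}(\xi>l)=e^{-\psi l}$ for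 $l\ge 0$. *)

theory Defs
  imports "HOL-Probability.Probability"
begin

section \<open>Filtered probability spaces and Wiener processes\<close>

text \<open>
  The time axis is \<open>[0, \<infinity>)\<close>. The filtration is indexed by all reals only because the library
  locale \<open>filtration\<close> asks for an index type; a filtration on \<open>[0, \<infinity>)\<close> extends by \<open>F t = F 0\<close> for
  \<open>t < 0\<close>, and negative times are never used. Right-continuity is not required.
\<close>

locale complete_filtered_prob_space =
  prob_space M + complete_measure M + filtration "space M" F
  for M :: "'w measure" and F :: "real \<Rightarrow> 'w measure" +
  assumes subalg: "\<And>t. subalgebra M (F t)"
    and null_sets_F0: "null_sets M \<subseteq> sets (F 0)"

definition adapted_process :: "(real \<Rightarrow> 'w measure) \<Rightarrow> (real \<Rightarrow> 'w \<Rightarrow> real) \<Rightarrow> bool" where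
  "adapted_process F Y \<longleftrightarrow> (\<forall>t\<ge>0. Y t \<in> borel_measurable (F t))"

definition continuous_paths :: "'w measure \<Rightarrow> (real \<Rightarrow> 'w \<Rightarrow> real) \<Rightarrow> bool" where
  "continuous_paths M Y \<longleftrightarrow> (AE \<omega> in M. continuous_on {0..} (\<lambda>t. Y t \<omega>))"

definition wiener_process ::
  "'w measure \<Rightarrow> (real \<Rightarrow> 'w measure) \<Rightarrow> (real \<Rightarrow> 'w \<Rightarrow> real) \<Rightarrow> bool" where
  "wiener_process M F W \<longleftrightarrow>
     adapted_process F W \<and> continuous_paths M W \<and> (AE \<omega> in M. W 0 \<omega> = 0) \<and>
     (\<forall>s t. 0 \<le> s \<longrightarrow> s < t \<longrightarrow>
        distributed M lborel (\<lambda>\<omega>. W t \<omega> - W s \<omega>) (normal_density 0 (sqrt (t - s))) \<and>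
        prob_space.indep_set M (sets (F s))
          {(\<lambda>\<omega>. W t \<omega> - W s \<omega>) -` B \<inter> space M | B. B \<in> sets borel})"


section \<open>The It\^o integral\<close>

text \<open>
  A simple process is given by a number \<open>n\<close> of steps, times \<open>0 \<le> \<tau> 0 \<le> \<dots> \<le> \<tau> n\<close> and bounded
  \<open>F (\<tau> i)\<close>-measurable heights \<open>\<zeta> i\<close> on \<open>(\<tau> i, \<tau> (i + 1)]\<close>.
\<close>

definition simple_process ::
  "(real \<Rightarrow> 'w measure) \<Rightarrow> nat \<Rightarrow> (nat \<Rightarrow> real) \<Rightarrow> (nat \<Rightarrow> 'w \<Rightarrow> real) \<Rightarrow> bool" where
  "simple_process F n \<tau> \<zeta> \<longleftrightarrow>
     0 \<le> \<tau> 0 \<and> (\<forall>i<n. \<tau> i \<le> \<tau> (Suc i)) \<and>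
     (\<forall>i<n. \<zeta> i \<in> borel_measurable (F (\<tau> i)) \<and>
            (\<exists>C. \<forall>\<omega>\<in>space (F (\<tau> i)). \<bar>\<zeta> i \<omega>\<bar> \<le> C))"

definition simple_value ::
  "nat \<Rightarrow> (nat \<Rightarrow> real) \<Rightarrow> (nat \<Rightarrow> 'w \<Rightarrow> real) \<Rightarrow> real \<Rightarrow> 'w \<Rightarrow> real" where
  "simple_value n \<tau> \<zeta> t \<omega> = (\<Sum>i<n. \<zeta> i \<omega> * indicator {\<tau> i<..\<tau> (Suc i)} t)"

definition simple_integral ::
  "(real \<Rightarrow> 'w \<Rightarrow> real) \<Rightarrow> nat \<Rightarrow> (nat \<Rightarrow> real) \<Rightarrow> (nat \<Rightarrow> 'w \<Rightarrow> real) \<Rightarrow> real \<Rightarrow> 'w \<Rightarrow> real" where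
  "simple_integral W n \<tau> \<zeta> t \<omega> =
     (\<Sum>i<n. \<zeta> i \<omega> * (W (min (\<tau> (Suc i)) t) \<omega> - W (min (\<tau> i) t) \<omega>))"

text \<open>
  Measurability is part of the next definition because the library assigns measure \<open>0\<close> to
  nonmeasurable sets.
\<close>

definition tendsto_0_in_prob :: "'w measure \<Rightarrow> (nat \<Rightarrow> 'w \<Rightarrow> ennreal) \<Rightarrow> bool" where
  "tendsto_0_in_prob M Y \<longleftrightarrow>
     (\<forall>k. Y k \<in> borel_measurable M) \<and>
     (\<forall>\<epsilon>>0. (\<lambda>k. measure M {\<omega> \<in> space M. ennreal \<epsilon> < Y k \<omega>}) \<longlonglongrightarrow> 0)"

text \<open>
  \<open>ito_integral M F W H I\<close>: the process \<open>I\<close> is (a continuous version of) \<open>\<integral>\<^sub>0\<^sup>t H\<^sub>s dW\<^sub>s\<close>, the limit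
  in probability of integrals of simple processes \<open>H\<^sup>k\<close> with \<open>\<integral>\<^sub>0\<^sup>T (H\<^sup>k\<^sub>s - H\<^sub>s)\<^sup>2 ds \<rightarrow> 0\<close> in probability
  for every \<open>T\<close>. This is the usual extension to integrands that are square integrable
  on compact time intervals almost surely, without a moment condition.
\<close>

definition ito_integral ::
  "'w measure \<Rightarrow> (real \<Rightarrow> 'w measure) \<Rightarrow> (real \<Rightarrow> 'w \<Rightarrow> real) \<Rightarrow> (real \<Rightarrow> 'w \<Rightarrow> real) \<Rightarrow>
   (real \<Rightarrow> 'w \<Rightarrow> real) \<Rightarrow> bool" where
  "ito_integral M F W H I \<longleftrightarrow>
     adapted_process F I \<and> continuous_paths M I \<and>
     (\<exists>n \<tau> \<zeta>. (\<forall>k. simple_process F (n k) (\<tau> k) (\<zeta> k)) \<and>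
        (\<forall>T\<ge>0.
           tendsto_0_in_prob M (\<lambda>k \<omega>. \<integral>\<^sup>+s\<in>{0..T}.
             ennreal ((simple_value (n k) (\<tau> k) (\<zeta> k) s \<omega> - H s \<omega>)\<^sup>2) \<partial>lborel) \<and>
           tendsto_0_in_prob M (\<lambda>k \<omega>.
             ennreal \<bar>simple_integral W (n k) (\<tau> k) (\<zeta> k) T \<omega> - I T \<omega>\<bar>)))"


section \<open>Diffusions\<close>

text \<open>
  \<open>X\<close> is a solution of \<open>dX = b(X) dt + a(X) dW\<close>, \<open>X\<^sub>0 = x\<close>. It is non-explosive, being real-valued
  and continuous on the whole of \<open>[0, \<infinity>)\<close>.
\<close>

definition sde_solution ::
  "'w measure \<Rightarrow> (real \<Rightarrow> 'w measure) \<Rightarrow> (real \<Rightarrow> 'w \<Rightarrow> real) \<Rightarrow> (real \<Rightarrow> real) \<Rightarrow> (real \<Rightarrow> real) \<Rightarrow>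
   real \<Rightarrow> (real \<Rightarrow> 'w \<Rightarrow> real) \<Rightarrow> bool" where
  "sde_solution M F W b a x X \<longleftrightarrow>
     adapted_process F X \<and> continuous_paths M X \<and>
     (\<exists>I. ito_integral M F W (\<lambda>t \<omega>. a (X t \<omega>)) I \<and>
        (AE \<omega> in M. \<forall>t\<ge>0. X t \<omega> = x + (LBINT s:{0..t}. b (X s \<omega>)) + I t \<omega>))"

definition scale_density :: "(real \<Rightarrow> real) \<Rightarrow> (real \<Rightarrow> real) \<Rightarrow> real \<Rightarrow> real \<Rightarrow> real" where
  "scale_density b a x0 x = exp (- 2 * (LBINT u=ereal x0..ereal x. b u / (a u)\<^sup>2))"

definition Phi :: "(real \<Rightarrow> real) \<Rightarrow> (real \<Rightarrow> real) \<Rightarrow> real \<Rightarrow> real \<Rightarrow> real" where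
  "Phi b a x0 x = (LBINT z=ereal x0..ereal x. scale_density b a x0 z)"

definition Phi_pinf :: "(real \<Rightarrow> real) \<Rightarrow> (real \<Rightarrow> real) \<Rightarrow> real \<Rightarrow> ereal" where
  "Phi_pinf b a x0 = Lim at_top (\<lambda>x. ereal (Phi b a x0 x))"

definition Phi_minf :: "(real \<Rightarrow> real) \<Rightarrow> (real \<Rightarrow> real) \<Rightarrow> real \<Rightarrow> ereal" where
  "Phi_minf b a x0 = Lim at_bot (\<lambda>x. ereal (Phi b a x0 x))"

definition transient :: "(real \<Rightarrow> real) \<Rightarrow> (real \<Rightarrow> real) \<Rightarrow> bool" where
  "transient b a \<longleftrightarrow> (\<exists>x0. \<bar>Phi_pinf b a x0\<bar> \<noteq> \<infinity> \<or> \<bar>Phi_minf b a x0\<bar> \<noteq> \<infinity>)"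

text \<open>
  In \<open>ereal\<close>, \<open>1 / \<infinity> = 1 / - \<infinity> = 0\<close>; the value below is finite since \<open>Phi_minf b a y < 0 < Phi_pinf b a y\<close>.
\<close>

definition psi0 :: "(real \<Rightarrow> real) \<Rightarrow> (real \<Rightarrow> real) \<Rightarrow> real \<Rightarrow> real" where
  "psi0 b a y = real_of_ereal (1 / 2 * (1 / Phi_pinf b a y - 1 / Phi_minf b a y))"


section \<open>Local time\<close>

definition local_time ::
  "(real \<Rightarrow> real) \<Rightarrow> (real \<Rightarrow> 'w \<Rightarrow> real) \<Rightarrow> real \<Rightarrow> real \<Rightarrow> 'w \<Rightarrow> real" where
  "local_time a X t y \<omega> = (a y)\<^sup>2 *
     Lim (at_right 0) (\<lambda>\<epsilon>. 1 / (2 * \<epsilon>) * (LBINT s:{0..t}. indicator {s. \<bar>X s \<omega> - y\<bar> \<le> \<epsilon>} s))"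

definition local_time_inf ::
  "(real \<Rightarrow> real) \<Rightarrow> (real \<Rightarrow> 'w \<Rightarrow> real) \<Rightarrow> real \<Rightarrow> 'w \<Rightarrow> ereal" where
  "local_time_inf a X y \<omega> = Lim at_top (\<lambda>t. ereal (local_time a X t y \<omega>))"

definition exponentially_distributed :: "'w measure \<Rightarrow> ('w \<Rightarrow> ereal) \<Rightarrow> real \<Rightarrow> bool" where
  "exponentially_distributed M \<xi> \<psi> \<longleftrightarrow>
     \<xi> \<in> borel_measurable M \<and>
     (\<forall>l::real. 0 \<le> l \<longrightarrow> measure M {\<omega> \<in> space M. ereal l < \<xi> \<omega>} = exp (- \<psi> * l))"

text \<open>
  \<open>Z\<close> has the law of \<open>\<kappa> \<xi>\<close>, with \<open>\<kappa>\<close> Bernoulli, \<open>P(\<kappa> = 0) = 1 - P(\<kappa> = 1) = p\<close>, \<open>\<xi>\<close> exponential with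
  parameter \<open>\<psi>\<close>, and \<open>\<kappa>\<close>, \<open>\<xi>\<close> independent. The pair \<open>(\<kappa>, \<xi>)\<close> may live on another probability space
  than \<open>Z\<close>.
\<close>

definition distributed_as_bernoulli_times_exponential ::
  "'w measure \<Rightarrow> ('w \<Rightarrow> ereal) \<Rightarrow> real \<Rightarrow> real \<Rightarrow> bool" where
  "distributed_as_bernoulli_times_exponential M Z p \<psi> \<longleftrightarrow>
     Z \<in> borel_measurable M \<and>
     (\<exists>(N :: (real \<times> real) measure) (\<kappa> :: real \<times> real \<Rightarrow> real) (\<xi> :: real \<times> real \<Rightarrow> real).
        prob_space N \<and>
        prob_space.indep_var N borel \<kappa> borel \<xi> \<and>
        measure N {\<omega> \<in> space N. \<kappa> \<omega> = 0} = p \<and>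
        1 - measure N {\<omega> \<in> space N. \<kappa> \<omega> = 1} = p \<and>
        exponentially_distributed N (\<lambda>\<omega>. ereal (\<xi> \<omega>)) \<psi> \<and>
        distr M borel Z = distr N borel (\<lambda>\<omega>. ereal (\<kappa> \<omega> * \<xi> \<omega>)))"

end

theory Submission
  imports Defs
begin

text \<open>
  Let \<open>s = Phi b a y\<close>, \<open>k\<^sub>+ = 1 / s (+\<infinity>)\<close>, \<open>k\<^sub>- = - 1 / s (-\<infinity>)\<close> and \<open>v = max (k\<^sub>+ s) (- k\<^sub>- s)\<close>, a function
  that is harmonic for the generator away from \<open>y\<close>. The kink of \<open>v\<close> at \<open>y\<close> produces the local time: for
  continuous weights \<open>k\<close> concentrating at \<open>y\<close>, the generator maps a smoothed version of \<open>v\<close> to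
  \<open>\<psi> k\<close>, so the Feynman-Kac formula for \<open>1 + (l / \<psi>) v\<close> killed at rate \<open>l k\<close>, together with
  \<open>v (X t) \<rightarrow> 1\<close> (transience), shows that \<open>exp (- l \<integral>\<^sub>0\<^sup>\<infinity> k (X u) du)\<close> has expectation close to
  \<open>(\<psi> + l v(x)) / (\<psi> + l)\<close>. This is the Laplace transform of \<open>\<kappa> \<xi>\<close> with \<open>P(\<kappa> = 0) = v(x)\<close>.
  Applied to two weights and to their average, the estimate also gives the convergence of the
  occupation functionals in \<open>L\<^sup>2\<close>, fast enough for almost sure convergence, and the limit is the local time.

  Stopping times are avoided throughout: instead of stopping \<open>X\<close> before its coefficients get large,
  expectations are discounted by \<open>exp (- \<integral> c(X))\<close> with a rate \<open>c\<close> that dominates the coefficients.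
\<close>

section \<open>Integrals over compact intervals\<close>

text \<open>Why \<open>1 + (l / \<psi>) v\<close>: since \<open>v\<close> vanishes at
  \<open>y\<close>, the generator of this function minus the killing term is
  \<open>- l k (l / \<psi>) v\<close>, which is small as \<open>k\<close> lives near
  \<open>y\<close>. The constant \<open>\<psi>\<close> is half the jump
  \<open>k\<^sub>+ + k\<^sub>-\<close> of the slope of \<open>v\<close> in the scale, and
  \<open>v(x)\<close> is the probability of never reaching \<open>y\<close>. The obstacle is that
  the stochastic integral is known only as a limit in probability of simple integrals, without
  moments. Ito's formula is therefore proved in expectation for simple integrands \<open>H\<close>,
  and the discount rate contains \<open>\<delta> H\<^sup>2\<close>: the discounted integral of
  \<open>H\<^sup>2\<close> is then at most \<open>1 / \<delta>\<close> on every path, a bound that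
  survives the limit. Errors in the Laplace transform are linear in the radius of the weight, so
  squared L2 distances are too, and radii \<open>(i + 2)^-4\<close> make the distances summable. As
  \<open>exp (- L)\<close> lies in [0, 1], integer values of \<open>l\<close> determine the
  law.\<close>

lemma set_integral_Icc_split:
  fixes g :: "real \<Rightarrow> real"
  assumes "s \<le> r" "r \<le> t" "set_integrable lborel {s..t} g"
  shows "(LBINT u:{s..t}. g u) = (LBINT u:{s..r}. g u) + (LBINT u:{r..t}. g u)"
proof -
  have 1: "set_integrable lborel {s..r} g" "set_integrable lborel {r..t} g"
    using assms by (auto intro: set_integrable_subset[OF assms(3)])
  have "(LBINT u:{s..t}. g u) = (LBINT u:{s..r} \<union> {r..t}. g u)"
    using assms by (simp add: ivl_disj_un)
  also have "\<dots> = (LBINT u:{s..r}. g u) + (LBINT u:{r..t}. g u)"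
  proof (rule set_integral_Un_AE[OF _ _ _ 1])
    have "AE x in lborel. x \<noteq> r"
      by (rule AE_lborel_singleton)
    then show "AE x in lborel. \<not> (x \<in> {s..r} \<and> x \<in> {r..t})"
      by eventually_elim auto
  qed auto
  finally show ?thesis .
qed

lemma set_integrable_bounded_Icc:
  fixes g :: "real \<Rightarrow> real"
  assumes "set_borel_measurable lborel {s..t} g" "\<And>u. u \<in> {s..t} \<Longrightarrow> \<bar>g u\<bar> \<le> m"
  shows "set_integrable lborel {s..t} g"
  unfolding set_integrable_def
proof (rule Bochner_Integration.integrable_bound)
  show "integrable lborel (\<lambda>u. indicator {s..t} u * m)"
    by (auto intro!: integrable_mult_left simp: integrable_indicator_iff emeasure_lborel_Icc_eq)
  show "AE u in lborel. norm (indicator {s..t} u *\<^sub>R g u) \<le> norm (indicator {s..t} u * m)"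
    using assms(2) by (intro AE_I2) (force simp: indicator_def)
qed (use assms in \<open>simp add: set_borel_measurable_def\<close>)

text \<open>Integrability is not assumed: a non-integrable \<open>g\<close> has Bochner integral 0
  by convention, and 0 satisfies the bound because \<open>m\<close> is nonnegative.\<close>

lemma set_integral_Icc_bound:
  fixes g :: "real \<Rightarrow> real"
  assumes "s \<le> t" "\<And>u. u \<in> {s..t} \<Longrightarrow> \<bar>g u\<bar> \<le> m"
  shows "\<bar>LBINT u:{s..t}. g u\<bar> \<le> m * (t - s)"
proof (cases "set_integrable lborel {s..t} g")
  case True
  have "\<bar>LBINT u:{s..t}. g u\<bar> \<le> (LBINT u:{s..t}. \<bar>g u\<bar>)"
    using set_integral_norm_bound[OF True] by simp
  also have "\<dots> \<le> (LBINT u:{s..t}. m)"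
    using assms by (intro set_integral_mono set_integrable_abs[OF True])
      (auto simp: set_integrable_def integrable_indicator_iff emeasure_lborel_Icc_eq)
  also have "\<dots> = m * (t - s)"
    using assms by (simp add: set_lebesgue_integral_def)
  finally show ?thesis .
next
  case False
  have "0 \<le> m" using assms(2)[of s] assms(1) by force
  then show ?thesis
    using False assms by (simp add: set_lebesgue_integral_def set_integrable_def not_integrable_integral_eq)
qed

lemma set_integral_Icc_lipschitz:
  fixes g :: "real \<Rightarrow> real"
  assumes "set_integrable lborel {s..t} g" "\<And>u. u \<in> {s..t} \<Longrightarrow> \<bar>g u\<bar> \<le> m" "0 \<le> m"
    and "v \<le> t" "w \<le> t"
  shows "\<bar>(LBINT u:{s..v}. g u) - (LBINT u:{s..w}. g u)\<bar> \<le> m * \<bar>v - w\<bar>"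
proof -
  have *: "\<bar>(LBINT u:{s..v}. g u) - (LBINT u:{s..w}. g u)\<bar> \<le> m * \<bar>v - w\<bar>"
    if "w \<le> v" "v \<le> t" for v w
  proof (cases "s \<le> w")
    case True
    have "(LBINT u:{s..v}. g u) = (LBINT u:{s..w}. g u) + (LBINT u:{w..v}. g u)"
      using that True by (intro set_integral_Icc_split set_integrable_subset[OF assms(1)]) auto
    with set_integral_Icc_bound[of w v g m] assms(2) that True show ?thesis by auto
  next
    \<comment> \<open>Here \<open>{s..w}\<close> is empty and its integral 0: the primitive is
      constant to the left of \<open>s\<close>, so only the part of the step inside
      \<open>{s..v}\<close> counts.\<close>
    case False
    then have w: "(LBINT u:{s..w}. g u) = 0" by (simp add: set_lebesgue_integral_def)
    show ?thesis
    proof (cases "s \<le> v")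
      case True
      have "m * (v - s) \<le> m * (v - w)" using False assms by (intro mult_left_mono) auto
      with set_integral_Icc_bound[of s v g m] assms(2) that True w show ?thesis by force
    qed (use w assms(3) in \<open>simp add: set_lebesgue_integral_def\<close>)
  qed
  show ?thesis using *[of w v] *[of v w] assms(4,5)
    by (cases "w \<le> v") (auto simp: abs_minus_commute)
qed

lemma set_integral_Icc_continuous:
  fixes g :: "real \<Rightarrow> real"
  assumes "set_integrable lborel {s..t} g" "\<And>u. u \<in> {s..t} \<Longrightarrow> \<bar>g u\<bar> \<le> m" "0 \<le> m"
  shows "continuous_on {..t} (\<lambda>v. LBINT u:{s..v}. g u)"
proof -
  have "m-lipschitz_on {..t} (\<lambda>v. LBINT u:{s..v}. g u)"
    using set_integral_Icc_lipschitz[OF assms] assms(3) by (intro lipschitz_onI) (auto simp: dist_real_def)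
  then show ?thesis by (rule lipschitz_on_continuous_on)
qed

lemma set_integral_Icc_deriv:
  fixes g :: "real \<Rightarrow> real"
  assumes "set_integrable lborel {s..t} g" "s < v" "v < t" "isCont g v"
  shows "((\<lambda>v. LBINT u:{s..v}. g u) has_real_derivative g v) (at v)"
proof -
  have eq: "(LBINT u:{s..w}. g u) = integral {s..w} g" if "w \<le> t" for w
    using that by (intro set_borel_integral_eq_integral(2) set_integrable_subset[OF assms(1)]) auto
  have "((\<lambda>w. integral {s..w} g) has_vector_derivative g v) (at v within {s..t})"
    using assms set_borel_integral_eq_integral(1)[OF assms(1)]
    using integral_has_vector_derivative_continuous_at[of g s t v "{}"]
    by (auto intro: continuous_at_imp_continuous_at_within)
  then have "((\<lambda>w. integral {s..w} g) has_real_derivative g v) (at v)"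
    using assms by (simp add: at_within_Icc_at has_real_derivative_iff_has_vector_derivative)
  moreover have "eventually (\<lambda>w. w < t) (nhds v)"
    using assms by (simp add: eventually_nhds) (meson lessThan_iff open_lessThan)
  then have "eventually (\<lambda>w. integral {s..w} g = (LBINT u:{s..w}. g u)) (nhds v)"
    by eventually_elim (use eq in auto)
  ultimately show ?thesis
    using DERIV_cong_ev[of v v] by fastforce
qed

text \<open>The derivative of \<open>exp (- \<integral> g)\<close> off a finite set, together with
  continuity. The exceptional set \<open>N\<close> is there for step integrands, whose squares enter
  the discount rate and jump at finitely many times.\<close>

lemma exp_set_integral_FTC:
  fixes g :: "real \<Rightarrow> real"
  assumes g: "set_borel_measurable lborel {s..t} g" "\<And>u. u \<in> {s..t} \<Longrightarrow> \<bar>g u\<bar> \<le> m"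
    and "finite N" "\<And>u. u \<in> {s..t} - N \<Longrightarrow> isCont g u"
    and r: "s \<le> r" "r \<le> r'" "r' \<le> t"
  shows "(LBINT v:{r..r'}. exp (- (LBINT u:{s..v}. g u)) * g v) =
    exp (- (LBINT u:{s..r}. g u)) - exp (- (LBINT u:{s..r'}. g u))"
proof -
  have gi: "set_integrable lborel {s..t} g" by (rule set_integrable_bounded_Icc[OF g])
  let ?G = "\<lambda>v. exp (- (LBINT u:{s..v}. g u))"
  have "0 \<le> m" using g(2)[of s] r by force
  then have c: "continuous_on {..t} ?G"
    by (intro continuous_intros set_integral_Icc_continuous[OF gi g(2)])
  have cr: "continuous_on {r..r'} ?G"
    by (rule continuous_on_subset[OF c]) (use r in auto)
  have mG: "set_borel_measurable lborel {r..r'} ?G"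
    using borel_measurable_continuous_on_indicator[OF _ cr] unfolding set_borel_measurable_def by simp
  have gr: "set_borel_measurable lborel {r..r'} g"
    by (rule set_borel_measurable_subset[OF g(1)]) (use r in auto)
  obtain B where "\<forall>v\<in>{r..r'}. \<bar>?G v\<bar> \<le> B"
    using compact_imp_bounded[OF compact_continuous_image[OF cr compact_Icc]]
    by (auto simp: bounded_iff)
  then have B: "\<And>v. v \<in> {r..r'} \<Longrightarrow> \<bar>?G v\<bar> \<le> B" by blast
  have i: "set_integrable lborel {r..r'} (\<lambda>v. ?G v * g v)"
  proof (rule set_integrable_bounded_Icc)
    have "(\<lambda>x. (indicator {r..r'} x *\<^sub>R ?G x) * (indicator {r..r'} x *\<^sub>R g x)) \<in> borel_measurable lborel"
      using mG gr unfolding set_borel_measurable_def by (rule borel_measurable_times)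
    also have "(\<lambda>x. (indicator {r..r'} x *\<^sub>R ?G x) * (indicator {r..r'} x *\<^sub>R g x)) =
       (\<lambda>x. indicator {r..r'} x *\<^sub>R (?G x * g x))" by (auto simp: indicator_def)
    finally show "set_borel_measurable lborel {r..r'} (\<lambda>v. ?G v * g v)"
      unfolding set_borel_measurable_def .
    show "\<bar>?G v * g v\<bar> \<le> B * m" if "v \<in> {r..r'}" for v
      unfolding abs_mult using order_trans[OF abs_ge_zero B[OF that]] B[OF that] g(2)[of v] r that
      by (intro mult_mono) auto
  qed
  have "((\<lambda>v. ?G v * g v) has_integral ((- ?G r') - (- ?G r))) {r..r'}"
  proof (rule fundamental_theorem_of_calculus_interior_strong[of "insert s (insert t N)"])
    show "finite (insert s (insert t N))" using assms by simp
    show "((\<lambda>a. - ?G a) has_vector_derivative ?G x * g x) (at x)"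
      if "x \<in> {r<..<r'} - insert s (insert t N)" for x
      unfolding has_real_derivative_iff_has_vector_derivative[symmetric]
      by (auto intro!: derivative_eq_intros set_integral_Icc_deriv[OF gi] assms(4)) (use r that in auto)
    show "continuous_on {r..r'} (\<lambda>a. - ?G a)" by (rule continuous_on_minus[OF cr])
  qed fact
  then have "integral {r..r'} (\<lambda>v. ?G v * g v) = ?G r - ?G r'" by (simp add: integral_unique)
  with set_borel_integral_eq_integral(2)[OF i] show ?thesis by simp
qed

section \<open>Increments of the Wiener process and progressive measurability\<close>

text \<open>Unlike in \<open>wiener_process\<close>, paths are continuous for every
  \<open>\<omega>\<close> and at all real times, so that path arguments need no null sets;
  \<open>continuous_modification\<close> reduces the general case to this one.\<close>

locale wiener_setup = prob_space M + filtration "space M" F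
  for M :: "'w measure" and F :: "real \<Rightarrow> 'w measure" +
  fixes W :: "real \<Rightarrow> 'w \<Rightarrow> real"
  assumes subalg: "\<And>t. subalgebra M (F t)"
    and W_adapted: "\<And>t. 0 \<le> t \<Longrightarrow> W t \<in> borel_measurable (F t)"
    and W_cont: "\<And>\<omega>. continuous_on UNIV (\<lambda>t. W t \<omega>)"
    and W_dist: "\<And>s t. 0 \<le> s \<Longrightarrow> s < t \<Longrightarrow>
        distributed M lborel (\<lambda>\<omega>. W t \<omega> - W s \<omega>) (normal_density 0 (sqrt (t - s)))"
    and W_indep: "\<And>s t. 0 \<le> s \<Longrightarrow> s < t \<Longrightarrow> indep_set (sets (F s))
          {(\<lambda>\<omega>. W t \<omega> - W s \<omega>) -` B \<inter> space M | B. B \<in> sets borel}"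
begin

lemma F_mono: "s \<le> t \<Longrightarrow> f \<in> borel_measurable (F s) \<Longrightarrow> f \<in> borel_measurable (F t)"
  by (rule measurable_mono[THEN subsetD]) (use sets_F_mono space_F in auto)

lemma F_M: "f \<in> borel_measurable (F s) \<Longrightarrow> f \<in> borel_measurable M"
  by (rule measurable_from_subalg[OF subalg])

lemma increment_indep:
  assumes s: "0 \<le> s" "s < t" and Z: "Z \<in> borel_measurable (F s)"
  shows "indep_var borel Z borel (\<lambda>\<omega>. W t \<omega> - W s \<omega>)"
proof -
  have WM: "(\<lambda>\<omega>. W t \<omega> - W s \<omega>) \<in> borel_measurable M"
    using W_dist[OF s] by (simp add: distributed_def)
  have 1: "sigma_sets (space M) {Z -` A \<inter> space M |A. A \<in> sets borel} \<subseteq> sets (F s)"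
  proof (rule sets.sigma_sets_subset'[of _ "F s", simplified space_F])
    show "{Z -` A \<inter> space M |A. A \<in> sets borel} \<subseteq> sets (F s)"
      using measurable_sets[OF Z] space_F by auto
  qed (metis sets.top space_F)
  \<comment> \<open>Preimages of Borel sets already form a \<sigma>-algebra, so closing them up
    changes nothing and the assumed independence applies directly.\<close>
  have 2: "sigma_sets (space M) {(\<lambda>\<omega>. W t \<omega> - W s \<omega>) -` A \<inter> space M |A. A \<in> sets borel}
     = {(\<lambda>\<omega>. W t \<omega> - W s \<omega>) -` A \<inter> space M |A. A \<in> sets borel}"
    using sigma_sets_vimage_commute[of "\<lambda>\<omega>. W t \<omega> - W s \<omega>" "space M" "UNIV :: real set" "sets borel"]
    by (simp add: sets.sigma_sets_eq[of borel, simplified])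
  show ?thesis
    unfolding indep_var_eq 2
  proof (intro conjI F_M[OF Z] WM)
    show "indep_set (sigma_sets (space M) {Z -` A \<inter> space M |A. A \<in> sets borel})
      {(\<lambda>\<omega>. W t \<omega> - W s \<omega>) -` A \<inter> space M |A. A \<in> sets borel}"
      unfolding indep_set_def
      by (rule indep_sets_mono_sets[OF W_indep[OF s, unfolded indep_set_def]])
        (use 1 in \<open>simp split: bool.split\<close>)
  qed
qed

text \<open>The law is given for \<open>s < t\<close>; for \<open>s = t\<close> everything vanishes.
  The fourth moment enters because moduli of continuity will be quadratic and get multiplied by a
  squared increment in the Taylor remainder.\<close>

lemma increment_moments:
  assumes s: "0 \<le> s" "s \<le> t"
  shows "integrable M (\<lambda>\<omega>. W t \<omega> - W s \<omega>)" "expectation (\<lambda>\<omega>. W t \<omega> - W s \<omega>) = 0"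
    "integrable M (\<lambda>\<omega>. (W t \<omega> - W s \<omega>)\<^sup>2)" "expectation (\<lambda>\<omega>. (W t \<omega> - W s \<omega>)\<^sup>2) = t - s"
    "integrable M (\<lambda>\<omega>. (W t \<omega> - W s \<omega>)^4)" "expectation (\<lambda>\<omega>. (W t \<omega> - W s \<omega>)^4) = 3 * (t - s)\<^sup>2"
proof -
  have "integrable M (\<lambda>\<omega>. W t \<omega> - W s \<omega>) \<and> expectation (\<lambda>\<omega>. W t \<omega> - W s \<omega>) = 0 \<and>
    integrable M (\<lambda>\<omega>. (W t \<omega> - W s \<omega>)\<^sup>2) \<and> expectation (\<lambda>\<omega>. (W t \<omega> - W s \<omega>)\<^sup>2) = t - s \<and>
    integrable M (\<lambda>\<omega>. (W t \<omega> - W s \<omega>)^4) \<and> expectation (\<lambda>\<omega>. (W t \<omega> - W s \<omega>)^4) = 3 * (t - s)\<^sup>2"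
  proof (cases "s = t")
    case False
    with s have st: "s < t" by simp
    define \<sigma> where "\<sigma> = sqrt (t - s)"
    have \<sigma>: "0 < \<sigma>" "\<sigma>\<^sup>2 = t - s" using st by (auto simp: \<sigma>_def)
    note D = W_dist[OF s(1) st, folded \<sigma>_def]
    have *: "integrable M (\<lambda>\<omega>. (W t \<omega> - W s \<omega>)^k) \<and> expectation (\<lambda>\<omega>. (W t \<omega> - W s \<omega>)^k) = c"
      if "has_bochner_integral lborel (\<lambda>x. normal_density 0 \<sigma> x * (x - 0)^k) c" for k c
      using distributed_integrable[OF D, of "\<lambda>x. x^k"] distributed_integral[OF D, of "\<lambda>x. x^k"] that
      by (auto simp: has_bochner_integral_iff)
    from *[OF normal_moment_odd[OF \<sigma>(1), of 0 0]] *[OF normal_moment_even[OF \<sigma>(1), of 0 1]]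
      *[OF normal_moment_even[OF \<sigma>(1), of 0 2]] \<sigma>
    show ?thesis by (simp add: power_divide fact_numeral)
  qed auto
  then show "integrable M (\<lambda>\<omega>. W t \<omega> - W s \<omega>)" "expectation (\<lambda>\<omega>. W t \<omega> - W s \<omega>) = 0"
    "integrable M (\<lambda>\<omega>. (W t \<omega> - W s \<omega>)\<^sup>2)" "expectation (\<lambda>\<omega>. (W t \<omega> - W s \<omega>)\<^sup>2) = t - s"
    "integrable M (\<lambda>\<omega>. (W t \<omega> - W s \<omega>)^4)" "expectation (\<lambda>\<omega>. (W t \<omega> - W s \<omega>)^4) = 3 * (t - s)\<^sup>2"
    by blast+
qed

lemma bounded_integrable:
  fixes Z :: "'w \<Rightarrow> real"
  assumes "Z \<in> borel_measurable M" "\<And>\<omega>. \<omega> \<in> space M \<Longrightarrow> \<bar>Z \<omega>\<bar> \<le> m"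
  shows "integrable M Z"
  by (rule integrable_const_bound[of _ m]) (use assms in auto)

text \<open>Independence factorises the expectation. These facts remove the first-order term and the
  compensated second-order term from an expansion over one time step.\<close>

lemma increment_mean_zero:
  assumes s: "0 \<le> s" "s \<le> t" and Z: "Z \<in> borel_measurable (F s)" "\<And>\<omega>. \<omega> \<in> space M \<Longrightarrow> \<bar>Z \<omega>\<bar> \<le> m"
  shows "integrable M (\<lambda>\<omega>. Z \<omega> * (W t \<omega> - W s \<omega>))"
    "expectation (\<lambda>\<omega>. Z \<omega> * (W t \<omega> - W s \<omega>)) = 0"
    "integrable M (\<lambda>\<omega>. Z \<omega> * ((W t \<omega> - W s \<omega>)\<^sup>2 - (t - s)))"
    "expectation (\<lambda>\<omega>. Z \<omega> * ((W t \<omega> - W s \<omega>)\<^sup>2 - (t - s))) = 0"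
proof -
  have Zi: "integrable M Z" by (rule bounded_integrable[OF F_M[OF Z(1)] Z(2)])
  have "integrable M (\<lambda>\<omega>. Z \<omega> * (W t \<omega> - W s \<omega>)) \<and>
    expectation (\<lambda>\<omega>. Z \<omega> * (W t \<omega> - W s \<omega>)) = 0 \<and>
    integrable M (\<lambda>\<omega>. Z \<omega> * ((W t \<omega> - W s \<omega>)\<^sup>2 - (t - s))) \<and>
    expectation (\<lambda>\<omega>. Z \<omega> * ((W t \<omega> - W s \<omega>)\<^sup>2 - (t - s))) = 0"
  proof (cases "s = t")
    case False
    with s have st: "s < t" by simp
    note I = increment_indep[OF s(1) st Z(1)]
    have I2: "indep_var borel Z borel (\<lambda>\<omega>. (W t \<omega> - W s \<omega>)\<^sup>2 - (t - s))"
      using indep_var_compose[OF I, of id borel "\<lambda>x. x\<^sup>2 - (t - s)" borel] by (simp add: comp_def)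
    have i2: "integrable M (\<lambda>\<omega>. (W t \<omega> - W s \<omega>)\<^sup>2 - (t - s))"
      using increment_moments[OF s] by simp
    have e2: "expectation (\<lambda>\<omega>. (W t \<omega> - W s \<omega>)\<^sup>2 - (t - s)) = 0"
      using increment_moments[OF s] by (simp add: prob_space)
    show ?thesis
      using indep_var_integrable[OF I Zi] indep_var_lebesgue_integral[OF I Zi]
        indep_var_integrable[OF I2 Zi i2] indep_var_lebesgue_integral[OF I2 Zi i2]
        increment_moments[OF s] e2 by simp
  qed auto
  then show "integrable M (\<lambda>\<omega>. Z \<omega> * (W t \<omega> - W s \<omega>))"
    "expectation (\<lambda>\<omega>. Z \<omega> * (W t \<omega> - W s \<omega>)) = 0"
    "integrable M (\<lambda>\<omega>. Z \<omega> * ((W t \<omega> - W s \<omega>)\<^sup>2 - (t - s)))"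
    "expectation (\<lambda>\<omega>. Z \<omega> * ((W t \<omega> - W s \<omega>)\<^sup>2 - (t - s))) = 0"
    by blast+
qed

text \<open>Progressive measurability. Multiplying by the indicator of \<open>{0..T}\<close>
  replaces restricting the time axis, so that all statements live on the full product with
  \<open>lborel\<close>.\<close>

definition prog :: "(real \<Rightarrow> 'w \<Rightarrow> real) \<Rightarrow> bool" where
  "prog Y \<longleftrightarrow> (\<forall>T\<ge>0. (\<lambda>(u, \<omega>). indicator {0..T} u * Y u \<omega>) \<in> borel_measurable (lborel \<Otimes>\<^sub>M F T))"

lemma progD: "prog Y \<Longrightarrow> 0 \<le> T \<Longrightarrow>
    (\<lambda>x. indicator {0..T} (fst x) * Y (fst x) (snd x)) \<in> borel_measurable (lborel \<Otimes>\<^sub>M F T)"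
  by (auto simp: prog_def split_beta')

lemma progI: "(\<And>T. 0 \<le> T \<Longrightarrow>
    (\<lambda>x. indicator {0..T} (fst x) * Y (fst x) (snd x)) \<in> borel_measurable (lborel \<Otimes>\<^sub>M F T)) \<Longrightarrow> prog Y"
  by (auto simp: prog_def split_beta')

lemma prog_adapted:
  assumes "prog Y" "0 \<le> t"
  shows "Y t \<in> borel_measurable (F t)"
proof -
  have "(\<lambda>\<omega>. (t, \<omega>)) \<in> F t \<rightarrow>\<^sub>M lborel \<Otimes>\<^sub>M F t" by simp
  from measurable_compose[OF this progD[OF assms]]
  show ?thesis using assms(2) by simp
qed

lemma prog_comp2:
  assumes Y: "prog Y1" "prog Y2" and g: "(\<lambda>x. g (fst x) (snd x)) \<in> borel_measurable (borel \<Otimes>\<^sub>M borel)"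
  shows "prog (\<lambda>u \<omega>. g (Y1 u \<omega>) (Y2 u \<omega>) :: real)"
proof (rule progI)
  fix T :: real assume T: "0 \<le> T"
  note [measurable] = progD[OF Y(1) T] progD[OF Y(2) T]
  have "(\<lambda>x. (indicator {0..T} (fst x) * Y1 (fst x) (snd x), indicator {0..T} (fst x) * Y2 (fst x) (snd x)))
     \<in> (lborel \<Otimes>\<^sub>M F T) \<rightarrow>\<^sub>M (borel \<Otimes>\<^sub>M borel)" by measurable
  from measurable_compose[OF this g] have [measurable]:
    "(\<lambda>x. g (indicator {0..T} (fst x) * Y1 (fst x) (snd x)) (indicator {0..T} (fst x) * Y2 (fst x) (snd x)))
     \<in> borel_measurable (lborel \<Otimes>\<^sub>M F T)" by simp
  \<comment> \<open>\<open>g\<close> need not vanish at \<open>(0, 0)\<close>, hence the second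
    multiplication by the indicator.\<close>
  have "(\<lambda>x. indicator {0..T} (fst x) * g (indicator {0..T} (fst x) * Y1 (fst x) (snd x)) (indicator {0..T} (fst x) * Y2 (fst x) (snd x)))
     \<in> borel_measurable (lborel \<Otimes>\<^sub>M F T)" by measurable
  also have "(\<lambda>x. indicator {0..T} (fst x) * g (indicator {0..T} (fst x) * Y1 (fst x) (snd x)) (indicator {0..T} (fst x) * Y2 (fst x) (snd x)))
    = (\<lambda>x. indicator {0..T} (fst x) * g (Y1 (fst x) (snd x)) (Y2 (fst x) (snd x)))"
    by (auto simp: indicator_def)
  finally show "(\<lambda>x. indicator {0..T} (fst x) * g (Y1 (fst x) (snd x)) (Y2 (fst x) (snd x)))
     \<in> borel_measurable (lborel \<Otimes>\<^sub>M F T)" .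
qed

lemma prog_comp: "prog Y \<Longrightarrow> g \<in> borel_measurable borel \<Longrightarrow> prog (\<lambda>u \<omega>. g (Y u \<omega>) :: real)"
  using prog_comp2[of Y Y "\<lambda>x y. g x"] by simp

lemma prog_add: "prog Y1 \<Longrightarrow> prog Y2 \<Longrightarrow> prog (\<lambda>u \<omega>. Y1 u \<omega> + Y2 u \<omega>)"
  and prog_diff: "prog Y1 \<Longrightarrow> prog Y2 \<Longrightarrow> prog (\<lambda>u \<omega>. Y1 u \<omega> - Y2 u \<omega>)"
  and prog_mult: "prog Y1 \<Longrightarrow> prog Y2 \<Longrightarrow> prog (\<lambda>u \<omega>. Y1 u \<omega> * Y2 u \<omega>)"
  by (auto intro!: prog_comp2[where g="(+)"] prog_comp2[where g="(-)"] prog_comp2[where g="(*)"])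

lemma prog_const: "prog (\<lambda>u \<omega>. c)"
  by (rule progI) measurable

lemma prog_sum: "(\<And>i. i \<in> I \<Longrightarrow> prog (Y i)) \<Longrightarrow> prog (\<lambda>u \<omega>. \<Sum>i\<in>I. Y i u \<omega>)"
  by (induction I rule: infinite_finite_induct) (auto intro: prog_add prog_const)

lemma prog_step:
  assumes "0 \<le> t" "\<zeta> \<in> borel_measurable (F t)"
  shows "prog (\<lambda>u \<omega>. \<zeta> \<omega> * indicator {t<..t'} u)"
proof (rule progI)
  fix T :: real assume T: "0 \<le> T"
  show "(\<lambda>x. indicator {0..T} (fst x) * (\<zeta> (snd x) * indicator {t<..t'} (fst x)))
     \<in> borel_measurable (lborel \<Otimes>\<^sub>M F T)"
  proof (cases "t \<le> T")
    case True
    have [measurable]: "\<zeta> \<in> borel_measurable (F T)" by (rule F_mono[OF True assms(2)])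
    show ?thesis by measurable
  next
    \<comment> \<open>For \<open>T < t\<close> the step has not begun, so \<open>\<zeta>\<close>,
      which need not be \<open>F T\<close>-measurable, does not appear on
      \<open>[0, T]\<close>.\<close>
    case False
    then have "(\<lambda>x. indicator {0..T} (fst x) * (\<zeta> (snd x) * indicator {t<..t'} (fst x))) = (\<lambda>x. 0)"
      by (auto simp: indicator_def)
    then show ?thesis by simp
  qed
qed

lemma prog_continuous:
  assumes ad: "\<And>t. 0 \<le> t \<Longrightarrow> Y t \<in> borel_measurable (F t)"
    and co: "\<And>\<omega>. continuous_on {0..} (\<lambda>t. Y t \<omega>)"
  shows "prog Y"
proof (rule progI)
  fix T :: real assume T: "0 \<le> T"
  \<comment> \<open>Rounding down to multiples of \<open>1 / Suc n\<close> and clamping to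
    \<open>[0, T]\<close>: the rounded process uses only values observed by time \<open>T\<close>,
    and the rounded time takes countably many values, which makes the approximations jointly
    measurable.\<close>
  define d where "d n u = min T (max 0 (real_of_int \<lfloor>real (Suc n) * u\<rfloor> / real (Suc n)))" for n :: nat and u
  have d: "(\<lambda>n. d n u) \<longlonglongrightarrow> u" if "u \<in> {0..T}" for u
  proof (rule LIM_zero_cancel, rule Lim_transform_bound[of _ "\<lambda>n. inverse (real (Suc n))"])
    show "\<forall>\<^sub>F n in sequentially. norm (d n u - u) \<le> norm (inverse (real (Suc n)))"
    proof (intro always_eventually allI)
      fix n
      let ?q = "real_of_int \<lfloor>real (Suc n) * u\<rfloor> / real (Suc n)"
      have 1: "?q \<le> u" by (simp add: divide_le_eq mult.commute del: of_nat_Suc)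
      have "real (Suc n) * u - 1 \<le> real_of_int \<lfloor>real (Suc n) * u\<rfloor>" by linarith
      then have "u \<le> (real_of_int \<lfloor>real (Suc n) * u\<rfloor> + 1) / real (Suc n)"
        by (simp add: le_divide_eq mult.commute del: of_nat_Suc)
      then have 2: "u \<le> ?q + inverse (real (Suc n))"
        by (simp add: add_divide_distrib inverse_eq_divide del: of_nat_Suc)
      show "norm (d n u - u) \<le> norm (inverse (real (Suc n)))"
        using 1 2 that unfolding d_def by (simp del: of_nat_Suc)
    qed
    show "(\<lambda>n. inverse (real (Suc n))) \<longlonglongrightarrow> 0" by (rule LIMSEQ_inverse_real_of_nat)
  qed
  show "(\<lambda>x. indicator {0..T} (fst x) * Y (fst x) (snd x)) \<in> borel_measurable (lborel \<Otimes>\<^sub>M F T)"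
  proof (rule borel_measurable_LIMSEQ_real)
    show "(\<lambda>n. indicator {0..T} (fst x) * Y (d n (fst x)) (snd x)) \<longlonglongrightarrow> indicator {0..T} (fst x) * Y (fst x) (snd x)" for x
    proof (cases "fst x \<in> {0..T}")
      case True
      have "(\<lambda>n. Y (d n (fst x)) (snd x)) \<longlonglongrightarrow> Y (fst x) (snd x)"
        by (rule continuous_on_tendsto_compose[OF co d[OF True]]) (use True T in \<open>auto simp: d_def\<close>)
      then show ?thesis by (intro tendsto_intros)
    qed auto
    show "(\<lambda>x. indicator {0..T} (fst x) * Y (d n (fst x)) (snd x)) \<in> borel_measurable (lborel \<Otimes>\<^sub>M F T)" for n
    proof -
      define g where "g j x = Y (min T (max 0 (real_of_int j / real (Suc n)))) (snd x)" for j and x :: "real \<times> 'w"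
      have [measurable]: "g j \<in> borel_measurable (lborel \<Otimes>\<^sub>M F T)" for j
        unfolding g_def
        by (rule measurable_compose[OF measurable_snd]) (rule F_mono[OF _ ad], use T in auto)
      have "(\<lambda>x. g \<lfloor>real (Suc n) * fst x\<rfloor> x) \<in> borel_measurable (lborel \<Otimes>\<^sub>M F T)"
        by (rule measurable_compose_countable) (auto intro!: measurable_compose[OF measurable_fst])
      then show ?thesis unfolding g_def d_def by (intro borel_measurable_times) auto
    qed
  qed
qed

lemma prog_set_integral:
  assumes "prog Y" "0 \<le> s" "t \<le> T" "0 \<le> T"
  shows "(\<lambda>\<omega>. LBINT u:{s..t}. Y u \<omega>) \<in> borel_measurable (F T)"
proof -
  note [measurable] = progD[OF assms(1,4)]
  have "(\<lambda>\<omega>. \<integral>u. indicator {s..t} u * (indicator {0..T} u * Y u \<omega>) \<partial>lborel) \<in> borel_measurable (F T)"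
    by (rule lborel.borel_measurable_lebesgue_integral)
      (use measurable_pair_swap[OF progD[OF assms(1,4)]] in
        \<open>auto simp: split_beta' intro!: borel_measurable_times measurable_compose[OF measurable_snd]\<close>)
  also have "(\<lambda>\<omega>. \<integral>u. indicator {s..t} u * (indicator {0..T} u * Y u \<omega>) \<partial>lborel) = (\<lambda>\<omega>. LBINT u:{s..t}. Y u \<omega>)"
    unfolding set_lebesgue_integral_def
    by (intro ext Bochner_Integration.integral_cong) (use assms in \<open>auto simp: indicator_def\<close>)
  finally show ?thesis .
qed

lemma prog_path:
  assumes "prog Y" "0 \<le> s" "\<omega> \<in> space M"
  shows "set_borel_measurable lborel {s..t} (\<lambda>u. Y u \<omega>)"
proof (cases "s \<le> t")
  case True
  have "(\<lambda>u. (u, \<omega>)) \<in> lborel \<rightarrow>\<^sub>M lborel \<Otimes>\<^sub>M F t" using assms(3) space_F by simp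
  from measurable_compose[OF this progD[OF assms(1)]] True assms(2)
  have "(\<lambda>u. indicator {0..t} u * Y u \<omega>) \<in> borel_measurable lborel" by simp
  then have "(\<lambda>u. indicator {s..t} u * (indicator {0..t} u * Y u \<omega>)) \<in> borel_measurable lborel" by measurable
  also have "(\<lambda>u. indicator {s..t} u * (indicator {0..t} u * Y u \<omega>)) = (\<lambda>u. indicator {s..t} u *\<^sub>R Y u \<omega>)"
    using assms(2) by (auto simp: indicator_def)
  finally show ?thesis unfolding set_borel_measurable_def .
qed (simp add: set_borel_measurable_def)

lemma prog_joint:
  assumes "prog Y" "0 \<le> s"
  shows "(\<lambda>x. indicator {s..t} (fst x) * Y (fst x) (snd x)) \<in> borel_measurable (lborel \<Otimes>\<^sub>M M)"
proof (cases "s \<le> t")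
  case True
  have "(\<lambda>x. x) \<in> lborel \<Otimes>\<^sub>M M \<rightarrow>\<^sub>M lborel \<Otimes>\<^sub>M F t"
    using measurable_from_subalg[OF subalg, of "\<lambda>x. x" t "F t"]
    by (intro measurable_pair) (auto simp: comp_def intro!: measurable_compose[OF measurable_snd])
  from measurable_compose[OF this progD[OF assms(1)]] True assms(2)
  have [measurable]: "(\<lambda>x. indicator {0..t} (fst x) * Y (fst x) (snd x)) \<in> borel_measurable (lborel \<Otimes>\<^sub>M M)" by simp
  have "(\<lambda>x. indicator {s..t} (fst x) * (indicator {0..t} (fst x) * Y (fst x) (snd x))) \<in> borel_measurable (lborel \<Otimes>\<^sub>M M)"
    by measurable
  also have "(\<lambda>x. indicator {s..t} (fst x) * (indicator {0..t} (fst x) * Y (fst x) (snd x))) =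
    (\<lambda>x. indicator {s..t} (fst x) * Y (fst x) (snd x))"
    using assms(2) by (auto simp: indicator_def)
  finally show ?thesis .
qed simp

text \<open>Fubini's theorem for a nonnegative progressive integrand; the constant \<open>c\<close>
  provides integrability on the product with a bounded time interval.\<close>

lemma expectation_set_integral:
  assumes g: "prog g" "0 \<le> r" "r \<le> r'"
    and nn: "\<And>v \<omega>. 0 \<le> g v \<omega>" and i: "\<And>v. v \<in> {r..r'} \<Longrightarrow> integrable M (g v)"
    and e: "\<And>v. v \<in> {r..r'} \<Longrightarrow> expectation (g v) \<le> c"
  shows "integrable M (\<lambda>\<omega>. LBINT v:{r..r'}. g v \<omega>)"
    "expectation (\<lambda>\<omega>. LBINT v:{r..r'}. g v \<omega>) \<le> c * (r' - r)"
    "expectation (\<lambda>\<omega>. LBINT v:{r..r'}. g v \<omega>) = (LBINT v:{r..r'}. expectation (g v))"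
proof -
  interpret P: pair_sigma_finite lborel M ..
  let ?f = "\<lambda>(v, \<omega>). indicator {r..r'} v * g v \<omega>"
  have m[measurable]: "?f \<in> borel_measurable (lborel \<Otimes>\<^sub>M M)"
    using prog_joint[OF g(1,2), of r'] by (simp add: split_beta')
  have nnE: "0 \<le> expectation (g v)" for v by (simp add: nn integral_nonneg_AE)
  have "integrable (lborel \<Otimes>\<^sub>M M) ?f"
  proof (rule P.Fubini_integrable[OF m])
    show "integrable lborel (\<lambda>x. \<integral>y. norm (?f (x, y)) \<partial>M)"
    proof (rule Bochner_Integration.integrable_bound)
      show "integrable lborel (\<lambda>x. indicator {r..r'} x * c)"
        by (auto intro!: integrable_mult_left simp: integrable_indicator_iff emeasure_lborel_Icc_eq)
      show "AE x in lborel. norm (\<integral>y. norm (?f (x, y)) \<partial>M) \<le> norm (indicator {r..r'} x * c)"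
        using e nnE nn by (intro AE_I2) (force simp: indicator_def)
    qed measurable
    show "AE x in lborel. integrable M (\<lambda>y. ?f (x, y))"
      using i by (intro AE_I2) (auto simp: indicator_def)
  qed
  note I = P.integrable_snd[OF this] P.integral_snd[OF this] P.integral_fst[OF this] P.integrable_fst[OF this]
  show "integrable M (\<lambda>\<omega>. LBINT v:{r..r'}. g v \<omega>)"
    using I(1) by (simp add: set_lebesgue_integral_def)
  have "expectation (\<lambda>\<omega>. LBINT v:{r..r'}. g v \<omega>) = (\<integral>v. indicator {r..r'} v * expectation (g v) \<partial>lborel)"
    using I(2,3) by (simp add: set_lebesgue_integral_def)
  then show eq: "expectation (\<lambda>\<omega>. LBINT v:{r..r'}. g v \<omega>) = (LBINT v:{r..r'}. expectation (g v))"
    by (simp add: set_lebesgue_integral_def)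
  have ii: "set_integrable lborel {r..r'} (\<lambda>v. expectation (g v))"
    using I(4) by (simp add: set_integrable_def)
  have "(LBINT v:{r..r'}. expectation (g v)) \<le> (LBINT v:{r..r'}. c)"
    using e by (intro set_integral_mono ii)
      (auto simp: set_integrable_def integrable_indicator_iff emeasure_lborel_Icc_eq)
  also have "\<dots> = c * (r' - r)" using g(3) by (simp add: set_lebesgue_integral_def)
  finally show "expectation (\<lambda>\<omega>. LBINT v:{r..r'}. g v \<omega>) \<le> c * (r' - r)" using eq by simp
qed

end

text \<open>Close points are handled by uniform continuity, distant ones by paying the bound
  \<open>2 * b\<close> with \<open>(x - y)\<^sup>2\<close>. The quadratic form is chosen so that the
  expected modulus over a Brownian increment is a second moment: \<open>\<eta>\<close> can be made
  small, while \<open>C\<close> multiplies a further power of the step length.\<close>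

lemma uniformly_continuous_quadratic_modulus:
  fixes g :: "real \<Rightarrow> real"
  assumes "uniformly_continuous_on UNIV g" "\<And>x. \<bar>g x\<bar> \<le> b" "0 < \<eta>"
  obtains C where "0 \<le> C" "\<And>x y. \<bar>g x - g y\<bar> \<le> \<eta> + C * (x - y)\<^sup>2"
proof -
  obtain d where "0 < d" "\<forall>x y. dist y x < d \<longrightarrow> dist (g y) (g x) < \<eta>"
    using assms(1,3) unfolding uniformly_continuous_on_def by (meson UNIV_I)
  then have d: "0 < d" "\<And>x y. \<bar>x - y\<bar> < d \<Longrightarrow> \<bar>g x - g y\<bar> < \<eta>"
    by (auto simp: dist_real_def)
  have b: "0 \<le> b" using assms(2)[of 0] by linarith
  have "\<bar>g x - g y\<bar> \<le> \<eta> + (2 * b / d\<^sup>2) * (x - y)\<^sup>2" for x y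
  proof (cases "\<bar>x - y\<bar> < d")
    case True
    have "0 \<le> (2 * b / d\<^sup>2) * (x - y)\<^sup>2" using b by simp
    with d(2)[OF True] show ?thesis by linarith
  next
    case False
    then have "d\<^sup>2 \<le> (x - y)\<^sup>2" using d(1) abs_le_square_iff[of d "x - y"] by simp
    then have "2 * b * d\<^sup>2 \<le> 2 * b * (x - y)\<^sup>2" using b by (intro mult_left_mono) auto
    then have "2 * b \<le> (2 * b / d\<^sup>2) * (x - y)\<^sup>2" using d by (simp add: le_divide_eq)
    moreover have "\<bar>g x - g y\<bar> \<le> 2 * b" using assms(2)[of x] assms(2)[of y] by linarith
    ultimately show ?thesis using assms(3) by linarith
  qed
  with b that[of "2 * b / d\<^sup>2"] show ?thesis by simp
qed

text \<open>Lagrange form of the remainder: the second derivative is taken at some point no further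
  from \<open>y\<close> than \<open>\<bar>d\<bar>\<close>, and the modulus compares it with
  \<open>f2 y\<close>.\<close>

lemma Taylor2_quadratic_modulus:
  fixes f :: "real \<Rightarrow> real"
  assumes "\<And>x. (f has_real_derivative f1 x) (at x)" "\<And>x. (f1 has_real_derivative f2 x) (at x)"
    and C: "0 \<le> C" "\<And>x y. \<bar>f2 x - f2 y\<bar> \<le> \<eta> + C * (x - y)\<^sup>2" and "0 < \<eta>"
  shows "\<bar>f (y + d) - f y - f1 y * d - f2 y * d\<^sup>2 / 2\<bar> \<le> d\<^sup>2 * (\<eta> + C * d\<^sup>2) / 2"
proof (cases "d = 0")
  case False
  have "\<exists>t. (if y + d < y then y + d < t \<and> t < y else y < t \<and> t < y + d) \<and>
      f (y + d) = (\<Sum>m<2. (\<lambda>k. if k = 0 then f else if k = 1 then f1 else f2) m y / fact m * (y + d - y) ^ m)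
       + (\<lambda>k. if k = 0 then f else if k = 1 then f1 else f2) (2::nat) t / fact 2 * (y + d - y) ^ 2"
    by (rule Taylor[of 2 _ f "min y (y + d)" "max y (y + d)"])
      (use assms False in \<open>auto simp: less_2_cases_iff\<close>)
  then obtain t where *: "if y + d < y then y + d < t \<and> t < y else y < t \<and> t < y + d"
      "f (y + d) = (\<Sum>m<2. (\<lambda>k. if k = 0 then f else if k = 1 then f1 else f2) m y / fact m * (y + d - y) ^ m)
       + (\<lambda>k. if k = 0 then f else if k = 1 then f1 else f2) (2::nat) t / fact 2 * (y + d - y) ^ 2" by blast
  have t: "\<bar>t - y\<bar> \<le> \<bar>d\<bar>" using *(1) by (auto split: if_splits)
  have t2: "f (y + d) = f y + f1 y * d + f2 t / 2 * d\<^sup>2"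
    using *(2) by (simp add: numeral_2_eq_2)
  have "(t - y)\<^sup>2 \<le> d\<^sup>2" using t by (simp add: abs_le_square_iff)
  then have "\<bar>f2 t - f2 y\<bar> \<le> \<eta> + C * d\<^sup>2" using C(2)[of t y] mult_left_mono[OF _ C(1)] by fastforce
  then have "d\<^sup>2 * \<bar>f2 t - f2 y\<bar> \<le> d\<^sup>2 * (\<eta> + C * d\<^sup>2)" by (intro mult_left_mono) auto
  moreover have eq: "f (y + d) - f y - f1 y * d - f2 y * d\<^sup>2 / 2 = (f2 t - f2 y) * d\<^sup>2 / 2"
    using t2 by (simp add: field_simps)
  ultimately show ?thesis unfolding eq by (simp add: abs_mult mult.commute)
qed simp

text \<open>Agreement is required off the left endpoint only, since simple integrands are constant
  on intervals \<open>(\<tau> i, \<tau> (i + 1)]\<close>.\<close>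

lemma set_integral_Icc_cong:
  fixes f g :: "real \<Rightarrow> real"
  assumes "set_integrable lborel {r..t} f" "set_integrable lborel {r..t} g" "\<And>v. v \<in> {r<..t} \<Longrightarrow> f v = g v"
  shows "(LBINT v:{r..t}. f v) = (LBINT v:{r..t}. g v)"
  unfolding set_lebesgue_integral_def
proof (rule integral_cong_AE)
  show "AE v in lborel. indicator {r..t} v *\<^sub>R f v = indicator {r..t} v *\<^sub>R g v"
    using AE_lborel_singleton[of r] by eventually_elim (use assms(3) in \<open>auto simp: indicator_def\<close>)
qed (use assms in \<open>auto simp: set_integrable_def\<close>)

lemma continuous_atMost_UNIV:
  fixes g :: "real \<Rightarrow> real"
  assumes "\<And>t. continuous_on {..t} g" shows "continuous_on UNIV g"
proof -
  have "continuous_on {..<t} g" for t by (rule continuous_on_subset[OF assms[of t]]) auto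
  then have "continuous_on (\<Union>t::nat. {..<real t}) g" by (intro continuous_on_open_UN) auto
  moreover have "(\<Union>t::nat. {..<real t}) = UNIV" using reals_Archimedean2 by auto
  ultimately show ?thesis by simp
qed

context wiener_setup
begin

text \<open>Processes built from simple integrands are controlled for \<open>\<omega>\<close> in
  \<open>space M\<close> only; elsewhere they are replaced by 0, which measurability does not
  see.\<close>

lemma prog_continuous_space:
  assumes ad: "\<And>t. 0 \<le> t \<Longrightarrow> P t \<in> borel_measurable (F t)"
    and co: "\<And>\<omega>. \<omega> \<in> space M \<Longrightarrow> continuous_on {0..} (\<lambda>t. P t \<omega>)"
  shows "prog P"
proof -
  have "prog (\<lambda>t \<omega>. if \<omega> \<in> space M then P t \<omega> else (0::real))"
  proof (rule prog_continuous)
    show "(\<lambda>\<omega>. if \<omega> \<in> space M then P t \<omega> else 0) \<in> borel_measurable (F t)" if "0 \<le> t" for t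
      using ad[OF that] by (subst measurable_cong[of _ _ "P t"]) (auto simp: space_F)
    show "continuous_on {0..} (\<lambda>t. if \<omega> \<in> space M then P t \<omega> else (0::real))" for \<omega>
      using co by (cases "\<omega> \<in> space M") auto
  qed
  moreover have "(\<lambda>x. indicator {0..T} (fst x) * P (fst x) (snd x)) \<in> borel_measurable (lborel \<Otimes>\<^sub>M F T) \<longleftrightarrow>
    (\<lambda>x. indicator {0..T} (fst x) * (if snd x \<in> space M then P (fst x) (snd x) else 0))
      \<in> borel_measurable (lborel \<Otimes>\<^sub>M F T)" for T
    by (rule measurable_cong) (auto simp: space_pair_measure space_F)
  ultimately show ?thesis by (simp add: prog_def split_beta')
qed

end

section \<open>Discounted Dynkin formula for simple integrands\<close>

text \<open>
  \<open>D\<close> is shown to be constant by differentiation: by a second order expansion its increments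
  over steps of length \<open>h\<close> are \<open>o(h)\<close> off the finitely many times \<open>\<tau> i\<close>.
\<close>

locale simple_ito = wiener_setup M F W
  for M :: "'w measure" and F :: "real \<Rightarrow> 'w measure" and W :: "real \<Rightarrow> 'w \<Rightarrow> real" +
  fixes \<beta> \<gamma>0 :: "real \<Rightarrow> 'w \<Rightarrow> real" and n :: nat and \<tau> :: "nat \<Rightarrow> real" and \<zeta> :: "nat \<Rightarrow> 'w \<Rightarrow> real"
    and \<delta> x s m :: real and f f1 f2 :: "real \<Rightarrow> real" and Z :: "'w \<Rightarrow> real"
  assumes \<beta>_ad: "\<And>t. 0 \<le> t \<Longrightarrow> \<beta> t \<in> borel_measurable (F t)"
    and \<beta>_co: "\<And>\<omega>. continuous_on UNIV (\<lambda>t. \<beta> t \<omega>)" and \<beta>_bd: "\<And>t \<omega>. \<bar>\<beta> t \<omega>\<bar> \<le> m"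
    and \<gamma>0_ad: "\<And>t. 0 \<le> t \<Longrightarrow> \<gamma>0 t \<in> borel_measurable (F t)"
    and \<gamma>0_co: "\<And>\<omega>. continuous_on UNIV (\<lambda>t. \<gamma>0 t \<omega>)" and \<gamma>0_bd: "\<And>t \<omega>. \<bar>\<gamma>0 t \<omega>\<bar> \<le> m"
    and \<gamma>0_nn: "\<And>t \<omega>. 0 \<le> \<gamma>0 t \<omega>"
    and simple: "simple_process F n \<tau> \<zeta>"
    and \<zeta>_bd: "\<And>i \<omega>. i < n \<Longrightarrow> \<omega> \<in> space M \<Longrightarrow> \<bar>\<zeta> i \<omega>\<bar> \<le> m"
    and \<delta>: "0 \<le> \<delta>" and s: "0 \<le> s"
    and f1: "\<And>y. (f has_real_derivative f1 y) (at y)" and f2: "\<And>y. (f1 has_real_derivative f2 y) (at y)"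
    and f_bd: "\<And>y. \<bar>f y\<bar> \<le> m" "\<And>y. \<bar>f1 y\<bar> \<le> m" "\<And>y. \<bar>f2 y\<bar> \<le> m"
    and f_uc: "uniformly_continuous_on UNIV f" "uniformly_continuous_on UNIV f1" "uniformly_continuous_on UNIV f2"
    and Z: "Z \<in> borel_measurable (F s)" "\<And>\<omega>. \<omega> \<in> space M \<Longrightarrow> \<bar>Z \<omega>\<bar> \<le> m"
begin

definition H where "H u \<omega> = simple_value n \<tau> \<zeta> u \<omega>"
definition Y where "Y u \<omega> = x + (LBINT v:{0..u}. \<beta> v \<omega>) + simple_integral W n \<tau> \<zeta> u \<omega>"
definition \<gamma> where "\<gamma> u \<omega> = \<gamma>0 u \<omega> + \<delta> * (H u \<omega>)\<^sup>2"
definition G where "G u \<omega> = exp (- (LBINT v:{s..u}. \<gamma> v \<omega>))"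
definition K where "K u \<omega> = f1 (Y u \<omega>) * \<beta> u \<omega> + (H u \<omega>)\<^sup>2 * f2 (Y u \<omega>) / 2 - \<gamma> u \<omega> * f (Y u \<omega>)"
text \<open>The discounted value minus its drift: by Ito's formula \<open>V\<close> should be a
  martingale on \<open>[s, \<infinity>)\<close>. \<open>D\<close> tests this against the
  \<open>F s\<close>-measurable \<open>Z\<close>, so constancy of \<open>D\<close> takes the place
  of the martingale property.\<close>

definition V where "V u \<omega> = f (Y u \<omega>) * G u \<omega> - (LBINT v:{s..u}. G v \<omega> * K v \<omega>)"
definition D where "D u = expectation (\<lambda>\<omega>. Z \<omega> * V u \<omega>)"
text \<open>One bound for all data. The summand 1 makes powers of \<open>B\<close> increasing, so
  that products of different bounds may be replaced by a power of \<open>B\<close>.\<close>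

definition B where "B = m + 1 + real n * m + m + \<delta> * (real n * m)\<^sup>2"

lemma \<tau>: "i \<le> n \<Longrightarrow> 0 \<le> \<tau> i" "i < n \<Longrightarrow> \<tau> i \<le> \<tau> (Suc i)"
  and \<zeta>: "i < n \<Longrightarrow> \<zeta> i \<in> borel_measurable (F (\<tau> i))"
proof -
  show *: "i < n \<Longrightarrow> \<tau> i \<le> \<tau> (Suc i)" for i using simple by (auto simp: simple_process_def)
  show "i \<le> n \<Longrightarrow> 0 \<le> \<tau> i"
  proof (induction i)
    case (Suc i)
    then show ?case using *[of i] by auto
  qed (use simple in \<open>simp add: simple_process_def\<close>)
  show "i < n \<Longrightarrow> \<zeta> i \<in> borel_measurable (F (\<tau> i))" using simple by (auto simp: simple_process_def)
qed

lemma m0: "0 \<le> m" using f_bd(1)[of 0] by linarith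

lemma B1: "1 \<le> B" "m \<le> B" "real n * m \<le> B" "m + \<delta> * (real n * m)\<^sup>2 \<le> B"
  using m0 \<delta> by (auto simp: B_def add_increasing add_increasing2)

lemma H_bd: "\<omega> \<in> space M \<Longrightarrow> \<bar>H u \<omega>\<bar> \<le> real n * m"
proof -
  assume "\<omega> \<in> space M"
  then have "\<bar>\<Sum>i<n. \<zeta> i \<omega> * indicator {\<tau> i<..\<tau> (Suc i)} u\<bar> \<le> (\<Sum>i<n. m)"
    using \<zeta>_bd m0 by (intro order_trans[OF sum_abs] sum_mono) (auto simp: indicator_def)
  then show ?thesis by (simp add: H_def simple_value_def)
qed

lemma \<gamma>_nn: "0 \<le> \<gamma> u \<omega>"
  using \<gamma>0_nn \<delta> by (simp add: \<gamma>_def)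

lemma \<gamma>_bd: "\<omega> \<in> space M \<Longrightarrow> \<bar>\<gamma> u \<omega>\<bar> \<le> B"
proof -
  assume "\<omega> \<in> space M"
  from H_bd[OF this, of u] have "(H u \<omega>)\<^sup>2 \<le> (real n * m)\<^sup>2"
    using m0 by (metis abs_le_square_iff abs_of_nonneg mult_nonneg_nonneg of_nat_0_le_iff)
  then have "\<delta> * (H u \<omega>)\<^sup>2 \<le> \<delta> * (real n * m)\<^sup>2" by (rule mult_left_mono[OF _ \<delta>])
  then show ?thesis using \<gamma>0_bd[of u \<omega>] \<gamma>_nn[of u \<omega>] B1(4) by (simp add: \<gamma>_def)
qed

lemma \<beta>_prog: "prog \<beta>" and \<gamma>0_prog: "prog \<gamma>0"
  by (auto intro!: prog_continuous \<beta>_ad \<gamma>0_ad continuous_on_subset[OF \<beta>_co] continuous_on_subset[OF \<gamma>0_co])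

lemma H_prog: "prog H"
  unfolding H_def simple_value_def
  by (intro prog_sum prog_step) (auto intro: \<tau> \<zeta>)

lemma \<gamma>_prog: "prog \<gamma>"
  unfolding \<gamma>_def power2_eq_square
  by (intro prog_add prog_mult prog_const \<gamma>0_prog H_prog)

lemma int_\<beta>: "0 \<le> s' \<Longrightarrow> \<omega> \<in> space M \<Longrightarrow> set_integrable lborel {s'..t} (\<lambda>v. \<beta> v \<omega>)"
  by (rule set_integrable_bounded_Icc[OF prog_path[OF \<beta>_prog] \<beta>_bd])

lemma int_\<gamma>: "0 \<le> s' \<Longrightarrow> \<omega> \<in> space M \<Longrightarrow> set_integrable lborel {s'..t} (\<lambda>v. \<gamma> v \<omega>)"
  by (rule set_integrable_bounded_Icc[OF prog_path[OF \<gamma>_prog] \<gamma>_bd])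

lemma simple_integral_adapted: "0 \<le> u \<Longrightarrow> simple_integral W n \<tau> \<zeta> u \<in> borel_measurable (F u)"
proof -
  assume u: "0 \<le> u"
  have "(\<lambda>\<omega>. \<zeta> i \<omega> * (W (min (\<tau> (Suc i)) u) \<omega> - W (min (\<tau> i) u) \<omega>)) \<in> borel_measurable (F u)" if i: "i < n" for i
  proof (cases "\<tau> i \<le> u")
    case True
    have "\<zeta> i \<in> borel_measurable (F u)" by (rule F_mono[OF True \<zeta>[OF i]])
    moreover have "W (min (\<tau> (Suc i)) u) \<in> borel_measurable (F u)" "W (min (\<tau> i) u) \<in> borel_measurable (F u)"
      using \<tau>(1)[of i] \<tau>(1)[of "Suc i"] i u by (auto intro!: F_mono[OF _ W_adapted])
    ultimately show ?thesis by measurable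
  next
    case False
    then have "min (\<tau> (Suc i)) u = u" "min (\<tau> i) u = u" using \<tau>(2)[OF i] by auto
    then show ?thesis by simp
  qed
  then show ?thesis unfolding simple_integral_def by measurable
qed

lemma simple_integral_continuous: "continuous_on UNIV (\<lambda>u. simple_integral W n \<tau> \<zeta> u \<omega>)"
  unfolding simple_integral_def
  by (intro continuous_intros continuous_on_compose2[OF W_cont]) auto

lemma Y_continuous: "\<omega> \<in> space M \<Longrightarrow> continuous_on UNIV (\<lambda>u. Y u \<omega>)"
  unfolding Y_def
  by (intro continuous_intros simple_integral_continuous continuous_atMost_UNIV
    set_integral_Icc_continuous[where m=m] int_\<beta> \<beta>_bd m0) auto

lemma G_continuous: "\<omega> \<in> space M \<Longrightarrow> continuous_on UNIV (\<lambda>u. G u \<omega>)"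
  unfolding G_def
  by (intro continuous_intros continuous_atMost_UNIV set_integral_Icc_continuous[where m=B] int_\<gamma> \<gamma>_bd s)
    (use B1 in auto)

lemma G_bd: "0 < G u \<omega>" "G u \<omega> \<le> 1"
  unfolding G_def set_lebesgue_integral_def by (auto intro!: integral_nonneg_AE simp: \<gamma>_nn)

lemma Y_adapted: "0 \<le> u \<Longrightarrow> Y u \<in> borel_measurable (F u)"
  unfolding Y_def by (intro borel_measurable_add borel_measurable_const prog_set_integral[OF \<beta>_prog] simple_integral_adapted) auto

lemma G_adapted: "0 \<le> u \<Longrightarrow> G u \<in> borel_measurable (F u)"
  unfolding G_def using prog_set_integral[OF \<gamma>_prog s, of u u] by measurable

lemma Y_prog: "prog Y"
  by (rule prog_continuous_space[OF Y_adapted]) (auto intro: continuous_on_subset[OF Y_continuous])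

lemma G_prog: "prog G"
  by (rule prog_continuous_space[OF G_adapted]) (auto intro: continuous_on_subset[OF G_continuous])

lemma f_meas: "f \<in> borel_measurable borel" "f1 \<in> borel_measurable borel" "f2 \<in> borel_measurable borel"
  using f_uc by (auto intro!: borel_measurable_continuous_onI uniformly_continuous_imp_continuous)

lemma K_prog: "prog K"
proof -
  have "prog (\<lambda>u \<omega>. f1 (Y u \<omega>) * \<beta> u \<omega> + (H u \<omega> * H u \<omega>) * f2 (Y u \<omega>) * (1/2) - \<gamma> u \<omega> * f (Y u \<omega>))"
    by (intro prog_add prog_diff prog_mult prog_comp[OF Y_prog] f_meas H_prog \<beta>_prog \<gamma>_prog prog_const)
  then show ?thesis by (simp add: K_def[abs_def] power2_eq_square)
qed

lemma K_bd: "\<omega> \<in> space M \<Longrightarrow> \<bar>K u \<omega>\<bar> \<le> 3 * B ^ 3"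
proof -
  assume w: "\<omega> \<in> space M"
  have B: "1 \<le> B" "0 \<le> B" using B1 by auto
  have B3: "B\<^sup>2 \<le> B^3" using B by (intro power_increasing) auto
  have 1: "\<bar>f1 (Y u \<omega>) * \<beta> u \<omega>\<bar> \<le> B\<^sup>2"
    unfolding abs_mult power2_eq_square using f_bd(2)[of "Y u \<omega>"] \<beta>_bd[of u \<omega>] B1 B by (intro mult_mono) linarith+
  have 2: "\<bar>\<gamma> u \<omega> * f (Y u \<omega>)\<bar> \<le> B\<^sup>2"
    unfolding abs_mult power2_eq_square using f_bd(1)[of "Y u \<omega>"] \<gamma>_bd[OF w, of u] B1 B by (intro mult_mono) linarith+
  have "\<bar>H u \<omega>\<bar> \<le> B" using H_bd[OF w, of u] B1 by linarith
  then have "\<bar>(H u \<omega>)\<^sup>2\<bar> \<le> B\<^sup>2" using B by (simp add: abs_le_square_iff[symmetric])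
  then have 3: "\<bar>(H u \<omega>)\<^sup>2 * f2 (Y u \<omega>)\<bar> \<le> B\<^sup>2 * B"
    unfolding abs_mult using f_bd(3)[of "Y u \<omega>"] B1 B by (intro mult_mono) auto
  have "B\<^sup>2 * B = B^3" by (simp add: power3_eq_cube power2_eq_square)
  with 1 2 3 B3 show ?thesis unfolding K_def by linarith
qed

lemma GK_prog: "prog (\<lambda>u \<omega>. G u \<omega> * K u \<omega>)"
  by (intro prog_mult G_prog K_prog)

lemma GK_bd: "\<omega> \<in> space M \<Longrightarrow> \<bar>G u \<omega> * K u \<omega>\<bar> \<le> 3 * B ^ 3"
proof -
  assume w: "\<omega> \<in> space M"
  have "\<bar>G u \<omega>\<bar> * \<bar>K u \<omega>\<bar> \<le> 1 * (3 * B^3)"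
    using K_bd[OF w, of u] G_bd[of u \<omega>] by (intro mult_mono) auto
  then show ?thesis by (simp add: abs_mult)
qed

lemma int_GK: "0 \<le> s' \<Longrightarrow> \<omega> \<in> space M \<Longrightarrow> set_integrable lborel {s'..t} (\<lambda>v. G v \<omega> * K v \<omega>)"
  by (rule set_integrable_bounded_Icc[OF prog_path[OF GK_prog] GK_bd])

lemma V_adapted: "0 \<le> u \<Longrightarrow> V u \<in> borel_measurable (F u)"
  unfolding V_def using prog_set_integral[OF GK_prog s, of u u] prog_adapted[OF Y_prog, of u] G_adapted[of u] f_meas
  by measurable

lemma V_continuous: "\<omega> \<in> space M \<Longrightarrow> continuous_on UNIV (\<lambda>u. V u \<omega>)"
  unfolding V_def
  by (intro continuous_intros G_continuous continuous_on_compose2[OF uniformly_continuous_imp_continuous[OF f_uc(1)] Y_continuous]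
    continuous_atMost_UNIV set_integral_Icc_continuous[where m="3*B^3"] int_GK GK_bd s) (use B1 in auto)

lemma V_bd: "\<omega> \<in> space M \<Longrightarrow> s \<le> u \<Longrightarrow> \<bar>V u \<omega>\<bar> \<le> B + 3 * B ^ 3 * (u - s)"
proof -
  assume w: "\<omega> \<in> space M" "s \<le> u"
  have "\<bar>f (Y u \<omega>)\<bar> * \<bar>G u \<omega>\<bar> \<le> B * 1"
    using G_bd[of u \<omega>] f_bd(1)[of "Y u \<omega>"] B1 by (intro mult_mono) auto
  moreover have "\<bar>LBINT v:{s..u}. G v \<omega> * K v \<omega>\<bar> \<le> 3 * B^3 * (u - s)"
    by (rule set_integral_Icc_bound[OF w(2) GK_bd[OF w(1)]])
  ultimately show ?thesis unfolding V_def
    using abs_triangle_ineq4[of "f (Y u \<omega>) * G u \<omega>" "LBINT v:{s..u}. G v \<omega> * K v \<omega>"] by (simp add: abs_mult)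
qed

lemma ZV_integrable: "s \<le> u \<Longrightarrow> integrable M (\<lambda>\<omega>. Z \<omega> * V u \<omega>)"
proof (rule bounded_integrable)
  assume u: "s \<le> u"
  show "(\<lambda>\<omega>. Z \<omega> * V u \<omega>) \<in> borel_measurable M"
    using F_M[OF Z(1)] F_M[OF V_adapted[OF order_trans[OF s u]]] by measurable
  show "\<bar>Z \<omega> * V u \<omega>\<bar> \<le> m * (B + 3 * B ^ 3 * (u - s))" if "\<omega> \<in> space M" for \<omega>
    unfolding abs_mult using Z(2)[OF that] V_bd[OF that u] m0 by (intro mult_mono) auto
qed

lemma D_continuous: "continuous_on {s..t} D"
proof (rule continuous_on_sequentiallyI)
  fix u a assume u: "\<forall>k. u k \<in> {s..t}" "a \<in> {s..t}" "u \<longlonglongrightarrow> a"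
  show "(\<lambda>k. D (u k)) \<longlonglongrightarrow> D a"
    unfolding D_def
  proof (rule integral_dominated_convergence[where w="\<lambda>_. m * (B + 3 * B ^ 3 * (t - s))"])
    show "AE \<omega> in M. (\<lambda>k. Z \<omega> * V (u k) \<omega>) \<longlonglongrightarrow> Z \<omega> * V a \<omega>"
      by (intro AE_I2 tendsto_intros continuous_on_tendsto_compose[OF V_continuous u(3)]) auto
    show "AE \<omega> in M. norm (Z \<omega> * V (u k) \<omega>) \<le> m * (B + 3 * B ^ 3 * (t - s))" for k
    proof (rule AE_I2)
      fix \<omega> assume w: "\<omega> \<in> space M"
      have uk: "s \<le> u k" "u k \<le> t" using u(1) by auto
      have "3 * B ^ 3 * (u k - s) \<le> 3 * B ^ 3 * (t - s)" using uk B1 by (intro mult_left_mono) auto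
      then show "norm (Z \<omega> * V (u k) \<omega>) \<le> m * (B + 3 * B ^ 3 * (t - s))"
        unfolding real_norm_def abs_mult using Z(2)[OF w] V_bd[OF w uk(1)] m0 by (intro mult_mono) auto
    qed
  qed (use u s in \<open>auto intro!: borel_measurable_integrable ZV_integrable\<close>)
qed

text \<open>A step \<open>(r, r']\<close> with no \<open>\<tau> i\<close> in its interior lies
  inside one interval of the simple process or misses all of them; thus \<open>H\<close> is a single
  \<open>F r\<close>-measurable variable there and the simple integral is linear in
  \<open>W\<close>.\<close>

lemma H_piece:
  assumes r: "0 \<le> r" "r < r'" and piece: "\<And>i. i \<le> n \<Longrightarrow> \<tau> i \<le> r \<or> r' \<le> \<tau> i"
  obtains \<zeta>' where "\<zeta>' \<in> borel_measurable (F r)"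
    "\<And>u \<omega>. u \<in> {r<..r'} \<Longrightarrow> H u \<omega> = \<zeta>' \<omega>"
    "\<And>v \<omega>. v \<in> {r..r'} \<Longrightarrow> simple_integral W n \<tau> \<zeta> v \<omega> =
        simple_integral W n \<tau> \<zeta> r \<omega> + \<zeta>' \<omega> * (W v \<omega> - W r \<omega>)"
proof
  \<comment> \<open>\<open>c\<close> picks the interval containing the step; as
    \<open>r < r'\<close>, there is at most one.\<close>
  define c :: "nat \<Rightarrow> real" where "c i = (if \<tau> i \<le> r \<and> r' \<le> \<tau> (Suc i) then 1 else 0)" for i
  define \<zeta>' where "\<zeta>' \<omega> = (\<Sum>i<n. \<zeta> i \<omega> * c i)" for \<omega>
  have p: "\<tau> i \<le> r \<and> \<tau> (Suc i) \<le> r \<or> \<tau> i \<le> r \<and> r' \<le> \<tau> (Suc i) \<or> r' \<le> \<tau> i \<and> r' \<le> \<tau> (Suc i)"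
    if "i < n" for i
    using piece[of i] piece[of "Suc i"] \<tau>(2)[OF that] that r by auto
  have "(\<lambda>\<omega>. \<zeta> i \<omega> * c i) \<in> borel_measurable (F r)" if "i < n" for i
    using F_mono[OF _ \<zeta>[OF that], of r] by (cases "\<tau> i \<le> r") (auto simp: c_def)
  then show "\<zeta>' \<in> borel_measurable (F r)" unfolding \<zeta>'_def by measurable
  show "H u \<omega> = \<zeta>' \<omega>" if "u \<in> {r<..r'}" for u \<omega>
    unfolding H_def simple_value_def \<zeta>'_def
  proof (rule sum.cong[OF refl])
    fix i assume "i \<in> {..<n}"
    then have "indicator {\<tau> i<..\<tau> (Suc i)} u = c i" using p[of i] that by (auto simp: c_def indicator_def)
    then show "\<zeta> i \<omega> * indicator {\<tau> i<..\<tau> (Suc i)} u = \<zeta> i \<omega> * c i" by simp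
  qed
  show "simple_integral W n \<tau> \<zeta> v \<omega> = simple_integral W n \<tau> \<zeta> r \<omega> + \<zeta>' \<omega> * (W v \<omega> - W r \<omega>)"
    if "v \<in> {r..r'}" for v \<omega>
  proof -
    have "W (min (\<tau> (Suc i)) v) \<omega> - W (min (\<tau> i) v) \<omega> =
       (W (min (\<tau> (Suc i)) r) \<omega> - W (min (\<tau> i) r) \<omega>) + c i * (W v \<omega> - W r \<omega>)" if "i < n" for i
      using p[OF that]
    proof (elim disjE conjE)
      assume "\<tau> i \<le> r" "\<tau> (Suc i) \<le> r"
      then show ?thesis using \<open>v \<in> {r..r'}\<close> r by (simp add: c_def min_absorb1)
    next
      assume "\<tau> i \<le> r" "r' \<le> \<tau> (Suc i)"
      then show ?thesis using \<open>v \<in> {r..r'}\<close> r by (simp add: c_def min_absorb1 min_absorb2)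
    next
      assume "r' \<le> \<tau> i" "r' \<le> \<tau> (Suc i)"
      then show ?thesis using \<open>v \<in> {r..r'}\<close> r by (simp add: c_def min_absorb2)
    qed
    then show ?thesis unfolding simple_integral_def \<zeta>'_def sum_distrib_right sum.distrib[symmetric]
      by (intro sum.cong refl) (simp add: distrib_left[symmetric] mult.assoc)
  qed
qed

lemma G_FTC:
  assumes "\<omega> \<in> space M" "s \<le> r" "r \<le> v"
  shows "(LBINT u:{r..v}. G u \<omega> * \<gamma> u \<omega>) = G r \<omega> - G v \<omega>"
  unfolding G_def
  proof (rule exp_set_integral_FTC[where m=B and N="\<tau> ` {..n}" and t=v])
    show "isCont (\<lambda>u. \<gamma> u \<omega>) u" if "u \<in> {s..v} - \<tau> ` {..n}" for u
      unfolding \<gamma>_def H_def simple_value_def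
    proof (intro continuous_intros)
      show "isCont (\<lambda>u. \<gamma>0 u \<omega>) u" using \<gamma>0_co by (simp add: continuous_on_eq_continuous_at)
      show "isCont (indicator {\<tau> i<..\<tau> (Suc i)} :: real \<Rightarrow> real) u" if "i \<in> {..<n}" for i
      proof -
        have "\<tau> i \<noteq> u" "\<tau> (Suc i) \<noteq> u" using \<open>u \<in> {s..v} - \<tau> ` {..n}\<close> that by auto
        moreover have "frontier {\<tau> i<..\<tau> (Suc i)} \<subseteq> {\<tau> i, \<tau> (Suc i)}"
          using closure_minimal[of "{\<tau> i<..\<tau> (Suc i)}" "{\<tau> i..\<tau> (Suc i)}"]
            interior_maximal[of "{\<tau> i<..<\<tau> (Suc i)}" "{\<tau> i<..\<tau> (Suc i)}"]
          by (force simp: frontier_def)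
        ultimately show ?thesis by (subst isCont_indicator) auto
      qed
    qed
  qed (use assms s in \<open>auto intro!: prog_path[OF \<gamma>_prog] \<gamma>_bd\<close>)

lemma G\<gamma>_integrable:
  assumes \<omega>: "\<omega> \<in> space M" and r0: "0 \<le> r"
  shows "set_integrable lborel {r..v} (\<lambda>v. G v \<omega> * \<gamma> v \<omega>)"
proof (rule set_integrable_bounded_Icc[OF prog_path[OF prog_mult[OF G_prog \<gamma>_prog] r0 \<omega>]])
  fix u
  have "\<bar>G u \<omega>\<bar> * \<bar>\<gamma> u \<omega>\<bar> \<le> 1 * B" using G_bd[of u \<omega>] \<gamma>_bd[OF \<omega>, of u] by (intro mult_mono) auto
  then show "\<bar>G u \<omega> * \<gamma> u \<omega>\<bar> \<le> B" by (simp add: abs_mult)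
qed

text \<open>The discount rate \<open>\<gamma>\<close> dominates drift and squared diffusion, so this bound does not involve \<open>n\<close> or \<open>\<zeta>\<close>.\<close>

lemma V_bd_uniform:
  assumes \<omega>: "\<omega> \<in> space M" and u: "s \<le> u" and d: "0 < \<delta>" "\<And>v. \<delta> * \<bar>\<beta> v \<omega>\<bar> \<le> \<gamma>0 v \<omega>"
    and L: "\<And>y. \<bar>f y\<bar> \<le> L" "\<And>y. \<bar>f1 y\<bar> \<le> L" "\<And>y. \<bar>f2 y\<bar> \<le> L"
  shows "\<bar>V u \<omega>\<bar> \<le> 2 * L + 2 * L / \<delta>"
proof -
  have L0: "0 \<le> L" using L(1)[of 0] by linarith
  have "\<bar>G v \<omega> * K v \<omega>\<bar> \<le> (L + 2 * L / \<delta>) * (G v \<omega> * \<gamma> v \<omega>)" for v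
  proof -
    let ?g = "\<gamma> v \<omega>" and ?y = "Y v \<omega>"
    have b: "\<bar>\<beta> v \<omega>\<bar> \<le> ?g / \<delta>" "(H v \<omega>)\<^sup>2 \<le> ?g / \<delta>"
      using d(1) d(2)[of v] \<gamma>0_nn[of v \<omega>] by (auto simp: \<gamma>_def le_divide_eq mult.commute add_increasing2)
    have "\<bar>f1 ?y\<bar> * \<bar>\<beta> v \<omega>\<bar> \<le> L * (?g / \<delta>)" using b L L0 by (intro mult_mono) auto
    moreover have "(H v \<omega>)\<^sup>2 * \<bar>f2 ?y\<bar> \<le> (?g / \<delta>) * L" using b L L0 \<gamma>_nn[of v \<omega>] d by (intro mult_mono) auto
    moreover have "?g * \<bar>f ?y\<bar> \<le> ?g * L" using L \<gamma>_nn[of v \<omega>] by (intro mult_left_mono) auto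
    moreover have "\<bar>K v \<omega>\<bar> \<le> \<bar>f1 ?y\<bar> * \<bar>\<beta> v \<omega>\<bar> + (H v \<omega>)\<^sup>2 * \<bar>f2 ?y\<bar> / 2 + ?g * \<bar>f ?y\<bar>"
    proof -
      have "\<bar>f1 ?y * \<beta> v \<omega>\<bar> = \<bar>f1 ?y\<bar> * \<bar>\<beta> v \<omega>\<bar>" "\<bar>(H v \<omega>)\<^sup>2 * f2 ?y / 2\<bar> = (H v \<omega>)\<^sup>2 * \<bar>f2 ?y\<bar> / 2"
        "\<bar>?g * f ?y\<bar> = ?g * \<bar>f ?y\<bar>" using \<gamma>_nn[of v \<omega>] by (auto simp: abs_mult)
      then show ?thesis unfolding K_def by linarith
    qed
    moreover have "0 \<le> (H v \<omega>)\<^sup>2 * \<bar>f2 ?y\<bar>" by simp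
    ultimately have "\<bar>K v \<omega>\<bar> \<le> L * (?g / \<delta>) + (?g / \<delta>) * L + ?g * L" by linarith
    then have "G v \<omega> * \<bar>K v \<omega>\<bar> \<le> G v \<omega> * (L * (?g / \<delta>) + (?g / \<delta>) * L + ?g * L)"
      using G_bd(1)[of v \<omega>] by (intro mult_left_mono) auto
    then show ?thesis using G_bd(1)[of v \<omega>] by (simp add: abs_mult algebra_simps)
  qed
  then have "(LBINT v:{s..u}. \<bar>G v \<omega> * K v \<omega>\<bar>) \<le> (LBINT v:{s..u}. (L + 2 * L / \<delta>) * (G v \<omega> * \<gamma> v \<omega>))"
    by (intro set_integral_mono set_integrable_abs int_GK[OF s \<omega>] set_integrable_mult_right G\<gamma>_integrable[OF \<omega> s])
  also have "\<dots> = (L + 2 * L / \<delta>) * (G s \<omega> - G u \<omega>)"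
    using G_FTC[OF \<omega> order_refl u] by simp
  also have "\<dots> \<le> (L + 2 * L / \<delta>) * 1"
    using G_bd[of s \<omega>] G_bd[of u \<omega>] L0 d(1) by (intro mult_left_mono) (auto simp: add_nonneg_nonneg)
  finally have 1: "(LBINT v:{s..u}. \<bar>G v \<omega> * K v \<omega>\<bar>) \<le> L + 2 * L / \<delta>" by simp
  have 2: "\<bar>LBINT v:{s..u}. G v \<omega> * K v \<omega>\<bar> \<le> (LBINT v:{s..u}. \<bar>G v \<omega> * K v \<omega>\<bar>)"
    using set_integral_norm_bound[OF int_GK[OF s \<omega>]] by simp
  have "\<bar>f (Y u \<omega>)\<bar> * \<bar>G u \<omega>\<bar> \<le> L * 1" using G_bd[of u \<omega>] L(1)[of "Y u \<omega>"] L0 by (intro mult_mono) auto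
  then have "\<bar>f (Y u \<omega>) * G u \<omega>\<bar> \<le> L" by (simp add: abs_mult)
  with 1 2 show ?thesis unfolding V_def by linarith
qed

text \<open>Second-order expansion over a step on which \<open>H\<close> is constant. The two
  subtracted terms have mean zero after multiplication by \<open>Z\<close>. In the error,
  \<open>q v\<close> bounds the squared increment of \<open>Y\<close>, and \<open>e v\<close> the
  change of \<open>G\<close> times \<open>f\<close>, \<open>f1\<close> or \<open>f2\<close> along
  \<open>Y\<close>; each summand has expectation of order \<open>h * \<eta>\<close> plus a multiple
  of \<open>h\<^sup>2\<close>.\<close>

lemma V_increment:
  fixes \<omega> \<zeta>' \<eta> C r r'
  assumes \<omega>: "\<omega> \<in> space M" and r: "s \<le> r" "r < r'" "r' \<le> t"
    and H: "\<And>u. u \<in> {r<..r'} \<Longrightarrow> H u \<omega> = \<zeta>'"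
    and I: "\<And>v. v \<in> {r..r'} \<Longrightarrow> simple_integral W n \<tau> \<zeta> v \<omega> =
        simple_integral W n \<tau> \<zeta> r \<omega> + \<zeta>' * (W v \<omega> - W r \<omega>)"
    and \<eta>: "0 < \<eta>" and C: "0 \<le> C"
    and mod: "\<And>x y. \<bar>f x - f y\<bar> \<le> \<eta> + C * (x - y)\<^sup>2"
      "\<And>x y. \<bar>f1 x - f1 y\<bar> \<le> \<eta> + C * (x - y)\<^sup>2" "\<And>x y. \<bar>f2 x - f2 y\<bar> \<le> \<eta> + C * (x - y)\<^sup>2"
  defines "w \<equiv> \<lambda>v. W v \<omega> - W r \<omega>" and "h \<equiv> r' - r"
  defines "q \<equiv> \<lambda>v. 2 * B\<^sup>2 * h\<^sup>2 + 2 * B\<^sup>2 * (w v)\<^sup>2"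
  defines "e \<equiv> \<lambda>v. \<eta> + C * q v + B\<^sup>2 * h"
  shows "\<bar>V r' \<omega> - V r \<omega> - G r \<omega> * f1 (Y r \<omega>) * \<zeta>' * w r' - G r \<omega> * f2 (Y r \<omega>) * \<zeta>'\<^sup>2 / 2 * ((w r')\<^sup>2 - h)\<bar>
    \<le> (2 * B + B\<^sup>2) * (LBINT v:{r..r'}. e v) + B * h * e r' + B ^ 3 * (h * (\<eta> + (w r')\<^sup>2 / \<eta>) + h\<^sup>2) +
      q r' * (\<eta> + C * q r') / 2"
proof -
  have B: "1 \<le> B" "0 \<le> B" using B1 by auto
  have r0: "0 \<le> r" using s r by simp
  have h: "0 < h" using r by (simp add: h_def)
  let ?y = "\<lambda>v. Y v \<omega>" and ?G = "\<lambda>v. G v \<omega>"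
  have \<zeta>': "\<bar>\<zeta>'\<bar> \<le> B" using H[of r'] H_bd[OF \<omega>, of r'] B1 r by simp
  have \<zeta>'2: "\<zeta>'\<^sup>2 \<le> B\<^sup>2" using \<zeta>' B by (simp add: abs_le_square_iff[symmetric])
  define b where "b v = (LBINT u:{r..v}. \<beta> u \<omega>)" for v
  have y: "?y v = ?y r + b v + \<zeta>' * w v" if "v \<in> {r..r'}" for v
    using set_integral_Icc_split[of 0 r v "\<lambda>u. \<beta> u \<omega>", OF _ _ int_\<beta>[OF _ \<omega>]] r0 that I[OF that]
    by (simp add: Y_def b_def w_def)
  have b: "\<bar>b v\<bar> \<le> B * h" if "v \<in> {r..r'}" for v
  proof -
    have "\<bar>b v\<bar> \<le> m * (v - r)" unfolding b_def using that by (intro set_integral_Icc_bound \<beta>_bd) auto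
    also have "\<dots> \<le> B * h" using that B1 B by (intro mult_mono) (auto simp: h_def)
    finally show ?thesis .
  qed
  have sq: "(?y v - ?y r)\<^sup>2 \<le> q v" if v: "v \<in> {r..r'}" for v
  proof -
    have "(?y v - ?y r)\<^sup>2 = (b v + \<zeta>' * w v)\<^sup>2" using y[OF v] by simp
    also have "\<dots> \<le> 2 * (b v)\<^sup>2 + 2 * (\<zeta>' * w v)\<^sup>2"
      using sum_squares_bound[of "b v" "\<zeta>' * w v"] by (simp add: power2_sum)
    also have "(b v)\<^sup>2 \<le> (B * h)\<^sup>2"
      using b[OF v] B h by (intro abs_le_square_iff[THEN iffD1]) auto
    also have "(\<zeta>' * w v)\<^sup>2 \<le> B\<^sup>2 * (w v)\<^sup>2"
      unfolding power_mult_distrib using \<zeta>'2 by (intro mult_right_mono) auto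
    finally show ?thesis by (simp add: q_def power_mult_distrib)
  qed
  have q0: "0 \<le> q v" for v by (simp add: q_def)
  have ge: "\<bar>g (?y v) - g (?y r)\<bar> \<le> \<eta> + C * q v"
    if "\<And>x y. \<bar>g x - g y\<bar> \<le> \<eta> + C * (x - y)\<^sup>2" "v \<in> {r..r'}" for g :: "real \<Rightarrow> real" and v
    using that(1)[of "?y v" "?y r"] mult_left_mono[OF sq[OF that(2)] C] by linarith
  \<comment> \<open>On the half-open step \<open>\<gamma>\<close> has the continuous version
    \<open>\<gamma>'\<close>; the two can differ at \<open>r\<close>, where \<open>H\<close> may
    jump.\<close>
  define \<gamma>' where "\<gamma>' v = \<gamma>0 v \<omega> + \<delta> * \<zeta>'\<^sup>2" for v
  have \<gamma>'_eq: "\<gamma>' v = \<gamma> v \<omega>" if "v \<in> {r<..r'}" for v using H[OF that] by (simp add: \<gamma>'_def \<gamma>_def)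
  have ae: "AE v in lborel. v \<in> {r..r'} \<longrightarrow> v \<in> {r<..r'}"
    using AE_lborel_singleton[of r] by eventually_elim auto
  have \<gamma>'_nn: "0 \<le> \<gamma>' v" for v using \<gamma>0_nn[of v \<omega>] \<delta> by (simp add: \<gamma>'_def)
  have \<gamma>'_bd: "\<bar>\<gamma>' v\<bar> \<le> B" for v
  proof -
    have "\<zeta>'\<^sup>2 \<le> (real n * m)\<^sup>2"
      using H[of r'] H_bd[OF \<omega>, of r'] r m0 by (intro abs_le_square_iff[THEN iffD1]) auto
    then have "\<delta> * \<zeta>'\<^sup>2 \<le> \<delta> * (real n * m)\<^sup>2" by (rule mult_left_mono[OF _ \<delta>])
    then show ?thesis using \<gamma>0_bd[of v \<omega>] \<gamma>'_nn[of v] B1(4) by (simp add: \<gamma>'_def)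
  qed
  have co: "continuous_on UNIV ?y" "continuous_on UNIV ?G" "continuous_on UNIV \<gamma>'" "continuous_on UNIV (\<lambda>v. \<beta> v \<omega>)"
    "continuous_on UNIV w"
    unfolding \<gamma>'_def w_def
    by (intro continuous_intros Y_continuous[OF \<omega>] G_continuous[OF \<omega>] \<gamma>0_co \<beta>_co W_cont)+
  have cof: "continuous_on UNIV (\<lambda>v. f (?y v))" "continuous_on UNIV (\<lambda>v. f1 (?y v))" "continuous_on UNIV (\<lambda>v. f2 (?y v))"
    by (intro continuous_on_compose2[OF uniformly_continuous_imp_continuous[OF f_uc(1)] co(1)]
      continuous_on_compose2[OF uniformly_continuous_imp_continuous[OF f_uc(2)] co(1)]
      continuous_on_compose2[OF uniformly_continuous_imp_continuous[OF f_uc(3)] co(1)] subset_UNIV)+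
  have int: "set_integrable lborel {r..v} g" if "continuous_on UNIV g" for g :: "real \<Rightarrow> real" and v
    using that by (intro borel_integrable_atLeastAtMost') (auto intro: continuous_on_subset)
  note G\<gamma>_i = G\<gamma>_integrable[OF \<omega> r0]
  have FTC: "(LBINT v:{r..v}. ?G v * \<gamma>' v) = ?G r - ?G v" if v: "v \<in> {r..r'}" for v
  proof -
    have "(LBINT v:{r..v}. ?G v * \<gamma>' v) = (LBINT v:{r..v}. ?G v * \<gamma> v \<omega>)"
      by (rule set_integral_Icc_cong) (use v \<gamma>'_eq G\<gamma>_i in \<open>auto intro!: int continuous_intros co\<close>)
    also have "\<dots> = ?G r - ?G v"
      by (rule G_FTC[OF \<omega>]) (use r v in auto)
    finally show ?thesis .
  qed
  have Gd: "\<bar>?G v - ?G r\<bar> \<le> B * h" if v: "v \<in> {r..r'}" for v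
  proof -
    have "\<bar>LBINT v:{r..v}. ?G v * \<gamma>' v\<bar> \<le> B * (v - r)"
    proof (rule set_integral_Icc_bound)
      fix u
      have "\<bar>?G u\<bar> * \<bar>\<gamma>' u\<bar> \<le> 1 * B" using G_bd[of u \<omega>] \<gamma>'_bd[of u] by (intro mult_mono) auto
      then show "\<bar>?G u * \<gamma>' u\<bar> \<le> B" by (simp add: abs_mult)
    qed (use v in auto)
    also have "\<dots> \<le> B * h" using v B by (intro mult_left_mono) (auto simp: h_def)
    finally show ?thesis using FTC[OF v] by simp
  qed
  have Gge: "\<bar>?G v * g (?y v) - ?G r * g (?y r)\<bar> \<le> e v"
    if g: "\<And>x y. \<bar>g x - g y\<bar> \<le> \<eta> + C * (x - y)\<^sup>2" "\<And>x. \<bar>g x\<bar> \<le> m" and v: "v \<in> {r..r'}" for g :: "real \<Rightarrow> real" and v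
  proof -
    have "\<bar>?G v\<bar> * \<bar>g (?y v) - g (?y r)\<bar> \<le> 1 * (\<eta> + C * q v)"
      using G_bd[of v \<omega>] ge[OF g(1) v] by (intro mult_mono) auto
    moreover have "\<bar>?G v - ?G r\<bar> * \<bar>g (?y r)\<bar> \<le> B * h * B"
      using Gd[OF v] g(2)[of "?y r"] B1 h by (intro mult_mono) auto
    moreover have eq: "?G v * g (?y v) - ?G r * g (?y r) = ?G v * (g (?y v) - g (?y r)) + (?G v - ?G r) * g (?y r)"
      by (simp add: algebra_simps)
    ultimately have "\<bar>?G v\<bar> * \<bar>g (?y v) - g (?y r)\<bar> + \<bar>?G v - ?G r\<bar> * \<bar>g (?y r)\<bar> \<le> e v"
      by (simp add: e_def power2_eq_square mult_ac)
    then show ?thesis unfolding eq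
      using abs_triangle_ineq[of "?G v * (g (?y v) - g (?y r))" "(?G v - ?G r) * g (?y r)"]
      unfolding abs_mult by (rule order_trans[rotated])
  qed
  have e0: "0 \<le> e v" for v using C q0 \<eta> h by (simp add: e_def)
  have ec: "continuous_on UNIV e"
    unfolding e_def q_def by (intro continuous_intros co)
  have ei: "set_integrable lborel {r..r'} e"
    by (rule int[OF ec])
  let ?E = "LBINT v:{r..r'}. e v"
  have bnd: "\<bar>LBINT v:{r..r'}. k v\<bar> \<le> c * ?E + d * h"
    if "continuous_on UNIV k" "\<And>v. v \<in> {r..r'} \<Longrightarrow> \<bar>k v\<bar> \<le> c * e v + d" for k :: "real \<Rightarrow> real" and c d
  proof -
    have "\<bar>LBINT v:{r..r'}. k v\<bar> \<le> (LBINT v:{r..r'}. \<bar>k v\<bar>)"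
      using set_integral_norm_bound[OF int[OF that(1)]] by simp
    also have "\<dots> \<le> (LBINT v:{r..r'}. c * e v + d)"
      using that(2) by (intro set_integral_mono set_integrable_abs int that(1) set_integral_add(1) set_integrable_mult_right ei)
        (auto intro!: int continuous_intros ec)
    also have "\<dots> = c * ?E + (LBINT v:{r..r'}. d)"
      by (subst set_integral_add(2)) (auto intro!: set_integrable_mult_right ei int continuous_intros ec)
    finally show ?thesis using r by (simp add: set_lebesgue_integral_def h_def mult.commute)
  qed
  have r'm: "r' \<in> {r..r'}" using r by simp
  define J1 where "J1 = (LBINT v:{r..r'}. ?G v * f1 (?y v) * \<beta> v \<omega>)"
  define J2 where "J2 = (LBINT v:{r..r'}. ?G v * f2 (?y v))"
  define J3 where "J3 = (LBINT v:{r..r'}. ?G v * \<gamma>' v * f (?y v))"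
  have "(LBINT v:{r..r'}. ?G v * K v \<omega>) = (LBINT v:{r..r'}. ?G v * f1 (?y v) * \<beta> v \<omega> + \<zeta>'\<^sup>2 / 2 * (?G v * f2 (?y v)) - ?G v * \<gamma>' v * f (?y v))"
  proof (rule set_integral_Icc_cong[OF int_GK[OF r0 \<omega>]])
    show "?G v * K v \<omega> = ?G v * f1 (?y v) * \<beta> v \<omega> + \<zeta>'\<^sup>2 / 2 * (?G v * f2 (?y v)) - ?G v * \<gamma>' v * f (?y v)" if "v \<in> {r<..r'}" for v
      using H[OF that] \<gamma>'_eq[OF that] by (simp add: K_def algebra_simps)
  qed (intro int continuous_intros co cof)
  also have "\<dots> = J1 + \<zeta>'\<^sup>2 / 2 * J2 - J3"
    unfolding J1_def J2_def J3_def
    by (subst set_integral_diff(2) set_integral_add(2); (intro int continuous_intros co cof)?)+ simp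
  finally have K: "(LBINT v:{r..r'}. ?G v * K v \<omega>) = J1 + \<zeta>'\<^sup>2 / 2 * J2 - J3" .
  have R1: "\<bar>J1 - ?G r * f1 (?y r) * b r'\<bar> \<le> B * ?E"
  proof -
    have eq: "J1 - ?G r * f1 (?y r) * b r' = (LBINT v:{r..r'}. (?G v * f1 (?y v) - ?G r * f1 (?y r)) * \<beta> v \<omega>)" (is "_ = ?I")
      unfolding J1_def b_def set_integral_mult_right[symmetric]
      by (subst set_integral_diff(2)[symmetric]; (intro int continuous_intros co cof)?) (simp add: algebra_simps)
    have "\<bar>?I\<bar> \<le> B * ?E + 0 * h"
    proof (rule bnd)
      show "\<bar>(?G v * f1 (?y v) - ?G r * f1 (?y r)) * \<beta> v \<omega>\<bar> \<le> B * e v + 0" if v: "v \<in> {r..r'}" for v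
      proof -
        have "\<bar>\<beta> v \<omega>\<bar> \<le> B" using \<beta>_bd[of v \<omega>] B1 by linarith
        from mult_mono[OF Gge[OF mod(2) f_bd(2) v] this e0] show ?thesis by (simp add: abs_mult mult.commute)
      qed
    qed (intro continuous_intros co cof)
    then show ?thesis unfolding eq by simp
  qed
  have R2: "\<bar>J2 - ?G r * f2 (?y r) * h\<bar> \<le> ?E"
  proof -
    have "?G r * f2 (?y r) * h = (LBINT v:{r..r'}. ?G r * f2 (?y r))"
      using r by (simp add: set_lebesgue_integral_def h_def)
    then have eq: "J2 - ?G r * f2 (?y r) * h = (LBINT v:{r..r'}. ?G v * f2 (?y v) - ?G r * f2 (?y r))" (is "_ = ?I")
      unfolding J2_def by (subst set_integral_diff(2); (intro int continuous_intros co cof)?) simp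
    have "\<bar>?I\<bar> \<le> 1 * ?E + 0 * h"
      using Gge[OF mod(3) f_bd(3)] by (intro bnd continuous_intros co cof) auto
    then show ?thesis unfolding eq by simp
  qed
  \<comment> \<open>The discount changes by \<open>- \<integral> G \<gamma>'\<close>. With
    \<open>f\<close> frozen at the right end this is one half of the product rule for
    \<open>f (Y) * G\<close>, and freezing costs only the oscillation of \<open>f\<close>.\<close>
  have R3: "\<bar>J3 + f (?y r') * (?G r' - ?G r)\<bar> \<le> B * ?E + B * e r' * h"
  proof -
    have "J3 + f (?y r') * (?G r' - ?G r) = J3 - (LBINT v:{r..r'}. f (?y r') * (?G v * \<gamma>' v))"
      unfolding set_integral_mult_right FTC[OF r'm] by (simp add: algebra_simps)
    also have "\<dots> = (LBINT v:{r..r'}. ?G v * \<gamma>' v * (f (?y v) - f (?y r')))" (is "_ = ?I")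
      unfolding J3_def
      by (subst set_integral_diff(2)[symmetric]; (intro int continuous_intros co cof)?) (simp add: algebra_simps)
    finally have eq: "J3 + f (?y r') * (?G r' - ?G r) = ?I" .
    have "\<bar>?I\<bar> \<le> B * ?E + (B * e r') * h"
    proof (rule bnd)
      show "\<bar>?G v * \<gamma>' v * (f (?y v) - f (?y r'))\<bar> \<le> B * e v + B * e r'" if v: "v \<in> {r..r'}" for v
      proof -
        have "\<bar>f (?y v) - f (?y r')\<bar> \<le> e v + e r'"
          using ge[OF mod(1) v] ge[OF mod(1) r'm] B h by (simp add: e_def) (smt (verit) mult_nonneg_nonneg zero_le_power2)
        moreover have "\<bar>?G v\<bar> * \<bar>\<gamma>' v\<bar> \<le> 1 * B" using G_bd[of v \<omega>] \<gamma>'_bd[of v] by (intro mult_mono) auto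
        ultimately have "\<bar>?G v\<bar> * \<bar>\<gamma>' v\<bar> * \<bar>f (?y v) - f (?y r')\<bar> \<le> B * (e v + e r')"
          using B by (intro mult_mono) auto
        then show ?thesis by (simp add: abs_mult distrib_left)
      qed
    qed (intro continuous_intros co cof)
    then show ?thesis unfolding eq by simp
  qed
  define d where "d = b r' + \<zeta>' * w r'"
  have yd: "?y r' = ?y r + d" using y[OF r'm] by (simp add: d_def)
  have d2: "d\<^sup>2 \<le> q r'" using sq[OF r'm] yd by simp
  have R5: "\<bar>?G r * (f (?y r') - f (?y r) - f1 (?y r) * d - f2 (?y r) * d\<^sup>2 / 2)\<bar> \<le> q r' * (\<eta> + C * q r') / 2"
  proof -
    have "\<bar>f (?y r + d) - f (?y r) - f1 (?y r) * d - f2 (?y r) * d\<^sup>2 / 2\<bar> \<le> d\<^sup>2 * (\<eta> + C * d\<^sup>2) / 2"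
      by (rule Taylor2_quadratic_modulus[OF f1 f2 C mod(3) \<eta>])
    also have "\<dots> \<le> q r' * (\<eta> + C * q r') / 2"
      using d2 C \<eta> q0 by (intro divide_right_mono mult_mono add_left_mono mult_left_mono) auto
    finally have *: "\<bar>f (?y r + d) - f (?y r) - f1 (?y r) * d - f2 (?y r) * d\<^sup>2 / 2\<bar> \<le> q r' * (\<eta> + C * q r') / 2" .
    have "\<bar>?G r\<bar> * \<bar>f (?y r + d) - f (?y r) - f1 (?y r) * d - f2 (?y r) * d\<^sup>2 / 2\<bar> \<le> 1 * (q r' * (\<eta> + C * q r') / 2)"
      by (rule mult_mono[OF _ *]) (use G_bd[of r \<omega>] in auto)
    then show ?thesis by (simp add: abs_mult yd)
  qed
  \<comment> \<open>Weighted arithmetic-geometric mean: it replaces \<open>\<bar>w r'\<bar>\<close>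
    by a second moment, and the price \<open>1 / \<eta>\<close> meets a further factor
    \<open>h\<close>.\<close>
  have wl: "\<bar>w r'\<bar> \<le> \<eta> + (w r')\<^sup>2 / \<eta>"
  proof -
    have "0 \<le> (\<bar>w r'\<bar> - \<eta>)\<^sup>2 + \<eta> * \<bar>w r'\<bar>" using \<eta> by simp
    then have "\<bar>w r'\<bar> * \<eta> \<le> \<eta>\<^sup>2 + (w r')\<^sup>2" by (simp add: power2_diff mult.commute)
    then have "\<bar>w r'\<bar> \<le> (\<eta>\<^sup>2 + (w r')\<^sup>2) / \<eta>" using \<eta> by (simp add: pos_le_divide_eq)
    then show ?thesis using \<eta> by (simp add: add_divide_distrib power2_eq_square)
  qed
  have R4: "\<bar>?G r * f2 (?y r) * (\<zeta>' * w r' * b r' + (b r')\<^sup>2 / 2)\<bar> \<le> B ^ 3 * (h * (\<eta> + (w r')\<^sup>2 / \<eta>) + h\<^sup>2)"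
  proof -
    have "\<bar>\<zeta>'\<bar> * \<bar>w r'\<bar> * \<bar>b r'\<bar> \<le> B * (\<eta> + (w r')\<^sup>2 / \<eta>) * (B * h)"
      using \<zeta>' wl b[OF r'm] B \<eta> by (intro mult_mono) auto
    moreover have "(b r')\<^sup>2 \<le> (B * h)\<^sup>2" using b[OF r'm] B h by (intro abs_le_square_iff[THEN iffD1]) auto
    moreover have "\<bar>\<zeta>' * w r' * b r' + (b r')\<^sup>2 / 2\<bar> \<le> \<bar>\<zeta>'\<bar> * \<bar>w r'\<bar> * \<bar>b r'\<bar> + (b r')\<^sup>2 / 2"
      using abs_triangle_ineq[of "\<zeta>' * w r' * b r'" "(b r')\<^sup>2 / 2"] by (simp add: abs_mult)
    ultimately have 1: "\<bar>\<zeta>' * w r' * b r' + (b r')\<^sup>2 / 2\<bar> \<le> B * (\<eta> + (w r')\<^sup>2 / \<eta>) * (B * h) + (B * h)\<^sup>2"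
      using zero_le_power2[of "B * h"] by linarith
    have 2: "\<bar>?G r\<bar> * \<bar>f2 (?y r)\<bar> \<le> 1 * B" using G_bd[of r \<omega>] f_bd(3)[of "?y r"] B1 by (intro mult_mono) auto
    have "\<bar>?G r\<bar> * \<bar>f2 (?y r)\<bar> * \<bar>\<zeta>' * w r' * b r' + (b r')\<^sup>2 / 2\<bar> \<le> (1 * B) * (B * (\<eta> + (w r')\<^sup>2 / \<eta>) * (B * h) + (B * h)\<^sup>2)"
      by (rule mult_mono[OF 2 1]) (use B in auto)
    moreover have eq: "(1 * B) * (B * (\<eta> + (w r')\<^sup>2 / \<eta>) * (B * h) + (B * h)\<^sup>2) = B ^ 3 * (h * (\<eta> + (w r')\<^sup>2 / \<eta>) + h\<^sup>2)"
      by (simp add: power2_eq_square power3_eq_cube algebra_simps)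
    ultimately show ?thesis unfolding eq by (simp only: abs_mult)
  qed
  have V: "V r' \<omega> - V r \<omega> = f (?y r') * ?G r' - f (?y r) * ?G r - (J1 + \<zeta>'\<^sup>2 / 2 * J2 - J3)"
    using set_integral_Icc_split[of s r r' "\<lambda>v. ?G v * K v \<omega>", OF _ _ int_GK[OF s \<omega>]] r K by (simp add: V_def)
  \<comment> \<open>Exact regrouping: drift, quadratic variation and discount are each paired with
    their values frozen at an endpoint, which leaves the mixed terms of \<open>d\<^sup>2\<close> and
    the Taylor remainder as the other errors.\<close>
  have "V r' \<omega> - V r \<omega> - G r \<omega> * f1 (Y r \<omega>) * \<zeta>' * w r' - G r \<omega> * f2 (Y r \<omega>) * \<zeta>'\<^sup>2 / 2 * ((w r')\<^sup>2 - h) =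
     - (J1 - ?G r * f1 (?y r) * b r') - \<zeta>'\<^sup>2 / 2 * (J2 - ?G r * f2 (?y r) * h) + (J3 + f (?y r') * (?G r' - ?G r))
     + ?G r * f2 (?y r) * (\<zeta>' * w r' * b r' + (b r')\<^sup>2 / 2)
     + ?G r * (f (?y r') - f (?y r) - f1 (?y r) * d - f2 (?y r) * d\<^sup>2 / 2)"
    unfolding V d_def by (simp add: power2_eq_square field_simps)
  then have eq: "V r' \<omega> - V r \<omega> - G r \<omega> * f1 (Y r \<omega>) * \<zeta>' * w r' - G r \<omega> * f2 (Y r \<omega>) * \<zeta>'\<^sup>2 / 2 * ((w r')\<^sup>2 - h) =
     - (J1 - ?G r * f1 (?y r) * b r') - \<zeta>'\<^sup>2 / 2 * (J2 - ?G r * f2 (?y r) * h) + (J3 + f (?y r') * (?G r' - ?G r))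
     + ?G r * f2 (?y r) * (\<zeta>' * w r' * b r' + (b r')\<^sup>2 / 2)
     + ?G r * (f (?y r') - f (?y r) - f1 (?y r) * d - f2 (?y r) * d\<^sup>2 / 2)" .
  have five: "\<bar>- x1 - x2 + x3 + x4 + x5\<bar> \<le> y1 + y2 + y3 + y4 + y5"
    if "\<bar>x1\<bar> \<le> y1" "\<bar>x2\<bar> \<le> y2" "\<bar>x3\<bar> \<le> y3" "\<bar>x4\<bar> \<le> y4" "\<bar>x5\<bar> \<le> y5"
    for x1 x2 x3 x4 x5 y1 y2 y3 y4 y5 :: real using that by linarith
  have R2': "\<bar>\<zeta>'\<^sup>2 / 2 * (J2 - ?G r * f2 (?y r) * h)\<bar> \<le> B\<^sup>2 * ?E"
  proof -
    have "\<bar>\<zeta>'\<^sup>2 / 2\<bar> \<le> B\<^sup>2" using \<zeta>'2 zero_le_power2[of \<zeta>'] by linarith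
    from mult_mono[OF this R2] show ?thesis using B by (simp add: abs_mult)
  qed
  show ?thesis unfolding eq
    by (rule order_trans[OF five[OF R1 R2' R3 R4 R5]]) (simp add: algebra_simps)
qed

text \<open>Take expectations in \<open>V_increment\<close>: the mean-zero terms drop out. The
  coefficient of \<open>\<eta>\<close> is \<open>10 * B ^ 4\<close> whatever \<open>\<eta>\<close>
  is, while \<open>C\<close> may depend on it; so the increments of \<open>D\<close> are of smaller
  order than the step.\<close>

lemma D_increment:
  assumes \<eta>: "0 < \<eta>"
  obtains C where "0 \<le> C" "\<And>r r'. s \<le> r \<Longrightarrow> r < r' \<Longrightarrow> r' \<le> r + 1 \<Longrightarrow> (\<And>i. i \<le> n \<Longrightarrow> \<tau> i \<le> r \<or> r' \<le> \<tau> i) \<Longrightarrow>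
     \<bar>D r' - D r\<bar> \<le> (r' - r) * (10 * B ^ 4 * \<eta> + C * (r' - r))"
proof -
  have B: "1 \<le> B" "0 \<le> B" using B1 by auto
  obtain C1 where C1: "0 \<le> C1" "\<And>x y. \<bar>f x - f y\<bar> \<le> \<eta> + C1 * (x - y)\<^sup>2"
    using uniformly_continuous_quadratic_modulus[OF f_uc(1) f_bd(1) \<eta>] by metis
  obtain C2 where C2: "0 \<le> C2" "\<And>x y. \<bar>f1 x - f1 y\<bar> \<le> \<eta> + C2 * (x - y)\<^sup>2"
    using uniformly_continuous_quadratic_modulus[OF f_uc(2) f_bd(2) \<eta>] by metis
  obtain C3 where C3: "0 \<le> C3" "\<And>x y. \<bar>f2 x - f2 y\<bar> \<le> \<eta> + C3 * (x - y)\<^sup>2"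
    using uniformly_continuous_quadratic_modulus[OF f_uc(3) f_bd(3) \<eta>] by metis
  define C where "C = C1 + C2 + C3"
  have C: "0 \<le> C" using C1 C2 C3 by (simp add: C_def)
  have mod: "\<bar>f x - f y\<bar> \<le> \<eta> + C * (x - y)\<^sup>2" "\<bar>f1 x - f1 y\<bar> \<le> \<eta> + C * (x - y)\<^sup>2"
    "\<bar>f2 x - f2 y\<bar> \<le> \<eta> + C * (x - y)\<^sup>2" for x y
  proof -
    have "C1 * (x - y)\<^sup>2 \<le> C * (x - y)\<^sup>2" "C2 * (x - y)\<^sup>2 \<le> C * (x - y)\<^sup>2" "C3 * (x - y)\<^sup>2 \<le> C * (x - y)\<^sup>2"
      using C1 C2 C3 by (auto intro!: mult_right_mono simp: C_def)
    then show "\<bar>f x - f y\<bar> \<le> \<eta> + C * (x - y)\<^sup>2" "\<bar>f1 x - f1 y\<bar> \<le> \<eta> + C * (x - y)\<^sup>2"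
      "\<bar>f2 x - f2 y\<bar> \<le> \<eta> + C * (x - y)\<^sup>2" using C1(2)[of x y] C2(2)[of x y] C3(2)[of x y] by linarith+
  qed
  \<comment> \<open>The coefficients of \<open>h\<^sup>2\<close> in
    \<open>B * expectation Q\<close>, with higher powers of \<open>h\<close> lowered by
    \<open>h \<le> 1\<close>; \<open>1 / \<eta>\<close> stems from the arithmetic-geometric bound
    and \<open>12 * C * B ^ 4\<close> from the second moment of \<open>q\<close>.\<close>
  define C' where "C' = B * ((2 * B + B\<^sup>2) * (4 * C * B\<^sup>2 + B\<^sup>2) + B * (4 * C * B\<^sup>2 + B\<^sup>2) + B ^ 3 * (1 / \<eta> + 1) + 2 * B\<^sup>2 * \<eta> + 12 * C * B ^ 4)"
  have C'0: "0 \<le> C'" unfolding C'_def using B C \<eta> by (intro mult_nonneg_nonneg add_nonneg_nonneg) auto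
  have "\<bar>D r' - D r\<bar> \<le> (r' - r) * (10 * B ^ 4 * \<eta> + C' * (r' - r))"
    if r: "s \<le> r" "r < r'" "r' \<le> r + 1" and piece: "\<And>i. i \<le> n \<Longrightarrow> \<tau> i \<le> r \<or> r' \<le> \<tau> i" for r r'
  proof -
    have r0: "0 \<le> r" using r s by simp
    obtain \<zeta>' where \<zeta>': "\<zeta>' \<in> borel_measurable (F r)"
      "\<And>u \<omega>. u \<in> {r<..r'} \<Longrightarrow> H u \<omega> = \<zeta>' \<omega>"
      "\<And>v \<omega>. v \<in> {r..r'} \<Longrightarrow> simple_integral W n \<tau> \<zeta> v \<omega> =
        simple_integral W n \<tau> \<zeta> r \<omega> + \<zeta>' \<omega> * (W v \<omega> - W r \<omega>)"
      using H_piece[OF r0 r(2) piece] by metis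
    define h where "h = r' - r"
    have h: "0 < h" "h \<le> 1" using r by (auto simp: h_def)
    define w where "w v \<omega> = W v \<omega> - W r \<omega>" for v \<omega>
    define q where "q v \<omega> = 2 * B\<^sup>2 * h\<^sup>2 + 2 * B\<^sup>2 * (w v \<omega>)\<^sup>2" for v \<omega>
    define e where "e v \<omega> = \<eta> + C * q v \<omega> + B\<^sup>2 * h" for v \<omega>
    define m1 where "m1 \<omega> = Z \<omega> * (G r \<omega> * f1 (Y r \<omega>) * \<zeta>' \<omega>)" for \<omega>
    define m2 where "m2 \<omega> = Z \<omega> * (G r \<omega> * f2 (Y r \<omega>) * (\<zeta>' \<omega>)\<^sup>2 / 2)" for \<omega>
    define Q where "Q \<omega> = (2 * B + B\<^sup>2) * (LBINT v:{r..r'}. e v \<omega>) + B * h * e r' \<omega> +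
       B ^ 3 * (h * (\<eta> + (w r' \<omega>)\<^sup>2 / \<eta>) + h\<^sup>2) + q r' \<omega> * (\<eta> + C * q r' \<omega>) / 2" for \<omega>
    have V: "\<bar>V r' \<omega> - V r \<omega> - G r \<omega> * f1 (Y r \<omega>) * \<zeta>' \<omega> * w r' \<omega> - G r \<omega> * f2 (Y r \<omega>) * (\<zeta>' \<omega>)\<^sup>2 / 2 * ((w r' \<omega>)\<^sup>2 - h)\<bar>
       \<le> Q \<omega>" if "\<omega> \<in> space M" for \<omega>
      using V_increment[OF that r(1,2) order_refl \<zeta>'(2,3) \<eta> C mod]
      unfolding Q_def e_def q_def w_def h_def by blast
    have mom: "integrable M (\<lambda>\<omega>. (w v \<omega>)\<^sup>2)" "expectation (\<lambda>\<omega>. (w v \<omega>)\<^sup>2) = v - r"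
      "integrable M (\<lambda>\<omega>. (w v \<omega>)^4)" "expectation (\<lambda>\<omega>. (w v \<omega>)^4) = 3 * (v - r)\<^sup>2" if "r \<le> v" for v
      using increment_moments[OF r0 that] unfolding w_def by auto
    have qi: "integrable M (q v)" if "r \<le> v" for v using mom[OF that] unfolding q_def by auto
    have qe: "expectation (q v) \<le> 4 * B\<^sup>2 * h" if "v \<in> {r..r'}" for v
    proof -
      have "expectation (q v) = 2 * B\<^sup>2 * h\<^sup>2 + 2 * B\<^sup>2 * (v - r)" using mom that unfolding q_def by (simp add: prob_space)
      also have "\<dots> \<le> 2 * B\<^sup>2 * h + 2 * B\<^sup>2 * h"
        using h that by (intro add_mono mult_left_mono) (auto simp: power2_eq_square mult_left_le h_def)
      finally show ?thesis by (simp add: mult_ac)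
    qed
    have ei: "integrable M (e v)" if "r \<le> v" for v unfolding e_def using qi[OF that] by simp
    have ee: "expectation (e v) \<le> \<eta> + (4 * C * B\<^sup>2 + B\<^sup>2) * h" if "v \<in> {r..r'}" for v
    proof -
      have "expectation (e v) = \<eta> + C * expectation (q v) + B\<^sup>2 * h" using qi that unfolding e_def by (simp add: prob_space)
      also have "\<dots> \<le> \<eta> + C * (4 * B\<^sup>2 * h) + B\<^sup>2 * h" using qe[OF that] C by (intro add_mono mult_left_mono) auto
      finally show ?thesis by (simp add: algebra_simps)
    qed
    have q0: "0 \<le> q v \<omega>" for v \<omega> by (simp add: q_def)
    \<comment> \<open>\<open>w v\<close> is adapted only from time \<open>r\<close> on; freezing it
      before \<open>r\<close>, at the value 0, gives a progressive process with the same values on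
      the step.\<close>
    have wp: "prog (\<lambda>v \<omega>. w (max v r) \<omega>)"
    proof (rule prog_continuous)
      show "w (max t r) \<in> borel_measurable (F t)" if "0 \<le> t" for t
      proof (cases "t \<le> r")
        case True then show ?thesis by (simp add: w_def[abs_def] max_absorb2)
      next
        case False
        then have "W r \<in> borel_measurable (F t)" by (intro F_mono[OF _ W_adapted] r0) auto
        with False W_adapted[OF that] show ?thesis by (simp add: w_def[abs_def] max_absorb1)
      qed
      show "continuous_on {0..} (\<lambda>t. w (max t r) \<omega>)" for \<omega>
        unfolding w_def by (intro continuous_intros continuous_on_compose2[OF W_cont]) auto
    qed
    have ep: "prog (\<lambda>v \<omega>. e (max v r) \<omega>)"
      unfolding e_def q_def
      by (rule prog_comp[OF wp, of "\<lambda>y. \<eta> + C * (2 * B\<^sup>2 * h\<^sup>2 + 2 * B\<^sup>2 * y\<^sup>2) + B\<^sup>2 * h"]) measurable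
    have e0: "0 \<le> e v \<omega>" for v \<omega> using q0 C \<eta> h by (simp add: e_def)
    have eq: "(LBINT v:{r..r'}. e (max v r) \<omega>) = (LBINT v:{r..r'}. e v \<omega>)" for \<omega>
      by (rule set_lebesgue_integral_cong) auto
    have Ei: "integrable M (\<lambda>\<omega>. LBINT v:{r..r'}. e v \<omega>)"
      and Ee: "expectation (\<lambda>\<omega>. LBINT v:{r..r'}. e v \<omega>) \<le> (\<eta> + (4 * C * B\<^sup>2 + B\<^sup>2) * h) * h"
      using expectation_set_integral[OF ep r0 less_imp_le[OF r(2)], of "\<eta> + (4 * C * B\<^sup>2 + B\<^sup>2) * h"]
        e0 ei ee unfolding eq by (auto simp: max_absorb1 h_def)
    have q2: "q v \<omega> * (\<eta> + C * q v \<omega>) / 2 = \<eta> * q v \<omega> / 2 + 2 * C * B ^ 4 * (h ^ 4 + 2 * h\<^sup>2 * (w v \<omega>)\<^sup>2 + (w v \<omega>) ^ 4)" for v \<omega>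
      unfolding q_def by (simp add: power2_eq_square power4_eq_xxxx field_simps)
    have Qi: "integrable M Q" unfolding Q_def q2 using Ei ei[of r'] qi[of r'] mom[of r'] r by auto
    have "expectation Q = (2 * B + B\<^sup>2) * expectation (\<lambda>\<omega>. LBINT v:{r..r'}. e v \<omega>) + B * h * expectation (e r') +
       B ^ 3 * (h * (\<eta> + h / \<eta>) + h\<^sup>2) + (\<eta> * expectation (q r') / 2 + 2 * C * B ^ 4 * (h ^ 4 + 2 * h\<^sup>2 * h + 3 * h\<^sup>2))"
      unfolding Q_def q2 using Ei ei[of r'] qi[of r'] mom[of r'] r by (simp add: prob_space h_def)
    also have "\<dots> \<le> (2 * B + B\<^sup>2) * ((\<eta> + (4 * C * B\<^sup>2 + B\<^sup>2) * h) * h) + B * h * (\<eta> + (4 * C * B\<^sup>2 + B\<^sup>2) * h) +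
       B ^ 3 * (h * (\<eta> + h / \<eta>) + h\<^sup>2) + (\<eta> * (4 * B\<^sup>2 * h) / 2 + 2 * C * B ^ 4 * (h\<^sup>2 + 2 * h\<^sup>2 + 3 * h\<^sup>2))"
    proof -
      have "h ^ 4 \<le> h\<^sup>2" "h\<^sup>2 * h \<le> h\<^sup>2" using h by (auto intro: power_decreasing simp: mult_left_le)
      then show ?thesis using ee[of r'] qe[of r'] Ee B h \<eta> C r
        by (intro add_mono mult_left_mono divide_right_mono) auto
    qed
    finally have "B * expectation Q \<le> B * \<dots>" using B by (intro mult_left_mono)
    also have "\<dots> \<le> h * ((2 * B\<^sup>2 + B ^ 3 + B\<^sup>2 + B ^ 4 + 2 * B ^ 3) * \<eta> + C' * h)"
      unfolding C'_def using B \<eta> h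
      by (simp add: field_simps power2_eq_square power3_eq_cube power4_eq_xxxx)
    also have "\<dots> \<le> h * (10 * B ^ 4 * \<eta> + C' * h)"
    proof -
      have "B\<^sup>2 \<le> B ^ 4" "B ^ 3 \<le> B ^ 4" using B by (auto intro!: power_increasing)
      moreover have "0 \<le> B ^ 4" by simp
      ultimately have "2 * B\<^sup>2 + B ^ 3 + B\<^sup>2 + B ^ 4 + 2 * B ^ 3 \<le> 10 * B ^ 4" by linarith
      then show ?thesis using \<eta> h by (intro mult_left_mono add_right_mono mult_right_mono) auto
    qed
    finally have Qe: "B * expectation Q \<le> h * (10 * B ^ 4 * \<eta> + C' * h)" .
    have \<zeta>'_bd: "\<bar>\<zeta>' \<omega>\<bar> \<le> B" if "\<omega> \<in> space M" for \<omega>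
      using \<zeta>'(2)[of r' \<omega>] H_bd[OF that, of r'] B1 r by simp
    have meas: "Z \<in> borel_measurable (F r)" "G r \<in> borel_measurable (F r)" "(\<lambda>\<omega>. f1 (Y r \<omega>)) \<in> borel_measurable (F r)"
      "(\<lambda>\<omega>. f2 (Y r \<omega>)) \<in> borel_measurable (F r)"
      using F_mono[OF r(1) Z(1)] G_adapted[OF r0] Y_adapted[OF r0] f_meas by (auto intro: measurable_compose)
    have m1: "m1 \<in> borel_measurable (F r)" "\<bar>m1 \<omega>\<bar> \<le> B * (1 * B * B)"
      and m2: "m2 \<in> borel_measurable (F r)" "\<bar>m2 \<omega>\<bar> \<le> B * (1 * B * B\<^sup>2)" if \<omega>: "\<omega> \<in> space M" for \<omega>
    proof -
      show "m1 \<in> borel_measurable (F r)" "m2 \<in> borel_measurable (F r)"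
        unfolding m1_def m2_def using meas \<zeta>'(1) by measurable
      have *: "\<bar>Z \<omega>\<bar> \<le> B" "\<bar>G r \<omega>\<bar> \<le> 1" "\<bar>f1 (Y r \<omega>)\<bar> \<le> B" "\<bar>f2 (Y r \<omega>)\<bar> \<le> B"
        using Z(2)[OF \<omega>] G_bd[of r \<omega>] f_bd(2,3)[of "Y r \<omega>"] B1 by auto
      show "\<bar>m1 \<omega>\<bar> \<le> B * (1 * B * B)"
        unfolding m1_def abs_mult using * \<zeta>'_bd[OF \<omega>] B by (intro mult_mono) auto
      have "(\<zeta>' \<omega>)\<^sup>2 \<le> B\<^sup>2" using \<zeta>'_bd[OF \<omega>] B by (simp add: abs_le_square_iff[symmetric])
      then have "\<bar>(\<zeta>' \<omega>)\<^sup>2 / 2\<bar> \<le> B\<^sup>2" using zero_le_power2[of "\<zeta>' \<omega>"] by linarith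
      then have "\<bar>Z \<omega>\<bar> * (\<bar>G r \<omega>\<bar> * \<bar>f2 (Y r \<omega>)\<bar> * \<bar>(\<zeta>' \<omega>)\<^sup>2 / 2\<bar>) \<le> B * (1 * B * B\<^sup>2)"
        using * B by (intro mult_mono) auto
      then show "\<bar>m2 \<omega>\<bar> \<le> B * (1 * B * B\<^sup>2)" by (simp add: m2_def abs_mult)
    qed
    obtain \<omega>0 where \<omega>0: "\<omega>0 \<in> space M" using not_empty by blast
    have mm: "integrable M (\<lambda>\<omega>. m1 \<omega> * w r' \<omega>)" "expectation (\<lambda>\<omega>. m1 \<omega> * w r' \<omega>) = 0"
       "integrable M (\<lambda>\<omega>. m2 \<omega> * ((w r' \<omega>)\<^sup>2 - h))" "expectation (\<lambda>\<omega>. m2 \<omega> * ((w r' \<omega>)\<^sup>2 - h)) = 0"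
      unfolding w_def h_def
      using increment_mean_zero[OF r0 less_imp_le[OF r(2)] m1(1)[OF \<omega>0] m1(2)]
        increment_mean_zero[OF r0 less_imp_le[OF r(2)] m2(1)[OF \<omega>0] m2(2)] by simp_all
    have "D r' - D r = expectation (\<lambda>\<omega>. Z \<omega> * V r' \<omega> - Z \<omega> * V r \<omega>)"
      unfolding D_def using ZV_integrable r by (subst Bochner_Integration.integral_diff) auto
    also have "\<dots> = expectation (\<lambda>\<omega>. Z \<omega> * V r' \<omega> - Z \<omega> * V r \<omega>) - expectation (\<lambda>\<omega>. m1 \<omega> * w r' \<omega>) - expectation (\<lambda>\<omega>. m2 \<omega> * ((w r' \<omega>)\<^sup>2 - h))"
      using mm by simp
    also have "\<dots> = expectation (\<lambda>\<omega>. Z \<omega> * V r' \<omega> - Z \<omega> * V r \<omega> - m1 \<omega> * w r' \<omega> - m2 \<omega> * ((w r' \<omega>)\<^sup>2 - h))"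
      using mm ZV_integrable r by (simp add: Bochner_Integration.integral_diff)
    finally have eq: "D r' - D r = expectation (\<lambda>\<omega>. Z \<omega> * V r' \<omega> - Z \<omega> * V r \<omega> - m1 \<omega> * w r' \<omega> - m2 \<omega> * ((w r' \<omega>)\<^sup>2 - h))" .
    have "\<bar>D r' - D r\<bar> \<le> expectation (\<lambda>\<omega>. B * Q \<omega>)"
      unfolding eq
    proof (rule order_trans[OF integral_abs_bound integral_mono])
      fix \<omega> assume \<omega>: "\<omega> \<in> space M"
      let ?R = "V r' \<omega> - V r \<omega> - G r \<omega> * f1 (Y r \<omega>) * \<zeta>' \<omega> * w r' \<omega> - G r \<omega> * f2 (Y r \<omega>) * (\<zeta>' \<omega>)\<^sup>2 / 2 * ((w r' \<omega>)\<^sup>2 - h)"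
      have "Z \<omega> * V r' \<omega> - Z \<omega> * V r \<omega> - m1 \<omega> * w r' \<omega> - m2 \<omega> * ((w r' \<omega>)\<^sup>2 - h) = Z \<omega> * ?R"
        by (simp add: m1_def m2_def algebra_simps)
      then have eq: "Z \<omega> * V r' \<omega> - Z \<omega> * V r \<omega> - m1 \<omega> * w r' \<omega> - m2 \<omega> * ((w r' \<omega>)\<^sup>2 - h) = Z \<omega> * ?R" .
      show "\<bar>Z \<omega> * V r' \<omega> - Z \<omega> * V r \<omega> - m1 \<omega> * w r' \<omega> - m2 \<omega> * ((w r' \<omega>)\<^sup>2 - h)\<bar> \<le> B * Q \<omega>"
        unfolding eq abs_mult using V[OF \<omega>] Z(2)[OF \<omega>] B1 by (intro mult_mono) auto
    qed (use Qi mm ZV_integrable r in auto)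
    also have "\<dots> = B * expectation Q" by simp
    finally show ?thesis using Qe by (simp add: h_def)
  qed
  with C'0 that show ?thesis by blast
qed

theorem D_constant: "s \<le> t \<Longrightarrow> D t = D s"
proof (rule has_derivative_zero_unique_strong_interval[of "insert s (insert t (\<tau> ` {..n}))" s t D "D s"])
  assume st: "s \<le> t"
  fix r assume r: "r \<in> {s..t} - insert s (insert t (\<tau> ` {..n}))"
  have "open (- (\<tau> ` {..n}))" by (intro open_Compl finite_imp_closed) auto
  with r obtain \<epsilon>0 where \<epsilon>0: "0 < \<epsilon>0" "ball r \<epsilon>0 \<subseteq> - (\<tau> ` {..n})"
    by (metis ComplI DiffD2 insertCI open_contains_ball)
  have piece: "\<tau> i \<le> u \<or> v \<le> \<tau> i" if "i \<le> n" "\<bar>u - r\<bar> < \<epsilon>0" "\<bar>v - r\<bar> < \<epsilon>0" for i u v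
  proof (rule ccontr)
    assume "\<not> ?thesis"
    then have "\<tau> i \<in> ball r \<epsilon>0" using that by (auto simp: dist_real_def)
    then show False using \<epsilon>0(2) that(1) by auto
  qed
  have "(D has_field_derivative 0) (at r within {s..t})"
    unfolding has_field_derivative_iff Lim_within
  proof (intro allI impI)
    fix e :: real assume e: "0 < e"
    have B: "0 < B" using B1 by auto
    \<comment> \<open>Then \<open>10 * B ^ 4 * \<eta> = e / 2\<close>; the radius \<open>d\<close>
      below leaves at most \<open>e / 4\<close> for the term with \<open>C\<close> and keeps the
      step clear of all \<open>\<tau> i\<close>, so the difference quotient stays below
      \<open>e\<close>.\<close>
    define \<eta> where "\<eta> = e / (20 * B ^ 4)"
    have \<eta>: "0 < \<eta>" using e B by (simp add: \<eta>_def)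
    obtain C where C: "0 \<le> C" "\<And>r r'. s \<le> r \<Longrightarrow> r < r' \<Longrightarrow> r' \<le> r + 1 \<Longrightarrow> (\<And>i. i \<le> n \<Longrightarrow> \<tau> i \<le> r \<or> r' \<le> \<tau> i) \<Longrightarrow>
     \<bar>D r' - D r\<bar> \<le> (r' - r) * (10 * B ^ 4 * \<eta> + C * (r' - r))"
      using D_increment[OF \<eta>] by metis
    define d where "d = min (min \<epsilon>0 1) (min (e / (4 * (C + 1))) (r - s))"
    have d: "0 < d" "d \<le> \<epsilon>0" "d \<le> 1" "d \<le> r - s" "d \<le> e / (4 * (C + 1))" using \<epsilon>0 e C r by (auto simp: d_def)
    have "dist ((D x - D r) / (x - r)) 0 < e" if x: "x \<in> {s..t}" "0 < dist x r" "dist x r < d" for x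
    proof -
      have "\<bar>D x - D r\<bar> \<le> \<bar>x - r\<bar> * (10 * B ^ 4 * \<eta> + C * \<bar>x - r\<bar>)"
      proof (cases "r < x")
        case True
        then show ?thesis using C(2)[of r x] piece[of _ r x] x d r by (auto simp: dist_real_def)
      next
        case False
        then show ?thesis using C(2)[of x r] piece[of _ x r] x d r by (auto simp: dist_real_def abs_minus_commute)
      qed
      also have "\<dots> < \<bar>x - r\<bar> * e"
      proof (rule mult_strict_left_mono)
        have "C * \<bar>x - r\<bar> \<le> C * (e / (4 * (C + 1)))"
          using C(1) x d by (intro mult_left_mono) (auto simp: dist_real_def)
        also have "\<dots> \<le> e / 4" using C(1) e by (simp add: field_simps)
        finally show "10 * B ^ 4 * \<eta> + C * \<bar>x - r\<bar> < e" using e B by (simp add: \<eta>_def)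
      qed (use x in auto)
      finally show ?thesis using x by (simp add: dist_real_def divide_less_eq mult.commute)
    qed
    with d(1) show "\<exists>d>0. \<forall>x\<in>{s..t}. 0 < dist x r \<and> dist x r < d \<longrightarrow> dist ((D x - D r) / (x - r)) 0 < e"
      by blast
  qed
  moreover have "(*) 0 = (\<lambda>h::real. 0::real)" by auto
  ultimately show "(D has_derivative (\<lambda>h. 0)) (at r within {s..t})"
    by (simp add: has_field_derivative_def)
qed (auto intro: D_continuous)

end

section \<open>Passage to the limit: the Feynman-Kac formula for diffusions\<close>

text \<open>The limit superior of \<open>A\<close> is at most \<open>\<eta> * K\<close> for every
  \<open>\<eta>\<close>. This form fits moduli of continuity, whose constant \<open>C\<close> may
  blow up as \<open>\<eta>\<close> shrinks.\<close>

lemma tendsto_0_of_eta_bound: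
  fixes A h :: "nat \<Rightarrow> real"
  assumes h: "h \<longlonglongrightarrow> 0" and K: "0 \<le> K" and A: "\<And>k. 0 \<le> A k"
    and b: "\<And>\<eta>. 0 < \<eta> \<Longrightarrow> \<exists>C. \<forall>k. A k \<le> \<eta> * K + C * h k"
  shows "A \<longlonglongrightarrow> 0"
proof (rule LIMSEQ_I)
  fix e :: real assume e: "0 < e"
  define \<eta> where "\<eta> = e / (2 * (K + 1))"
  have \<eta>: "0 < \<eta>" using e K by (simp add: \<eta>_def)
  have \<eta>2: "\<eta> * K \<le> e / 2" using e K by (auto simp: \<eta>_def field_simps)
  obtain C where C: "\<And>k. A k \<le> \<eta> * K + C * h k" using b[OF \<eta>] by blast
  have "(\<lambda>k. C * h k) \<longlonglongrightarrow> C * 0" by (intro tendsto_intros h)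
  then obtain N where "\<And>k. N \<le> k \<Longrightarrow> \<bar>C * h k\<bar> < e / 2"
    using LIMSEQ_D[of "\<lambda>k. C * h k" 0 "e / 2"] e by auto
  then have "norm (A k - 0) < e" if "N \<le> k" for k
    using C[of k] \<eta>2 A[of k] that by (smt (verit) field_sum_of_halves real_norm_def)
  then show "\<exists>N. \<forall>k\<ge>N. norm (A k - 0) < e" by blast
qed

text \<open>The distance enters as \<open>min 1 \<bar>x - y\<bar>\<close>, because the expectation
  of that quantity is what convergence in probability controls.\<close>

lemma uniformly_continuous_min_modulus:
  fixes g :: "real \<Rightarrow> real"
  assumes "uniformly_continuous_on UNIV g" "\<And>x. \<bar>g x\<bar> \<le> b" "0 < \<eta>"
  obtains C where "0 \<le> C" "\<And>x y. \<bar>g x - g y\<bar> \<le> \<eta> + C * min 1 \<bar>x - y\<bar>"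
proof -
  obtain C where C: "0 \<le> C" "\<And>x y. \<bar>g x - g y\<bar> \<le> \<eta> + C * (x - y)\<^sup>2"
    using uniformly_continuous_quadratic_modulus[OF assms] by metis
  have b: "0 \<le> b" using assms(2)[of 0] by linarith
  have "\<bar>g x - g y\<bar> \<le> \<eta> + (C + 2 * b) * min 1 \<bar>x - y\<bar>" for x y
  proof (cases "\<bar>x - y\<bar> \<le> 1")
    case True
    have "(x - y)\<^sup>2 \<le> \<bar>x - y\<bar>" using True
      by (metis abs_ge_zero abs_mult_self_eq mult_left_le power2_eq_square)
    then have "C * (x - y)\<^sup>2 \<le> C * \<bar>x - y\<bar>" using C by (intro mult_left_mono)
    with C(2)[of x y] True b show ?thesis
      by (simp add: min_absorb2 distrib_right) (smt (verit) mult_nonneg_nonneg)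
  next
    case False
    have "\<bar>g x - g y\<bar> \<le> 2 * b" using assms(2)[of x] assms(2)[of y] by linarith
    with False C(1) assms(3) show ?thesis by simp
  qed
  with C b that[of "C + 2 * b"] show ?thesis by simp
qed

lemma abs_exp_minus_diff_le:
  fixes p q :: real
  assumes "0 \<le> p" "0 \<le> q"
  shows "\<bar>exp (- p) - exp (- q)\<bar> \<le> \<bar>p - q\<bar>"
proof -
  have *: "exp (- p) - exp (- q) \<le> q - p" if "0 \<le> p" "p \<le> q" for p q :: real
  proof -
    have "exp (- p) - exp (- q) = exp (- p) * (1 - exp (- (q - p)))"
      by (simp add: algebra_simps exp_add[symmetric])
    also have "\<dots> \<le> 1 * (q - p)"
    proof (rule mult_mono)
      show "1 - exp (- (q - p)) \<le> q - p" using exp_ge_add_one_self[of "- (q - p)"] by linarith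
    qed (use that in auto)
    finally show ?thesis by simp
  qed
  show ?thesis using *[of p q] *[of q p] assms by (cases "p \<le> q") auto
qed

lemma continuous_Icc_bound:
  fixes g :: "real \<Rightarrow> real"
  assumes "continuous_on UNIV g"
  obtains m where "0 \<le> m" "\<And>u. u \<in> {s..t} \<Longrightarrow> \<bar>g u\<bar> \<le> m"
proof -
  have "compact (g ` {s..t})"
    by (intro compact_continuous_image continuous_on_subset[OF assms]) auto
  then obtain m where m: "\<forall>x\<in>g ` {s..t}. norm x \<le> m" using compact_imp_bounded by (metis bounded_iff)
  then show ?thesis using that[of "max m 0"] by (auto simp: le_max_iff_disj)
qed

text \<open>A deterministic statement about one path. \<open>H k\<close> converges to
  \<open>\<alpha>\<close> in mean square over the time interval only; hence
  \<open>(H k)\<^sup>2\<close> converges in mean, the discounts converge uniformly, and differences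
  of integrands are split so that each piece contains one of these controlled factors. The bounds
  \<open>hb k\<close> may grow with \<open>k\<close> and serve integrability alone.\<close>

lemma discounted_path_limit:
  fixes y H :: "nat \<Rightarrow> real \<Rightarrow> real" and \<xi> \<alpha> \<beta> c :: "real \<Rightarrow> real"
  assumes st: "s \<le> t" and \<delta>: "0 \<le> \<delta>"
    and f_bd: "\<And>y. \<bar>f y\<bar> \<le> m" "\<And>y. \<bar>f1 y\<bar> \<le> m" "\<And>y. \<bar>f2 y\<bar> \<le> m"
    and f_uc: "uniformly_continuous_on UNIV f" "uniformly_continuous_on UNIV f1" "uniformly_continuous_on UNIV f2"
    and co: "continuous_on UNIV \<xi>" "continuous_on UNIV \<alpha>" "continuous_on UNIV \<beta>" "continuous_on UNIV c"
    and y: "\<And>k. continuous_on UNIV (y k)"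
    and H: "\<And>k. set_borel_measurable lborel {s..t} (H k)" "\<And>k u. \<bar>H k u\<bar> \<le> hb k"
    and c: "\<And>u. 0 \<le> c u"
    and h: "(\<lambda>k. LBINT u:{s..t}. (H k u - \<alpha> u)\<^sup>2) \<longlonglongrightarrow> 0"
    and e: "(\<lambda>k. LBINT u:{s..t}. min 1 \<bar>y k u - \<xi> u\<bar>) \<longlonglongrightarrow> 0"
    and et: "(\<lambda>k. y k t) \<longlonglongrightarrow> \<xi> t"
  shows "(\<lambda>k. f (y k t) * exp (- (LBINT v:{s..t}. c v + \<delta> * (H k v)\<^sup>2)) -
      (LBINT u:{s..t}. exp (- (LBINT v:{s..u}. c v + \<delta> * (H k v)\<^sup>2)) *
        (f1 (y k u) * \<beta> u + (H k u)\<^sup>2 * f2 (y k u) / 2 - (c u + \<delta> * (H k u)\<^sup>2) * f (y k u))))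
    \<longlonglongrightarrow> f (\<xi> t) * exp (- (LBINT v:{s..t}. c v + \<delta> * (\<alpha> v)\<^sup>2)) -
      (LBINT u:{s..t}. exp (- (LBINT v:{s..u}. c v + \<delta> * (\<alpha> v)\<^sup>2)) *
        (f1 (\<xi> u) * \<beta> u + (\<alpha> u)\<^sup>2 * f2 (\<xi> u) / 2 - (c u + \<delta> * (\<alpha> u)\<^sup>2) * f (\<xi> u)))"
proof -
  have m0: "0 \<le> m" using f_bd(1)[of 0] by linarith
  have fc: "continuous_on UNIV f" "continuous_on UNIV f1" "continuous_on UNIV f2"
    using f_uc by (auto intro: uniformly_continuous_imp_continuous)
  note cmp = continuous_on_compose2[OF fc(1) _ subset_UNIV] continuous_on_compose2[OF fc(2) _ subset_UNIV]
    continuous_on_compose2[OF fc(3) _ subset_UNIV]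
  have int: "set_integrable lborel {s..t} g" if "continuous_on UNIV g" for g :: "real \<Rightarrow> real"
    using that by (intro borel_integrable_atLeastAtMost') (auto intro: continuous_on_subset)
  have Hm[measurable]: "(\<lambda>u. indicator {s..t} u * H k u) \<in> borel_measurable borel" for k
    using H(1)[of k] by (simp add: set_borel_measurable_def)
  have ind: "set_borel_measurable lborel {s..t} (\<lambda>u. g u (H k u))"
    if "(\<lambda>x. g (fst x) (snd x)) \<in> borel_measurable (borel \<Otimes>\<^sub>M borel)" for g :: "real \<Rightarrow> real \<Rightarrow> real" and k
  proof -
    have "(\<lambda>u. (u, indicator {s..t} u * H k u)) \<in> borel \<rightarrow>\<^sub>M borel \<Otimes>\<^sub>M borel" by measurable
    from measurable_compose[OF this that]
    have [measurable]: "(\<lambda>u. g u (indicator {s..t} u * H k u)) \<in> borel_measurable borel" by simp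
    have "(\<lambda>u. indicator {s..t} u * g u (indicator {s..t} u * H k u)) \<in> borel_measurable borel" by measurable
    also have "(\<lambda>u. indicator {s..t} u * g u (indicator {s..t} u * H k u)) = (\<lambda>u. indicator {s..t} u * g u (H k u))"
      by (auto simp: indicator_def)
    finally show ?thesis by (simp add: set_borel_measurable_def)
  qed
  have cob: "continuous_on UNIV g \<Longrightarrow> g \<in> borel_measurable borel" for g :: "real \<Rightarrow> real"
    by (rule borel_measurable_continuous_onI)
  note [measurable] = cob[OF co(1)] cob[OF co(2)] cob[OF co(3)] cob[OF co(4)] cob[OF y] cob[OF fc(1)] cob[OF fc(2)] cob[OF fc(3)]
  obtain a0 where a0: "0 \<le> a0" "\<And>u. u \<in> {s..t} \<Longrightarrow> \<bar>\<alpha> u\<bar> \<le> a0" using continuous_Icc_bound[OF co(2)] by metis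
  obtain b0 where b0: "0 \<le> b0" "\<And>u. u \<in> {s..t} \<Longrightarrow> \<bar>\<beta> u\<bar> \<le> b0" using continuous_Icc_bound[OF co(3)] by metis
  obtain c0 where c0: "0 \<le> c0" "\<And>u. u \<in> {s..t} \<Longrightarrow> \<bar>c u\<bar> \<le> c0" using continuous_Icc_bound[OF co(4)] by metis
  have hb0: "0 \<le> hb k" for k using H(2)[of k 0] by linarith
  have H2: "(H k u)\<^sup>2 \<le> (hb k)\<^sup>2" for k u using H(2)[of k u] hb0[of k] by (simp add: abs_le_square_iff[symmetric])
  have \<alpha>2: "(\<alpha> u)\<^sup>2 \<le> a0\<^sup>2" if "u \<in> {s..t}" for u using a0(2)[OF that] a0(1) by (simp add: abs_le_square_iff[symmetric])
  have HI: "set_integrable lborel {s..t} (\<lambda>u. (H k u)\<^sup>2)" for k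
    by (rule set_integrable_bounded_Icc[of _ _ _ "(hb k)\<^sup>2"]) (use ind[of "\<lambda>u h. h\<^sup>2"] H2 in auto)
  have HA: "set_integrable lborel {s..t} (\<lambda>u. \<bar>(H k u)\<^sup>2 - (\<alpha> u)\<^sup>2\<bar>)" for k
    by (rule set_integrable_abs, rule set_integral_diff(1)[OF HI int]) (intro continuous_intros co)
  have HD: "set_integrable lborel {s..t} (\<lambda>u. (H k u - \<alpha> u)\<^sup>2)" for k
  proof (rule set_integrable_bounded_Icc)
    show "\<bar>(H k u - \<alpha> u)\<^sup>2\<bar> \<le> (hb k + a0)\<^sup>2" if "u \<in> {s..t}" for u
    proof -
      have "\<bar>H k u - \<alpha> u\<bar> \<le> \<bar>hb k + a0\<bar>" using H(2)[of k u] a0(2)[OF that] by linarith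
      then show ?thesis by (simp add: abs_le_square_iff)
    qed
  qed (use ind[of "\<lambda>u h. (h - \<alpha> u)\<^sup>2"] in auto)
  define A where "A k = (LBINT u:{s..t}. \<bar>(H k u)\<^sup>2 - (\<alpha> u)\<^sup>2\<bar>)" for k
  have A0: "0 \<le> A k" for k unfolding A_def set_lebesgue_integral_def by (intro integral_nonneg_AE) auto
  have A: "A \<longlonglongrightarrow> 0"
  proof (rule tendsto_0_of_eta_bound[OF h _ A0])
    show "0 \<le> a0\<^sup>2 * (t - s)" using st by simp
    fix \<eta> :: real assume \<eta>: "0 < \<eta>"
    have "A k \<le> \<eta> * (a0\<^sup>2 * (t - s)) + (1 + 1 / \<eta>) * (LBINT u:{s..t}. (H k u - \<alpha> u)\<^sup>2)" for k
    proof -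
      have "A k \<le> (LBINT u:{s..t}. \<eta> * a0\<^sup>2 + (1 + 1 / \<eta>) * (H k u - \<alpha> u)\<^sup>2)"
        unfolding A_def
      proof (intro set_integral_mono HA set_integral_add(1) set_integrable_mult_right HD)
        fix u assume u: "u \<in> {s..t}"
        let ?d = "H k u - \<alpha> u"
        \<comment> \<open>The cross term \<open>2 * \<alpha> u * ?d\<close> is at most
          \<open>\<eta> * (\<alpha> u)\<^sup>2 + ?d\<^sup>2 / \<eta>\<close>, so that only
          \<open>?d\<^sup>2\<close>, the quantity whose integral vanishes in the limit, carries a
          large constant.\<close>
        have 1: "(H k u)\<^sup>2 - (\<alpha> u)\<^sup>2 = ?d\<^sup>2 + 2 * \<alpha> u * ?d" by (simp add: power2_eq_square algebra_simps)
        have "0 \<le> (\<eta> * \<bar>\<alpha> u\<bar> - \<bar>?d\<bar>)\<^sup>2" by simp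
        then have "2 * \<bar>\<alpha> u\<bar> * \<bar>?d\<bar> * \<eta> \<le> \<eta>\<^sup>2 * (\<alpha> u)\<^sup>2 + ?d\<^sup>2"
          by (simp add: power2_diff power_mult_distrib mult_ac)
        then have "2 * \<bar>\<alpha> u\<bar> * \<bar>?d\<bar> \<le> (\<eta>\<^sup>2 * (\<alpha> u)\<^sup>2 + ?d\<^sup>2) / \<eta>" using \<eta> by (simp add: pos_le_divide_eq)
        also have "\<dots> = \<eta> * (\<alpha> u)\<^sup>2 + ?d\<^sup>2 / \<eta>" using \<eta> by (simp add: add_divide_distrib power2_eq_square)
        also have "\<dots> \<le> \<eta> * a0\<^sup>2 + ?d\<^sup>2 / \<eta>" using \<alpha>2[OF u] \<eta> by simp
        finally have "\<bar>2 * \<alpha> u * ?d\<bar> \<le> \<eta> * a0\<^sup>2 + ?d\<^sup>2 / \<eta>" by (simp add: abs_mult)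
        then show "\<bar>(H k u)\<^sup>2 - (\<alpha> u)\<^sup>2\<bar> \<le> \<eta> * a0\<^sup>2 + (1 + 1 / \<eta>) * ?d\<^sup>2"
          unfolding 1 using abs_triangle_ineq[of "?d\<^sup>2" "2 * \<alpha> u * ?d"] by (simp add: distrib_right)
      qed (intro int continuous_intros)
      also have "\<dots> = (LBINT u:{s..t}. \<eta> * a0\<^sup>2) + (1 + 1 / \<eta>) * (LBINT u:{s..t}. (H k u - \<alpha> u)\<^sup>2)"
        by (subst set_integral_add(2)[OF int[OF continuous_on_const] set_integrable_mult_right[OF HD]]) simp
      finally show ?thesis using st by (simp add: set_lebesgue_integral_def mult_ac)
    qed
    then show "\<exists>C. \<forall>k. A k \<le> \<eta> * (a0\<^sup>2 * (t - s)) + C * (LBINT u:{s..t}. (H k u - \<alpha> u)\<^sup>2)" by blast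
  qed
  define P where "P g k = (LBINT u:{s..t}. \<bar>g (y k u) - g (\<xi> u)\<bar>)" for g :: "real \<Rightarrow> real" and k
  have P: "P g \<longlonglongrightarrow> 0" if g: "uniformly_continuous_on UNIV g" "\<And>x. \<bar>g x\<bar> \<le> m" for g
  proof (rule tendsto_0_of_eta_bound[OF e])
    show "0 \<le> t - s" using st by simp
    show "0 \<le> P g k" for k unfolding P_def set_lebesgue_integral_def by (intro integral_nonneg_AE) auto
    fix \<eta> :: real assume \<eta>: "0 < \<eta>"
    obtain C where C: "0 \<le> C" "\<And>x y. \<bar>g x - g y\<bar> \<le> \<eta> + C * min 1 \<bar>x - y\<bar>"
      using uniformly_continuous_min_modulus[OF g \<eta>] by metis
    note cg = continuous_on_compose2[OF uniformly_continuous_imp_continuous[OF g(1)] _ subset_UNIV]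
    have "P g k \<le> \<eta> * (t - s) + C * (LBINT u:{s..t}. min 1 \<bar>y k u - \<xi> u\<bar>)" for k
    proof -
      have "P g k \<le> (LBINT u:{s..t}. \<eta> + C * min 1 \<bar>y k u - \<xi> u\<bar>)"
        unfolding P_def using C(2) by (intro set_integral_mono int continuous_intros cg y co) auto
      also have "\<dots> = (LBINT u:{s..t}. \<eta>) + C * (LBINT u:{s..t}. min 1 \<bar>y k u - \<xi> u\<bar>)"
        by (subst set_integral_add(2)) (auto intro!: set_integrable_mult_right int continuous_intros y co)
      finally show ?thesis using st by (simp add: set_lebesgue_integral_def mult_ac)
    qed
    then show "\<exists>C. \<forall>k. P g k \<le> \<eta> * (t - s) + C * (LBINT u:{s..t}. min 1 \<bar>y k u - \<xi> u\<bar>)" by blast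
  qed
  define \<gamma> where "\<gamma> k v = c v + \<delta> * (H k v)\<^sup>2" for k v
  define \<gamma>' where "\<gamma>' v = c v + \<delta> * (\<alpha> v)\<^sup>2" for v
  define G where "G k u = exp (- (LBINT v:{s..u}. \<gamma> k v))" for k u
  define G' where "G' u = exp (- (LBINT v:{s..u}. \<gamma>' v))" for u
  define K where "K k u = f1 (y k u) * \<beta> u + (H k u)\<^sup>2 * f2 (y k u) / 2 - \<gamma> k u * f (y k u)" for k u
  define K' where "K' u = f1 (\<xi> u) * \<beta> u + (\<alpha> u)\<^sup>2 * f2 (\<xi> u) / 2 - \<gamma>' u * f (\<xi> u)" for u
  have \<gamma>I: "set_integrable lborel {s..t} (\<gamma> k)" for k unfolding \<gamma>_def
    by (intro set_integral_add(1) set_integrable_mult_right HI int co)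
  have \<gamma>c: "continuous_on UNIV \<gamma>'" unfolding \<gamma>'_def by (intro continuous_intros co)
  have nn: "0 \<le> (LBINT v:{s..u}. \<gamma> k v)" "0 \<le> (LBINT v:{s..u}. \<gamma>' v)" for k u
    unfolding set_lebesgue_integral_def by (auto intro!: integral_nonneg_AE simp: \<gamma>_def \<gamma>'_def c \<delta>)
  have G01: "\<bar>G k u\<bar> \<le> 1" "\<bar>G' u\<bar> \<le> 1" for k u using nn by (auto simp: G_def G'_def)
  have GG: "\<bar>G k u - G' u\<bar> \<le> \<delta> * A k" if u: "u \<in> {s..t}" for k u
  proof -
    have sub: "set_integrable lborel {s..u} g" if "set_integrable lborel {s..t} g" for g :: "real \<Rightarrow> real"
      by (rule set_integrable_subset[OF that]) (use u in auto)
    have "(LBINT v:{s..u}. \<gamma> k v) - (LBINT v:{s..u}. \<gamma>' v) = (LBINT v:{s..u}. \<delta> * ((H k v)\<^sup>2 - (\<alpha> v)\<^sup>2))"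
      by (subst set_integral_diff(2)[symmetric, OF sub[OF \<gamma>I] sub[OF int[OF \<gamma>c]]])
        (simp add: \<gamma>_def \<gamma>'_def algebra_simps)
    then have "\<bar>(LBINT v:{s..u}. \<gamma> k v) - (LBINT v:{s..u}. \<gamma>' v)\<bar> = \<delta> * \<bar>LBINT v:{s..u}. (H k v)\<^sup>2 - (\<alpha> v)\<^sup>2\<bar>"
      using \<delta> by (simp add: abs_mult)
    also have "\<bar>LBINT v:{s..u}. (H k v)\<^sup>2 - (\<alpha> v)\<^sup>2\<bar> \<le> (LBINT v:{s..u}. \<bar>(H k v)\<^sup>2 - (\<alpha> v)\<^sup>2\<bar>)"
    proof -
      have "set_integrable lborel {s..u} (\<lambda>v. (H k v)\<^sup>2 - (\<alpha> v)\<^sup>2)"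
        by (rule sub, rule set_integral_diff(1)[OF HI int]) (intro continuous_intros co)
      from set_integral_norm_bound[OF this] show ?thesis by simp
    qed
    also have "\<dots> \<le> A k"
      unfolding A_def set_lebesgue_integral_def
    proof (rule integral_mono)
      show "integrable lborel (\<lambda>v. indicator {s..u} v *\<^sub>R \<bar>(H k v)\<^sup>2 - (\<alpha> v)\<^sup>2\<bar>)"
        using sub[OF HA[of k]] by (simp add: set_integrable_def)
      show "integrable lborel (\<lambda>v. indicator {s..t} v *\<^sub>R \<bar>(H k v)\<^sup>2 - (\<alpha> v)\<^sup>2\<bar>)"
        using HA[of k] by (simp add: set_integrable_def)
    qed (use u in \<open>auto simp: indicator_def\<close>)
    finally have "\<bar>(LBINT v:{s..u}. \<gamma> k v) - (LBINT v:{s..u}. \<gamma>' v)\<bar> \<le> \<delta> * A k"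
      using \<delta> by (simp add: mult_left_mono)
    then show ?thesis unfolding G_def G'_def
      using abs_exp_minus_diff_le[OF nn] by (rule order_trans[rotated])
  qed
  define L where "L = b0 + a0\<^sup>2 + (c0 + \<delta> * a0\<^sup>2)"
  have L0: "0 \<le> L" using a0 b0 c0 \<delta> by (simp add: L_def)
  have K'b: "\<bar>K' u\<bar> \<le> L * m" if u: "u \<in> {s..t}" for u
  proof -
    have "\<bar>f1 (\<xi> u) * \<beta> u\<bar> \<le> m * b0" unfolding abs_mult using f_bd(2) b0(2)[OF u] m0 by (intro mult_mono) auto
    moreover have "\<bar>(\<alpha> u)\<^sup>2 * f2 (\<xi> u)\<bar> \<le> a0\<^sup>2 * m" unfolding abs_mult using f_bd(3) \<alpha>2[OF u] by (intro mult_mono) auto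
    moreover have "\<bar>\<gamma>' u * f (\<xi> u)\<bar> \<le> (c0 + \<delta> * a0\<^sup>2) * m"
    proof -
      have "\<bar>\<gamma>' u\<bar> \<le> c0 + \<delta> * a0\<^sup>2" using c[of u] c0(2)[OF u] mult_left_mono[OF \<alpha>2[OF u] \<delta>] \<delta> by (simp add: \<gamma>'_def)
      then show ?thesis unfolding abs_mult using f_bd(1) c0(1) \<delta> by (intro mult_mono) auto
    qed
    moreover have "0 \<le> a0\<^sup>2 * m" using m0 by simp
    ultimately have "\<bar>K' u\<bar> \<le> m * b0 + a0\<^sup>2 * m + (c0 + \<delta> * a0\<^sup>2) * m" unfolding K'_def by linarith
    then show ?thesis by (simp add: L_def algebra_simps)
  qed
  \<comment> \<open>\<open>L\<close> bounds the limiting coefficients; the last summand is the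
    discount error \<open>\<delta> * A k\<close> times the bound \<open>L * m\<close> of
    \<open>K'\<close>, over an interval of length \<open>t - s\<close>.\<close>
  define S where "S k = L * (P f k + P f1 k + P f2 k) + (m + \<delta> * m) * A k + L * m * \<delta> * (t - s) * A k" for k
  have KI: "set_integrable lborel {s..t} (\<lambda>u. G k u * K k u)" for k
  proof -
    have Gm: "continuous_on {s..t} (G k)"
      unfolding G_def
      by (intro continuous_intros continuous_on_subset[OF set_integral_Icc_continuous[OF \<gamma>I, where m="c0 + \<delta> * (hb k)\<^sup>2"]])
        (use c c0 \<delta> H2[of k] mult_left_mono[OF H2[of k] \<delta>] in \<open>auto simp: \<gamma>_def intro!: add_mono\<close>)
    have m1: "set_borel_measurable lborel {s..t} (K k)" unfolding K_def \<gamma>_def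
      by (rule ind[of "\<lambda>u h. f1 (y k u) * \<beta> u + h\<^sup>2 * f2 (y k u) / 2 - (c u + \<delta> * h\<^sup>2) * f (y k u)"]) measurable
    have m2: "set_borel_measurable lborel {s..t} (G k)"
      using borel_measurable_continuous_on_indicator[OF _ Gm] by (simp add: set_borel_measurable_def)
    have Kb: "\<bar>K k u\<bar> \<le> m * b0 + (hb k)\<^sup>2 * m + (c0 + \<delta> * (hb k)\<^sup>2) * m" if u: "u \<in> {s..t}" for u
    proof -
      have "\<bar>f1 (y k u) * \<beta> u\<bar> \<le> m * b0" unfolding abs_mult using f_bd(2) b0(2)[OF u] m0 by (intro mult_mono) auto
      moreover have "\<bar>(H k u)\<^sup>2 * f2 (y k u)\<bar> \<le> (hb k)\<^sup>2 * m" unfolding abs_mult using f_bd(3) H2[of k u] by (intro mult_mono) auto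
      moreover have "\<bar>\<gamma> k u * f (y k u)\<bar> \<le> (c0 + \<delta> * (hb k)\<^sup>2) * m"
      proof -
        have "\<bar>\<gamma> k u\<bar> \<le> c0 + \<delta> * (hb k)\<^sup>2" using c[of u] c0(2)[OF u] mult_left_mono[OF H2[of k u] \<delta>] \<delta> by (simp add: \<gamma>_def)
        then show ?thesis unfolding abs_mult using f_bd(1) c0(1) \<delta> by (intro mult_mono) auto
      qed
      moreover have "0 \<le> (hb k)\<^sup>2 * m" using m0 by simp
      ultimately show ?thesis unfolding K_def by linarith
    qed
    show ?thesis
    proof (rule set_integrable_bounded_Icc)
      have "(\<lambda>u. (indicator {s..t} u *\<^sub>R G k u) * (indicator {s..t} u *\<^sub>R K k u)) \<in> borel_measurable lborel"
        using m1 m2 unfolding set_borel_measurable_def by (rule borel_measurable_times[rotated])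
      also have "(\<lambda>u. (indicator {s..t} u *\<^sub>R G k u) * (indicator {s..t} u *\<^sub>R K k u)) = (\<lambda>u. indicator {s..t} u *\<^sub>R (G k u * K k u))"
        by (auto simp: indicator_def)
      finally show "set_borel_measurable lborel {s..t} (\<lambda>u. G k u * K k u)" by (simp add: set_borel_measurable_def)
      show "\<bar>G k u * K k u\<bar> \<le> 1 * (m * b0 + (hb k)\<^sup>2 * m + (c0 + \<delta> * (hb k)\<^sup>2) * m)" if "u \<in> {s..t}" for u
        unfolding abs_mult by (rule mult_mono[OF G01(1) Kb[OF that]]) auto
    qed
  qed
  have G'c: "continuous_on {s..t} G'"
  proof -
    obtain g0 where "0 \<le> g0" "\<And>u. u \<in> {s..t} \<Longrightarrow> \<bar>\<gamma>' u\<bar> \<le> g0" using continuous_Icc_bound[OF \<gamma>c] by metis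
    then show ?thesis unfolding G'_def
      by (intro continuous_intros continuous_on_subset[OF set_integral_Icc_continuous[OF int[OF \<gamma>c], where m=g0]]) auto
  qed
  have KI': "set_integrable lborel {s..t} (\<lambda>u. G' u * K' u)"
    unfolding K'_def by (intro borel_integrable_atLeastAtMost' continuous_intros G'c continuous_on_subset[OF \<gamma>c]
      continuous_on_subset[OF co(2)] continuous_on_subset[OF co(3)] continuous_on_subset[OF cmp(1)[OF co(1)]]
      continuous_on_subset[OF cmp(2)[OF co(1)]] continuous_on_subset[OF cmp(3)[OF co(1)]]) auto
  have main: "\<bar>(LBINT u:{s..t}. G k u * K k u) - (LBINT u:{s..t}. G' u * K' u)\<bar> \<le> S k" for k
  proof -
    let ?p = "\<lambda>g u. \<bar>g (y k u) - g (\<xi> u)\<bar>" and ?a = "\<lambda>u. \<bar>(H k u)\<^sup>2 - (\<alpha> u)\<^sup>2\<bar>"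
    have eq: "(LBINT u:{s..t}. G k u * K k u) - (LBINT u:{s..t}. G' u * K' u) = (LBINT u:{s..t}. G k u * K k u - G' u * K' u)"
      by (rule set_integral_diff(2)[symmetric, OF KI KI'])
    have bd: "\<bar>G k u * K k u - G' u * K' u\<bar> \<le> L * (?p f u + ?p f1 u + ?p f2 u) + (m + \<delta> * m) * ?a u + L * m * \<delta> * A k"
      if u: "u \<in> {s..t}" for u
    proof -
      have Kd: "K k u - K' u = (f1 (y k u) - f1 (\<xi> u)) * \<beta> u + ((H k u)\<^sup>2 - (\<alpha> u)\<^sup>2) * f2 (y k u) / 2 + (\<alpha> u)\<^sup>2 * (f2 (y k u) - f2 (\<xi> u)) / 2
        - \<gamma>' u * (f (y k u) - f (\<xi> u)) - \<delta> * ((H k u)\<^sup>2 - (\<alpha> u)\<^sup>2) * f (y k u)"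
        unfolding K_def K'_def \<gamma>_def \<gamma>'_def by (simp add: field_simps)
      have 1: "\<bar>(f1 (y k u) - f1 (\<xi> u)) * \<beta> u\<bar> \<le> L * ?p f1 u"
      proof -
        have "\<bar>\<beta> u\<bar> \<le> L" using b0(2)[OF u] a0 c0 \<delta> unfolding L_def by (smt (verit) mult_nonneg_nonneg zero_le_power2)
        then show ?thesis unfolding abs_mult by (subst mult.commute) (intro mult_right_mono, auto)
      qed
      have 2: "\<bar>((H k u)\<^sup>2 - (\<alpha> u)\<^sup>2) * f2 (y k u)\<bar> \<le> m * ?a u"
        unfolding abs_mult using f_bd(3)[of "y k u"] by (subst mult.commute) (intro mult_right_mono, auto)
      have 3: "\<bar>(\<alpha> u)\<^sup>2 * (f2 (y k u) - f2 (\<xi> u))\<bar> \<le> L * ?p f2 u"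
      proof -
        have "\<bar>(\<alpha> u)\<^sup>2\<bar> \<le> L" using \<alpha>2[OF u] b0 c0 \<delta> unfolding L_def by (smt (verit) mult_nonneg_nonneg zero_le_power2)
        then show ?thesis unfolding abs_mult by (intro mult_right_mono) auto
      qed
      have 4: "\<bar>\<gamma>' u * (f (y k u) - f (\<xi> u))\<bar> \<le> L * ?p f u"
      proof -
        have "\<bar>\<gamma>' u\<bar> \<le> L"
          using c[of u] c0(2)[OF u] mult_left_mono[OF \<alpha>2[OF u] \<delta>] \<delta> b0(1) unfolding L_def \<gamma>'_def
          by (smt (verit) mult_nonneg_nonneg zero_le_power2)
        then show ?thesis unfolding abs_mult by (intro mult_right_mono) auto
      qed
      have 5: "\<bar>\<delta> * ((H k u)\<^sup>2 - (\<alpha> u)\<^sup>2) * f (y k u)\<bar> \<le> \<delta> * m * ?a u"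
      proof -
        have "\<delta> * ?a u * \<bar>f (y k u)\<bar> \<le> \<delta> * ?a u * m" using f_bd(1) \<delta> by (intro mult_left_mono) auto
        then show ?thesis using \<delta> by (simp add: abs_mult mult_ac)
      qed
      have nn2: "0 \<le> m * ?a u" "0 \<le> L * ?p f2 u" using m0 L0 by auto
      have tri: "\<bar>x1 + x2 / 2 + x3 / 2 - x4 - x5\<bar> \<le> y1 + y2 + y3 + y4 + y5"
        if "\<bar>x1\<bar> \<le> y1" "\<bar>x2\<bar> \<le> y2" "\<bar>x3\<bar> \<le> y3" "\<bar>x4\<bar> \<le> y4" "\<bar>x5\<bar> \<le> y5"
        for x1 x2 x3 x4 x5 y1 y2 y3 y4 y5 :: real using that by linarith
      have "\<bar>K k u - K' u\<bar> \<le> L * ?p f1 u + m * ?a u + L * ?p f2 u + L * ?p f u + \<delta> * m * ?a u"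
        unfolding Kd by (rule tri[OF 1 2 3 4 5])
      then have KK: "\<bar>K k u - K' u\<bar> \<le> L * (?p f u + ?p f1 u + ?p f2 u) + (m + \<delta> * m) * ?a u"
        by (simp add: algebra_simps)
      have "\<bar>G k u\<bar> * \<bar>K k u - K' u\<bar> \<le> 1 * (L * (?p f u + ?p f1 u + ?p f2 u) + (m + \<delta> * m) * ?a u)"
        by (rule mult_mono[OF G01(1) KK]) auto
      moreover have "\<bar>G k u - G' u\<bar> * \<bar>K' u\<bar> \<le> (\<delta> * A k) * (L * m)"
        by (rule mult_mono[OF GG[OF u] K'b[OF u]]) (use A0 \<delta> in auto)
      moreover have e: "G k u * K k u - G' u * K' u = G k u * (K k u - K' u) + (G k u - G' u) * K' u" by (simp add: algebra_simps)
      ultimately show ?thesis unfolding e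
        using abs_triangle_ineq[of "G k u * (K k u - K' u)" "(G k u - G' u) * K' u"]
        by (simp only: abs_mult) (simp add: mult_ac)
    qed
    have pI: "set_integrable lborel {s..t} (?p f)" "set_integrable lborel {s..t} (?p f1)" "set_integrable lborel {s..t} (?p f2)"
      by (intro int continuous_intros cmp y co)+
    have ri: "set_integrable lborel {s..t} (\<lambda>u. L * (?p f u + ?p f1 u + ?p f2 u) + (m + \<delta> * m) * ?a u + L * m * \<delta> * A k)"
      by (rule set_integral_add(1)[OF set_integral_add(1)[OF set_integrable_mult_right[OF set_integral_add(1)[OF set_integral_add(1)[OF pI(1,2)] pI(3)]]
        set_integrable_mult_right[OF HA]] int[OF continuous_on_const]])
    have "\<bar>LBINT u:{s..t}. G k u * K k u - G' u * K' u\<bar> \<le> (LBINT u:{s..t}. \<bar>G k u * K k u - G' u * K' u\<bar>)"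
      using set_integral_norm_bound[OF set_integral_diff(1)[OF KI KI']] by simp
    also have "\<dots> \<le> (LBINT u:{s..t}. L * (?p f u + ?p f1 u + ?p f2 u) + (m + \<delta> * m) * ?a u + L * m * \<delta> * A k)"
      by (rule set_integral_mono[OF set_integrable_abs[OF set_integral_diff(1)[OF KI KI']] ri bd])
    also have "\<dots> = L * (P f k + P f1 k + P f2 k) + (m + \<delta> * m) * A k + (LBINT u:{s..t}. L * m * \<delta> * A k)"
      unfolding P_def A_def
      by (simp add: set_integral_add set_integrable_mult_right pI HA int[OF continuous_on_const])
    also have "\<dots> = S k" using st by (simp add: S_def set_lebesgue_integral_def)
    finally show ?thesis unfolding eq .
  qed
  have S: "S \<longlonglongrightarrow> 0"
    unfolding S_def using P[OF f_uc(1) f_bd(1)] P[OF f_uc(2) f_bd(2)] P[OF f_uc(3) f_bd(3)] A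
    by (auto intro!: tendsto_eq_intros)
  have 1: "(\<lambda>k. (LBINT u:{s..t}. G k u * K k u)) \<longlonglongrightarrow> (LBINT u:{s..t}. G' u * K' u)"
    by (rule LIM_zero_cancel, rule Lim_null_comparison[OF always_eventually S]) (use main in auto)
  have 2: "(\<lambda>k. G k t) \<longlonglongrightarrow> G' t"
  proof (rule LIM_zero_cancel, rule Lim_null_comparison[OF always_eventually])
    show "\<forall>k. norm (G k t - G' t) \<le> \<delta> * A k" using GG[of t] st by auto
    show "(\<lambda>k. \<delta> * A k) \<longlonglongrightarrow> 0" using A by (auto intro!: tendsto_eq_intros)
  qed
  have 3: "(\<lambda>k. f (y k t)) \<longlonglongrightarrow> f (\<xi> t)"
    using fc(1) et by (rule continuous_on_tendsto_compose) auto
  have "(\<lambda>k. f (y k t) * G k t - (LBINT u:{s..t}. G k u * K k u)) \<longlonglongrightarrow> f (\<xi> t) * G' t - (LBINT u:{s..t}. G' u * K' u)"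
    by (intro tendsto_intros 1 2 3)
  then show ?thesis by (simp add: G_def G'_def K_def K'_def \<gamma>_def \<gamma>'_def)
qed

text \<open>Truncating at 1 turns convergence in probability into convergence of expectations,
  without any moment of \<open>Y\<close>.\<close>

lemma (in prob_space) tendsto_0_in_prob_expectation:
  assumes "tendsto_0_in_prob M Y"
  shows "(\<lambda>k. expectation (\<lambda>\<omega>. enn2real (min 1 (Y k \<omega>)))) \<longlonglongrightarrow> 0"
proof (rule LIMSEQ_I)
  fix e :: real assume e: "0 < e"
  have m[measurable]: "Y k \<in> borel_measurable M" for k using assms by (simp add: tendsto_0_in_prob_def)
  have "(\<lambda>k. prob {\<omega> \<in> space M. ennreal (e / 2) < Y k \<omega>}) \<longlonglongrightarrow> 0"
    using assms e by (simp add: tendsto_0_in_prob_def)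
  from LIMSEQ_D[OF this, of "e / 2"] e obtain N where
    N: "\<And>k. N \<le> k \<Longrightarrow> prob {\<omega> \<in> space M. ennreal (e / 2) < Y k \<omega>} < e / 2" by auto
  have i: "integrable M (\<lambda>\<omega>. enn2real (min 1 (Y k \<omega>)))" for k
  proof (rule integrable_const_bound[of _ 1])
    have "enn2real (min 1 (Y k \<omega>)) \<le> 1" for \<omega> using enn2real_mono[of "min 1 (Y k \<omega>)" 1] by simp
    then show "AE \<omega> in M. norm (enn2real (min 1 (Y k \<omega>))) \<le> 1" by simp
  qed measurable
  have "norm (expectation (\<lambda>\<omega>. enn2real (min 1 (Y k \<omega>))) - 0) < e" if k: "N \<le> k" for k
  proof -
    let ?A = "{\<omega> \<in> space M. ennreal (e / 2) < Y k \<omega>}"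
    have "expectation (\<lambda>\<omega>. enn2real (min 1 (Y k \<omega>))) \<le> expectation (\<lambda>\<omega>. e / 2 + indicator ?A \<omega>)"
    proof (rule integral_mono[OF i])
      fix \<omega> assume \<omega>: "\<omega> \<in> space M"
      show "enn2real (min 1 (Y k \<omega>)) \<le> e / 2 + indicator ?A \<omega>"
      proof (cases "ennreal (e / 2) < Y k \<omega>")
        case True
        have "enn2real (min 1 (Y k \<omega>)) \<le> 1" using enn2real_mono[of "min 1 (Y k \<omega>)" 1] by simp
        with True \<omega> e show ?thesis by simp
      next
        case False
        then have "min 1 (Y k \<omega>) \<le> ennreal (e / 2)" by (simp add: min.coboundedI2)
        from enn2real_mono[OF this] e show ?thesis using False by simp
      qed
    qed (auto intro!: integrable_real_indicator simp: emeasure_eq_measure)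
    also have "\<dots> = e / 2 + prob ?A"
      by (subst Bochner_Integration.integral_add)
        (auto intro!: integrable_real_indicator simp: emeasure_eq_measure prob_space)
    also have "\<dots> < e" using N[OF k] by simp
    finally show ?thesis by simp
  qed
  then show "\<exists>N. \<forall>k\<ge>N. norm (expectation (\<lambda>\<omega>. enn2real (min 1 (Y k \<omega>))) - 0) < e" by blast
qed

text \<open>The Ito integral is eliminated: the simple processes are parameters, and
  \<open>approx_X\<close> says that starting value plus drift plus simple integral converges to
  \<open>X\<close> itself.\<close>

locale diffusion = wiener_setup M F W
  for M :: "'w measure" and F :: "real \<Rightarrow> 'w measure" and W :: "real \<Rightarrow> 'w \<Rightarrow> real" +
  fixes b a :: "real \<Rightarrow> real" and x :: real and X :: "real \<Rightarrow> 'w \<Rightarrow> real"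
    and n :: "nat \<Rightarrow> nat" and \<tau> :: "nat \<Rightarrow> nat \<Rightarrow> real" and \<zeta> :: "nat \<Rightarrow> nat \<Rightarrow> 'w \<Rightarrow> real"
  assumes X_ad: "\<And>t. 0 \<le> t \<Longrightarrow> X t \<in> borel_measurable (F t)"
    and X_co: "\<And>\<omega>. continuous_on UNIV (\<lambda>t. X t \<omega>)"
    and a_co: "continuous_on UNIV a" and b_co: "continuous_on UNIV b" and a_nz: "\<And>z. a z \<noteq> 0"
    and simple: "\<And>k. simple_process F (n k) (\<tau> k) (\<zeta> k)"
    and approx_int: "\<And>T. 0 \<le> T \<Longrightarrow> tendsto_0_in_prob M (\<lambda>k \<omega>. \<integral>\<^sup>+s\<in>{0..T}.
             ennreal ((simple_value (n k) (\<tau> k) (\<zeta> k) s \<omega> - a (X s \<omega>))\<^sup>2) \<partial>lborel)"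
    and approx_X: "\<And>T. 0 \<le> T \<Longrightarrow> tendsto_0_in_prob M (\<lambda>k \<omega>.
             ennreal \<bar>x + (LBINT s:{0..T}. b (X s \<omega>)) + simple_integral W (n k) (\<tau> k) (\<zeta> k) T \<omega> - X T \<omega>\<bar>)"
begin

lemma X_prog: "prog X"
  by (rule prog_continuous[OF X_ad]) (auto intro: continuous_on_subset[OF X_co])

lemma comp_X_co: "continuous_on UNIV g \<Longrightarrow> continuous_on UNIV (\<lambda>t. g (X t \<omega>) :: real)"
  by (rule continuous_on_compose2[OF _ X_co]) auto

lemma comp_X_ad: "continuous_on UNIV g \<Longrightarrow> 0 \<le> t \<Longrightarrow> (\<lambda>\<omega>. g (X t \<omega>) :: real) \<in> borel_measurable (F t)"
  by (rule measurable_compose[OF X_ad borel_measurable_continuous_onI])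

text \<open>Only the stochastic integral is approximated; the drift is that of the true
  path.\<close>

definition Xs where "Xs k u \<omega> = x + (LBINT s:{0..u}. b (X s \<omega>)) + simple_integral W (n k) (\<tau> k) (\<zeta> k) u \<omega>"

lemma int_X: "continuous_on UNIV g \<Longrightarrow> set_integrable lborel {s..t} (\<lambda>u. g (X u \<omega>) :: real)"
  by (intro borel_integrable_atLeastAtMost' continuous_on_subset[OF comp_X_co]) auto

lemma int_X_continuous:
  assumes g: "continuous_on UNIV g"
  shows "continuous_on UNIV (\<lambda>t. LBINT u:{s..t}. g (X u \<omega>) :: real)"
proof (rule continuous_atMost_UNIV)
  fix t
  obtain m where m: "0 \<le> m" "\<And>u. u \<in> {s..t} \<Longrightarrow> \<bar>g (X u \<omega>)\<bar> \<le> m"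
    using continuous_Icc_bound[OF comp_X_co[OF g]] by metis
  then show "continuous_on {..t} (\<lambda>t. LBINT u:{s..t}. g (X u \<omega>))"
    by (intro set_integral_Icc_continuous int_X g) auto
qed

text \<open>An instance with zero coefficients and zero test function, whose purpose is to make the
  facts of \<open>simple_ito\<close> on simple integrals available.\<close>

lemma simple_trivial:
  "simple_ito M F W (\<lambda>_ _. 0) (\<lambda>_ _. 0) (n k) (\<tau> k) (\<zeta> k) 0 0 m (\<lambda>_. 0) (\<lambda>_. 0) (\<lambda>_. 0) (\<lambda>_. 0)"
  if "\<And>i \<omega>. i < n k \<Longrightarrow> \<omega> \<in> space M \<Longrightarrow> \<bar>\<zeta> k i \<omega>\<bar> \<le> m" "0 \<le> m"
  by unfold_locales (use that simple in \<open>auto intro: uniformly_continuous_on_const\<close>)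

lemma \<zeta>_bound: "\<exists>m\<ge>0. \<forall>i<n k. \<forall>\<omega>\<in>space M. \<bar>\<zeta> k i \<omega>\<bar> \<le> m"
proof -
  have "\<exists>C. \<forall>\<omega>\<in>space M. \<bar>\<zeta> k i \<omega>\<bar> \<le> C" if "i < n k" for i
    using simple[of k] that space_F by (auto simp: simple_process_def)
  then obtain C where C: "\<And>i \<omega>. i < n k \<Longrightarrow> \<omega> \<in> space M \<Longrightarrow> \<bar>\<zeta> k i \<omega>\<bar> \<le> C i" by metis
  have "\<bar>\<zeta> k i \<omega>\<bar> \<le> (\<Sum>i<n k. \<bar>C i\<bar>)" if "i < n k" "\<omega> \<in> space M" for i \<omega>
    using C[OF that] member_le_sum[of i "{..<n k}" "\<lambda>i. \<bar>C i\<bar>"] that by force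
  then show ?thesis by (intro exI[of _ "\<Sum>i<n k. \<bar>C i\<bar>"]) (auto intro: sum_nonneg)
qed

lemma Xs_continuous: "continuous_on UNIV (\<lambda>u. Xs k u \<omega>)"
  and Xs_prog: "prog (Xs k)"
proof -
  obtain m where "0 \<le> m" "\<And>i \<omega>. i < n k \<Longrightarrow> \<omega> \<in> space M \<Longrightarrow> \<bar>\<zeta> k i \<omega>\<bar> \<le> m" using \<zeta>_bound[of k] by auto
  then interpret S: simple_ito M F W "\<lambda>_ _. 0" "\<lambda>_ _. 0" "n k" "\<tau> k" "\<zeta> k" 0 0 0 m "\<lambda>_. 0" "\<lambda>_. 0" "\<lambda>_. 0" "\<lambda>_. 0"
    by (intro simple_trivial) auto
  show *: "continuous_on UNIV (\<lambda>u. Xs k u \<omega>)" for \<omega>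
    unfolding Xs_def by (intro continuous_intros int_X_continuous b_co S.simple_integral_continuous)
  show "prog (Xs k)"
  proof (rule prog_continuous)
    show "Xs k t \<in> borel_measurable (F t)" if t: "0 \<le> t" for t
    proof -
      have "prog (\<lambda>u \<omega>. b (X u \<omega>))" by (rule prog_comp[OF X_prog borel_measurable_continuous_onI[OF b_co]])
      from prog_set_integral[OF this order_refl order_refl t] S.simple_integral_adapted[OF t]
      show ?thesis unfolding Xs_def by measurable
    qed
    show "continuous_on {0..} (\<lambda>t. Xs k t \<omega>)" for \<omega> by (rule continuous_on_subset[OF *]) auto
  qed
qed

text \<open>All four errors, built from distances truncated at 1, are added up to one variable
  \<open>D k\<close> tending to 0 in L1; a single almost surely convergent subsequence of
  \<open>D\<close> then serves them all.\<close>

lemma approx_subseq: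
  assumes st: "0 \<le> s" "s \<le> t"
  obtains r :: "nat \<Rightarrow> nat" where "strict_mono r"
    "AE \<omega> in M. (\<lambda>j. Xs (r j) s \<omega>) \<longlonglongrightarrow> X s \<omega>" "AE \<omega> in M. (\<lambda>j. Xs (r j) t \<omega>) \<longlonglongrightarrow> X t \<omega>"
    "AE \<omega> in M. (\<lambda>j. LBINT u:{s..t}. min 1 \<bar>Xs (r j) u \<omega> - X u \<omega>\<bar>) \<longlonglongrightarrow> 0"
    "AE \<omega> in M. (\<lambda>j. LBINT u:{s..t}. (simple_value (n (r j)) (\<tau> (r j)) (\<zeta> (r j)) u \<omega> - a (X u \<omega>))\<^sup>2) \<longlonglongrightarrow> 0"
proof -
  define d where "d k u \<omega> = min 1 \<bar>Xs k u \<omega> - X u \<omega>\<bar>" for k u \<omega>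
  define q where "q k \<omega> = (\<integral>\<^sup>+s\<in>{0..t}. ennreal ((simple_value (n k) (\<tau> k) (\<zeta> k) s \<omega> - a (X s \<omega>))\<^sup>2) \<partial>lborel)" for k \<omega>
  have dp: "prog (d k)" for k
    unfolding d_def by (rule prog_comp2[OF Xs_prog X_prog]) measurable
  have d01: "0 \<le> d k u \<omega>" "d k u \<omega> \<le> 1" for k u \<omega> by (auto simp: d_def)
  have di: "integrable M (d k u)" if "0 \<le> u" for k u
    by (rule bounded_integrable[OF F_M[OF prog_adapted[OF dp that]], where m=1]) (use d01 in auto)
  have dt: "(\<lambda>k. expectation (d k u)) \<longlonglongrightarrow> 0" if u: "0 \<le> u" for u
  proof -
    have "enn2real (min 1 (ennreal \<bar>Xs k u \<omega> - X u \<omega>\<bar>)) = d k u \<omega>" for k \<omega>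
      unfolding d_def by (simp add: min_def ennreal_1[symmetric] del: ennreal_1)
    with tendsto_0_in_prob_expectation[OF approx_X[OF u]] show ?thesis by (simp add: Xs_def)
  qed
  have qm[measurable]: "q k \<in> borel_measurable M" for k
    using approx_int[of t] st unfolding tendsto_0_in_prob_def q_def[abs_def] by auto
  have qt: "(\<lambda>k. expectation (\<lambda>\<omega>. enn2real (min 1 (q k \<omega>)))) \<longlonglongrightarrow> 0"
    unfolding q_def by (rule tendsto_0_in_prob_expectation[OF approx_int]) (use st in auto)
  have q01: "enn2real (min 1 (q k \<omega>)) \<le> 1" for k \<omega> using enn2real_mono[of "min 1 (q k \<omega>)" 1] by simp
  have qi: "integrable M (\<lambda>\<omega>. enn2real (min 1 (q k \<omega>)))" for k
    by (rule integrable_const_bound[of _ 1]) (use q01 in auto)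
  define D where "D k \<omega> = d k s \<omega> + d k t \<omega> + (LBINT u:{s..t}. d k u \<omega>) + enn2real (min 1 (q k \<omega>))" for k \<omega>
  have Ii: "integrable M (\<lambda>\<omega>. LBINT u:{s..t}. d k u \<omega>)"
    and Ie: "expectation (\<lambda>\<omega>. LBINT u:{s..t}. d k u \<omega>) = (LBINT u:{s..t}. expectation (d k u))" for k
  proof -
    have 1: "integrable M (d k v)" if "v \<in> {s..t}" for v using that st by (intro di) auto
    have 2: "expectation (d k v) \<le> 1" if "v \<in> {s..t}" for v
      using integral_mono[OF di, of v "\<lambda>_. 1" k] that st d01 by (auto simp: prob_space)
    show "integrable M (\<lambda>\<omega>. LBINT u:{s..t}. d k u \<omega>)"
      "expectation (\<lambda>\<omega>. LBINT u:{s..t}. d k u \<omega>) = (LBINT u:{s..t}. expectation (d k u))"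
      by (rule expectation_set_integral[OF dp st d01(1) 1 2]; assumption)+
  qed
  have It: "(\<lambda>k. LBINT u:{s..t}. expectation (d k u)) \<longlonglongrightarrow> 0"
  proof -
    have "(\<lambda>k. \<integral>u. indicator {s..t} u * expectation (d k u) \<partial>lborel) \<longlonglongrightarrow> (\<integral>u. 0 \<partial>(lborel :: real measure))"
    proof (rule integral_dominated_convergence[where w="\<lambda>u. indicator {s..t} u * 1"])
      show "(\<lambda>u. indicator {s..t} u * expectation (d k u)) \<in> borel_measurable lborel" for k
      proof -
        have "(\<lambda>u. \<integral>\<omega>. indicator {s..t} u * d k u \<omega> \<partial>M) \<in> borel_measurable lborel"
          by (rule borel_measurable_lebesgue_integral) (use prog_joint[OF dp st(1), of t] in \<open>simp add: split_beta'\<close>)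
        then show ?thesis by simp
      qed
      show "integrable lborel (\<lambda>u. indicator {s..t} u * 1 :: real)"
        by (simp add: integrable_indicator_iff emeasure_lborel_Icc_eq)
      show "AE u in lborel. (\<lambda>k. indicator {s..t} u * expectation (d k u)) \<longlonglongrightarrow> 0"
        using dt st by (intro AE_I2) (auto simp: indicator_def)
      show "AE u in lborel. norm (indicator {s..t} u * expectation (d k u)) \<le> indicator {s..t} u * 1" for k
      proof (rule AE_I2)
        fix u
        have "0 \<le> expectation (d k u)" using d01 by (intro integral_nonneg_AE) auto
        moreover have "expectation (d k u) \<le> 1" if "u \<in> {s..t}"
          using integral_mono[OF di, of u "\<lambda>_. 1" k] that st d01 by (auto simp: prob_space)
        ultimately show "norm (indicator {s..t} u * expectation (d k u)) \<le> indicator {s..t} u * 1"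
          by (auto simp: indicator_def)
      qed
    qed auto
    then show ?thesis by (simp add: set_lebesgue_integral_def)
  qed
  have Di: "integrable M (D k)" for k unfolding D_def using di Ii qi st by auto
  have Inn: "0 \<le> (LBINT u:{s..t}. d k u \<omega>)" for k \<omega>
    unfolding set_lebesgue_integral_def using d01 by (intro integral_nonneg_AE) auto
  have D0: "0 \<le> D k \<omega>" for k \<omega> unfolding D_def using d01 Inn by (simp add: add_nonneg_nonneg)
  have De: "expectation (D k) = expectation (d k s) + expectation (d k t) + (LBINT u:{s..t}. expectation (d k u)) +
      expectation (\<lambda>\<omega>. enn2real (min 1 (q k \<omega>)))" for k
    unfolding D_def using di Ii qi st Ie by simp
  have "(\<lambda>k. expectation (D k)) \<longlonglongrightarrow> 0 + 0 + 0 + 0"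
    unfolding De by (intro tendsto_intros dt It qt) (use st in auto)
  then have "(\<lambda>k. \<integral>\<omega>. norm (D k \<omega>) \<partial>M) \<longlonglongrightarrow> 0" using D0 by simp
  from tendsto_L1_AE_subseq[OF Di this] obtain r where
    r: "strict_mono r" "AE \<omega> in M. (\<lambda>j. D (r j) \<omega>) \<longlonglongrightarrow> 0" by blast
  have dlim: "(\<lambda>j. Xs (r j) u \<omega>) \<longlonglongrightarrow> X u \<omega>" if "(\<lambda>j. d (r j) u \<omega>) \<longlonglongrightarrow> 0" for u \<omega>
  proof (rule LIM_zero_cancel, rule Lim_null_comparison[OF _ that])
    have "eventually (\<lambda>j. d (r j) u \<omega> < 1) sequentially" using order_tendstoD(2)[OF that, of 1] by simp
    then show "\<forall>\<^sub>F j in sequentially. norm (Xs (r j) u \<omega> - X u \<omega>) \<le> d (r j) u \<omega>"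
      by eventually_elim (auto simp: d_def min_def split: if_splits)
  qed
  have bnd: "AE \<omega> in M. (\<lambda>j. g (r j) \<omega>) \<longlonglongrightarrow> 0" if "\<And>k \<omega>. 0 \<le> g k \<omega>" "\<And>k \<omega>. g k \<omega> \<le> D k \<omega>" for g :: "nat \<Rightarrow> 'w \<Rightarrow> real"
    using r(2) by eventually_elim (rule tendsto_sandwich[OF _ _ tendsto_const], use that in auto)
  have nn: "0 \<le> enn2real (min 1 (q k \<omega>))" for k \<omega> by simp
  show ?thesis
  proof
    show "strict_mono r" by fact
    have "AE \<omega> in M. (\<lambda>j. d (r j) s \<omega>) \<longlonglongrightarrow> 0"
      using d01 Inn nn by (intro bnd) (auto simp: D_def add_nonneg_nonneg intro!: add_increasing2)
    then show "AE \<omega> in M. (\<lambda>j. Xs (r j) s \<omega>) \<longlonglongrightarrow> X s \<omega>" by eventually_elim (rule dlim)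
    have "AE \<omega> in M. (\<lambda>j. d (r j) t \<omega>) \<longlonglongrightarrow> 0"
      using d01 Inn nn by (intro bnd) (auto simp: D_def add_nonneg_nonneg intro!: add_increasing2)
    then show "AE \<omega> in M. (\<lambda>j. Xs (r j) t \<omega>) \<longlonglongrightarrow> X t \<omega>" by eventually_elim (rule dlim)
    show "AE \<omega> in M. (\<lambda>j. LBINT u:{s..t}. min 1 \<bar>Xs (r j) u \<omega> - X u \<omega>\<bar>) \<longlonglongrightarrow> 0"
      using bnd[of "\<lambda>k \<omega>. LBINT u:{s..t}. d k u \<omega>"] d01 Inn nn
      by (auto simp: d_def[symmetric] D_def add_nonneg_nonneg intro!: add_increasing2)
    have "AE \<omega> in M. (\<lambda>j. enn2real (min 1 (q (r j) \<omega>))) \<longlonglongrightarrow> 0"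
      using d01 Inn nn by (intro bnd) (auto simp: D_def add_nonneg_nonneg intro!: add_increasing2)
    then show "AE \<omega> in M. (\<lambda>j. LBINT u:{s..t}. (simple_value (n (r j)) (\<tau> (r j)) (\<zeta> (r j)) u \<omega> - a (X u \<omega>))\<^sup>2) \<longlonglongrightarrow> 0"
    proof eventually_elim
      case (elim \<omega>)
      show ?case
      proof (rule Lim_null_comparison[OF _ elim])
        \<comment> \<open>Once the truncated value is below 1 the truncation is inactive, so the
          integral itself is finite and given by it.\<close>
        have "eventually (\<lambda>j. enn2real (min 1 (q (r j) \<omega>)) < 1) sequentially" using order_tendstoD(2)[OF elim, of 1] by simp
        then show "\<forall>\<^sub>F j in sequentially. norm (LBINT u:{s..t}. (simple_value (n (r j)) (\<tau> (r j)) (\<zeta> (r j)) u \<omega> - a (X u \<omega>))\<^sup>2)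
           \<le> enn2real (min 1 (q (r j) \<omega>))"
        proof eventually_elim
          case (elim j)
          let ?h = "\<lambda>u. (simple_value (n (r j)) (\<tau> (r j)) (\<zeta> (r j)) u \<omega> - a (X u \<omega>))\<^sup>2"
          have ge0: "0 \<le> (LBINT u:{s..t}. ?h u)"
            unfolding set_lebesgue_integral_def by (intro integral_nonneg_AE) auto
          have q1: "q (r j) \<omega> \<le> 1" using elim by (auto simp: min_def split: if_splits)
          then have mq: "min 1 (q (r j) \<omega>) = q (r j) \<omega>" by (simp add: min_absorb2)
          have "(LBINT u:{s..t}. ?h u) \<le> enn2real (\<integral>\<^sup>+u\<in>{s..t}. ennreal (?h u) \<partial>lborel)"
          proof (cases "set_integrable lborel {s..t} ?h")
            case True
            have "ennreal (LBINT u:{s..t}. ?h u) = (\<integral>\<^sup>+u. ennreal (indicator {s..t} u *\<^sub>R ?h u) \<partial>lborel)"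
              unfolding set_lebesgue_integral_def
              by (rule nn_integral_eq_integral[symmetric]) (use True in \<open>auto simp: set_integrable_def\<close>)
            also have "\<dots> = (\<integral>\<^sup>+u\<in>{s..t}. ennreal (?h u) \<partial>lborel)"
              by (intro nn_integral_cong) (auto simp: indicator_def)
            finally have "(\<integral>\<^sup>+u\<in>{s..t}. ennreal (?h u) \<partial>lborel) = ennreal (LBINT u:{s..t}. ?h u)" by simp
            then show ?thesis using ge0 by simp
          next
            case False
            then show ?thesis by (simp add: set_lebesgue_integral_def set_integrable_def not_integrable_integral_eq)
          qed
          also have "\<dots> \<le> enn2real (q (r j) \<omega>)"
            unfolding q_def
            by (intro enn2real_mono nn_integral_mono) (use st q1 in \<open>auto simp: q_def indicator_def intro: order_le_less_trans\<close>)
          finally have "(LBINT u:{s..t}. ?h u) \<le> enn2real (min 1 (q (r j) \<omega>))" unfolding mq .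
          with ge0 show ?case by simp
        qed
      qed
    qed
  qed
qed

definition discount :: "(real \<Rightarrow> real) \<Rightarrow> real \<Rightarrow> real \<Rightarrow> 'w \<Rightarrow> real" where
  "discount c s t \<omega> = exp (- (LBINT u:{s..t}. c (X u \<omega>)))"

text \<open>The limit of \<open>D_constant\<close> along the simple approximations. Dominated
  convergence rests on \<open>V_bd_uniform\<close>, whose bound is free of the approximation; this
  is why the rate contains \<open>\<delta> * (a y)\<^sup>2\<close> and \<open>c\<close> has to
  dominate \<open>\<delta> * \<bar>b y\<bar>\<close>.\<close>

lemma Feynman_Kac_bounded_derivatives:
  assumes st: "0 \<le> s" "s \<le> t"
    and f1: "\<And>y. (f has_real_derivative f1 y) (at y)" and f2: "\<And>y. (f1 has_real_derivative f2 y) (at y)"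
    and f_bd: "\<And>y. \<bar>f y\<bar> \<le> m" "\<And>y. \<bar>f1 y\<bar> \<le> m" "\<And>y. \<bar>f2 y\<bar> \<le> m"
    and f_uc: "uniformly_continuous_on UNIV f" "uniformly_continuous_on UNIV f1" "uniformly_continuous_on UNIV f2"
    and c: "continuous_on UNIV c" "\<And>y. 0 \<le> c y" "\<And>y. \<delta> * \<bar>b y\<bar> \<le> c y" and \<delta>: "0 < \<delta>" "\<delta> \<le> 1"
    and Z: "Z \<in> borel_measurable (F s)" "\<And>\<omega>. \<omega> \<in> space M \<Longrightarrow> \<bar>Z \<omega>\<bar> \<le> mZ"
  shows "expectation (\<lambda>\<omega>. Z \<omega> * (f (X t \<omega>) * discount (\<lambda>y. c y + \<delta> * (a y)\<^sup>2) s t \<omega> -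
     (LBINT u:{s..t}. discount (\<lambda>y. c y + \<delta> * (a y)\<^sup>2) s u \<omega> *
        (f1 (X u \<omega>) * b (X u \<omega>) + (a (X u \<omega>))\<^sup>2 * f2 (X u \<omega>) / 2 - (c (X u \<omega>) + \<delta> * (a (X u \<omega>))\<^sup>2) * f (X u \<omega>)))))
    = expectation (\<lambda>\<omega>. Z \<omega> * f (X s \<omega>))"
proof -
  have m0: "0 \<le> m" using f_bd(1)[of 0] by linarith
  have mZ0: "0 \<le> mZ" using Z(2) not_empty by (metis abs_ge_zero ex_in_conv order_trans)
  obtain \<zeta>b where \<zeta>b: "\<And>k. 0 \<le> \<zeta>b k" "\<And>k i \<omega>. i < n k \<Longrightarrow> \<omega> \<in> space M \<Longrightarrow> \<bar>\<zeta> k i \<omega>\<bar> \<le> \<zeta>b k"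
    using \<zeta>_bound by metis
  \<comment> \<open>Drift and rate are clipped at level \<open>k\<close> to be bounded as
    \<open>simple_ito\<close> demands; on a fixed path both clips are inactive up to time
    \<open>t\<close> for large \<open>k\<close>.\<close>
  define \<beta> where "\<beta> k u \<omega> = max (- real k) (min (real k) (b (X u \<omega>)))" for k :: nat and u \<omega>
  define \<gamma>0 where "\<gamma>0 k u \<omega> = min (c (X u \<omega>)) (real k)" for k :: nat and u \<omega>
  define H where "H k u \<omega> = simple_value (n k) (\<tau> k) (\<zeta> k) u \<omega>" for k u \<omega>
  define y where "y k u \<omega> = x + (LBINT v:{0..u}. \<beta> k v \<omega>) + simple_integral W (n k) (\<tau> k) (\<zeta> k) u \<omega>" for k u \<omega>
  define V where "V k \<omega> = f (y k t \<omega>) * exp (- (LBINT v:{s..t}. \<gamma>0 k v \<omega> + \<delta> * (H k v \<omega>)\<^sup>2)) -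
      (LBINT u:{s..t}. exp (- (LBINT v:{s..u}. \<gamma>0 k v \<omega> + \<delta> * (H k v \<omega>)\<^sup>2)) *
        (f1 (y k u \<omega>) * \<beta> k u \<omega> + (H k u \<omega>)\<^sup>2 * f2 (y k u \<omega>) / 2 - (\<gamma>0 k u \<omega> + \<delta> * (H k u \<omega>)\<^sup>2) * f (y k u \<omega>)))" for k \<omega>
  define mk where "mk k = m + real k + \<zeta>b k + mZ" for k
  have S: "simple_ito M F W (\<beta> k) (\<gamma>0 k) (n k) (\<tau> k) (\<zeta> k) \<delta> s (mk k) f f1 f2 Z" for k
  proof unfold_locales
    show "\<beta> k u \<in> borel_measurable (F u)" "\<gamma>0 k u \<in> borel_measurable (F u)" if "0 \<le> u" for u
      unfolding \<beta>_def \<gamma>0_def using comp_X_ad[OF b_co that] comp_X_ad[OF c(1) that] by measurable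
    show "continuous_on UNIV (\<lambda>t. \<beta> k t \<omega>)" "continuous_on UNIV (\<lambda>t. \<gamma>0 k t \<omega>)" for \<omega>
      unfolding \<beta>_def \<gamma>0_def by (intro continuous_intros comp_X_co b_co c)+
    show "\<bar>\<beta> k u \<omega>\<bar> \<le> mk k" "\<bar>\<gamma>0 k u \<omega>\<bar> \<le> mk k" "0 \<le> \<gamma>0 k u \<omega>" for u \<omega>
      using m0 mZ0 \<zeta>b(1)[of k] c(2)[of "X u \<omega>"] by (auto simp: \<beta>_def \<gamma>0_def mk_def)
    show "\<bar>\<zeta> k i \<omega>\<bar> \<le> mk k" if "i < n k" "\<omega> \<in> space M" for i \<omega>
      using \<zeta>b(2)[OF that] m0 mZ0 by (auto simp: mk_def)
    show "\<bar>f z\<bar> \<le> mk k" "\<bar>f1 z\<bar> \<le> mk k" "\<bar>f2 z\<bar> \<le> mk k" for z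
      using f_bd[of z] \<zeta>b(1)[of k] mZ0 by (auto simp: mk_def intro: order_trans)
    show "\<bar>Z \<omega>\<bar> \<le> mk k" if "\<omega> \<in> space M" for \<omega>
      using Z(2)[OF that] \<zeta>b(1)[of k] m0 by (auto simp: mk_def)
  qed (use simple f1 f2 f_uc Z st \<delta> in auto)
  have V: "V k \<in> borel_measurable M" "\<And>\<omega>. \<omega> \<in> space M \<Longrightarrow> \<bar>V k \<omega>\<bar> \<le> 2 * m + 2 * m / \<delta>"
    "expectation (\<lambda>\<omega>. Z \<omega> * V k \<omega>) = expectation (\<lambda>\<omega>. Z \<omega> * f (y k s \<omega>))"
    "(\<lambda>\<omega>. f (y k s \<omega>)) \<in> borel_measurable M"
    "\<And>\<omega>. \<omega> \<in> space M \<Longrightarrow> set_borel_measurable lborel {s..t} (\<lambda>u. H k u \<omega>)"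
    "\<And>\<omega> u. \<omega> \<in> space M \<Longrightarrow> \<bar>H k u \<omega>\<bar> \<le> real (n k) * mk k" for k
  proof -
    interpret S: simple_ito M F W "\<beta> k" "\<gamma>0 k" "n k" "\<tau> k" "\<zeta> k" \<delta> x s "mk k" f f1 f2 Z by (rule S)
    have Veq: "V k = S.V t"
      by (simp add: fun_eq_iff V_def S.V_def S.G_def S.K_def S.\<gamma>_def S.H_def S.Y_def H_def y_def)
    have Ds: "S.D s = expectation (\<lambda>\<omega>. Z \<omega> * f (y k s \<omega>))"
    proof -
      have 0: "(LBINT v:{s..s}. g v) = 0" for g :: "real \<Rightarrow> real"
        using set_integral_Icc_bound[of s s g "\<bar>g s\<bar>"] by auto
      show ?thesis unfolding S.D_def S.V_def S.G_def 0 by (simp add: S.Y_def y_def)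
    qed
    show "V k \<in> borel_measurable M" unfolding Veq by (rule F_M[OF S.V_adapted]) (use st in auto)
    show "\<bar>V k \<omega>\<bar> \<le> 2 * m + 2 * m / \<delta>" if \<omega>: "\<omega> \<in> space M" for \<omega>
      unfolding Veq
    proof (rule S.V_bd_uniform[OF \<omega> st(2) \<delta>(1) _ f_bd])
      fix v
      \<comment> \<open>Clipping preserves the domination because \<open>\<delta> \<le> 1\<close>:
        where the rate is cut to \<open>k\<close>, the drift is at most \<open>k\<close> as
        well.\<close>
      have "\<delta> * real k \<le> real k" using mult_right_mono[OF \<delta>(2), of "real k"] by simp
      have "\<delta> * \<bar>\<beta> k v \<omega>\<bar> \<le> \<delta> * \<bar>b (X v \<omega>)\<bar>" "\<delta> * \<bar>\<beta> k v \<omega>\<bar> \<le> \<delta> * real k"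
        using \<delta> by (intro mult_left_mono; auto simp: \<beta>_def)+
      with \<open>\<delta> * real k \<le> real k\<close> c(3)[of "X v \<omega>"] show "\<delta> * \<bar>\<beta> k v \<omega>\<bar> \<le> \<gamma>0 k v \<omega>"
        by (auto simp: \<gamma>0_def)
    qed
    show "expectation (\<lambda>\<omega>. Z \<omega> * V k \<omega>) = expectation (\<lambda>\<omega>. Z \<omega> * f (y k s \<omega>))"
      using S.D_constant[OF st(2)] unfolding Ds by (simp add: S.D_def Veq)
    have "y k s = S.Y s" by (simp add: fun_eq_iff y_def S.Y_def)
    then show "(\<lambda>\<omega>. f (y k s \<omega>)) \<in> borel_measurable M"
      using measurable_compose[OF F_M[OF S.Y_adapted[OF st(1)]] S.f_meas(1)] by simp
    show "set_borel_measurable lborel {s..t} (\<lambda>u. H k u \<omega>)" if "\<omega> \<in> space M" for \<omega>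
      using prog_path[OF S.H_prog st(1) that, of t] by (simp add: H_def S.H_def)
    show "\<bar>H k u \<omega>\<bar> \<le> real (n k) * mk k" if "\<omega> \<in> space M" for \<omega> u
      using S.H_bd[OF that, of u] by (simp add: H_def S.H_def)
  qed
  define V' where "V' \<omega> = f (X t \<omega>) * discount (\<lambda>y. c y + \<delta> * (a y)\<^sup>2) s t \<omega> -
     (LBINT u:{s..t}. discount (\<lambda>y. c y + \<delta> * (a y)\<^sup>2) s u \<omega> *
        (f1 (X u \<omega>) * b (X u \<omega>) + (a (X u \<omega>))\<^sup>2 * f2 (X u \<omega>) / 2 - (c (X u \<omega>) + \<delta> * (a (X u \<omega>))\<^sup>2) * f (X u \<omega>)))" for \<omega>
  obtain r :: "nat \<Rightarrow> nat" where r: "strict_mono r"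
    "AE \<omega> in M. (\<lambda>j. Xs (r j) s \<omega>) \<longlonglongrightarrow> X s \<omega>" "AE \<omega> in M. (\<lambda>j. Xs (r j) t \<omega>) \<longlonglongrightarrow> X t \<omega>"
    "AE \<omega> in M. (\<lambda>j. LBINT u:{s..t}. min 1 \<bar>Xs (r j) u \<omega> - X u \<omega>\<bar>) \<longlonglongrightarrow> 0"
    "AE \<omega> in M. (\<lambda>j. LBINT u:{s..t}. (H (r j) u \<omega> - a (X u \<omega>))\<^sup>2) \<longlonglongrightarrow> 0"
    by (rule approx_subseq[OF st, folded H_def])
  have ev: "eventually (\<lambda>j. \<forall>u\<in>{0..t}. \<beta> (r j) u \<omega> = b (X u \<omega>) \<and> \<gamma>0 (r j) u \<omega> = c (X u \<omega>)) sequentially" for \<omega>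
  proof -
    obtain b0 where b0: "\<And>u. u \<in> {0..t} \<Longrightarrow> \<bar>b (X u \<omega>)\<bar> \<le> b0" using continuous_Icc_bound[OF comp_X_co[OF b_co]] by metis
    obtain c0 where c0: "\<And>u. u \<in> {0..t} \<Longrightarrow> \<bar>c (X u \<omega>)\<bar> \<le> c0" using continuous_Icc_bound[OF comp_X_co[OF c(1)]] by metis
    have "eventually (\<lambda>j. b0 \<le> real (r j) \<and> c0 \<le> real (r j)) sequentially"
    proof (rule eventually_conj)
      note L = filterlim_compose[OF filterlim_real_sequentially filterlim_subseq[OF r(1)]]
      show "eventually (\<lambda>j. b0 \<le> real (r j)) sequentially" "eventually (\<lambda>j. c0 \<le> real (r j)) sequentially"
        using filterlim_at_top[THEN iffD1, OF L] by blast+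
    qed
    then show ?thesis
    proof eventually_elim
      case (elim j)
      show ?case
      proof
        fix u assume u: "u \<in> {0..t}"
        show "\<beta> (r j) u \<omega> = b (X u \<omega>) \<and> \<gamma>0 (r j) u \<omega> = c (X u \<omega>)"
          using b0[OF u] c0[OF u] elim by (auto simp: \<beta>_def \<gamma>0_def min_def max_def)
      qed
    qed
  qed
  have yX: "y (r j) u \<omega> = Xs (r j) u \<omega>"
    if "\<forall>u\<in>{0..t}. \<beta> (r j) u \<omega> = b (X u \<omega>) \<and> \<gamma>0 (r j) u \<omega> = c (X u \<omega>)" "u \<in> {0..t}" for j u \<omega>
  proof -
    have "(LBINT v:{0..u}. \<beta> (r j) v \<omega>) = (LBINT v:{0..u}. b (X v \<omega>))"
      by (rule set_lebesgue_integral_cong) (use that in auto)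
    then show ?thesis by (simp add: y_def Xs_def)
  qed
  have Vlim: "AE \<omega> in M. (\<lambda>j. V (r j) \<omega>) \<longlonglongrightarrow> V' \<omega>"
    using r(3,4,5) AE_space
  proof eventually_elim
    case (elim \<omega>)
    have "(\<lambda>j. f (Xs (r j) t \<omega>) * exp (- (LBINT v:{s..t}. c (X v \<omega>) + \<delta> * (H (r j) v \<omega>)\<^sup>2)) -
      (LBINT u:{s..t}. exp (- (LBINT v:{s..u}. c (X v \<omega>) + \<delta> * (H (r j) v \<omega>)\<^sup>2)) *
        (f1 (Xs (r j) u \<omega>) * b (X u \<omega>) + (H (r j) u \<omega>)\<^sup>2 * f2 (Xs (r j) u \<omega>) / 2 - (c (X u \<omega>) + \<delta> * (H (r j) u \<omega>)\<^sup>2) * f (Xs (r j) u \<omega>))))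
      \<longlonglongrightarrow> V' \<omega>"
      unfolding V'_def discount_def
      by (rule discounted_path_limit[OF st(2) less_imp_le[OF \<delta>(1)] f_bd f_uc X_co comp_X_co[OF a_co] comp_X_co[OF b_co] comp_X_co[OF c(1)]
         Xs_continuous V(5) V(6) c(2)]) (use elim in auto)
    moreover have "eventually (\<lambda>j. V (r j) \<omega> = f (Xs (r j) t \<omega>) * exp (- (LBINT v:{s..t}. c (X v \<omega>) + \<delta> * (H (r j) v \<omega>)\<^sup>2)) -
      (LBINT u:{s..t}. exp (- (LBINT v:{s..u}. c (X v \<omega>) + \<delta> * (H (r j) v \<omega>)\<^sup>2)) *
        (f1 (Xs (r j) u \<omega>) * b (X u \<omega>) + (H (r j) u \<omega>)\<^sup>2 * f2 (Xs (r j) u \<omega>) / 2 - (c (X u \<omega>) + \<delta> * (H (r j) u \<omega>)\<^sup>2) * f (Xs (r j) u \<omega>))))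
       sequentially"
      using ev[of \<omega>]
    proof eventually_elim
      case (elim j)
      have G: "(LBINT v:{s..u}. \<gamma>0 (r j) v \<omega> + \<delta> * (H (r j) v \<omega>)\<^sup>2) = (LBINT v:{s..u}. c (X v \<omega>) + \<delta> * (H (r j) v \<omega>)\<^sup>2)"
        if "u \<in> {s..t}" for u
        by (rule set_lebesgue_integral_cong) (use elim that st in auto)
      have 1: "y (r j) t \<omega> = Xs (r j) t \<omega>" by (rule yX[OF elim]) (use st in auto)
      have 2: "(LBINT u:{s..t}. exp (- (LBINT v:{s..u}. \<gamma>0 (r j) v \<omega> + \<delta> * (H (r j) v \<omega>)\<^sup>2)) *
        (f1 (y (r j) u \<omega>) * \<beta> (r j) u \<omega> + (H (r j) u \<omega>)\<^sup>2 * f2 (y (r j) u \<omega>) / 2 - (\<gamma>0 (r j) u \<omega> + \<delta> * (H (r j) u \<omega>)\<^sup>2) * f (y (r j) u \<omega>)))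
        = (LBINT u:{s..t}. exp (- (LBINT v:{s..u}. c (X v \<omega>) + \<delta> * (H (r j) v \<omega>)\<^sup>2)) *
        (f1 (Xs (r j) u \<omega>) * b (X u \<omega>) + (H (r j) u \<omega>)\<^sup>2 * f2 (Xs (r j) u \<omega>) / 2 - (c (X u \<omega>) + \<delta> * (H (r j) u \<omega>)\<^sup>2) * f (Xs (r j) u \<omega>)))"
        by (rule set_lebesgue_integral_cong) (use elim st G yX[OF elim] in auto)
      show ?case unfolding V_def 1 2 using G[of t] st by simp
    qed
    ultimately show ?case by (simp add: tendsto_cong)
  qed
  have flim: "AE \<omega> in M. (\<lambda>j. f (y (r j) s \<omega>)) \<longlonglongrightarrow> f (X s \<omega>)"
    using r(2)
  proof eventually_elim
    case (elim \<omega>)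
    have "(\<lambda>j. f (Xs (r j) s \<omega>)) \<longlonglongrightarrow> f (X s \<omega>)"
      by (rule continuous_on_tendsto_compose[OF uniformly_continuous_imp_continuous[OF f_uc(1)] elim]) auto
    moreover have "eventually (\<lambda>j. f (y (r j) s \<omega>) = f (Xs (r j) s \<omega>)) sequentially"
      using ev[of \<omega>] by eventually_elim (use yX st in auto)
    ultimately show ?case by (simp add: tendsto_cong)
  qed
  have ZM[measurable]: "Z \<in> borel_measurable M" by (rule F_M[OF Z(1)])
  have fX[measurable]: "(\<lambda>\<omega>. f (X s \<omega>)) \<in> borel_measurable M"
    by (rule F_M[OF comp_X_ad[OF uniformly_continuous_imp_continuous[OF f_uc(1)] st(1)]])
  have V'M[measurable]: "V' \<in> borel_measurable M"
  proof -
    let ?c = "\<lambda>y. c y + \<delta> * (a y)\<^sup>2"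
    have cc: "continuous_on UNIV ?c" by (intro continuous_intros c a_co)
    have fcont: "continuous_on UNIV f" "continuous_on UNIV f1" "continuous_on UNIV f2"
      using f_uc by (auto intro: uniformly_continuous_imp_continuous)
    have pc: "prog (\<lambda>u \<omega>. g (X u \<omega>))" if "continuous_on UNIV g" for g :: "real \<Rightarrow> real"
      by (rule prog_comp[OF X_prog borel_measurable_continuous_onI[OF that]])
    have dp: "prog (discount ?c s)"
    proof (rule prog_continuous)
      show "discount ?c s u \<in> borel_measurable (F u)" if "0 \<le> u" for u
        unfolding discount_def using prog_set_integral[OF pc[OF cc] st(1) order_refl that] by measurable
      show "continuous_on {0..} (\<lambda>t. discount ?c s t \<omega>)" for \<omega>
        unfolding discount_def by (intro continuous_intros continuous_on_subset[OF int_X_continuous[OF cc]]) auto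
    qed
    have "prog (\<lambda>u \<omega>. discount ?c s u \<omega> * (f1 (X u \<omega>) * b (X u \<omega>) + (a (X u \<omega>))\<^sup>2 * f2 (X u \<omega>) / 2 - (c (X u \<omega>) + \<delta> * (a (X u \<omega>))\<^sup>2) * f (X u \<omega>)))"
      by (rule prog_mult[OF dp pc[of "\<lambda>z. f1 z * b z + (a z)\<^sup>2 * f2 z / 2 - (c z + \<delta> * (a z)\<^sup>2) * f z"]])
        (intro continuous_intros fcont b_co a_co c; simp)
    from prog_set_integral[OF this st(1) order_refl, of t] prog_adapted[OF dp, of t] comp_X_ad[OF fcont(1), of t] st
    have "V' \<in> borel_measurable (F t)" unfolding V'_def by (intro borel_measurable_diff borel_measurable_times) auto
    then show ?thesis by (rule F_M)
  qed
  have 1: "(\<lambda>j. expectation (\<lambda>\<omega>. Z \<omega> * V (r j) \<omega>)) \<longlonglongrightarrow> expectation (\<lambda>\<omega>. Z \<omega> * V' \<omega>)"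
  proof (rule integral_dominated_convergence[where w="\<lambda>_. mZ * (2 * m + 2 * m / \<delta>)"])
    show "AE \<omega> in M. (\<lambda>j. Z \<omega> * V (r j) \<omega>) \<longlonglongrightarrow> Z \<omega> * V' \<omega>" using Vlim by eventually_elim (intro tendsto_intros)
    show "AE \<omega> in M. norm (Z \<omega> * V (r j) \<omega>) \<le> mZ * (2 * m + 2 * m / \<delta>)" for j
      using V(2)[of _ "r j"] Z(2) mZ0 by (intro AE_I2) (auto simp: abs_mult intro!: mult_mono)
  qed (use V(1) in auto)
  have 2: "(\<lambda>j. expectation (\<lambda>\<omega>. Z \<omega> * f (y (r j) s \<omega>))) \<longlonglongrightarrow> expectation (\<lambda>\<omega>. Z \<omega> * f (X s \<omega>))"
  proof (rule integral_dominated_convergence[where w="\<lambda>_. mZ * m"])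
    show "AE \<omega> in M. (\<lambda>j. Z \<omega> * f (y (r j) s \<omega>)) \<longlonglongrightarrow> Z \<omega> * f (X s \<omega>)" using flim by eventually_elim (intro tendsto_intros)
    show "AE \<omega> in M. norm (Z \<omega> * f (y (r j) s \<omega>)) \<le> mZ * m" for j
      using f_bd(1) Z(2) mZ0 by (intro AE_I2) (auto simp: abs_mult intro!: mult_mono)
  qed (use V(4) in auto)
  have "expectation (\<lambda>\<omega>. Z \<omega> * V' \<omega>) = expectation (\<lambda>\<omega>. Z \<omega> * f (X s \<omega>))"
    using LIMSEQ_unique[OF 1 2[folded V(3)]] .
  then show ?thesis by (simp add: V'_def)
qed

end

section \<open>Bounded test functions\<close>

text \<open>For \<open>\<kappa> > 0\<close> a bump supported in
  \<open>\<bar>y\<bar> \<le> 1 / \<kappa>\<close>; the cube is the lowest integer power of the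
  truncated parabola that is twice continuously differentiable.\<close>

definition cut :: "real \<Rightarrow> real \<Rightarrow> real" where
  "cut \<kappa> y = max 0 (1 - (\<kappa> * y)\<^sup>2) ^ 3"
definition cut1 :: "real \<Rightarrow> real \<Rightarrow> real" where
  "cut1 \<kappa> y = - 6 * \<kappa> * (\<kappa> * y) * max 0 (1 - (\<kappa> * y)\<^sup>2) ^ 2"
definition cut2 :: "real \<Rightarrow> real \<Rightarrow> real" where
  "cut2 \<kappa> y = 24 * \<kappa>\<^sup>2 * (\<kappa> * y)\<^sup>2 * max 0 (1 - (\<kappa> * y)\<^sup>2) - 6 * \<kappa>\<^sup>2 * max 0 (1 - (\<kappa> * y)\<^sup>2) ^ 2"

text \<open>At 0 the difference quotient is bounded by \<open>\<bar>h\<bar> ^ Suc k\<close>;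
  exponents start at 2 so that this tends to 0.\<close>

lemma has_derivative_max_power:
  "((\<lambda>t::real. max 0 t ^ Suc (Suc k)) has_real_derivative real (Suc (Suc k)) * max 0 t ^ Suc k) (at t)"
proof -
  consider "t < 0" | "t = 0" | "0 < t" by linarith
  then show ?thesis
  proof cases
    case 1
    have "((\<lambda>t::real. 0) has_real_derivative 0) (at t)" by simp
    moreover have "eventually (\<lambda>t::real. 0 = max 0 t ^ Suc (Suc k)) (nhds t)"
      using eventually_nhds_in_open[of "{..<0}" t] 1 by (auto elim!: eventually_mono)
    ultimately show ?thesis using 1 DERIV_cong_ev[OF refl, of "\<lambda>t. 0" _ t 0 0] by simp
  next
    case 2
    have "((\<lambda>h::real. (max 0 h ^ Suc (Suc k)) / h) \<longlongrightarrow> 0) (at 0)"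
    proof (rule Lim_null_comparison)
      show "eventually (\<lambda>h::real. norm (max 0 h ^ Suc (Suc k) / h) \<le> \<bar>h\<bar> ^ Suc k) (at 0)"
      proof (intro always_eventually allI)
        show "norm (max 0 h ^ Suc (Suc k) / h) \<le> \<bar>h\<bar> ^ Suc k" for h :: real
          by (cases "0 < h") (use zero_le_power[OF abs_ge_zero, of h "Suc k"] in \<open>simp_all add: max_absorb1 max_absorb2\<close>)
      qed
      show "((\<lambda>h::real. \<bar>h\<bar> ^ Suc k) \<longlongrightarrow> 0) (at 0)" by (auto intro!: tendsto_eq_intros)
    qed
    then show ?thesis using 2 by (simp add: has_field_derivative_iff)
  next
    case 3
    have "((\<lambda>t::real. t ^ Suc (Suc k)) has_real_derivative real (Suc (Suc k)) * t ^ Suc k) (at t)"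
      by (auto intro!: derivative_eq_intros simp del: power_Suc)
    moreover have "eventually (\<lambda>t::real. t ^ Suc (Suc k) = max 0 t ^ Suc (Suc k)) (nhds t)"
      using eventually_nhds_in_open[of "{0<..}" t] 3 by (auto elim!: eventually_mono)
    ultimately show ?thesis using 3 by (subst DERIV_cong_ev[OF refl, symmetric]) auto
  qed
qed

lemma cut_deriv:
  "(cut \<kappa> has_real_derivative cut1 \<kappa> y) (at y)" "(cut1 \<kappa> has_real_derivative cut2 \<kappa> y) (at y)"
proof -
  have i: "((\<lambda>y. 1 - (\<kappa> * y)\<^sup>2) has_real_derivative - 2 * \<kappa> * (\<kappa> * y)) (at y)"
    by (auto intro!: derivative_eq_intros)
  have 3: "((\<lambda>y. max 0 (1 - (\<kappa> * y)\<^sup>2) ^ 3) has_real_derivative 3 * max 0 (1 - (\<kappa> * y)\<^sup>2) ^ 2 * (- 2 * \<kappa> * (\<kappa> * y))) (at y)"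
    using DERIV_chain2[OF has_derivative_max_power[of 1] i] by (simp add: eval_nat_numeral)
  have 2: "((\<lambda>y. max 0 (1 - (\<kappa> * y)\<^sup>2) ^ 2) has_real_derivative 2 * max 0 (1 - (\<kappa> * y)\<^sup>2) * (- 2 * \<kappa> * (\<kappa> * y))) (at y)"
    using DERIV_chain2[OF has_derivative_max_power[of 0] i] by (simp add: eval_nat_numeral)
  show "(cut \<kappa> has_real_derivative cut1 \<kappa> y) (at y)"
    unfolding cut_def[abs_def] cut1_def by (rule DERIV_cong[OF 3]) simp
  have "((\<lambda>y. (- 6 * \<kappa> * (\<kappa> * y)) * max 0 (1 - (\<kappa> * y)\<^sup>2) ^ 2) has_real_derivative
    (- 6 * \<kappa> * \<kappa>) * max 0 (1 - (\<kappa> * y)\<^sup>2) ^ 2 + 2 * max 0 (1 - (\<kappa> * y)\<^sup>2) * (- 2 * \<kappa> * (\<kappa> * y)) * (- 6 * \<kappa> * (\<kappa> * y))) (at y)"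
    by (rule DERIV_mult[OF _ 2]) (auto intro!: derivative_eq_intros)
  then show "(cut1 \<kappa> has_real_derivative cut2 \<kappa> y) (at y)"
    unfolding cut1_def[abs_def] cut2_def by (rule DERIV_cong) (simp add: power2_eq_square algebra_simps)
qed

lemma cut_continuous: "continuous_on UNIV (cut \<kappa>)" "continuous_on UNIV (cut1 \<kappa>)" "continuous_on UNIV (cut2 \<kappa>)"
  unfolding cut_def[abs_def] cut1_def[abs_def] cut2_def[abs_def] by (intro continuous_intros)+

lemma cut_zero: "0 < \<kappa> \<Longrightarrow> 1 / \<kappa> \<le> \<bar>y\<bar> \<Longrightarrow> cut \<kappa> y = 0 \<and> cut1 \<kappa> y = 0 \<and> cut2 \<kappa> y = 0"
proof -
  assume *: "0 < \<kappa>" "1 / \<kappa> \<le> \<bar>y\<bar>"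
  then have "1 \<le> \<bar>\<kappa> * y\<bar>" by (simp add: divide_le_eq abs_mult mult.commute)
  then have "max 0 (1 - (\<kappa> * y)\<^sup>2) = 0" using abs_le_square_iff[of 1 "\<kappa> * y"] by simp
  then show ?thesis by (simp add: cut_def cut1_def cut2_def)
qed

lemma cut_bounds:
  assumes "0 < \<kappa>" "\<kappa> \<le> 1"
  shows "0 \<le> cut \<kappa> y" "\<bar>cut \<kappa> y\<bar> \<le> 1" "\<bar>cut1 \<kappa> y\<bar> \<le> 6" "\<bar>cut2 \<kappa> y\<bar> \<le> 30"
proof -
  define p where "p = max 0 (1 - (\<kappa> * y)\<^sup>2)"
  have p: "0 \<le> p" "p \<le> 1" by (auto simp: p_def)
  have p3: "p ^ 3 \<le> 1" "p ^ 2 \<le> 1" using p by (auto intro: power_le_one)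
  show "0 \<le> cut \<kappa> y" "\<bar>cut \<kappa> y\<bar> \<le> 1" using p p3 by (auto simp: cut_def p_def[symmetric])
  have \<kappa>2: "\<kappa>\<^sup>2 \<le> 1" using assms by (auto intro: power_le_one)
  show "\<bar>cut1 \<kappa> y\<bar> \<le> 6" "\<bar>cut2 \<kappa> y\<bar> \<le> 30"
  proof (atomize (full), cases "\<bar>\<kappa> * y\<bar> \<le> 1")
    case True
    then have y2: "(\<kappa> * y)\<^sup>2 \<le> 1" by (metis abs_le_square_iff abs_one one_power2)
    have "\<kappa> * \<bar>\<kappa> * y\<bar> * p ^ 2 \<le> 1 * 1 * 1" using assms True p p3 by (intro mult_mono) auto
    then have 1: "\<bar>cut1 \<kappa> y\<bar> \<le> 6" using assms by (simp add: cut1_def p_def[symmetric] abs_mult)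
    have "\<kappa>\<^sup>2 * (\<kappa> * y)\<^sup>2 * p \<le> 1 * 1 * 1" "\<kappa>\<^sup>2 * p ^ 2 \<le> 1 * 1"
      using \<kappa>2 y2 p p3 by (intro mult_mono; simp)+
    moreover have "0 \<le> \<kappa>\<^sup>2 * (\<kappa> * y)\<^sup>2 * p" "0 \<le> \<kappa>\<^sup>2 * p ^ 2" using p by auto
    ultimately have "\<bar>cut2 \<kappa> y\<bar> \<le> 30" unfolding cut2_def p_def[symmetric] by linarith
    with 1 show "\<bar>cut1 \<kappa> y\<bar> \<le> 6 \<and> \<bar>cut2 \<kappa> y\<bar> \<le> 30" by simp
  next
    case False
    then have "1 / \<kappa> \<le> \<bar>y\<bar>" using assms by (simp add: divide_le_eq abs_mult mult.commute)
    from cut_zero[OF assms(1) this] show "\<bar>cut1 \<kappa> y\<bar> \<le> 6 \<and> \<bar>cut2 \<kappa> y\<bar> \<le> 30" by simp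
  qed
qed

lemma cut_limit:
  assumes "\<kappa> \<longlonglongrightarrow> 0"
  shows "(\<lambda>j. cut (\<kappa> j) y) \<longlonglongrightarrow> 1" "(\<lambda>j. cut1 (\<kappa> j) y) \<longlonglongrightarrow> 0" "(\<lambda>j. cut2 (\<kappa> j) y) \<longlonglongrightarrow> 0"
  unfolding cut_def cut1_def cut2_def by (auto intro!: tendsto_eq_intros assms)

lemma compact_support_uniformly_continuous:
  fixes g :: "real \<Rightarrow> real"
  assumes "continuous_on UNIV g" "\<And>y. r \<le> \<bar>y\<bar> \<Longrightarrow> g y = 0" "0 \<le> r"
  shows "uniformly_continuous_on UNIV g" "\<exists>m. \<forall>y. \<bar>g y\<bar> \<le> m"
proof -
  \<comment> \<open>Composition with this 1-Lipschitz retraction leaves \<open>g\<close> unchanged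
    and carries uniform continuity from the compact interval to the line.\<close>
  define cl where "cl y = max (- r) (min r y)" for y
  have cl: "g (cl y) = g y" for y using assms(2)[of y] assms(2)[of r] assms(2)[of "- r"] assms(3)
    by (auto simp: cl_def min_def max_def abs_if)
  have cl_in: "cl y \<in> {-r..r}" for y using assms(3) by (auto simp: cl_def)
  have cl1: "dist (cl y) (cl z) \<le> dist y z" for y z by (auto simp: cl_def dist_real_def)
  have u: "uniformly_continuous_on {-r..r} g"
    by (intro compact_uniformly_continuous continuous_on_subset[OF assms(1)]) auto
  show "uniformly_continuous_on UNIV g"
    unfolding uniformly_continuous_on_def
  proof (intro allI impI)
    fix e :: real assume "0 < e"
    with u obtain d where d: "0 < d" "\<And>y z. y \<in> {-r..r} \<Longrightarrow> z \<in> {-r..r} \<Longrightarrow> dist z y < d \<Longrightarrow> dist (g z) (g y) < e"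
      unfolding uniformly_continuous_on_def by metis
    have "dist (g z) (g y) < e" if "dist z y < d" for z y
      using d(2)[OF cl_in cl_in, of z y] cl1[of z y] that by (simp add: cl)
    with d(1) show "\<exists>d>0. \<forall>x\<in>UNIV. \<forall>x'\<in>UNIV. dist x' x < d \<longrightarrow> dist (g x') (g x) < e" by blast
  qed
  obtain m where "\<And>y. y \<in> {-r..r} \<Longrightarrow> \<bar>g y\<bar> \<le> m" using continuous_Icc_bound[OF assms(1)] by metis
  then have "\<bar>g y\<bar> \<le> m" for y using cl_in[of y] cl[of y] by metis
  then show "\<exists>m. \<forall>y. \<bar>g y\<bar> \<le> m" by blast
qed

section \<open>Feynman-Kac relations for bounded test functions without compact support\<close>

context diffusion
begin

lemma prog_X: "continuous_on UNIV g \<Longrightarrow> prog (\<lambda>u \<omega>. g (X u \<omega>) :: real)"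
  by (rule prog_comp[OF X_prog borel_measurable_continuous_onI])

lemma discount_continuous: "continuous_on UNIV c \<Longrightarrow> continuous_on UNIV (\<lambda>u. discount c s u \<omega>)"
  unfolding discount_def by (intro continuous_intros int_X_continuous)

lemma discount_adapted:
  assumes "continuous_on UNIV c" "0 \<le> s" "0 \<le> u"
  shows "discount c s u \<in> borel_measurable (F u)"
  unfolding discount_def using prog_set_integral[OF prog_X[OF assms(1)] assms(2) order_refl assms(3)] by measurable

lemma discount_prog: "continuous_on UNIV c \<Longrightarrow> 0 \<le> s \<Longrightarrow> prog (discount c s)"
  by (rule prog_continuous[OF discount_adapted]) (auto intro: continuous_on_subset[OF discount_continuous])

lemma discount_bounds:
  assumes "\<And>y. 0 \<le> c y"
  shows "0 < discount c s u \<omega>" "discount c s u \<omega> \<le> 1"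
  unfolding discount_def set_lebesgue_integral_def by (auto intro!: integral_nonneg_AE simp: assms)

lemma discount_int_adapted:
  assumes "continuous_on UNIV c" "continuous_on UNIV g" "0 \<le> s" "0 \<le> t"
  shows "(\<lambda>\<omega>. LBINT u:{s..t}. discount c s u \<omega> * g (X u \<omega>)) \<in> borel_measurable (F t)"
  by (rule prog_set_integral[OF prog_mult[OF discount_prog prog_X]]) (use assms in auto)

lemma discount_integrable:
  assumes "continuous_on UNIV c" "continuous_on UNIV g"
  shows "set_integrable lborel {s..t} (\<lambda>u. discount c s u \<omega> * g (X u \<omega>))"
proof -
  have "continuous_on UNIV (\<lambda>u. discount c s u \<omega> * g (X u \<omega>))"
    by (intro continuous_intros discount_continuous comp_X_co assms)
  then show ?thesis by (intro borel_integrable_atLeastAtMost') (rule continuous_on_subset, auto)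
qed

lemma discount_FTC:
  assumes c: "continuous_on UNIV c" and "s \<le> t"
  shows "(LBINT u:{s..t}. discount c s u \<omega> * c (X u \<omega>)) = 1 - discount c s t \<omega>"
proof -
  obtain m where m: "0 \<le> m" "\<And>u. u \<in> {s..t} \<Longrightarrow> \<bar>c (X u \<omega>)\<bar> \<le> m"
    using continuous_Icc_bound[OF comp_X_co[OF c]] by metis
  have 0: "(LBINT v:{s..s}. g v) = 0" for g :: "real \<Rightarrow> real"
    using set_integral_Icc_bound[of s s g "\<bar>g s\<bar>"] by auto
  have "(LBINT u:{s..t}. exp (- (LBINT v:{s..u}. c (X v \<omega>))) * c (X u \<omega>)) =
    exp (- (LBINT v:{s..s}. c (X v \<omega>))) - exp (- (LBINT v:{s..t}. c (X v \<omega>)))"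
  proof (rule exp_set_integral_FTC[where N="{}" and t=t and m=m])
    show "set_borel_measurable lborel {s..t} (\<lambda>v. c (X v \<omega>))"
      using int_X[OF c, of s t \<omega>] by (simp add: set_integrable_def set_borel_measurable_def borel_measurable_integrable)
    show "isCont (\<lambda>v. c (X v \<omega>)) u" for u using comp_X_co[OF c] by (simp add: continuous_on_eq_continuous_at)
  qed (use m assms in auto)
  then show ?thesis unfolding discount_def 0 by simp
qed

text \<open>By \<open>discount_FTC\<close> the discounted integral of the rate itself is
  \<open>1 - discount\<close>, hence at most 1. So a function dominated by \<open>C\<close> times
  the rate has discounted integral at most \<open>C\<close>, whatever the length of the time
  interval and however far the path travels.\<close>

lemma discount_int_bound:
  assumes c: "continuous_on UNIV c" "\<And>y. 0 \<le> c y" and g: "continuous_on UNIV g" and st: "s \<le> t"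
    and bd: "\<And>y. \<bar>g y\<bar> \<le> C * c y" and C: "0 \<le> C"
  shows "\<bar>LBINT u:{s..t}. discount c s u \<omega> * g (X u \<omega>)\<bar> \<le> C"
proof -
  have "\<bar>LBINT u:{s..t}. discount c s u \<omega> * g (X u \<omega>)\<bar> \<le> (LBINT u:{s..t}. \<bar>discount c s u \<omega> * g (X u \<omega>)\<bar>)"
    using set_integral_norm_bound[OF discount_integrable[OF c(1) g]] by simp
  also have "\<dots> \<le> (LBINT u:{s..t}. C * (discount c s u \<omega> * c (X u \<omega>)))"
  proof (rule set_integral_mono[OF set_integrable_abs[OF discount_integrable[OF c(1) g]]
      set_integrable_mult_right[OF discount_integrable[OF c(1) c(1)]]])
    fix u
    have "discount c s u \<omega> * \<bar>g (X u \<omega>)\<bar> \<le> discount c s u \<omega> * (C * c (X u \<omega>))"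
      using discount_bounds(1)[of c s u \<omega>, OF c(2)] bd by (intro mult_left_mono) auto
    then show "\<bar>discount c s u \<omega> * g (X u \<omega>)\<bar> \<le> C * (discount c s u \<omega> * c (X u \<omega>))"
      using discount_bounds(1)[of c s u \<omega>, OF c(2)] by (simp add: abs_mult mult_ac)
  qed
  also have "\<dots> = C * (1 - discount c s t \<omega>)" by (simp add: discount_FTC[OF c(1) st])
  also have "\<dots> \<le> C" using C discount_bounds(1)[of c s t \<omega>, OF c(2)] mult_left_mono[of "1 - discount c s t \<omega>" 1 C] by simp
  finally show ?thesis .
qed

lemma Feynman_Kac_compact_support:
  assumes st: "0 \<le> s" "s \<le> t"
    and f1: "\<And>y. (f has_real_derivative f1 y) (at y)" and f2: "\<And>y. (f1 has_real_derivative f2 y) (at y)"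
    and f2c: "continuous_on UNIV f2" and supp: "\<And>y. r \<le> \<bar>y\<bar> \<Longrightarrow> f y = 0 \<and> f1 y = 0 \<and> f2 y = 0" "0 \<le> r"
    and c: "continuous_on UNIV c" "\<And>y. 0 \<le> c y" "\<And>y. \<delta> * \<bar>b y\<bar> \<le> c y" and \<delta>: "0 < \<delta>" "\<delta> \<le> 1"
    and Z: "Z \<in> borel_measurable (F s)" "\<And>\<omega>. \<omega> \<in> space M \<Longrightarrow> \<bar>Z \<omega>\<bar> \<le> mZ"
  defines "d \<equiv> discount (\<lambda>y. c y + \<delta> * (a y)\<^sup>2) s"
  shows "expectation (\<lambda>\<omega>. Z \<omega> * (f (X t \<omega>) * d t \<omega> -
     (LBINT u:{s..t}. d u \<omega> *
        (f1 (X u \<omega>) * b (X u \<omega>) + (a (X u \<omega>))\<^sup>2 * f2 (X u \<omega>) / 2 - (c (X u \<omega>) + \<delta> * (a (X u \<omega>))\<^sup>2) * f (X u \<omega>)))))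
    = expectation (\<lambda>\<omega>. Z \<omega> * f (X s \<omega>))"
proof -
  have fc: "continuous_on UNIV f" "continuous_on UNIV f1"
    using f1 f2 by (auto intro!: continuous_at_imp_continuous_on DERIV_isCont)
  have u: "uniformly_continuous_on UNIV f" "uniformly_continuous_on UNIV f1" "uniformly_continuous_on UNIV f2"
    by (rule compact_support_uniformly_continuous[where r=r]; use fc f2c supp in auto)+
  obtain m0 where m0: "\<And>y. \<bar>f y\<bar> \<le> m0" using compact_support_uniformly_continuous(2)[OF fc(1), of r] supp by auto
  obtain m1 where m1: "\<And>y. \<bar>f1 y\<bar> \<le> m1" using compact_support_uniformly_continuous(2)[OF fc(2), of r] supp by auto
  obtain m2 where m2: "\<And>y. \<bar>f2 y\<bar> \<le> m2" using compact_support_uniformly_continuous(2)[OF f2c, of r] supp by auto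
  show ?thesis unfolding d_def
  proof (rule Feynman_Kac_bounded_derivatives[OF st f1 f2 _ _ _ u c \<delta> Z, where m="max m0 (max m1 m2)"])
    show "\<bar>f y\<bar> \<le> max m0 (max m1 m2)" "\<bar>f1 y\<bar> \<le> max m0 (max m1 m2)" "\<bar>f2 y\<bar> \<le> max m0 (max m1 m2)" for y
      using m0[of y] m1[of y] m2[of y] by auto
  qed
qed

text \<open>
  The additional damping \<open>\<epsilon> \<rho>\<close> bounds all terms arising from the cutoff of \<open>f\<close>; it is removed in
  \<open>Feynman_Kac_le\<close>, where only an inequality survives.
\<close>

lemma Feynman_Kac_damped:
  assumes st: "0 \<le> s" "s \<le> t"
    and f1: "\<And>y. (f has_real_derivative f1 y) (at y)" and f2: "\<And>y. (f1 has_real_derivative f2 y) (at y)"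
    and f2c: "continuous_on UNIV f2" and fb: "\<And>y. \<bar>f y\<bar> \<le> m"
    and c: "continuous_on UNIV c" "\<And>y. 0 \<le> c y"
    and \<epsilon>: "0 < \<epsilon>" "\<epsilon> \<le> 1"
    and Z: "Z \<in> borel_measurable (F s)" "\<And>\<omega>. \<omega> \<in> space M \<Longrightarrow> \<bar>Z \<omega>\<bar> \<le> mZ"
  defines "\<rho> \<equiv> \<lambda>y. ((a y)\<^sup>2 + \<bar>b y\<bar>) * (1 + \<bar>f1 y\<bar> + \<bar>f2 y\<bar>) + (a y)\<^sup>2"
  defines "d \<equiv> discount (\<lambda>y. c y + \<epsilon> * \<rho> y) s"
  shows "expectation (\<lambda>\<omega>. Z \<omega> * (f (X t \<omega>) * d t \<omega> -
     (LBINT u:{s..t}. d u \<omega> *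
        (f1 (X u \<omega>) * b (X u \<omega>) + (a (X u \<omega>))\<^sup>2 * f2 (X u \<omega>) / 2 - (c (X u \<omega>) + \<epsilon> * \<rho> (X u \<omega>)) * f (X u \<omega>)))))
    = expectation (\<lambda>\<omega>. Z \<omega> * f (X s \<omega>))"
proof -
  have m0: "0 \<le> m" using fb[of 0] by linarith
  have mZ0: "0 \<le> mZ" using Z(2) not_empty by (metis abs_ge_zero ex_in_conv order_trans)
  have fc: "continuous_on UNIV f" "continuous_on UNIV f1"
    using f1 f2 by (auto intro!: continuous_at_imp_continuous_on DERIV_isCont)
  define \<rho>0 where "\<rho>0 y = ((a y)\<^sup>2 + \<bar>b y\<bar>) * (1 + \<bar>f1 y\<bar> + \<bar>f2 y\<bar>)" for y
  have \<rho>0: "0 \<le> \<rho>0 y" for y unfolding \<rho>0_def by (intro mult_nonneg_nonneg add_nonneg_nonneg) auto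
  have \<rho>_eq: "\<rho> y = \<rho>0 y + (a y)\<^sup>2" for y by (simp add: \<rho>_def \<rho>0_def)
  have \<rho>0c: "continuous_on UNIV \<rho>0" and \<rho>c: "continuous_on UNIV \<rho>"
    unfolding \<rho>0_def \<rho>_def by (intro continuous_intros a_co b_co fc f2c)+
  have \<rho>nn: "0 \<le> \<rho> y" for y using \<rho>0[of y] by (simp add: \<rho>_eq)
  let ?c = "\<lambda>y. c y + \<epsilon> * \<rho> y"
  have cc: "continuous_on UNIV ?c" by (intro continuous_intros c \<rho>c)
  have c0: "0 \<le> ?c y" for y using c(2)[of y] \<rho>nn[of y] \<epsilon> by simp
  have b\<rho>: "\<bar>b y\<bar> \<le> \<rho>0 y" for y
  proof -
    have "(0 + \<bar>b y\<bar>) * (1 + 0 + 0) \<le> \<rho>0 y" unfolding \<rho>0_def by (intro mult_mono add_mono) auto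
    then show ?thesis by simp
  qed
  \<comment> \<open>The supports of \<open>cut (\<kappa> j)\<close> grow to the whole line, while
    \<open>cut_bounds\<close> holds uniformly in \<open>j\<close>.\<close>
  define \<kappa> where "\<kappa> j = inverse (real (Suc j))" for j
  have \<kappa>: "0 < \<kappa> j" "\<kappa> j \<le> 1" for j by (auto simp: \<kappa>_def inverse_le_1_iff)
  have \<kappa>lim: "\<kappa> \<longlonglongrightarrow> 0" unfolding \<kappa>_def by (rule LIMSEQ_inverse_real_of_nat)
  define g where "g j y = f y * cut (\<kappa> j) y" for j y
  define g1 where "g1 j y = f1 y * cut (\<kappa> j) y + f y * cut1 (\<kappa> j) y" for j y
  define g2 where "g2 j y = f2 y * cut (\<kappa> j) y + 2 * (f1 y * cut1 (\<kappa> j) y) + f y * cut2 (\<kappa> j) y" for j y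
  define K where "K j y = g1 j y * b y + (a y)\<^sup>2 * g2 j y / 2 - ?c y * g j y" for j y
  define K' where "K' y = f1 y * b y + (a y)\<^sup>2 * f2 y / 2 - ?c y * f y" for y
  have gc: "continuous_on UNIV (g j)" "continuous_on UNIV (g1 j)" "continuous_on UNIV (g2 j)" for j
    unfolding g_def g1_def g2_def by (intro continuous_intros fc f2c cut_continuous)+
  have Kc: "continuous_on UNIV (K j)" "continuous_on UNIV K'" for j
    unfolding K_def K'_def by (intro continuous_intros fc f2c gc a_co b_co cc c \<rho>c; simp)+
  have E: "expectation (\<lambda>\<omega>. Z \<omega> * (g j (X t \<omega>) * d t \<omega> - (LBINT u:{s..t}. d u \<omega> * K j (X u \<omega>)))) =
      expectation (\<lambda>\<omega>. Z \<omega> * g j (X s \<omega>))" for j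
  proof -
    \<comment> \<open>The part \<open>\<epsilon> * (a y)\<^sup>2\<close> of the damping is split off
      to serve as the \<open>\<delta>\<close>-term of \<open>Feynman_Kac_compact_support\<close>;
      the remainder \<open>\<epsilon> * \<rho>0\<close> dominates
      \<open>\<epsilon> * \<bar>b y\<bar>\<close>.\<close>
    have ceq: "(\<lambda>y. (c y + \<epsilon> * \<rho>0 y) + \<epsilon> * (a y)\<^sup>2) = ?c" by (simp add: \<rho>_eq algebra_simps)
    have ceq': "(c y + \<epsilon> * \<rho>0 y) + \<epsilon> * (a y)\<^sup>2 = ?c y" for y by (simp add: \<rho>_eq algebra_simps)
    have d1: "(g j has_real_derivative g1 j y) (at y)" "(g1 j has_real_derivative g2 j y) (at y)" for y
      unfolding g_def g1_def g2_def
      by (auto intro!: derivative_eq_intros f1 f2 cut_deriv)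
    have sp: "1 / \<kappa> j \<le> \<bar>y\<bar> \<Longrightarrow> g j y = 0 \<and> g1 j y = 0 \<and> g2 j y = 0" for y
      using cut_zero[OF \<kappa>(1)] by (simp add: g_def g1_def g2_def)
    have "continuous_on UNIV (\<lambda>y. c y + \<epsilon> * \<rho>0 y)" by (intro continuous_intros c \<rho>0c)
    moreover have "0 \<le> c y + \<epsilon> * \<rho>0 y" "\<epsilon> * \<bar>b y\<bar> \<le> c y + \<epsilon> * \<rho>0 y" for y
      using c(2)[of y] mult_nonneg_nonneg[OF less_imp_le[OF \<epsilon>(1)] \<rho>0[of y]] mult_left_mono[OF b\<rho>[of y] less_imp_le[OF \<epsilon>(1)]]
      by linarith+
    ultimately show ?thesis
      using Feynman_Kac_compact_support[OF st d1 gc(3) sp _ _ _ _ \<epsilon> Z(1) Z(2), where c="\<lambda>y. c y + \<epsilon> * \<rho>0 y" and r="1 / \<kappa> j"] \<kappa>(1)[of j]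
      unfolding ceq ceq' K_def d_def by (simp add: less_imp_le)
  qed
  \<comment> \<open>From the bounds 1, 6 and 30 on \<open>cut\<close> and its two derivatives; the
    last one is halved by the generator.\<close>
  define C where "C = 6 + 15 * m"
  have Kb: "\<bar>K j y\<bar> \<le> (C / \<epsilon> + m) * ?c y" for j y
  proof -
    note cb = cut_bounds[OF \<kappa>(1,2), of j y]
    have gb: "\<bar>g j y\<bar> \<le> m * 1" unfolding g_def abs_mult using fb cb m0 by (intro mult_mono) auto
    have g1b: "\<bar>g1 j y\<bar> \<le> \<bar>f1 y\<bar> * 1 + m * 6"
      unfolding g1_def using fb cb m0 by (intro order_trans[OF abs_triangle_ineq] add_mono; simp add: abs_mult mult_mono mult_left_le)
    have g2b: "\<bar>g2 j y\<bar> \<le> \<bar>f2 y\<bar> * 1 + 2 * (\<bar>f1 y\<bar> * 6) + m * 30"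
    proof -
      have "\<bar>f2 y * cut (\<kappa> j) y\<bar> \<le> \<bar>f2 y\<bar> * 1" "\<bar>f1 y * cut1 (\<kappa> j) y\<bar> \<le> \<bar>f1 y\<bar> * 6" "\<bar>f y * cut2 (\<kappa> j) y\<bar> \<le> m * 30"
        unfolding abs_mult using fb cb m0 by (intro mult_mono; simp)+
      then show ?thesis unfolding g2_def by linarith
    qed
    have "\<bar>g1 j y * b y + (a y)\<^sup>2 * g2 j y / 2\<bar> \<le> \<bar>b y\<bar> * \<bar>g1 j y\<bar> + (a y)\<^sup>2 * (\<bar>g2 j y\<bar> / 2)"
      using abs_triangle_ineq[of "g1 j y * b y" "(a y)\<^sup>2 * g2 j y / 2"] by (simp add: abs_mult mult.commute)
    also have "\<dots> \<le> \<bar>b y\<bar> * (C * (1 + \<bar>f1 y\<bar> + \<bar>f2 y\<bar>)) + (a y)\<^sup>2 * (C * (1 + \<bar>f1 y\<bar> + \<bar>f2 y\<bar>))"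
    proof (intro add_mono mult_left_mono)
      have *: "0 \<le> m * \<bar>f1 y\<bar>" "0 \<le> m * \<bar>f2 y\<bar>" using m0 by auto
      have e: "C * (1 + \<bar>f1 y\<bar> + \<bar>f2 y\<bar>) = 6 + 15 * m + 6 * \<bar>f1 y\<bar> + 15 * (m * \<bar>f1 y\<bar>) + 6 * \<bar>f2 y\<bar> + 15 * (m * \<bar>f2 y\<bar>)"
        by (simp add: C_def algebra_simps)
      show "\<bar>g1 j y\<bar> \<le> C * (1 + \<bar>f1 y\<bar> + \<bar>f2 y\<bar>)" "\<bar>g2 j y\<bar> / 2 \<le> C * (1 + \<bar>f1 y\<bar> + \<bar>f2 y\<bar>)"
        unfolding e using g1b g2b * m0 abs_ge_zero[of "f1 y"] abs_ge_zero[of "f2 y"] by linarith+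
    qed auto
    also have "\<dots> = C * \<rho>0 y" by (simp add: \<rho>0_def algebra_simps)
    also have "\<dots> \<le> C * \<rho> y" using m0 by (intro mult_left_mono) (auto simp: \<rho>_eq C_def)
    also have "\<dots> = C / \<epsilon> * (\<epsilon> * \<rho> y)" using \<epsilon> by simp
    also have "\<dots> \<le> C / \<epsilon> * ?c y" using m0 \<epsilon> c(2)[of y] by (intro mult_left_mono) (auto simp: C_def)
    finally have 1: "\<bar>g1 j y * b y + (a y)\<^sup>2 * g2 j y / 2\<bar> \<le> C / \<epsilon> * ?c y" .
    have 2: "\<bar>?c y * g j y\<bar> \<le> ?c y * m" unfolding abs_mult using c0[of y] gb by (intro mult_mono) auto
    have "\<bar>K j y\<bar> \<le> C / \<epsilon> * ?c y + ?c y * m" unfolding K_def using 1 2 by linarith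
    then show ?thesis by (simp add: algebra_simps)
  qed
  have Km: "0 \<le> C / \<epsilon> + m" using m0 \<epsilon> by (simp add: C_def)
  have glim: "(\<lambda>j. g j y) \<longlonglongrightarrow> f y" for y
    unfolding g_def using tendsto_mult[OF tendsto_const cut_limit(1)[OF \<kappa>lim], of "f y" y] by simp
  have Klim: "(\<lambda>j. K j y) \<longlonglongrightarrow> K' y" for y
    unfolding K_def K'_def g_def g1_def g2_def
    by (auto intro!: tendsto_eq_intros cut_limit[OF \<kappa>lim])
  have intlim: "(\<lambda>j. LBINT u:{s..t}. d u \<omega> * K j (X u \<omega>)) \<longlonglongrightarrow> (LBINT u:{s..t}. d u \<omega> * K' (X u \<omega>))" for \<omega>
    unfolding set_lebesgue_integral_def
  proof (rule integral_dominated_convergence)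
    show "integrable lborel (\<lambda>u. (C / \<epsilon> + m) * (indicator {s..t} u *\<^sub>R (d u \<omega> * ?c (X u \<omega>))))"
      using discount_integrable[OF cc cc, of s t \<omega>] unfolding d_def set_integrable_def by (intro integrable_mult_right)
    show "AE u in lborel. (\<lambda>j. indicator {s..t} u *\<^sub>R (d u \<omega> * K j (X u \<omega>))) \<longlonglongrightarrow> indicator {s..t} u *\<^sub>R (d u \<omega> * K' (X u \<omega>))"
      by (intro AE_I2 tendsto_intros Klim)
    show "AE u in lborel. norm (indicator {s..t} u *\<^sub>R (d u \<omega> * K j (X u \<omega>))) \<le> (C / \<epsilon> + m) * (indicator {s..t} u *\<^sub>R (d u \<omega> * ?c (X u \<omega>)))" for j
    proof (rule AE_I2)
      fix u
      have "d u \<omega> * \<bar>K j (X u \<omega>)\<bar> \<le> d u \<omega> * ((C / \<epsilon> + m) * ?c (X u \<omega>))"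
        using discount_bounds(1)[of ?c s u \<omega>, OF c0] Kb by (intro mult_left_mono) (auto simp: d_def)
      then show "norm (indicator {s..t} u *\<^sub>R (d u \<omega> * K j (X u \<omega>))) \<le> (C / \<epsilon> + m) * (indicator {s..t} u *\<^sub>R (d u \<omega> * ?c (X u \<omega>)))"
        using discount_bounds(1)[of ?c s u \<omega>, OF c0] by (auto simp: d_def indicator_def abs_mult mult_ac)
    qed
  qed (use discount_integrable[OF cc Kc(1), of s t \<omega>] discount_integrable[OF cc Kc(2), of s t \<omega>] in \<open>auto simp: set_integrable_def d_def\<close>)
  have ZM[measurable]: "Z \<in> borel_measurable M" by (rule F_M[OF Z(1)])
  have t0: "0 \<le> t" using st by simp
  have dM[measurable]: "d t \<in> borel_measurable M" unfolding d_def by (rule F_M[OF discount_adapted[OF cc st(1) t0]])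
  have XM: "(\<lambda>\<omega>. h (X v \<omega>)) \<in> borel_measurable M" if "continuous_on UNIV h" "0 \<le> v" for h :: "real \<Rightarrow> real" and v
    by (rule F_M[OF comp_X_ad[OF that]])
  have IM: "(\<lambda>\<omega>. LBINT u:{s..t}. d u \<omega> * h (X u \<omega>)) \<in> borel_measurable M" if "continuous_on UNIV h" for h
    unfolding d_def by (rule F_M[OF discount_int_adapted[OF cc that st(1) t0]])
  have gb: "\<bar>g j y\<bar> \<le> m" for j y
  proof -
    have "\<bar>g j y\<bar> \<le> m * 1" unfolding g_def abs_mult using fb cut_bounds[OF \<kappa>(1,2), of j y] m0 by (intro mult_mono) auto
    then show ?thesis by simp
  qed
  have 1: "(\<lambda>j. expectation (\<lambda>\<omega>. Z \<omega> * (g j (X t \<omega>) * d t \<omega> - (LBINT u:{s..t}. d u \<omega> * K j (X u \<omega>))))) \<longlonglongrightarrow>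
     expectation (\<lambda>\<omega>. Z \<omega> * (f (X t \<omega>) * d t \<omega> - (LBINT u:{s..t}. d u \<omega> * K' (X u \<omega>))))"
  proof (rule integral_dominated_convergence[where w="\<lambda>_. mZ * (m + (C / \<epsilon> + m))"])
    show "AE \<omega> in M. norm (Z \<omega> * (g j (X t \<omega>) * d t \<omega> - (LBINT u:{s..t}. d u \<omega> * K j (X u \<omega>)))) \<le> mZ * (m + (C / \<epsilon> + m))" for j
    proof (rule AE_I2)
      fix \<omega> assume \<omega>: "\<omega> \<in> space M"
      have "\<bar>LBINT u:{s..t}. d u \<omega> * K j (X u \<omega>)\<bar> \<le> C / \<epsilon> + m"
        unfolding d_def by (rule discount_int_bound[OF cc c0 Kc(1) st(2) Kb Km])
      moreover have "\<bar>g j (X t \<omega>) * d t \<omega>\<bar> \<le> m * 1"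
        unfolding abs_mult d_def using gb discount_bounds[of ?c s t \<omega>, OF c0] m0 by (intro mult_mono) (auto simp: less_imp_le)
      ultimately have "\<bar>g j (X t \<omega>) * d t \<omega> - (LBINT u:{s..t}. d u \<omega> * K j (X u \<omega>))\<bar> \<le> m + (C / \<epsilon> + m)" by linarith
      then show "norm (Z \<omega> * (g j (X t \<omega>) * d t \<omega> - (LBINT u:{s..t}. d u \<omega> * K j (X u \<omega>)))) \<le> mZ * (m + (C / \<epsilon> + m))"
        unfolding real_norm_def abs_mult using Z(2)[OF \<omega>] mZ0 by (intro mult_mono) auto
    qed
    show "AE \<omega> in M. (\<lambda>j. Z \<omega> * (g j (X t \<omega>) * d t \<omega> - (LBINT u:{s..t}. d u \<omega> * K j (X u \<omega>)))) \<longlonglongrightarrow>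
       Z \<omega> * (f (X t \<omega>) * d t \<omega> - (LBINT u:{s..t}. d u \<omega> * K' (X u \<omega>)))"
      by (intro AE_I2 tendsto_intros glim intlim)
  qed (use XM[OF gc(1) t0] XM[OF fc(1) t0] IM[OF Kc(1)] IM[OF Kc(2)] in auto)
  have 2: "(\<lambda>j. expectation (\<lambda>\<omega>. Z \<omega> * g j (X s \<omega>))) \<longlonglongrightarrow> expectation (\<lambda>\<omega>. Z \<omega> * f (X s \<omega>))"
  proof (rule integral_dominated_convergence[where w="\<lambda>_. mZ * m"])
    show "AE \<omega> in M. (\<lambda>j. Z \<omega> * g j (X s \<omega>)) \<longlonglongrightarrow> Z \<omega> * f (X s \<omega>)" by (intro AE_I2 tendsto_intros glim)
    show "AE \<omega> in M. norm (Z \<omega> * g j (X s \<omega>)) \<le> mZ * m" for j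
      using gb Z(2) mZ0 by (intro AE_I2) (auto simp: abs_mult intro!: mult_mono)
  qed (use XM[OF gc(1) st(1)] XM[OF fc(1) st(1)] in auto)
  show ?thesis using LIMSEQ_unique[OF 1 2[folded E]] by (simp add: K'_def)
qed

theorem Feynman_Kac_le:
  assumes st: "0 \<le> s" "s \<le> t"
    and f1: "\<And>y. (f has_real_derivative f1 y) (at y)" and f2: "\<And>y. (f1 has_real_derivative f2 y) (at y)"
    and f2c: "continuous_on UNIV f2" and fb: "\<And>y. \<bar>f y\<bar> \<le> m"
    and c: "continuous_on UNIV c" "\<And>y. 0 \<le> c y"
    and e: "continuous_on UNIV e" "\<And>y. \<bar>e y\<bar> \<le> me"
    and le: "\<And>y. f1 y * b y + (a y)\<^sup>2 * f2 y / 2 - c y * f y \<le> e y"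
    and Z: "Z \<in> borel_measurable (F s)" "\<And>\<omega>. \<omega> \<in> space M \<Longrightarrow> \<bar>Z \<omega>\<bar> \<le> mZ" "\<And>\<omega>. \<omega> \<in> space M \<Longrightarrow> 0 \<le> Z \<omega>"
  shows "expectation (\<lambda>\<omega>. Z \<omega> * (f (X t \<omega>) * discount c s t \<omega>)) \<le>
    expectation (\<lambda>\<omega>. Z \<omega> * f (X s \<omega>)) + expectation (\<lambda>\<omega>. Z \<omega> * (LBINT u:{s..t}. discount c s u \<omega> * e (X u \<omega>)))"
proof -
  have m0: "0 \<le> m" using fb[of 0] by linarith
  have me0: "0 \<le> me" using e(2)[of 0] by linarith
  have mZ0: "0 \<le> mZ" using Z(2) not_empty by (metis abs_ge_zero ex_in_conv order_trans)
  have fc: "continuous_on UNIV f" "continuous_on UNIV f1"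
    using f1 f2 by (auto intro!: continuous_at_imp_continuous_on DERIV_isCont)
  define \<rho> where "\<rho> y = ((a y)\<^sup>2 + \<bar>b y\<bar>) * (1 + \<bar>f1 y\<bar> + \<bar>f2 y\<bar>) + (a y)\<^sup>2" for y
  have \<rho>nn: "0 \<le> \<rho> y" for y unfolding \<rho>_def by (intro mult_nonneg_nonneg add_nonneg_nonneg) auto
  have \<rho>c: "continuous_on UNIV \<rho>" unfolding \<rho>_def by (intro continuous_intros a_co b_co fc f2c)
  define \<epsilon> where "\<epsilon> j = inverse (real (Suc j))" for j
  have \<epsilon>: "0 < \<epsilon> j" "\<epsilon> j \<le> 1" for j by (auto simp: \<epsilon>_def inverse_le_1_iff)
  have \<epsilon>lim: "\<epsilon> \<longlonglongrightarrow> 0" unfolding \<epsilon>_def by (rule LIMSEQ_inverse_real_of_nat)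
  define cj where "cj j y = c y + \<epsilon> j * \<rho> y" for j y
  have cjc: "continuous_on UNIV (cj j)" for j unfolding cj_def by (intro continuous_intros c \<rho>c)
  have cj0: "0 \<le> cj j y" for j y using c(2)[of y] \<rho>nn[of y] \<epsilon>(1)[of j] by (simp add: cj_def)
  define d where "d j = discount (cj j) s" for j
  define K where "K j y = f1 y * b y + (a y)\<^sup>2 * f2 y / 2 - cj j y * f y" for j y
  have Kc: "continuous_on UNIV (K j)" for j unfolding K_def by (intro continuous_intros fc f2c a_co b_co cjc; simp)
  \<comment> \<open>\<open>K j\<close> is bounded only by \<open>1 / \<epsilon> j + m\<close> times
    the rate, which degenerates as \<open>j\<close> grows. Its upper bound \<open>k j\<close> has
    discounted integrals bounded in \<open>j\<close>, since \<open>\<epsilon> j * \<rho>\<close> is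
    itself part of the rate.\<close>
  define k where "k j y = e y + m * (\<epsilon> j * \<rho> y)" for j y
  have kc: "continuous_on UNIV (k j)" for j unfolding k_def by (intro continuous_intros e \<rho>c)
  have E: "expectation (\<lambda>\<omega>. Z \<omega> * (f (X t \<omega>) * d j t \<omega> - (LBINT u:{s..t}. d j u \<omega> * K j (X u \<omega>)))) =
      expectation (\<lambda>\<omega>. Z \<omega> * f (X s \<omega>))" for j
    using Feynman_Kac_damped[OF st f1 f2 f2c fb c \<epsilon>[of j] Z(1,2)] unfolding \<rho>_def[symmetric] cj_def[symmetric] d_def K_def .
  have Kk: "K j y \<le> k j y" for j y
  proof -
    have "\<epsilon> j * \<rho> y * - f y \<le> \<epsilon> j * \<rho> y * m"
      using fb[of y] \<epsilon>(1)[of j] \<rho>nn[of y] by (intro mult_left_mono) auto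
    then show ?thesis using le[of y] by (simp add: K_def k_def cj_def algebra_simps)
  qed
  have ZM[measurable]: "Z \<in> borel_measurable M" by (rule F_M[OF Z(1)])
  have t0: "0 \<le> t" using st by simp
  have dM[measurable]: "d j t \<in> borel_measurable M" for j unfolding d_def by (rule F_M[OF discount_adapted[OF cjc st(1) t0]])
  have fXM[measurable]: "(\<lambda>\<omega>. f (X t \<omega>)) \<in> borel_measurable M" "(\<lambda>\<omega>. f (X s \<omega>)) \<in> borel_measurable M"
    using F_M[OF comp_X_ad[OF fc(1) t0]] F_M[OF comp_X_ad[OF fc(1) st(1)]] by auto
  have IM: "(\<lambda>\<omega>. LBINT u:{s..t}. d j u \<omega> * h (X u \<omega>)) \<in> borel_measurable M" if "continuous_on UNIV h" for h j
    unfolding d_def by (rule F_M[OF discount_int_adapted[OF cjc that st(1) t0]])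
  have d01: "0 < d j u \<omega>" "d j u \<omega> \<le> 1" for j u \<omega> unfolding d_def using discount_bounds[of "cj j" s u \<omega>, OF cj0] by auto
  define R where "R j \<omega> = (LBINT u:{s..t}. d j u \<omega> * e (X u \<omega>))" for j \<omega>
  define Q where "Q j \<omega> = (LBINT u:{s..t}. d j u \<omega> * (\<epsilon> j * \<rho> (X u \<omega>)))" for j \<omega>
  have \<epsilon>\<rho>c: "continuous_on UNIV (\<lambda>y. \<epsilon> j * \<rho> y)" for j by (intro continuous_intros \<rho>c)
  have di: "set_integrable lborel {s..t} (\<lambda>u. d j u \<omega> * h (X u \<omega>))" if "continuous_on UNIV h" for h j \<omega>
    unfolding d_def by (rule discount_integrable[OF cjc that])
  have kint: "(LBINT u:{s..t}. d j u \<omega> * k j (X u \<omega>)) = R j \<omega> + m * Q j \<omega>" for j \<omega>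
  proof -
    have "(LBINT u:{s..t}. d j u \<omega> * k j (X u \<omega>)) = (LBINT u:{s..t}. d j u \<omega> * e (X u \<omega>) + m * (d j u \<omega> * (\<epsilon> j * \<rho> (X u \<omega>))))"
      by (simp add: k_def algebra_simps)
    also have "\<dots> = R j \<omega> + m * Q j \<omega>"
      unfolding R_def Q_def by (subst set_integral_add(2)[OF di[OF e(1)] set_integrable_mult_right[OF di[OF \<epsilon>\<rho>c]]]) simp
    finally show ?thesis .
  qed
  have Kint: "(LBINT u:{s..t}. d j u \<omega> * K j (X u \<omega>)) \<le> R j \<omega> + m * Q j \<omega>" for j \<omega>
    unfolding kint[symmetric] using d01 Kk
    by (intro set_integral_mono di Kc kc mult_left_mono) (auto intro: less_imp_le)
  have Qb: "0 \<le> Q j \<omega>" "Q j \<omega> \<le> 1" for j \<omega>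
  proof -
    show "0 \<le> Q j \<omega>" unfolding Q_def set_lebesgue_integral_def
      using d01 \<rho>nn \<epsilon>(1)[of j] by (intro integral_nonneg_AE) (auto intro!: AE_I2 mult_nonneg_nonneg intro: less_imp_le)
    have "\<bar>Q j \<omega>\<bar> \<le> 1" unfolding Q_def d_def
      using c(2) \<rho>nn \<epsilon>(1)[of j] by (intro discount_int_bound[OF cjc cj0 \<epsilon>\<rho>c st(2)]) (auto simp: cj_def)
    then show "Q j \<omega> \<le> 1" by simp
  qed
  have Rb: "\<bar>R j \<omega>\<bar> \<le> me * (t - s)" for j \<omega>
    unfolding R_def
  proof (rule set_integral_Icc_bound[OF st(2)])
    fix u
    have "\<bar>d j u \<omega>\<bar> * \<bar>e (X u \<omega>)\<bar> \<le> 1 * me" using d01[of j u \<omega>] e(2) by (intro mult_mono) auto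
    then show "\<bar>d j u \<omega> * e (X u \<omega>)\<bar> \<le> me" by (simp add: abs_mult)
  qed
  have RM[measurable]: "R j \<in> borel_measurable M" "Q j \<in> borel_measurable M" for j
    unfolding R_def Q_def using IM[OF e(1)] IM[OF \<epsilon>\<rho>c] by auto
  have fdb: "\<bar>f (X t \<omega>) * d j t \<omega>\<bar> \<le> m" for j \<omega>
    using mult_mono[OF fb[of "X t \<omega>"], of "d j t \<omega>" 1] d01[of j t \<omega>] m0 by (auto simp: abs_mult less_imp_le)
  have Zb: "\<bar>Z \<omega> * h\<bar> \<le> mZ * C" if "\<omega> \<in> space M" "\<bar>h\<bar> \<le> C" for \<omega> h C
    unfolding abs_mult using Z(2)[OF that(1)] that(2) mZ0 by (intro mult_mono) auto
  have le_j: "expectation (\<lambda>\<omega>. Z \<omega> * (f (X t \<omega>) * d j t \<omega>)) \<le> expectation (\<lambda>\<omega>. Z \<omega> * f (X s \<omega>)) + expectation (\<lambda>\<omega>. Z \<omega> * (R j \<omega> + m * Q j \<omega>))" for j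
  proof -
    have i1: "integrable M (\<lambda>\<omega>. Z \<omega> * (f (X t \<omega>) * d j t \<omega>))"
      by (rule bounded_integrable[where m="mZ * m"]) (use Zb fdb in auto)
    have i2: "integrable M (\<lambda>\<omega>. Z \<omega> * (R j \<omega> + m * Q j \<omega>))"
    proof (rule bounded_integrable[where m="mZ * (me * (t - s) + m)"])
      fix \<omega> assume "\<omega> \<in> space M"
      moreover have "\<bar>R j \<omega> + m * Q j \<omega>\<bar> \<le> me * (t - s) + m"
        using Rb[of j \<omega>] Qb[of j \<omega>] m0 mult_left_mono[OF Qb(2)[of j \<omega>] m0] mult_nonneg_nonneg[OF m0 Qb(1)[of j \<omega>]] by auto
      ultimately show "\<bar>Z \<omega> * (R j \<omega> + m * Q j \<omega>)\<bar> \<le> mZ * (me * (t - s) + m)" by (rule Zb)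
    qed measurable
    let ?J = "\<lambda>\<omega>. LBINT u:{s..t}. d j u \<omega> * K j (X u \<omega>)"
    have i3: "integrable M (\<lambda>\<omega>. Z \<omega> * ?J \<omega>)"
    proof (rule bounded_integrable[where m="mZ * (1 / \<epsilon> j + m)"])
      fix \<omega> assume \<omega>: "\<omega> \<in> space M"
      have "\<bar>K j y\<bar> \<le> (1 / \<epsilon> j + m) * cj j y" for y
      proof -
        have "((a y)\<^sup>2 + \<bar>b y\<bar>) * (1 + \<bar>f1 y\<bar> + \<bar>f2 y\<bar>) = \<bar>f1 y\<bar> * \<bar>b y\<bar> + (a y)\<^sup>2 * \<bar>f2 y\<bar> + ((a y)\<^sup>2 * (1 + \<bar>f1 y\<bar>) + \<bar>b y\<bar> * (1 + \<bar>f2 y\<bar>))"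
          by (simp add: algebra_simps)
        moreover have "0 \<le> (a y)\<^sup>2 * (1 + \<bar>f1 y\<bar>) + \<bar>b y\<bar> * (1 + \<bar>f2 y\<bar>)" "0 \<le> (a y)\<^sup>2 * \<bar>f2 y\<bar>" "0 \<le> (a y)\<^sup>2"
          by (auto intro!: add_nonneg_nonneg mult_nonneg_nonneg)
        moreover have "\<bar>f1 y * b y\<bar> = \<bar>f1 y\<bar> * \<bar>b y\<bar>" "\<bar>(a y)\<^sup>2 * f2 y / 2\<bar> = (a y)\<^sup>2 * \<bar>f2 y\<bar> / 2" by (auto simp: abs_mult)
        ultimately have "\<bar>f1 y * b y + (a y)\<^sup>2 * f2 y / 2\<bar> \<le> \<rho> y" unfolding \<rho>_def by linarith
        moreover have "\<rho> y \<le> 1 / \<epsilon> j * cj j y" using \<epsilon>(1)[of j] c(2)[of y] by (simp add: cj_def field_simps)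
        moreover have "\<bar>cj j y * f y\<bar> \<le> cj j y * m" unfolding abs_mult using fb[of y] cj0[of j y] by (intro mult_mono) auto
        ultimately have "\<bar>K j y\<bar> \<le> 1 / \<epsilon> j * cj j y + cj j y * m" unfolding K_def by linarith
        then show ?thesis by (simp add: algebra_simps)
      qed
      then have "\<bar>?J \<omega>\<bar> \<le> 1 / \<epsilon> j + m" unfolding d_def
        using m0 \<epsilon>(1)[of j] by (intro discount_int_bound[OF cjc cj0 Kc st(2)]) auto
      with \<omega> show "\<bar>Z \<omega> * ?J \<omega>\<bar> \<le> mZ * (1 / \<epsilon> j + m)" by (rule Zb)
    qed (use IM[OF Kc] in measurable)
    have "expectation (\<lambda>\<omega>. Z \<omega> * f (X s \<omega>)) = expectation (\<lambda>\<omega>. Z \<omega> * (f (X t \<omega>) * d j t \<omega>) - Z \<omega> * ?J \<omega>)"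
      unfolding E[of j, symmetric] by (simp add: right_diff_distrib)
    also have "\<dots> = expectation (\<lambda>\<omega>. Z \<omega> * (f (X t \<omega>) * d j t \<omega>)) - expectation (\<lambda>\<omega>. Z \<omega> * ?J \<omega>)"
      by (rule Bochner_Integration.integral_diff[OF i1 i3])
    finally have "expectation (\<lambda>\<omega>. Z \<omega> * (f (X t \<omega>) * d j t \<omega>)) = expectation (\<lambda>\<omega>. Z \<omega> * f (X s \<omega>)) + expectation (\<lambda>\<omega>. Z \<omega> * ?J \<omega>)" by simp
    moreover have "expectation (\<lambda>\<omega>. Z \<omega> * ?J \<omega>) \<le> expectation (\<lambda>\<omega>. Z \<omega> * (R j \<omega> + m * Q j \<omega>))"
      by (rule integral_mono[OF i3 i2]) (use Kint Z(3) in \<open>auto intro: mult_left_mono\<close>)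
    ultimately show ?thesis by simp
  qed
  let ?d = "discount c s"
  have dlim: "(\<lambda>j. d j u \<omega>) \<longlonglongrightarrow> ?d u \<omega>" for u \<omega>
  proof -
    have "(LBINT v:{s..u}. cj j (X v \<omega>)) = (LBINT v:{s..u}. c (X v \<omega>)) + \<epsilon> j * (LBINT v:{s..u}. \<rho> (X v \<omega>))" for j
      unfolding cj_def by (subst set_integral_add(2)[OF int_X[OF c(1)] set_integrable_mult_right[OF int_X[OF \<rho>c]]]) simp
    then have eq: "d j u \<omega> = exp (- ((LBINT v:{s..u}. c (X v \<omega>)) + \<epsilon> j * (LBINT v:{s..u}. \<rho> (X v \<omega>))))" for j
      by (simp add: d_def discount_def)
    have "(\<lambda>j. exp (- ((LBINT v:{s..u}. c (X v \<omega>)) + \<epsilon> j * (LBINT v:{s..u}. \<rho> (X v \<omega>))))) \<longlonglongrightarrow>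
      exp (- ((LBINT v:{s..u}. c (X v \<omega>)) + 0 * (LBINT v:{s..u}. \<rho> (X v \<omega>))))"
      by (intro tendsto_intros \<epsilon>lim)
    then show ?thesis unfolding eq by (simp add: discount_def)
  qed
  have d'01: "0 < ?d u \<omega>" "?d u \<omega> \<le> 1" for u \<omega> using discount_bounds[of c s u \<omega>, OF c(2)] by auto
  have Rlim: "(\<lambda>j. R j \<omega>) \<longlonglongrightarrow> (LBINT u:{s..t}. ?d u \<omega> * e (X u \<omega>))" for \<omega>
    unfolding R_def set_lebesgue_integral_def
  proof (rule integral_dominated_convergence[where w="\<lambda>u. indicator {s..t} u * me"])
    show "AE u in lborel. (\<lambda>j. indicator {s..t} u *\<^sub>R (d j u \<omega> * e (X u \<omega>))) \<longlonglongrightarrow> indicator {s..t} u *\<^sub>R (?d u \<omega> * e (X u \<omega>))"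
      by (intro AE_I2 tendsto_intros dlim)
    show "AE u in lborel. norm (indicator {s..t} u *\<^sub>R (d j u \<omega> * e (X u \<omega>))) \<le> indicator {s..t} u * me" for j
    proof (rule AE_I2)
      fix u
      have "\<bar>d j u \<omega>\<bar> * \<bar>e (X u \<omega>)\<bar> \<le> 1 * me" using d01[of j u \<omega>] e(2) by (intro mult_mono) auto
      then show "norm (indicator {s..t} u *\<^sub>R (d j u \<omega> * e (X u \<omega>))) \<le> indicator {s..t} u * me"
        by (auto simp: abs_mult indicator_def)
    qed
    show "integrable lborel (\<lambda>u. indicator {s..t} u * me)"
      by (auto intro!: integrable_mult_left simp: integrable_indicator_iff emeasure_lborel_Icc_eq)
  qed (use di[OF e(1)] discount_integrable[OF c(1) e(1), of s t \<omega>] in \<open>auto simp: set_integrable_def\<close>)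
  \<comment> \<open>\<open>Q j\<close> is bounded by 1 through the discount, and by
    \<open>\<epsilon> j\<close> times a finite path integral; the former gives the domination, the
    latter the limit.\<close>
  have Qlim: "(\<lambda>j. Q j \<omega>) \<longlonglongrightarrow> 0" for \<omega>
  proof (rule tendsto_sandwich[OF _ _ tendsto_const])
    show "eventually (\<lambda>j. 0 \<le> Q j \<omega>) sequentially" using Qb by simp
    show "eventually (\<lambda>j. Q j \<omega> \<le> \<epsilon> j * (LBINT u:{s..t}. \<rho> (X u \<omega>))) sequentially"
    proof (intro always_eventually allI)
      fix j
      have "Q j \<omega> \<le> (LBINT u:{s..t}. \<epsilon> j * \<rho> (X u \<omega>))" unfolding Q_def
      proof (rule set_integral_mono[OF di[OF \<epsilon>\<rho>c] int_X[OF \<epsilon>\<rho>c]])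
        show "d j u \<omega> * (\<epsilon> j * \<rho> (X u \<omega>)) \<le> \<epsilon> j * \<rho> (X u \<omega>)" for u
          using d01[of j u \<omega>] \<rho>nn[of "X u \<omega>"] \<epsilon>(1)[of j] by (intro mult_left_le_one_le) (auto intro: less_imp_le)
      qed
      then show "Q j \<omega> \<le> \<epsilon> j * (LBINT u:{s..t}. \<rho> (X u \<omega>))" by simp
    qed
    show "(\<lambda>j. \<epsilon> j * (LBINT u:{s..t}. \<rho> (X u \<omega>))) \<longlonglongrightarrow> 0"
      using tendsto_mult_left_zero[OF \<epsilon>lim] .
  qed
  have dcM[measurable]: "?d t \<in> borel_measurable M" "(\<lambda>\<omega>. LBINT u:{s..t}. ?d u \<omega> * e (X u \<omega>)) \<in> borel_measurable M"
    using F_M[OF discount_adapted[OF c(1) st(1) t0]] F_M[OF discount_int_adapted[OF c(1) e(1) st(1) t0]] by auto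
  have L: "(\<lambda>j. expectation (\<lambda>\<omega>. Z \<omega> * (f (X t \<omega>) * d j t \<omega>))) \<longlonglongrightarrow> expectation (\<lambda>\<omega>. Z \<omega> * (f (X t \<omega>) * ?d t \<omega>))"
  proof (rule integral_dominated_convergence[where w="\<lambda>_. mZ * m"])
    show "AE \<omega> in M. (\<lambda>j. Z \<omega> * (f (X t \<omega>) * d j t \<omega>)) \<longlonglongrightarrow> Z \<omega> * (f (X t \<omega>) * ?d t \<omega>)"
      by (intro AE_I2 tendsto_intros dlim)
    show "AE \<omega> in M. norm (Z \<omega> * (f (X t \<omega>) * d j t \<omega>)) \<le> mZ * m" for j
      using Zb[OF _ fdb] by (intro AE_I2) auto
  qed auto
  have Rl: "(\<lambda>j. expectation (\<lambda>\<omega>. Z \<omega> * (R j \<omega> + m * Q j \<omega>))) \<longlonglongrightarrow> expectation (\<lambda>\<omega>. Z \<omega> * ((LBINT u:{s..t}. ?d u \<omega> * e (X u \<omega>)) + m * 0))"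
  proof (rule integral_dominated_convergence[where w="\<lambda>_. mZ * (me * (t - s) + m)"])
    show "AE \<omega> in M. (\<lambda>j. Z \<omega> * (R j \<omega> + m * Q j \<omega>)) \<longlonglongrightarrow> Z \<omega> * ((LBINT u:{s..t}. ?d u \<omega> * e (X u \<omega>)) + m * 0)"
      by (intro AE_I2 tendsto_intros Rlim Qlim)
    show "AE \<omega> in M. norm (Z \<omega> * (R j \<omega> + m * Q j \<omega>)) \<le> mZ * (me * (t - s) + m)" for j
    proof (rule AE_I2)
      fix \<omega> assume "\<omega> \<in> space M"
      moreover have "\<bar>R j \<omega> + m * Q j \<omega>\<bar> \<le> me * (t - s) + m"
        using Rb[of j \<omega>] Qb[of j \<omega>] m0 mult_left_mono[OF Qb(2)[of j \<omega>] m0] mult_nonneg_nonneg[OF m0 Qb(1)[of j \<omega>]] by auto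
      ultimately have "\<bar>Z \<omega> * (R j \<omega> + m * Q j \<omega>)\<bar> \<le> mZ * (me * (t - s) + m)" by (rule Zb)
      then show "norm (Z \<omega> * (R j \<omega> + m * Q j \<omega>)) \<le> mZ * (me * (t - s) + m)" by simp
    qed
  qed auto
  show ?thesis
    using LIMSEQ_le[OF L tendsto_add[OF tendsto_const Rl]] le_j by auto
qed

section \<open>Transience\<close>

text \<open>The starting value is contained in \<open>approx_X\<close>: at time 0 all integrals
  vanish, so the approximations equal \<open>x\<close> there.\<close>

lemma X0: "AE \<omega> in M. X 0 \<omega> = x"
proof -
  have 0: "(LBINT s:{0..0}. g s) = 0" for g :: "real \<Rightarrow> real"
    using set_integral_Icc_bound[of 0 0 g "\<bar>g 0\<bar>"] by auto
  have Xs0: "Xs k 0 \<omega> = x" for k \<omega>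
  proof -
    obtain m where "0 \<le> m" "\<And>i \<omega>. i < n k \<Longrightarrow> \<omega> \<in> space M \<Longrightarrow> \<bar>\<zeta> k i \<omega>\<bar> \<le> m" using \<zeta>_bound[of k] by auto
    then interpret S: simple_ito M F W "\<lambda>_ _. 0" "\<lambda>_ _. 0" "n k" "\<tau> k" "\<zeta> k" 0 0 0 m "\<lambda>_. 0" "\<lambda>_. 0" "\<lambda>_. 0" "\<lambda>_. 0"
      by (intro simple_trivial) auto
    have "simple_integral W (n k) (\<tau> k) (\<zeta> k) 0 \<omega> = 0"
      unfolding simple_integral_def by (rule sum.neutral) (use S.\<tau>(1) in \<open>auto simp: min_absorb2\<close>)
    then show ?thesis unfolding Xs_def 0 by simp
  qed
  obtain r :: "nat \<Rightarrow> nat" where "AE \<omega> in M. (\<lambda>j. Xs (r j) 0 \<omega>) \<longlonglongrightarrow> X 0 \<omega>"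
    using approx_subseq[of 0 0] by (metis order_refl)
  then show ?thesis unfolding Xs0 by eventually_elim (simp add: LIMSEQ_const_iff)
qed

lemma supermartingale_X:
  assumes st: "0 \<le> s" "s \<le> t"
    and f1: "\<And>y. (f has_real_derivative f1 y) (at y)" and f2: "\<And>y. (f1 has_real_derivative f2 y) (at y)"
    and f2c: "continuous_on UNIV f2" and fb: "\<And>y. \<bar>f y\<bar> \<le> m"
    and e: "continuous_on UNIV e" "\<And>y. \<bar>e y\<bar> \<le> me"
    and le: "\<And>y. f1 y * b y + (a y)\<^sup>2 * f2 y / 2 \<le> e y"
    and Z: "Z \<in> borel_measurable (F s)" "\<And>\<omega>. \<omega> \<in> space M \<Longrightarrow> \<bar>Z \<omega>\<bar> \<le> mZ" "\<And>\<omega>. \<omega> \<in> space M \<Longrightarrow> 0 \<le> Z \<omega>"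
  shows "expectation (\<lambda>\<omega>. Z \<omega> * f (X t \<omega>)) \<le>
    expectation (\<lambda>\<omega>. Z \<omega> * f (X s \<omega>)) + expectation (\<lambda>\<omega>. Z \<omega> * (LBINT u:{s..t}. e (X u \<omega>)))"
proof -
  have "discount (\<lambda>_. 0) s u \<omega> = 1" for u \<omega> by (simp add: discount_def set_lebesgue_integral_def)
  with Feynman_Kac_le[OF st f1 f2 f2c fb _ _ e _ Z, of "\<lambda>_. 0"] le show ?thesis by simp
qed

text \<open>Doob's inequality on a grid. \<open>A i\<close> is the event that \<open>\<eta>\<close>
  is not exceeded at the first \<open>i\<close> grid times. By induction, the expectation carried by
  \<open>A i\<close> plus \<open>\<eta>\<close> times the probability already lost stays below the
  initial expectation, the supermartingale property being tested against the indicator of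
  \<open>A (Suc i)\<close>.\<close>

lemma maximal_inequality_grid:
  fixes f :: "real \<Rightarrow> real"
  assumes T: "0 \<le> T" and d: "0 \<le> d" and f: "continuous_on UNIV f" "\<And>y. 0 \<le> f y" "\<And>y. f y \<le> m"
    and sup: "\<And>s t Z. 0 \<le> s \<Longrightarrow> s \<le> t \<Longrightarrow> Z \<in> borel_measurable (F s) \<Longrightarrow> (\<And>\<omega>. 0 \<le> Z \<omega> \<and> Z \<omega> \<le> 1) \<Longrightarrow>
       expectation (\<lambda>\<omega>. Z \<omega> * f (X t \<omega>)) \<le> expectation (\<lambda>\<omega>. Z \<omega> * f (X s \<omega>))"
    and \<eta>: "0 < \<eta>"
  shows "\<eta> * prob {\<omega> \<in> space M. \<exists>i\<le>N::nat. \<eta> < f (X (T + real i * d) \<omega>)} \<le> expectation (\<lambda>\<omega>. f (X T \<omega>))"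
proof -
  define t where "t i = T + real i * d" for i :: nat
  have t: "0 \<le> t i" "t i \<le> t (Suc i)" "i \<le> j \<Longrightarrow> t i \<le> t j" for i j using T d by (auto simp: t_def mult_right_mono)
  define A where "A i = {\<omega> \<in> space M. \<forall>j<i. f (X (t j) \<omega>) \<le> \<eta>}" for i
  have AF: "A (Suc i) \<in> sets (F (t i))" for i
  proof -
    have [measurable]: "(\<lambda>\<omega>. f (X (t j) \<omega>)) \<in> borel_measurable (F (t i))" if "j < Suc i" for j
      by (rule F_mono[OF _ comp_X_ad[OF f(1) t(1)]]) (use t(3)[of j i] that in auto)
    have "{\<omega> \<in> space (F (t i)). \<forall>j\<in>{..<Suc i}. f (X (t j) \<omega>) \<le> \<eta>} \<in> sets (F (t i))"
      by (rule sets.sets_Collect_finite_All) (auto intro!: borel_measurable_le)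
    also have "{\<omega> \<in> space (F (t i)). \<forall>j\<in>{..<Suc i}. f (X (t j) \<omega>) \<le> \<eta>} = A (Suc i)"
      by (auto simp: A_def space_F)
    finally show ?thesis .
  qed
  have AM: "A i \<in> sets M" for i
  proof (cases i)
    case (Suc j)
    then show ?thesis using AF[of j] subalg[of "t j"] by (auto simp: subalgebra_def)
  qed (simp add: A_def)
  have fM[measurable]: "(\<lambda>\<omega>. f (X (t i) \<omega>)) \<in> borel_measurable M" for i by (rule F_M[OF comp_X_ad[OF f(1) t(1)]])
  have int: "integrable M (\<lambda>\<omega>. indicator S \<omega> * f (X (t i) \<omega>))" if "S \<in> sets M" for S i
    by (rule bounded_integrable[where m=m]) (use that f(2,3) order_trans[OF f(2) f(3)] in \<open>auto simp: indicator_def\<close>)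
  have S: "expectation (\<lambda>\<omega>. indicator (A i) \<omega> * f (X (t i) \<omega>)) + \<eta> * prob (space M - A i) \<le> expectation (\<lambda>\<omega>. f (X T \<omega>))" for i
  proof (induction i)
    case 0
    have "A 0 = space M" by (simp add: A_def)
    then have "expectation (\<lambda>\<omega>. indicator (A 0) \<omega> * f (X (t 0) \<omega>)) = expectation (\<lambda>\<omega>. f (X T \<omega>))"
      by (intro Bochner_Integration.integral_cong) (auto simp: t_def)
    with \<open>A 0 = space M\<close> show ?case by simp
  next
    case (Suc i)
    let ?B = "A i - A (Suc i)"
    have sub: "A (Suc i) \<subseteq> A i" by (auto simp: A_def)
    have BM: "?B \<in> sets M" using AM by auto
    have "expectation (\<lambda>\<omega>. indicator (A (Suc i)) \<omega> * f (X (t (Suc i)) \<omega>)) \<le> expectation (\<lambda>\<omega>. indicator (A (Suc i)) \<omega> * f (X (t i) \<omega>))"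
      by (rule sup[OF t(1) t(2)]) (use AF[of i] in \<open>auto simp: indicator_def intro!: borel_measurable_indicator\<close>)
    moreover have "\<eta> * prob ?B \<le> expectation (\<lambda>\<omega>. indicator ?B \<omega> * f (X (t i) \<omega>))"
    proof -
      have "\<eta> * prob ?B = expectation (\<lambda>\<omega>. \<eta> * indicator ?B \<omega>)" using BM by simp
      also have "\<dots> \<le> expectation (\<lambda>\<omega>. indicator ?B \<omega> * f (X (t i) \<omega>))"
      proof (rule integral_mono[OF _ int[OF BM]])
        show "integrable M (\<lambda>\<omega>. \<eta> * indicator ?B \<omega>)"
          using BM by (intro integrable_mult_right integrable_real_indicator) (auto simp: emeasure_eq_measure)
      qed (auto simp: indicator_def A_def less_Suc_eq)
      finally show ?thesis .
    qed
    moreover have "expectation (\<lambda>\<omega>. indicator (A i) \<omega> * f (X (t i) \<omega>)) =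
       expectation (\<lambda>\<omega>. indicator (A (Suc i)) \<omega> * f (X (t i) \<omega>)) + expectation (\<lambda>\<omega>. indicator ?B \<omega> * f (X (t i) \<omega>))"
      by (subst Bochner_Integration.integral_add[symmetric, OF int[OF AM] int[OF BM]])
        (use sub in \<open>auto intro!: Bochner_Integration.integral_cong simp: indicator_def\<close>)
    moreover have "prob (space M - A (Suc i)) = prob (space M - A i) + prob ?B"
    proof -
      have "space M - A (Suc i) = (space M - A i) \<union> ?B" using sub by (auto simp: A_def)
      then show ?thesis using AM BM by (auto intro!: finite_measure_Union)
    qed
    ultimately show ?case using Suc.IH by (simp add: distrib_left)
  qed
  have "{\<omega> \<in> space M. \<exists>i\<le>N. \<eta> < f (X (T + real i * d) \<omega>)} = space M - A (Suc N)"
    by (auto simp: A_def t_def less_Suc_eq_le not_le not_less)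
  moreover have "0 \<le> expectation (\<lambda>\<omega>. indicator (A (Suc N)) \<omega> * f (X (t (Suc N)) \<omega>))"
    using f(2) by (intro integral_nonneg_AE) auto
  ultimately show ?thesis using S[of "Suc N"] by simp
qed

text \<open>Exceeding \<open>\<eta>\<close> strictly is an open condition on a continuous path, so
  it is detected on dyadic grids. The grids are nested and their horizon \<open>N\<close> grows
  while the mesh shrinks, hence the events increase to the full one.\<close>

lemma exceed_sets:
  fixes f :: "real \<Rightarrow> real"
  assumes f: "continuous_on UNIV f" and T: "0 \<le> T"
  shows "{\<omega> \<in> space M. \<exists>t\<ge>T. \<eta> < f (X t \<omega>)} \<in> sets M"
    "(\<lambda>N. prob {\<omega> \<in> space M. \<exists>i\<le>N * 2 ^ N. \<eta> < f (X (T + real i * (1 / 2 ^ N)) \<omega>)}) \<longlonglongrightarrow>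
      prob {\<omega> \<in> space M. \<exists>t\<ge>T. \<eta> < f (X t \<omega>)}"
proof -
  define A where "A N = {\<omega> \<in> space M. \<exists>i\<le>N * 2 ^ N. \<eta> < f (X (T + real i * (1 / 2 ^ N)) \<omega>)}" for N :: nat
  have AM: "A N \<in> sets M" for N
  proof -
    have [measurable]: "(\<lambda>\<omega>. f (X (T + real i * (1 / 2 ^ N)) \<omega>)) \<in> borel_measurable M" for i
      using T by (intro F_M[OF comp_X_ad[OF f]]) auto
    have "{\<omega> \<in> space M. \<exists>i\<in>{..N * 2 ^ N}. \<eta> < f (X (T + real i * (1 / 2 ^ N)) \<omega>)} \<in> sets M" by measurable
    also have "{\<omega> \<in> space M. \<exists>i\<in>{..N * 2 ^ N}. \<eta> < f (X (T + real i * (1 / 2 ^ N)) \<omega>)} = A N"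
      by (auto simp: A_def)
    finally show ?thesis .
  qed
  have inc: "incseq A"
  proof (rule incseq_SucI)
    fix N show "A N \<le> A (Suc N)"
    proof
      fix \<omega> assume "\<omega> \<in> A N"
      then obtain i where i: "\<omega> \<in> space M" "i \<le> N * 2 ^ N" "\<eta> < f (X (T + real i * (1 / 2 ^ N)) \<omega>)" by (auto simp: A_def)
      have "2 * i \<le> Suc N * 2 ^ Suc N" using i(2) by (simp add: algebra_simps)
      moreover have "real (2 * i) * (1 / 2 ^ Suc N) = real i * (1 / 2 ^ N)" by simp
      ultimately show "\<omega> \<in> A (Suc N)" using i(1,3) unfolding A_def by (metis (mono_tags, lifting) mem_Collect_eq)
    qed
  qed
  have U: "(\<Union>N. A N) = {\<omega> \<in> space M. \<exists>t\<ge>T. \<eta> < f (X t \<omega>)}"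
  proof (intro equalityI subsetI)
    fix \<omega> assume "\<omega> \<in> (\<Union>N. A N)"
    then obtain N i where "\<omega> \<in> space M" "\<eta> < f (X (T + real i * (1 / 2 ^ N)) \<omega>)" by (auto simp: A_def)
    then show "\<omega> \<in> {\<omega> \<in> space M. \<exists>t\<ge>T. \<eta> < f (X t \<omega>)}" by (auto intro!: exI[of _ "T + real i * (1 / 2 ^ N)"])
  next
    fix \<omega> assume "\<omega> \<in> {\<omega> \<in> space M. \<exists>t\<ge>T. \<eta> < f (X t \<omega>)}"
    then obtain t where t: "\<omega> \<in> space M" "T \<le> t" "\<eta> < f (X t \<omega>)" by auto
    define i where "i N = nat \<lfloor>(t - T) * 2 ^ N\<rfloor>" for N :: nat
    define u where "u N = T + real (i N) * (1 / 2 ^ N)" for N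
    have ub: "\<bar>u N - t\<bar> \<le> (1 / 2) ^ N" for N
    proof -
      have "real (i N) = of_int \<lfloor>(t - T) * 2 ^ N\<rfloor>" using t by (simp add: i_def)
      then have "real (i N) \<le> (t - T) * 2 ^ N" "(t - T) * 2 ^ N \<le> real (i N) + 1" by linarith+
      then have "real (i N) * (1 / 2 ^ N) \<le> t - T" "t - T \<le> real (i N) * (1 / 2 ^ N) + 1 / 2 ^ N"
        by (auto simp: field_simps)
      then show ?thesis by (simp add: u_def power_one_over)
    qed
    have "u \<longlonglongrightarrow> t"
      by (rule LIM_zero_cancel, rule Lim_null_comparison[of _ "\<lambda>N. (1 / 2) ^ N"])
        (use ub in \<open>auto intro!: always_eventually LIMSEQ_realpow_zero\<close>)
    then have "(\<lambda>N. f (X (u N) \<omega>)) \<longlonglongrightarrow> f (X t \<omega>)"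
      by (rule continuous_on_tendsto_compose[OF comp_X_co[OF f]]) auto
    then have "eventually (\<lambda>N. \<eta> < f (X (u N) \<omega>)) sequentially" using t(3) by (rule order_tendstoD)
    moreover have "eventually (\<lambda>N. t - T \<le> real N) sequentially"
      using filterlim_real_sequentially unfolding filterlim_at_top by blast
    ultimately have "eventually (\<lambda>N. \<eta> < f (X (u N) \<omega>) \<and> t - T \<le> real N) sequentially" by (rule eventually_conj)
    then obtain N where N: "\<eta> < f (X (u N) \<omega>)" "t - T \<le> real N" by (auto simp: eventually_sequentially)
    have "(t - T) * 2 ^ N \<le> real (N * 2 ^ N)" using N(2) by simp
    then have "i N \<le> N * 2 ^ N" unfolding i_def by linarith
    then show "\<omega> \<in> (\<Union>N. A N)" using t(1) N(1) by (auto simp: A_def u_def)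
  qed
  show "{\<omega> \<in> space M. \<exists>t\<ge>T. \<eta> < f (X t \<omega>)} \<in> sets M" unfolding U[symmetric] using AM by auto
  have "(\<lambda>N. prob (A N)) \<longlonglongrightarrow> prob (\<Union>N. A N)"
    by (rule finite_Lim_measure_incseq) (use AM inc in auto)
  then have "(\<lambda>N. prob (A N)) \<longlonglongrightarrow> prob {\<omega> \<in> space M. \<exists>t\<ge>T. \<eta> < f (X t \<omega>)}" unfolding U .
  then show "(\<lambda>N. prob {\<omega> \<in> space M. \<exists>i\<le>N * 2 ^ N. \<eta> < f (X (T + real i * (1 / 2 ^ N)) \<omega>)}) \<longlonglongrightarrow>
      prob {\<omega> \<in> space M. \<exists>t\<ge>T. \<eta> < f (X t \<omega>)}" unfolding A_def .
qed

lemma maximal_inequality: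
  fixes f :: "real \<Rightarrow> real"
  assumes T: "0 \<le> T" and f: "continuous_on UNIV f" "\<And>y. 0 \<le> f y" "\<And>y. f y \<le> m"
    and sup: "\<And>s t Z. 0 \<le> s \<Longrightarrow> s \<le> t \<Longrightarrow> Z \<in> borel_measurable (F s) \<Longrightarrow> (\<And>\<omega>. 0 \<le> Z \<omega> \<and> Z \<omega> \<le> 1) \<Longrightarrow>
       expectation (\<lambda>\<omega>. Z \<omega> * f (X t \<omega>)) \<le> expectation (\<lambda>\<omega>. Z \<omega> * f (X s \<omega>))"
    and \<eta>: "0 < \<eta>"
  shows "\<eta> * prob {\<omega> \<in> space M. \<exists>t\<ge>T. \<eta> < f (X t \<omega>)} \<le> expectation (\<lambda>\<omega>. f (X T \<omega>))"
proof (rule LIMSEQ_le_const2)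
  show "(\<lambda>N. \<eta> * prob {\<omega> \<in> space M. \<exists>i\<le>N * 2 ^ N. \<eta> < f (X (T + real i * (1 / 2 ^ N)) \<omega>)}) \<longlonglongrightarrow>
    \<eta> * prob {\<omega> \<in> space M. \<exists>t\<ge>T. \<eta> < f (X t \<omega>)}"
    by (rule tendsto_mult[OF tendsto_const exceed_sets(2)[OF f(1) T]])
  have "\<eta> * prob {\<omega> \<in> space M. \<exists>i\<le>N * 2 ^ N. \<eta> < f (X (T + real i * (1 / 2 ^ N)) \<omega>)} \<le> expectation (\<lambda>\<omega>. f (X T \<omega>))" for N
    by (rule maximal_inequality_grid[OF T _ f sup \<eta>]) auto
  then show "\<exists>K. \<forall>N\<ge>K. \<eta> * prob {\<omega> \<in> space M. \<exists>i\<le>N * 2 ^ N. \<eta> < f (X (T + real i * (1 / 2 ^ N)) \<omega>)} \<le> expectation (\<lambda>\<omega>. f (X T \<omega>))"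
    by blast
qed

end

text \<open>\<open>sc\<close> stands for the scale based at \<open>y\<close> and \<open>p\<close>
  for its density. \<open>kp\<close> and \<open>km\<close> are the reciprocals of the absolute
  values of its two limits, so that an infinite limit is encoded by 0; \<open>0 < kp + km\<close> is
  transience.\<close>

locale scaled_diffusion = diffusion M F W b a x X n \<tau> \<zeta>
  for M :: "'w measure" and F and W :: "real \<Rightarrow> 'w \<Rightarrow> real" and b a :: "real \<Rightarrow> real" and x :: real
    and X :: "real \<Rightarrow> 'w \<Rightarrow> real" and n \<tau> \<zeta> +
  fixes y kp km :: real and p sc :: "real \<Rightarrow> real"
  assumes sc_deriv: "\<And>z. (sc has_real_derivative p z) (at z)"
    and p_deriv: "\<And>z. (p has_real_derivative - 2 * b z / (a z)\<^sup>2 * p z) (at z)"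
    and p_pos: "\<And>z. 0 < p z" and p_y: "p y = 1" and sc_y: "sc y = 0"
    and kpm: "0 \<le> kp" "0 \<le> km" "0 < kp + km"
    and kp_less: "\<And>z. kp * sc z < 1" and km_less: "\<And>z. - km * sc z < 1"
    and kp0: "kp = 0 \<Longrightarrow> filterlim sc at_top at_top" and kp1: "0 < kp \<Longrightarrow> ((\<lambda>z. kp * sc z) \<longlongrightarrow> 1) at_top"
    and km0: "km = 0 \<Longrightarrow> filterlim sc at_bot at_bot" and km1: "0 < km \<Longrightarrow> ((\<lambda>z. - km * sc z) \<longlongrightarrow> 1) at_bot"
begin

text \<open>
  \<open>h0\<close> is positive, concave in the scale \<open>sc\<close>, and tends to \<open>0\<close> at exactly those ends of the line where
  the scale has a finite limit. The transforms \<open>hR R\<close> are bounded by \<open>R\<close> and strictly concave in the scale, so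
  \<open>hR 1\<close> loses mass at the rate \<open>kill > 0\<close>, which forces \<open>hR 1 (X t)\<close> to \<open>0\<close>.
\<close>

definition h0 where "h0 z = (1 + km * sc z) * (1 - kp * sc z)"
definition v where "v z = max (kp * sc z) (- km * sc z)"

lemma sc_co: "continuous_on UNIV sc" and p_co: "continuous_on UNIV p"
  using sc_deriv p_deriv by (auto intro!: continuous_at_imp_continuous_on DERIV_isCont)

lemma h0_pos: "0 < h0 z"
  unfolding h0_def using kp_less[of z] km_less[of z] by (intro mult_pos_pos) auto

lemma v_eq: "0 \<le> sc z \<Longrightarrow> v z = kp * sc z" "sc z \<le> 0 \<Longrightarrow> v z = - km * sc z"
proof -
  assume "0 \<le> sc z"
  then have "0 \<le> kp * sc z" "0 \<le> km * sc z" using kpm by auto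
  then show "v z = kp * sc z" by (simp add: v_def max_def)
next
  assume "sc z \<le> 0"
  then have "kp * sc z \<le> 0" "km * sc z \<le> 0" using kpm by (auto simp: mult_nonneg_nonpos)
  then show "v z = - km * sc z" by (simp add: v_def max_def)
qed

lemma v_bounds: "0 \<le> v z" "v z < 1"
proof -
  show "v z < 1" using kp_less[of z] km_less[of z] by (simp add: v_def)
  show "0 \<le> v z" using v_eq[of z] kpm mult_nonneg_nonneg[of kp "sc z"] mult_nonneg_nonpos[of km "sc z"]
    by (cases "0 \<le> sc z") auto
qed

text \<open>Reduces the convergence of \<open>v\<close> to 1 along paths to that of
  \<open>h0\<close> to 0.\<close>

lemma one_minus_v_le: "1 - v z \<le> h0 z"
proof (cases "0 \<le> sc z")
  case True
  have "1 * (1 - kp * sc z) \<le> h0 z" unfolding h0_def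
    using True kpm kp_less[of z] by (intro mult_right_mono) auto
  then show ?thesis using v_eq(1)[OF True] by simp
next
  case False
  have "(1 + km * sc z) * 1 \<le> h0 z" unfolding h0_def
    using False kpm km_less[of z] mult_nonneg_nonpos[of kp "sc z"] by (intro mult_left_mono) auto
  then show ?thesis using v_eq(2)[of z] False by simp
qed

lemma h0_co: "continuous_on UNIV h0"
  unfolding h0_def by (intro continuous_intros sc_co)

text \<open>At each end of the line \<open>h0\<close> tends to 0 or to infinity, according to
  whether the scale is finite or infinite there, so values in \<open>[\<eta>, R]\<close> are taken
  on a bounded set only.\<close>

lemma h0_band:
  assumes "0 < \<eta>" obtains r where "0 \<le> r" "\<And>z. \<eta> \<le> h0 z \<Longrightarrow> h0 z \<le> R \<Longrightarrow> \<bar>z\<bar> \<le> r"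
proof -
  have top: "eventually (\<lambda>z. h0 z < \<eta> \<or> R < h0 z) at_top"
  proof (cases "kp = 0")
    case True
    with kpm have km: "0 < km" by simp
    have "filterlim (\<lambda>z. 1 + km * sc z) at_top at_top"
      by (intro filterlim_tendsto_add_at_top[OF tendsto_const] filterlim_tendsto_pos_mult_at_top[OF tendsto_const km] kp0 True)
    then have "eventually (\<lambda>z. R < h0 z) at_top" using True unfolding filterlim_at_top_dense h0_def by simp
    then show ?thesis by eventually_elim simp
  next
    case False
    with kpm have kp: "0 < kp" by simp
    have "((\<lambda>z. (1 + km / kp * (kp * sc z)) * (1 - kp * sc z)) \<longlongrightarrow> (1 + km / kp * 1) * (1 - 1)) at_top"
      by (intro tendsto_intros kp1 kp)
    then have "(h0 \<longlongrightarrow> 0) at_top" using kp by (simp add: h0_def[abs_def])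
    from order_tendstoD(2)[OF this assms] show ?thesis by eventually_elim simp
  qed
  have bot: "eventually (\<lambda>z. h0 z < \<eta> \<or> R < h0 z) at_bot"
  proof (cases "km = 0")
    case True
    with kpm have kp: "0 < kp" by simp
    have "filterlim (\<lambda>z. 1 + kp * (- sc z)) at_top at_bot"
      by (intro filterlim_tendsto_add_at_top[OF tendsto_const] filterlim_tendsto_pos_mult_at_top[OF tendsto_const kp])
        (use km0[OF True] in \<open>simp add: filterlim_uminus_at_bot\<close>)
    then have "eventually (\<lambda>z. R < h0 z) at_bot" using True unfolding filterlim_at_top_dense h0_def by simp
    then show ?thesis by eventually_elim simp
  next
    case False
    with kpm have km: "0 < km" by simp
    have "((\<lambda>z. (1 - (- km * sc z)) * (1 + kp / km * (- km * sc z))) \<longlongrightarrow> (1 - 1) * (1 + kp / km * 1)) at_bot"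
      by (intro tendsto_intros km1 km)
    then have "(h0 \<longlongrightarrow> 0) at_bot" using km by (simp add: h0_def[abs_def])
    from order_tendstoD(2)[OF this assms] show ?thesis by eventually_elim simp
  qed
  from top bot obtain r1 r2 where r: "\<And>z. r1 \<le> z \<Longrightarrow> h0 z < \<eta> \<or> R < h0 z" "\<And>z. z \<le> r2 \<Longrightarrow> h0 z < \<eta> \<or> R < h0 z"
    unfolding eventually_at_top_linorder eventually_at_bot_linorder by metis
  show ?thesis
  proof (rule that[of "\<bar>r1\<bar> + \<bar>r2\<bar>"])
    fix z assume "\<eta> \<le> h0 z" "h0 z \<le> R"
    then have "z < r1" "r2 < z" using r(1)[of z] r(2)[of z] by force+
    then show "\<bar>z\<bar> \<le> \<bar>r1\<bar> + \<bar>r2\<bar>" by linarith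
  qed simp
qed

definition hR where "hR R z = R * h0 z / (R + h0 z)"
text \<open>The derivative of \<open>h0\<close> with respect to the scale; the second one is the
  constant \<open>- 2 * km * kp\<close>.\<close>

definition q1 where "q1 z = (km - kp) - 2 * km * kp * sc z"
definition hR1 where "hR1 R z = R\<^sup>2 / (R + h0 z)\<^sup>2 * (q1 z * p z)"
definition hR2 where "hR2 R z = R\<^sup>2 / (R + h0 z)\<^sup>2 * (- 2 * km * kp * (p z)\<^sup>2 + q1 z * (- 2 * b z / (a z)\<^sup>2 * p z))
   - 2 * R\<^sup>2 / (R + h0 z) ^ 3 * (q1 z * p z)\<^sup>2"

lemma h0_deriv: "(h0 has_real_derivative q1 z * p z) (at z)"
  unfolding h0_def q1_def by (auto intro!: derivative_eq_intros sc_deriv simp: algebra_simps)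

lemma hR_deriv:
  assumes "0 < R"
  shows "(hR R has_real_derivative hR1 R z) (at z)" "(hR1 R has_real_derivative hR2 R z) (at z)"
proof -
  have nz: "R + h0 z \<noteq> 0" using h0_pos[of z] assms by simp
  show "(hR R has_real_derivative hR1 R z) (at z)"
    unfolding hR_def[abs_def] hR1_def using nz
    by (auto intro!: derivative_eq_intros h0_deriv simp: field_simps power2_eq_square)
  have d: "((\<lambda>z. R\<^sup>2 / (R + h0 z)\<^sup>2) has_real_derivative - 2 * R\<^sup>2 / (R + h0 z) ^ 3 * (q1 z * p z)) (at z)"
  proof -
    have "((\<lambda>u. R\<^sup>2 / u\<^sup>2) has_real_derivative - 2 * R\<^sup>2 / u ^ 3) (at u)" if "u \<noteq> 0" for u :: real
      using that by (auto intro!: derivative_eq_intros simp: field_simps eval_nat_numeral)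
    from DERIV_chain2[OF this[OF nz] DERIV_add[OF DERIV_const h0_deriv]] show ?thesis by simp
  qed
  have q: "((\<lambda>z. q1 z * p z) has_real_derivative - 2 * km * kp * (p z)\<^sup>2 + q1 z * (- 2 * b z / (a z)\<^sup>2 * p z)) (at z)"
  proof -
    have "(q1 has_real_derivative - 2 * km * kp * p z) (at z)"
      unfolding q1_def by (auto intro!: derivative_eq_intros sc_deriv)
    from DERIV_mult[OF this p_deriv] show ?thesis
      by (rule DERIV_cong) (simp add: power2_eq_square mult_ac)
  qed
  show "(hR1 R has_real_derivative hR2 R z) (at z)"
    unfolding hR1_def[abs_def] by (rule DERIV_cong[OF DERIV_mult[OF d q]]) (simp add: hR2_def power2_eq_square algebra_simps)
qed

lemma hR2_co: "0 < R \<Longrightarrow> continuous_on UNIV (hR2 R)"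
  unfolding hR2_def[abs_def] q1_def
  by (intro continuous_intros h0_co sc_co p_co a_co b_co) (use h0_pos a_nz in \<open>auto simp: add_pos_pos less_imp_neq[symmetric] dest: add_pos_pos[OF _ h0_pos]\<close>)

lemma hR_co: "0 < R \<Longrightarrow> continuous_on UNIV (hR R)"
  using hR_deriv(1) by (auto intro!: continuous_at_imp_continuous_on DERIV_isCont)

text \<open>Since \<open>p' = - 2 * b / a\<^sup>2 * p\<close>, the first-order terms cancel. What
  remains is the concavity of \<open>h0\<close> in the scale, giving \<open>km * kp\<close>, and
  that of \<open>u \<mapsto> R * u / (R + u)\<close>, giving the square of
  \<open>q1\<close>.\<close>

lemma hR_generator:
  assumes "0 < R"
  shows "hR1 R z * b z + (a z)\<^sup>2 * hR2 R z / 2 = - (a z)\<^sup>2 * (p z)\<^sup>2 * (R\<^sup>2 / (R + h0 z)\<^sup>2) * (km * kp + (q1 z)\<^sup>2 / (R + h0 z))"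
proof -
  have nz: "R + h0 z \<noteq> 0" using h0_pos[of z] assms by simp
  have "(a z)\<^sup>2 * (b z / (a z)\<^sup>2) = b z" using a_nz[of z] by simp
  define A where "A = R\<^sup>2 / (R + h0 z)\<^sup>2"
  have A3: "R\<^sup>2 / (R + h0 z) ^ 3 = A / (R + h0 z)" using nz by (simp add: A_def power3_eq_cube power2_eq_square)
  have 2: "hR2 R z = A * (- 2 * km * kp * (p z)\<^sup>2) - 2 * A * q1 z * p z * (b z / (a z)\<^sup>2) - 2 * (A / (R + h0 z)) * (q1 z * p z)\<^sup>2"
    unfolding hR2_def A3[symmetric] by (simp add: A_def algebra_simps)
  have gen: "A * q * P * b' + a2 * (A * (- 2 * k * P\<^sup>2) - 2 * A * q * P * c - 2 * (A * i) * (q * P)\<^sup>2) / 2 = - a2 * P\<^sup>2 * A * (k + q\<^sup>2 * i)"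
    if "b' = a2 * c" for a2 A k P q c b' i :: real
    unfolding that by (simp add: algebra_simps power2_eq_square add_divide_distrib diff_divide_distrib)
  have 1: "hR1 R z = A * q1 z * p z" by (simp add: hR1_def A_def)
  define i where "i = 1 / (R + h0 z)"
  have i: "A / (R + h0 z) = A * i" "(q1 z)\<^sup>2 / (R + h0 z) = (q1 z)\<^sup>2 * i" by (simp_all add: i_def)
  have 2: "hR2 R z = A * (- 2 * (km * kp) * (p z)\<^sup>2) - 2 * A * q1 z * p z * (b z / (a z)\<^sup>2) - 2 * (A * i) * (q1 z * p z)\<^sup>2"
    using 2 i by (simp add: mult.assoc)
  show ?thesis unfolding A_def[symmetric] i 1 2
    by (rule gen) (use a_nz[of z] in simp)
qed

text \<open>If one of \<open>km\<close>, \<open>kp\<close> is 0, then \<open>h0\<close> is affine in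
  the scale with nonzero slope, and strict concavity comes from the transform alone; otherwise
  \<open>h0\<close> itself is strictly concave.\<close>

lemma hR_generator_neg:
  assumes "0 < R" shows "hR1 R z * b z + (a z)\<^sup>2 * hR2 R z / 2 < 0"
proof -
  have pos: "0 < R + h0 z" using h0_pos[of z] assms by simp
  have "0 < km * kp + (q1 z)\<^sup>2 / (R + h0 z)"
  proof (cases "km = 0 \<or> kp = 0")
    case True
    then have "q1 z \<noteq> 0" using kpm by (auto simp: q1_def)
    then have "0 < (q1 z)\<^sup>2 / (R + h0 z)" using pos by simp
    then show ?thesis using kpm by (simp add: add_nonneg_pos)
  next
    case False
    then have "0 < km * kp" using kpm by simp
    then show ?thesis using pos by (simp add: add_pos_nonneg)
  qed
  moreover have "0 < (a z)\<^sup>2 * (p z)\<^sup>2 * (R\<^sup>2 / (R + h0 z)\<^sup>2)" using a_nz[of z] p_pos[of z] assms pos by simp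
  ultimately have "0 < (a z)\<^sup>2 * (p z)\<^sup>2 * (R\<^sup>2 / (R + h0 z)\<^sup>2) * (km * kp + (q1 z)\<^sup>2 / (R + h0 z))" by (rule mult_pos_pos[rotated])
  then show ?thesis unfolding hR_generator[OF assms] by simp
qed

lemma hR_bounds:
  assumes "0 < R" shows "0 < hR R z" "hR R z < R" "hR R z \<le> h0 z" "R \<le> h0 z \<Longrightarrow> R / 2 \<le> hR R z"
proof -
  have pos: "0 < R + h0 z" "0 < h0 z" using h0_pos[of z] assms by auto
  then show "0 < hR R z" using assms by (simp add: hR_def)
  show "hR R z < R" "hR R z \<le> h0 z" using pos assms by (auto simp: hR_def divide_less_eq divide_le_eq algebra_simps)
  show "R / 2 \<le> hR R z" if "R \<le> h0 z" using pos assms that by (simp add: hR_def field_simps)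
qed

lemma hR_supermartingale:
  assumes R: "0 < R" and st: "0 \<le> s" "s \<le> t" and Z: "Z \<in> borel_measurable (F s)" "\<And>\<omega>. 0 \<le> Z \<omega> \<and> Z \<omega> \<le> 1"
  shows "expectation (\<lambda>\<omega>. Z \<omega> * hR R (X t \<omega>)) \<le> expectation (\<lambda>\<omega>. Z \<omega> * hR R (X s \<omega>))"
proof -
  have "expectation (\<lambda>\<omega>. Z \<omega> * hR R (X t \<omega>)) \<le>
    expectation (\<lambda>\<omega>. Z \<omega> * hR R (X s \<omega>)) + expectation (\<lambda>\<omega>. Z \<omega> * (LBINT u:{s..t}. 0))"
  proof (rule supermartingale_X[OF st hR_deriv[OF R] hR2_co[OF R], where m=R and me=0 and mZ=1])
    show "\<bar>hR R z\<bar> \<le> R" for z using hR_bounds(1,2)[OF R, of z] by simp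
  qed (use Z hR_generator_neg[OF R] in \<open>auto intro: less_imp_le\<close>)
  then show ?thesis by (simp add: set_lebesgue_integral_def)
qed

text \<open>Truncated at 1 so that it may serve as the bounded right-hand side in
  \<open>supermartingale_X\<close>.\<close>

definition kill where "kill z = min 1 (- (hR1 1 z * b z + (a z)\<^sup>2 * hR2 1 z / 2))"

lemma hR1_co: "0 < R \<Longrightarrow> continuous_on UNIV (hR1 R)"
  using hR_deriv(2) by (auto intro!: continuous_at_imp_continuous_on DERIV_isCont)

lemma kill: "0 < kill z" "kill z \<le> 1" "continuous_on UNIV kill"
  using hR_generator_neg[of 1 z] unfolding kill_def
  by (auto intro!: continuous_intros hR1_co hR2_co a_co b_co)

lemma kill_abs: "\<bar>kill z\<bar> \<le> 1"
  using kill(1,2)[of z] by simp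

lemma hR_abs: "0 < R \<Longrightarrow> \<bar>hR R z\<bar> \<le> R"
  using hR_bounds(1,2)[of R z] by simp

section \<open>Decay of the transformed \<open>h0\<close> along paths\<close>

lemma hR_X: "0 \<le> t \<Longrightarrow> 0 < R \<Longrightarrow> integrable M (\<lambda>\<omega>. hR R (X t \<omega>))"
  by (rule bounded_integrable[where m=R, OF F_M[OF comp_X_ad[OF hR_co]] hR_abs])

text \<open>\<open>hR 1\<close> starts below 1, stays positive, and in expectation loses at least
  the integral of \<open>kill\<close>; the total loss is therefore at most 1.\<close>

lemma expectation_kill:
  assumes "0 \<le> t"
  shows "expectation (\<lambda>\<omega>. LBINT u:{0..t}. kill (X u \<omega>)) \<le> 1"
proof -
  have h1: "expectation (\<lambda>\<omega>. 1 * hR 1 (X t \<omega>)) \<le>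
    expectation (\<lambda>\<omega>. 1 * hR 1 (X 0 \<omega>)) + expectation (\<lambda>\<omega>. 1 * (LBINT u:{0..t}. - kill (X u \<omega>)))"
  proof (rule supermartingale_X[OF order_refl assms hR_deriv[OF zero_less_one] hR2_co[OF zero_less_one], where m=1 and me=1 and mZ=1])
    show "\<bar>hR 1 z\<bar> \<le> 1" for z using hR_bounds(1,2)[of 1 z] by simp
    show "continuous_on UNIV (\<lambda>z. - kill z)" by (intro continuous_intros kill)
    show "\<bar>- kill z\<bar> \<le> 1" for z using kill_abs[of z] by simp
    show "hR1 1 z * b z + (a z)\<^sup>2 * hR2 1 z / 2 \<le> - kill z" for z by (simp add: kill_def)
  qed auto
  have "integrable M (\<lambda>\<omega>. hR 1 (X 0 \<omega>))" by (rule hR_X) auto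
  then have "expectation (\<lambda>\<omega>. hR 1 (X 0 \<omega>)) \<le> expectation (\<lambda>\<omega>. 1)"
    by (rule integral_mono) (use hR_bounds(2)[of 1] in \<open>auto intro: less_imp_le\<close>)
  moreover have "0 \<le> expectation (\<lambda>\<omega>. hR 1 (X t \<omega>))"
    using hR_bounds(1)[of 1] by (intro integral_nonneg_AE) (auto intro: less_imp_le)
  moreover have "expectation (\<lambda>\<omega>. LBINT u:{0..t}. - kill (X u \<omega>)) = - expectation (\<lambda>\<omega>. LBINT u:{0..t}. kill (X u \<omega>))"
    by (simp add: set_lebesgue_integral_def)
  ultimately show ?thesis using h1 by (simp add: prob_space)
qed

lemma kill_X: "0 \<le> t \<Longrightarrow> integrable M (\<lambda>\<omega>. kill (X t \<omega>))"
  by (rule bounded_integrable[where m=1, OF F_M[OF comp_X_ad[OF kill(3)]] kill_abs])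

lemma kill_small:
  assumes e: "0 < e" and T: "0 \<le> T"
  shows "\<exists>t\<ge>T. expectation (\<lambda>\<omega>. kill (X t \<omega>)) < e"
proof (rule ccontr)
  assume "\<not> ?thesis"
  then have ge: "e \<le> expectation (\<lambda>\<omega>. kill (X t \<omega>))" if "T \<le> t" for t using that by (meson not_le)
  \<comment> \<open>On an interval of length \<open>2 / e\<close> the loss would reach 2, against
    the bound 1 of \<open>expectation_kill\<close>.\<close>
  define t where "t = T + 2 / e"
  have t: "T \<le> t" "0 \<le> t" using e T by (auto simp: t_def)
  have c: "continuous_on UNIV (\<lambda>z. 1 - kill z)" by (intro continuous_intros kill)
  have i: "integrable M (\<lambda>\<omega>. 1 - kill (X u \<omega>))" if "u \<in> {T..t}" for u using kill_X[of u] that T by auto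
  \<comment> \<open>\<open>expectation_set_integral\<close> bounds from above, so the lower bound
    \<open>e\<close> is passed on through \<open>1 - kill\<close>.\<close>
  have "expectation (\<lambda>\<omega>. LBINT u:{T..t}. 1 - kill (X u \<omega>)) \<le> (1 - e) * (t - T)"
  proof (rule expectation_set_integral(2)[OF prog_X[OF c] T t(1)])
    show "0 \<le> 1 - kill (X u \<omega>)" for u \<omega> using kill(2) by simp
    show "expectation (\<lambda>\<omega>. 1 - kill (X u \<omega>)) \<le> 1 - e" if "u \<in> {T..t}" for u
      using ge[of u] kill_X[of u] that T by (simp add: prob_space)
  qed (rule i)
  moreover have I: "integrable M (\<lambda>\<omega>. LBINT u:{s..t}. kill (X u \<omega>))" if "0 \<le> s" "s \<le> t" for s
  proof (rule expectation_set_integral(1)[OF prog_X[OF kill(3)] that])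
    show "0 \<le> kill (X u \<omega>)" for u \<omega> using kill(1) less_imp_le by blast
    show "expectation (\<lambda>\<omega>. kill (X u \<omega>)) \<le> 1" if "u \<in> {s..t}" for u
      using integral_mono[OF kill_X[of u], of "\<lambda>_. 1"] kill(2) that \<open>0 \<le> s\<close> by (simp add: prob_space)
  qed (use kill_X that in auto)
  have "(LBINT u:{T..t}. 1 - kill (X u \<omega>)) = (t - T) - (LBINT u:{T..t}. kill (X u \<omega>))" for \<omega>
    using t(1) by (subst set_integral_diff(2)[OF int_X[OF continuous_on_const] int_X[OF kill(3)]])
      (simp add: set_lebesgue_integral_def)
  ultimately have "(t - T) - expectation (\<lambda>\<omega>. LBINT u:{T..t}. kill (X u \<omega>)) \<le> (1 - e) * (t - T)"
    using I[OF T t(1)] by (simp add: prob_space)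
  then have 1: "e * (t - T) \<le> expectation (\<lambda>\<omega>. LBINT u:{T..t}. kill (X u \<omega>))" by (simp add: algebra_simps)
  have "expectation (\<lambda>\<omega>. LBINT u:{T..t}. kill (X u \<omega>)) \<le> expectation (\<lambda>\<omega>. LBINT u:{0..t}. kill (X u \<omega>))"
  proof (rule integral_mono[OF I[OF T t(1)] I[OF order_refl t(2)]])
    fix \<omega>
    have "0 \<le> (LBINT u:{0..T}. kill (X u \<omega>))" unfolding set_lebesgue_integral_def
      using less_imp_le[OF kill(1)] by (intro integral_nonneg_AE AE_I2) simp
    then show "(LBINT u:{T..t}. kill (X u \<omega>)) \<le> (LBINT u:{0..t}. kill (X u \<omega>))"
      using set_integral_Icc_split[OF T t(1) int_X[OF kill(3)]] by simp
  qed
  with 1 expectation_kill[OF t(2)] have "e * (t - T) \<le> 1" by linarith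
  then show False using e by (simp add: t_def)
qed


text \<open>Markov's inequality for the bounded supermartingale \<open>hR R\<close>, which is at
  least \<open>R / 2\<close> where \<open>h0\<close> is at least \<open>R\<close>; this costs the
  factor 2.\<close>

lemma h0_upper:
  assumes t: "0 \<le> t" and R: "0 < R"
  shows "prob {\<omega> \<in> space M. R \<le> h0 (X t \<omega>)} \<le> 2 * h0 x / R"
proof -
  let ?A = "{\<omega> \<in> space M. R \<le> h0 (X t \<omega>)}"
  have [measurable]: "(\<lambda>\<omega>. h0 (X t \<omega>)) \<in> borel_measurable M" by (rule F_M[OF comp_X_ad[OF h0_co t]])
  have AM: "?A \<in> sets M" by measurable
  have "R / 2 * prob ?A = expectation (\<lambda>\<omega>. R / 2 * indicator ?A \<omega>)" using AM by simp
  also have "\<dots> \<le> expectation (\<lambda>\<omega>. hR R (X t \<omega>))"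
  proof (rule integral_mono[OF _ hR_X[OF t R]])
    show "integrable M (\<lambda>\<omega>. R / 2 * indicator ?A \<omega>)"
      using AM by (intro integrable_mult_right integrable_real_indicator) (auto simp: emeasure_eq_measure)
    show "R / 2 * indicator ?A \<omega> \<le> hR R (X t \<omega>)" for \<omega>
      using hR_bounds(1,4)[OF R, of "X t \<omega>"] by (auto simp: indicator_def)
  qed
  also have "\<dots> \<le> expectation (\<lambda>\<omega>. hR R (X 0 \<omega>))"
    using hR_supermartingale[OF R order_refl t, of "\<lambda>_. 1"] by simp
  also have "\<dots> = hR R x"
  proof -
    have "expectation (\<lambda>\<omega>. hR R (X 0 \<omega>)) = expectation (\<lambda>\<omega>. hR R x)"
    proof (rule integral_cong_AE)
      show "AE \<omega> in M. hR R (X 0 \<omega>) = hR R x" using X0 by eventually_elim simp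
    qed (use F_M[OF comp_X_ad[OF hR_co[OF R] order_refl]] in auto)
    then show ?thesis by (simp add: prob_space)
  qed
  also have "\<dots> \<le> h0 x" by (rule hR_bounds[OF R])
  finally show ?thesis using R by (simp add: field_simps)
qed

text \<open>Split by the size of \<open>h0 (X t)\<close>: small values contribute at most
  \<open>e / 4\<close>, large ones are improbable, and in the band between them \<open>X t\<close>
  lies in a compact set, where \<open>kill\<close> is bounded below while its expectation is small
  at a suitable time.\<close>

lemma h1_small:
  assumes e: "0 < e" and T: "0 \<le> T"
  obtains t where "T \<le> t" "expectation (\<lambda>\<omega>. hR 1 (X t \<omega>)) < e"
proof -
  \<comment> \<open>Chosen so that the bound \<open>2 * h0 x / R\<close> of \<open>h0_upper\<close>
    equals \<open>e / 4\<close>.\<close>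
  define R where "R = 8 * h0 x / e"
  have R: "0 < R" using h0_pos[of x] e by (simp add: R_def)
  obtain r where r: "0 \<le> r" "\<And>z. e / 4 \<le> h0 z \<Longrightarrow> h0 z \<le> R \<Longrightarrow> \<bar>z\<bar> \<le> r"
    using h0_band[of "e / 4" R] e by auto
  obtain z0 where z0: "\<And>z. \<bar>z\<bar> \<le> r \<Longrightarrow> kill z0 \<le> kill z"
  proof -
    have "\<exists>z0\<in>{-r..r}. \<forall>z\<in>{-r..r}. kill z0 \<le> kill z"
      by (rule continuous_attains_inf) (use r in \<open>auto intro: continuous_on_subset[OF kill(3)]\<close>)
    then obtain z0 where z0: "\<forall>z\<in>{-r..r}. kill z0 \<le> kill z" by blast
    show ?thesis by (rule that[of z0]) (use z0 in \<open>auto simp: abs_le_iff minus_le_iff\<close>)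
  qed
  have k0: "0 < kill z0" by (rule kill)
  obtain t where t: "T \<le> t" "expectation (\<lambda>\<omega>. kill (X t \<omega>)) < e / 4 * kill z0"
    using kill_small[of "e / 4 * kill z0" T] e k0 T by auto
  have t0: "0 \<le> t" using t T by simp
  let ?A = "{\<omega> \<in> space M. R \<le> h0 (X t \<omega>)}"
  have [measurable]: "(\<lambda>\<omega>. h0 (X t \<omega>)) \<in> borel_measurable M" by (rule F_M[OF comp_X_ad[OF h0_co t0]])
  have AM: "?A \<in> sets M" by measurable
  have "expectation (\<lambda>\<omega>. hR 1 (X t \<omega>)) \<le> expectation (\<lambda>\<omega>. e / 4 + indicator ?A \<omega> + 1 / kill z0 * kill (X t \<omega>))"
  proof (rule integral_mono[OF hR_X[OF t0]])
    show "integrable M (\<lambda>\<omega>. e / 4 + indicator ?A \<omega> + 1 / kill z0 * kill (X t \<omega>))"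
      using AM kill_X[OF t0] by (intro Bochner_Integration.integrable_add integrable_mult_right integrable_real_indicator)
        (auto simp: emeasure_eq_measure)
    fix \<omega> assume \<omega>: "\<omega> \<in> space M"
    have h: "hR 1 (X t \<omega>) \<le> h0 (X t \<omega>)" "hR 1 (X t \<omega>) < 1" using hR_bounds[of 1 "X t \<omega>"] by auto
    have kn: "0 \<le> 1 / kill z0 * kill (X t \<omega>)" using kill(1)[of "X t \<omega>"] k0 by simp
    consider "h0 (X t \<omega>) < e / 4" | "R \<le> h0 (X t \<omega>)" | "e / 4 \<le> h0 (X t \<omega>)" "h0 (X t \<omega>) \<le> R" by linarith
    then show "hR 1 (X t \<omega>) \<le> e / 4 + indicator ?A \<omega> + 1 / kill z0 * kill (X t \<omega>)"
    proof cases
      case 1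
      have "0 \<le> (indicator ?A \<omega> :: real)" by simp
      with 1 h(1) kn show ?thesis by linarith
    next
      case 2
      then have "(indicator ?A \<omega> :: real) = 1" using \<omega> by simp
      with h(2) kn e show ?thesis by linarith
    next
      case 3
      have "1 \<le> 1 / kill z0 * kill (X t \<omega>)" using z0[OF r(2)[OF 3]] k0 by simp
      moreover have "0 \<le> (indicator ?A \<omega> :: real)" by simp
      ultimately show ?thesis using h(2) e by linarith
    qed
  qed simp
  also have "\<dots> = e / 4 + prob ?A + 1 / kill z0 * expectation (\<lambda>\<omega>. kill (X t \<omega>))"
    using AM kill_X[OF t0] by (simp add: prob_space emeasure_eq_measure integrable_real_indicator)
  also have "\<dots> < e / 4 + 2 * h0 x / R + e / 4"
  proof -
    have "1 / kill z0 * expectation (\<lambda>\<omega>. kill (X t \<omega>)) < e / 4" using t(2) k0 by (simp add: divide_less_eq)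
    with h0_upper[OF t0 R] show ?thesis by linarith
  qed
  also have "\<dots> < e" using e h0_pos[of x] by (simp add: R_def)
  finally show ?thesis using that t(1) by blast
qed

text \<open>A small expectation at a single time bounds, by the maximal inequality, the probability
  of ever exceeding \<open>\<eta>\<close> afterwards. A sequence of such times suffices, because the
  bad event lies in the intersection of the exceedance events.\<close>

theorem h1_tendsto_0: "AE \<omega> in M. \<forall>\<eta>>0. \<exists>T. \<forall>t\<ge>T. hR 1 (X t \<omega>) \<le> \<eta>"
proof -
  have 1: "AE \<omega> in M. \<exists>T. \<forall>t\<ge>T. hR 1 (X t \<omega>) \<le> \<eta>" if \<eta>: "0 < \<eta>" for \<eta>
  proof -
    have "\<exists>T\<ge>0. expectation (\<lambda>\<omega>. hR 1 (X T \<omega>)) < \<eta> / real (Suc j)" for j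
      using h1_small[of "\<eta> / real (Suc j)" 0] \<eta> by (metis divide_pos_pos of_nat_0_less_iff order_refl zero_less_Suc)
    then obtain T where T: "\<And>j. 0 \<le> T j" "\<And>j. expectation (\<lambda>\<omega>. hR 1 (X (T j) \<omega>)) < \<eta> / real (Suc j)" by metis
    define A where "A j = {\<omega> \<in> space M. \<exists>t\<ge>T j. \<eta> < hR 1 (X t \<omega>)}" for j
    have AM: "A j \<in> sets M" for j unfolding A_def by (rule exceed_sets(1)[OF hR_co T(1)]) simp
    have Ap: "prob (A j) \<le> inverse (real (Suc j))" for j
    proof -
      have "\<eta> * prob (A j) \<le> expectation (\<lambda>\<omega>. hR 1 (X (T j) \<omega>))"
        unfolding A_def
        by (rule maximal_inequality[OF T(1) hR_co _ _ hR_supermartingale \<eta>, where m=1])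
          (use hR_bounds(1,2)[of 1] in \<open>auto intro: less_imp_le\<close>)
      also have "\<dots> \<le> \<eta> * inverse (real (Suc j))" using T(2)[of j] by (simp add: divide_inverse del: of_nat_Suc)
      finally show ?thesis using \<eta> by (simp del: of_nat_Suc)
    qed
    have IM: "(\<Inter>j. A j) \<in> sets M" using AM by auto
    have "prob (\<Inter>j. A j) \<le> inverse (real (Suc j))" for j
      using finite_measure_mono[of "\<Inter>j. A j" "A j"] AM Ap[of j] by (meson INT_lower UNIV_I order_trans)
    then have "prob (\<Inter>j. A j) \<le> 0"
      by (intro LIMSEQ_le_const[OF LIMSEQ_inverse_real_of_nat]) auto
    then have "prob (\<Inter>j. A j) = 0" using measure_nonneg by (metis order_antisym)
    then have "emeasure M (\<Inter>j. A j) = 0" by (simp add: emeasure_eq_measure)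
    then have "(\<Inter>j. A j) \<in> null_sets M" using IM by blast
    from AE_not_in[OF this] AE_space show ?thesis
    proof eventually_elim
      case (elim \<omega>)
      then obtain j where "\<omega> \<notin> A j" by auto
      with elim show ?case unfolding A_def by (auto simp: not_less)
    qed
  qed
  have "AE \<omega> in M. \<forall>j::nat. \<exists>T. \<forall>t\<ge>T. hR 1 (X t \<omega>) \<le> inverse (real (Suc j))"
    by (subst AE_all_countable) (auto intro: 1)
  then show ?thesis
  proof eventually_elim
    case (elim \<omega>)
    show ?case
    proof (intro allI impI)
      fix \<eta> :: real assume "0 < \<eta>"
      then obtain j where "inverse (real (Suc j)) < \<eta>" using reals_Archimedean by blast
      with elim show "\<exists>T. \<forall>t\<ge>T. hR 1 (X t \<omega>) \<le> \<eta>" by (meson less_imp_le order_trans)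
    qed
  qed
qed

lemma v_tendsto_1: "AE \<omega> in M. ((\<lambda>t. v (X t \<omega>)) \<longlongrightarrow> 1) at_top"
  using h1_tendsto_0
proof eventually_elim
  case (elim \<omega>)
  have "((\<lambda>t. v (X t \<omega>) - 1) \<longlongrightarrow> 0) at_top"
  proof (rule tendstoI)
    fix e :: real assume e: "0 < e"
    \<comment> \<open>The value of \<open>u / (1 + u)\<close> at \<open>u = e / 2\<close>;
      monotonicity turns \<open>hR 1 \<le> \<eta>\<close> into
      \<open>h0 \<le> e / 2\<close>.\<close>
    define \<eta> where "\<eta> = (e / 2) / (1 + e / 2)"
    have "0 < \<eta>" using e by (simp add: \<eta>_def)
    then obtain T where T: "\<And>t. T \<le> t \<Longrightarrow> hR 1 (X t \<omega>) \<le> \<eta>" using elim by blast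
    have "dist (v (X t \<omega>) - 1) 0 < e" if "T \<le> t" for t
    proof -
      have "h0 (X t \<omega>) / (1 + h0 (X t \<omega>)) \<le> (e / 2) / (1 + e / 2)" using T[OF that] by (simp add: hR_def \<eta>_def)
      then have "h0 (X t \<omega>) \<le> e / 2" using h0_pos[of "X t \<omega>"] e by (simp add: divide_simps mult_ac) (simp add: algebra_simps)
      with one_minus_v_le[of "X t \<omega>"] v_bounds(2)[of "X t \<omega>"] e show ?thesis by (simp add: dist_real_def)
    qed
    then show "eventually (\<lambda>t. dist (v (X t \<omega>) - 1) 0 < e) at_top"
      unfolding eventually_at_top_linorder by blast
  qed
  then show ?case by (rule LIM_zero_cancel)
qed

lemma v_co: "continuous_on UNIV v"
  unfolding v_def by (intro continuous_intros sc_co)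

text \<open>On a compact set the maximum of \<open>v\<close> is below 1, while \<open>v\<close>
  tends to 1 along the path.\<close>

lemma X_leaves_compacts: "AE \<omega> in M. \<forall>r. \<exists>T\<ge>0. \<forall>t\<ge>T. r < \<bar>X t \<omega>\<bar>"
  using v_tendsto_1
proof eventually_elim
  case (elim \<omega>)
  show ?case
  proof
    fix r :: real
    define r' where "r' = max r 0"
    have "\<exists>z0\<in>{-r'..r'}. \<forall>z\<in>{-r'..r'}. v z \<le> v z0"
      by (rule continuous_attains_sup) (auto simp: r'_def intro: continuous_on_subset[OF v_co])
    then obtain z0 where "\<forall>z\<in>{-r'..r'}. v z \<le> v z0" by blast
    then have z0: "\<And>z. \<bar>z\<bar> \<le> r' \<Longrightarrow> v z \<le> v z0" by (auto simp: abs_le_iff minus_le_iff)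
    have "eventually (\<lambda>t. v z0 < v (X t \<omega>)) at_top" using elim v_bounds(2)[of z0] by (rule order_tendstoD)
    then obtain T where T: "\<And>t. T \<le> t \<Longrightarrow> v z0 < v (X t \<omega>)" by (auto simp: eventually_at_top_linorder)
    have "r < \<bar>X t \<omega>\<bar>" if "max T 0 \<le> t" for t
      using T[of t] z0[of "X t \<omega>"] that by (force simp: r'_def)
    then show "\<exists>T\<ge>0. \<forall>t\<ge>T. r < \<bar>X t \<omega>\<bar>" by (intro exI[of _ "max T 0"]) auto
  qed
qed

end

section \<open>Laplace transforms of occupation functionals\<close>

text \<open>Starting the integral one unit inside the region where \<open>g\<close> vanishes yields
  an antiderivative on the whole line, including the points left of the start, where the set
  integral is 0.\<close>

lemma integral_vanishing_below_deriv:
  fixes g :: "real \<Rightarrow> real"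
  assumes g: "continuous_on UNIV g" and y: "\<And>w. w \<le> y \<Longrightarrow> g w = 0"
  shows "((\<lambda>z. LBINT w:{y - 1..z}. g w) has_real_derivative g z) (at z)"
    "z \<le> y \<Longrightarrow> (LBINT w:{y - 1..z}. g w) = 0"
proof -
  have z0: "(LBINT w:{y - 1..z}. g w) = 0" if "z \<le> y" for z
    unfolding set_lebesgue_integral_def by (rule Bochner_Integration.integral_eq_zero_AE) (use that y in \<open>auto simp: indicator_def\<close>)
  then show "z \<le> y \<Longrightarrow> (LBINT w:{y - 1..z}. g w) = 0" .
  show "((\<lambda>z. LBINT w:{y - 1..z}. g w) has_real_derivative g z) (at z)"
  proof (cases "y - 1 < z")
    case True
    show ?thesis
    proof (rule set_integral_Icc_deriv[where t="z + 1"])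
      show "set_integrable lborel {y - 1..z + 1} g"
        by (intro borel_integrable_atLeastAtMost' continuous_on_subset[OF g]) auto
      show "isCont g z" using g by (simp add: continuous_on_eq_continuous_at)
    qed (use True in auto)
  next
    case False
    have "eventually (\<lambda>w. w \<in> {..<y}) (nhds z)" by (rule eventually_nhds_in_open) (use False in auto)
    then have "eventually (\<lambda>w. (LBINT u:{y - 1..w}. g u) = 0) (nhds z)" by eventually_elim (use z0 in auto)
    moreover have "((\<lambda>_. 0) has_real_derivative 0) (at z)" by simp
    ultimately show ?thesis using y[of z] False DERIV_cong_ev[of z z _ "\<lambda>_. 0" "g z" 0] by simp
  qed
qed

context scaled_diffusion
begin

definition \<psi> where "\<psi> = (kp + km) / 2"
text \<open>A Lipschitz constant of the scale near \<open>y\<close>; it turns the radius of a weight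
  into an error.\<close>

definition Pm where "Pm = (SUP z\<in>{y - 1..y + 1}. p z)"

lemma \<psi>_pos: "0 < \<psi>" using kpm by (simp add: \<psi>_def)

lemma Pm: "z \<in> {y - 1..y + 1} \<Longrightarrow> p z \<le> Pm"
proof -
  assume z: "z \<in> {y - 1..y + 1}"
  have "compact (p ` {y - 1..y + 1})" by (intro compact_continuous_image continuous_on_subset[OF p_co]) auto
  then have "bdd_above (p ` {y - 1..y + 1})" by (intro bounded_imp_bdd_above compact_imp_bounded)
  then show ?thesis unfolding Pm_def using z by (intro cSUP_upper)
qed

lemma Pm_pos: "0 < Pm" using Pm[of y] p_y by simp

text \<open>\<open>1 / (a\<^sup>2 * p)\<close> is half the speed density; with this normalisation,
  and \<open>p y = 1\<close>, the occupation functional of \<open>k\<close> approximates the local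
  time at \<open>y\<close>. The radius only bounds the support, so different weights can share one
  \<open>\<epsilon>\<close>.\<close>

definition weight :: "(real \<Rightarrow> real) \<Rightarrow> real \<Rightarrow> bool" where
  "weight k \<epsilon> \<longleftrightarrow> continuous_on UNIV k \<and> (\<forall>z. 0 \<le> k z) \<and> (\<forall>z. \<epsilon> \<le> \<bar>z - y\<bar> \<longrightarrow> k z = 0) \<and>
     0 < \<epsilon> \<and> \<epsilon> \<le> 1 \<and> (LBINT z:{y - 1..y + 1}. k z / ((a z)\<^sup>2 * p z)) = 1"

lemma weight_average: "weight k1 \<epsilon> \<Longrightarrow> weight k2 \<epsilon> \<Longrightarrow> weight (\<lambda>z. (k1 z + k2 z) / 2) \<epsilon>"
proof -
  assume w: "weight k1 \<epsilon>" "weight k2 \<epsilon>"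
  have i: "set_integrable lborel {y - 1..y + 1} (\<lambda>z. k z / ((a z)\<^sup>2 * p z))" if "weight k \<epsilon>" for k
    using that a_nz p_pos unfolding weight_def
    by (intro borel_integrable_atLeastAtMost' continuous_on_subset[of UNIV _ "{y - 1..y + 1}"] continuous_intros a_co p_co)
      (auto simp: less_imp_neq[symmetric])
  have "(LBINT z:{y - 1..y + 1}. (k1 z + k2 z) / 2 / ((a z)\<^sup>2 * p z)) =
    (LBINT z:{y - 1..y + 1}. 1 / 2 * (k1 z / ((a z)\<^sup>2 * p z)) + 1 / 2 * (k2 z / ((a z)\<^sup>2 * p z)))"
    by (simp add: add_divide_distrib)
  also have "\<dots> = 1 / 2 * (LBINT z:{y - 1..y + 1}. k1 z / ((a z)\<^sup>2 * p z)) + 1 / 2 * (LBINT z:{y - 1..y + 1}. k2 z / ((a z)\<^sup>2 * p z))"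
    by (subst set_integral_add(2)[OF set_integrable_mult_right[OF i[OF w(1)]] set_integrable_mult_right[OF i[OF w(2)]]])
      (simp only: set_integral_mult_right)
  also have "\<dots> = 1" using w by (simp add: weight_def)
  finally show ?thesis using w unfolding weight_def by (auto intro!: continuous_intros add_nonneg_nonneg)
qed

text \<open>\<open>J\<close> is the distribution function of \<open>k / (a\<^sup>2 * p)\<close>,
  rising from 0 to 1 across the support. The function with derivative
  \<open>p * (2 * \<psi> * J - km)\<close> solves the equation, and its slope in the scale is
  \<open>- km\<close> to the left of the support and \<open>kp\<close> to the right: it is
  \<open>v\<close> with the kink smoothed out. The slopes differ only within distance
  \<open>\<epsilon>\<close> of \<open>y\<close>, hence the functions by a multiple of
  \<open>\<epsilon>\<close>.\<close>

lemma corrector: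
  assumes w: "weight k \<epsilon>"
  obtains V V1 V2 where "\<And>z. (V has_real_derivative V1 z) (at z)" "\<And>z. (V1 has_real_derivative V2 z) (at z)"
    "continuous_on UNIV V2" "\<And>z. V1 z * b z + (a z)\<^sup>2 * V2 z / 2 = \<psi> * k z"
    "\<And>z. \<bar>V z - v z\<bar> \<le> 2 * \<psi> * Pm * \<epsilon>" "\<And>z. \<bar>z - y\<bar> \<le> \<epsilon> \<Longrightarrow> \<bar>V z\<bar> \<le> 4 * \<psi> * Pm * \<epsilon>"
proof -
  have k: "continuous_on UNIV k" "\<And>z. 0 \<le> k z" "\<And>z. \<epsilon> \<le> \<bar>z - y\<bar> \<Longrightarrow> k z = 0" "0 < \<epsilon>" "\<epsilon> \<le> 1"
    and k1: "(LBINT z:{y - 1..y + 1}. k z / ((a z)\<^sup>2 * p z)) = 1"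
    using w by (auto simp: weight_def)
  define q where "q z = k z / ((a z)\<^sup>2 * p z)" for z
  have qc: "continuous_on UNIV q" unfolding q_def using a_nz p_pos
    by (intro continuous_intros k a_co p_co) (auto simp: less_imp_neq[symmetric])
  have q0: "0 \<le> q z" for z using k(2)[of z] p_pos[of z] by (simp add: q_def)
  have qz: "q z = 0" if "\<epsilon> \<le> \<bar>z - y\<bar>" for z using k(3)[OF that] by (simp add: q_def)
  define J where "J z = (LBINT w:{y - \<epsilon> - 1..z}. q w)" for z
  have Jd: "(J has_real_derivative q z) (at z)" for z
    unfolding J_def by (rule integral_vanishing_below_deriv(1)[OF qc]) (rule qz, simp)
  have J0: "J z = 0" if "z \<le> y - \<epsilon>" for z
    unfolding J_def by (rule integral_vanishing_below_deriv(2)[OF qc]) (use that qz in auto)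
  have Jc: "continuous_on UNIV J" using Jd by (auto intro!: continuous_at_imp_continuous_on DERIV_isCont)
  have qi: "set_integrable lborel {r..t} q" for r t
    by (intro borel_integrable_atLeastAtMost' continuous_on_subset[OF qc]) auto
  have J1: "J z = 1" if z: "y + \<epsilon> \<le> z" for z
  proof -
    have z0: "(LBINT w:{r..t}. q w) = 0" if "\<And>w. w \<in> {r..t} \<Longrightarrow> \<epsilon> \<le> \<bar>w - y\<bar>" for r t
      unfolding set_lebesgue_integral_def by (rule Bochner_Integration.integral_eq_zero_AE) (use that qz in \<open>auto simp: indicator_def\<close>)
    have "J z = J (y + \<epsilon>)"
      unfolding J_def using set_integral_Icc_split[OF _ z qi, of "y - \<epsilon> - 1"] z0[of "y + \<epsilon>" z] k(4) by simp
    also have "J (y + \<epsilon>) = (LBINT w:{y - \<epsilon>..y + \<epsilon>}. q w)"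
      unfolding J_def using set_integral_Icc_split[of "y - \<epsilon> - 1" "y - \<epsilon>" "y + \<epsilon>" q, OF _ _ qi] z0[of "y - \<epsilon> - 1" "y - \<epsilon>"] k(4) by simp
    also have "\<dots> = (LBINT w:{y - 1..y + 1}. q w)"
      using set_integral_Icc_split[of "y - 1" "y - \<epsilon>" "y + 1" q, OF _ _ qi] set_integral_Icc_split[of "y - \<epsilon>" "y + \<epsilon>" "y + 1" q, OF _ _ qi]
        z0[of "y - 1" "y - \<epsilon>"] z0[of "y + \<epsilon>" "y + 1"] k(4,5) by simp
    finally show ?thesis using k1 by (simp add: q_def)
  qed
  have Jmono: "J z \<le> J z'" if "z \<le> z'" for z z'
    by (rule DERIV_nonneg_imp_nondecreasing[OF that]) (use Jd q0 in blast)
  have J01: "0 \<le> J z" "J z \<le> 1" for z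
    using Jmono[of "min z (y - \<epsilon>)" z] J0[of "min z (y - \<epsilon>)"] Jmono[of z "max z (y + \<epsilon>)"] J1[of "max z (y + \<epsilon>)"] by auto
  define u where "u z = 2 * \<psi> * (p z * J z)" for z
  have uc: "continuous_on UNIV u" unfolding u_def by (intro continuous_intros p_co Jc)
  define U where "U z = (LBINT w:{y - \<epsilon> - 1..z}. u w)" for z
  have Ud: "(U has_real_derivative u z) (at z)" for z
    unfolding U_def by (rule integral_vanishing_below_deriv(1)[OF uc]) (simp add: u_def J0)
  \<comment> \<open>Subtracting \<open>U y\<close> gives \<open>V y = 0 = v y\<close>, so that the
    distance to \<open>v\<close> can be estimated starting from \<open>y\<close>.\<close>
  define V where "V z = U z - U y - km * sc z" for z
  define V1 where "V1 z = p z * (2 * \<psi> * J z - km)" for z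
  define V2 where "V2 z = - 2 * b z / (a z)\<^sup>2 * p z * (2 * \<psi> * J z - km) + p z * (2 * \<psi> * q z)" for z
  have Vd: "(V has_real_derivative V1 z) (at z)" for z
    unfolding V_def V1_def by (auto intro!: derivative_eq_intros Ud sc_deriv simp: u_def algebra_simps)
  have V1d: "(V1 has_real_derivative V2 z) (at z)" for z
  proof -
    have "((\<lambda>z. 2 * \<psi> * J z - km) has_real_derivative 2 * \<psi> * q z) (at z)" by (auto intro!: derivative_eq_intros Jd)
    from DERIV_mult[OF p_deriv this] show ?thesis unfolding V1_def[abs_def] V2_def by (rule DERIV_cong) simp
  qed
  have V2c: "continuous_on UNIV V2" unfolding V2_def using a_nz by (intro continuous_intros b_co a_co p_co Jc qc) auto
  have gen: "V1 z * b z + (a z)\<^sup>2 * V2 z / 2 = \<psi> * k z" for z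
  proof -
    have "(a z)\<^sup>2 * (p z * q z) = k z" using a_nz[of z] p_pos[of z] by (simp add: q_def)
    moreover have "(a z)\<^sup>2 * (b z / (a z)\<^sup>2) = b z" using a_nz[of z] by simp
    moreover have "(a z)\<^sup>2 * V2 z / 2 = - ((a z)\<^sup>2 * (b z / (a z)\<^sup>2)) * (p z * (2 * \<psi> * J z - km)) + \<psi> * ((a z)\<^sup>2 * (p z * q z))"
      by (simp add: V2_def algebra_simps add_divide_distrib diff_divide_distrib)
    ultimately show ?thesis by (simp add: V1_def algebra_simps)
  qed
  have scd: "sc z - sc y = sc z" for z by (simp add: sc_y)
  have psi2: "2 * \<psi> = kp + km" by (simp add: \<psi>_def)
  have sc_sign: "y \<le> z \<Longrightarrow> 0 \<le> sc z" "z \<le> y \<Longrightarrow> sc z \<le> 0" for z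
    using DERIV_nonneg_imp_nondecreasing[of y z sc] DERIV_nonneg_imp_nondecreasing[of z y sc] sc_deriv p_pos sc_y
    by (metis less_imp_le)+
  have lip: "\<bar>g z\<bar> \<le> 2 * \<psi> * Pm * \<epsilon>"
    if g: "\<And>z. (g has_real_derivative g1 z) (at z)" "g y = 0" "\<And>z. \<bar>g1 z\<bar> \<le> 2 * \<psi> * p z" and z: "\<bar>z - y\<bar> \<le> \<epsilon>" for g g1 z
  proof -
    have "\<bar>g z - g y\<bar> \<le> (2 * \<psi> * Pm) * \<bar>z - y\<bar>"
    proof -
      have "norm (g z - g y) \<le> (2 * \<psi> * Pm) * norm (z - y)"
      proof (rule field_differentiable_bound[of "{y - 1..y + 1}" g g1])
        show "(g has_field_derivative g1 w) (at w within {y - 1..y + 1})" for w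
          by (rule has_field_derivative_at_within[OF g(1)])
        show "norm (g1 w) \<le> 2 * \<psi> * Pm" if "w \<in> {y - 1..y + 1}" for w
        proof -
          have "2 * \<psi> * p w \<le> 2 * \<psi> * Pm" using Pm[OF that] \<psi>_pos by (intro mult_left_mono) auto
          with g(3)[of w] show ?thesis by simp
        qed
      qed (use z k in auto)
      then show ?thesis by simp
    qed
    also have "\<dots> \<le> (2 * \<psi> * Pm) * \<epsilon>" using z \<psi>_pos Pm_pos by (intro mult_left_mono) auto
    finally show ?thesis using g(2) by simp
  qed
  have near: "\<bar>V z - v z\<bar> \<le> 2 * \<psi> * Pm * \<epsilon>" for z
  proof (cases "y \<le> z")
    case True
    \<comment> \<open>To the right of \<open>y\<close> the difference to \<open>v\<close> has
      derivative \<open>2 * \<psi> * p * (J - 1)\<close>, which vanishes beyond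
      \<open>y + \<epsilon>\<close>; there the difference is constant.\<close>
    define g where "g z = V z - kp * sc z" for z
    define g1 where "g1 z = 2 * \<psi> * p z * (J z - 1)" for z
    have gd: "(g has_real_derivative g1 z) (at z)" for z
      unfolding g_def g1_def by (rule DERIV_cong[OF DERIV_diff[OF Vd DERIV_cmult[OF sc_deriv]]])
        (use psi2 in \<open>simp add: V1_def algebra_simps\<close>)
    have gy: "g y = 0" by (simp add: g_def V_def sc_y)
    have gb: "\<bar>g1 z\<bar> \<le> 2 * \<psi> * p z" for z
    proof -
      have "\<bar>2 * \<psi> * p z\<bar> * \<bar>J z - 1\<bar> \<le> (2 * \<psi> * p z) * 1" using J01[of z] \<psi>_pos p_pos[of z] by (intro mult_mono) auto
      then show ?thesis by (simp add: g1_def abs_mult)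
    qed
    have "\<bar>g z\<bar> \<le> 2 * \<psi> * Pm * \<epsilon>"
    proof (cases "z \<le> y + \<epsilon>")
      case True
      with \<open>y \<le> z\<close> show ?thesis by (intro lip[OF gd gy gb]) auto
    next
      case False
      have "g z = g (y + \<epsilon>)"
      proof (rule DERIV_isconst_end[of _ _ g])
        show "continuous_on {y + \<epsilon>..z} g" using gd by (auto intro!: continuous_at_imp_continuous_on DERIV_isCont)
        show "(g has_real_derivative 0) (at w)" if "y + \<epsilon> < w" "w < z" for w
          using gd[of w] J1[of w] that by (simp add: g1_def)
      qed (use False in auto)
      with lip[OF gd gy gb, of "y + \<epsilon>"] k(4) show ?thesis by simp
    qed
    then show ?thesis using v_eq(1)[OF sc_sign(1)[OF True]] by (simp add: g_def)
  next
    case False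
    define g where "g z = V z + km * sc z" for z
    define g1 where "g1 z = 2 * \<psi> * p z * J z" for z
    have gd: "(g has_real_derivative g1 z) (at z)" for z
      unfolding g_def g1_def by (rule DERIV_cong[OF DERIV_add[OF Vd DERIV_cmult[OF sc_deriv]]])
        (simp add: V1_def algebra_simps)
    have gy: "g y = 0" by (simp add: g_def V_def sc_y)
    have gb: "\<bar>g1 z\<bar> \<le> 2 * \<psi> * p z" for z
    proof -
      have "\<bar>2 * \<psi> * p z\<bar> * \<bar>J z\<bar> \<le> (2 * \<psi> * p z) * 1" using J01[of z] \<psi>_pos p_pos[of z] by (intro mult_mono) auto
      then show ?thesis by (simp add: g1_def abs_mult)
    qed
    have "\<bar>g z\<bar> \<le> 2 * \<psi> * Pm * \<epsilon>"
    proof (cases "y - \<epsilon> \<le> z")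
      case True
      with \<open>\<not> y \<le> z\<close> show ?thesis by (intro lip[OF gd gy gb]) auto
    next
      case False
      have "g (y - \<epsilon>) = g z"
      proof (rule DERIV_isconst_end[of _ _ g])
        show "continuous_on {z..y - \<epsilon>} g" using gd by (auto intro!: continuous_at_imp_continuous_on DERIV_isCont)
        show "(g has_real_derivative 0) (at w)" if "z < w" "w < y - \<epsilon>" for w
          using gd[of w] J0[of w] that by (simp add: g1_def)
      qed (use False in auto)
      with lip[OF gd gy gb, of "y - \<epsilon>"] k(4) show ?thesis by simp
    qed
    then show ?thesis using v_eq(2)[OF sc_sign(2)[of z]] False by (simp add: g_def)
  qed
  have vb: "\<bar>v z\<bar> \<le> 2 * \<psi> * Pm * \<epsilon>" if z: "\<bar>z - y\<bar> \<le> \<epsilon>" for z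
  proof -
    have "\<bar>2 * \<psi> * sc z\<bar> \<le> 2 * \<psi> * Pm * \<epsilon>"
      by (rule lip[OF DERIV_cmult[OF sc_deriv] _ _ z]) (use sc_y \<psi>_pos less_imp_le[OF p_pos] in \<open>auto simp: abs_mult\<close>)
    moreover have "\<bar>v z\<bar> \<le> \<bar>2 * \<psi> * sc z\<bar>"
    proof (cases "0 \<le> sc z")
      case True
      have "kp * sc z \<le> 2 * \<psi> * sc z" using True kpm psi2 by (intro mult_right_mono) auto
      with True v_eq(1)[OF True] kpm \<psi>_pos show ?thesis by simp
    next
      case False
      have "km * - sc z \<le> 2 * \<psi> * - sc z" using False kpm psi2 by (intro mult_right_mono) auto
      with False v_eq(2)[of z] v_bounds(1)[of z] \<psi>_pos kpm show ?thesis by (simp add: abs_mult)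
    qed
    ultimately show ?thesis by linarith
  qed
  have Vb: "\<bar>V z\<bar> \<le> 4 * \<psi> * Pm * \<epsilon>" if "\<bar>z - y\<bar> \<le> \<epsilon>" for z
    using near[of z] vb[OF that] by linarith
  show ?thesis by (rule that[OF Vd V1d V2c gen near Vb])
qed

lemma lv_bounds: "0 \<le> l \<Longrightarrow> 0 \<le> l / \<psi> * v z" "0 \<le> l \<Longrightarrow> l / \<psi> * v z \<le> l / \<psi> * 1"
proof -
  assume l: "0 \<le> l"
  show "0 \<le> l / \<psi> * v z" using v_bounds[of z] l \<psi>_pos by (intro mult_nonneg_nonneg) auto
  show "l / \<psi> * v z \<le> l / \<psi> * 1" using v_bounds[of z] l \<psi>_pos by (intro mult_left_mono) auto
qed

text \<open>With \<open>f = 1 + l / \<psi> * V\<close> the generator minus the killing is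
  \<open>- l * k * (l / \<psi> * V)\<close>, in absolute value at most
  \<open>C = 4 * l * Pm * \<epsilon>\<close> times the rate \<open>l * k\<close>.
  \<open>Feynman_Kac_le\<close> is applied to \<open>f\<close> and to \<open>- f\<close>, and
  \<open>discount_int_bound\<close> makes the error at most \<open>C\<close> for all
  \<open>t\<close>. Replacing \<open>V\<close> by \<open>v\<close> at time \<open>t\<close> and at
  \<open>x\<close> costs \<open>2 * l * Pm * \<epsilon>\<close> each, which adds up to the factor
  8.\<close>

lemma laplace_finite_time:
  assumes w: "weight k \<epsilon>" and l: "0 \<le> l" and t: "0 \<le> t"
  shows "\<bar>expectation (\<lambda>\<omega>. (1 + l / \<psi> * v (X t \<omega>)) * discount (\<lambda>z. l * k z) 0 t \<omega>) - (1 + l / \<psi> * v x)\<bar> \<le> 8 * l * Pm * \<epsilon>"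
proof -
  have k: "continuous_on UNIV k" "\<And>z. 0 \<le> k z" "\<And>z. \<epsilon> \<le> \<bar>z - y\<bar> \<Longrightarrow> k z = 0" "0 < \<epsilon>" "\<epsilon> \<le> 1"
    using w by (auto simp: weight_def)
  obtain V V1 V2 where V: "\<And>z. (V has_real_derivative V1 z) (at z)" "\<And>z. (V1 has_real_derivative V2 z) (at z)"
    "continuous_on UNIV V2" "\<And>z. V1 z * b z + (a z)\<^sup>2 * V2 z / 2 = \<psi> * k z"
    "\<And>z. \<bar>V z - v z\<bar> \<le> 2 * \<psi> * Pm * \<epsilon>" "\<And>z. \<bar>z - y\<bar> \<le> \<epsilon> \<Longrightarrow> \<bar>V z\<bar> \<le> 4 * \<psi> * Pm * \<epsilon>"
    using corrector[OF w] by metis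
  have Vc: "continuous_on UNIV V" using V(1) by (auto intro!: continuous_at_imp_continuous_on DERIV_isCont)
  let ?c = "\<lambda>z. l * k z"
  have cc: "continuous_on UNIV ?c" by (intro continuous_intros k)
  have c0: "0 \<le> ?c z" for z using k(2) l by simp
  obtain mk where mk: "0 \<le> mk" "\<And>z. z \<in> {y - 1..y + 1} \<Longrightarrow> \<bar>k z\<bar> \<le> mk" using continuous_Icc_bound[OF k(1)] by metis
  have mk': "k z \<le> mk" for z
  proof (cases "z \<in> {y - 1..y + 1}")
    case False
    then have "k z = 0" using k(5) by (intro k(3)) auto
    then show ?thesis using mk(1) by simp
  qed (use mk(2)[of z] in auto)
  define f where "f z = 1 + l / \<psi> * V z" for z
  have fb: "\<bar>f z - (1 + l / \<psi> * v z)\<bar> \<le> 2 * l * Pm * \<epsilon>" for z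
  proof -
    have "f z - (1 + l / \<psi> * v z) = l / \<psi> * (V z - v z)" by (simp add: f_def right_diff_distrib)
    then have "\<bar>f z - (1 + l / \<psi> * v z)\<bar> = l / \<psi> * \<bar>V z - v z\<bar>"
      using l \<psi>_pos by (simp add: abs_mult)
    also have "\<dots> \<le> l / \<psi> * (2 * \<psi> * Pm * \<epsilon>)" using V(5) l \<psi>_pos by (intro mult_left_mono) auto
    finally show ?thesis using \<psi>_pos by simp
  qed
  have fm: "\<bar>f z\<bar> \<le> 1 + l / \<psi> + 2 * l * Pm * \<epsilon>" for z
  proof -
    have "0 \<le> l / \<psi> * v z" "l / \<psi> * v z \<le> l / \<psi> * 1"
      by (rule lv_bounds[OF l])+
    moreover have "\<bar>F\<bar> \<le> 1 + L + B" if "0 \<le> w" "w \<le> L * 1" "\<bar>F - (1 + w)\<bar> \<le> B" for F w L B :: real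
      using that by linarith
    ultimately show ?thesis using fb[of z] by blast
  qed
  have fd: "(f has_real_derivative l / \<psi> * V1 z) (at z)" "((\<lambda>z. l / \<psi> * V1 z) has_real_derivative l / \<psi> * V2 z) (at z)" for z
    unfolding f_def using \<psi>_pos by (auto intro!: derivative_eq_intros V(1,2))
  have f2c: "continuous_on UNIV (\<lambda>z. l / \<psi> * V2 z)" by (intro continuous_intros V)
  have fc: "continuous_on UNIV f" unfolding f_def by (intro continuous_intros Vc)
  define C where "C = 4 * l * Pm * \<epsilon>"
  have C0: "0 \<le> C" using l Pm_pos k(4) by (simp add: C_def)
  let ?e = "\<lambda>z. C * ?c z"
  have ec: "continuous_on UNIV ?e" by (intro continuous_intros k)
  have eb: "\<bar>?e z\<bar> \<le> C * (l * mk)" for z using mk'[of z] k(2)[of z] l C0 by (auto intro!: mult_left_mono)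
  have gen: "\<bar>l / \<psi> * V1 z * b z + (a z)\<^sup>2 * (l / \<psi> * V2 z) / 2 - ?c z * f z\<bar> \<le> ?e z" for z
  proof -
    have "l / \<psi> * V1 z * b z + (a z)\<^sup>2 * (l / \<psi> * V2 z) / 2 = l / \<psi> * (V1 z * b z + (a z)\<^sup>2 * V2 z / 2)" by (simp add: algebra_simps)
    also have "\<dots> = l * k z" using V(4)[of z] \<psi>_pos by simp
    finally have eq: "l / \<psi> * V1 z * b z + (a z)\<^sup>2 * (l / \<psi> * V2 z) / 2 - ?c z * f z = - (l * k z) * (l / \<psi> * V z)"
      by (simp add: f_def algebra_simps)
    show ?thesis
    proof (cases "\<bar>z - y\<bar> \<le> \<epsilon>")
      case True
      have "\<bar>l / \<psi> * V z\<bar> \<le> l / \<psi> * (4 * \<psi> * Pm * \<epsilon>)" unfolding abs_mult using V(6)[OF True] l \<psi>_pos by (intro mult_mono) auto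
      also have "\<dots> = C" using \<psi>_pos by (simp add: C_def)
      finally have "\<bar>l / \<psi> * V z\<bar> \<le> C" .
      then have "(l * k z) * \<bar>l / \<psi> * V z\<bar> \<le> (l * k z) * C" using c0 by (intro mult_left_mono) auto
      then show ?thesis unfolding eq using k(2)[of z] l by (simp add: abs_mult mult_ac)
    next
      case False
      then show ?thesis unfolding eq using k(3)[of z] by simp
    qed
  qed
  let ?d = "discount ?c 0"
  have Ie: "expectation (\<lambda>\<omega>. 1 * (LBINT u:{0..t}. ?d u \<omega> * ?e (X u \<omega>))) \<le> C"
  proof -
    have Ib: "\<bar>LBINT u:{0..t}. ?d u \<omega> * ?e (X u \<omega>)\<bar> \<le> C" for \<omega>
      by (rule discount_int_bound[OF cc c0 ec t _ C0]) (use C0 k(2) l in \<open>simp add: abs_mult\<close>)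
    then have "(LBINT u:{0..t}. ?d u \<omega> * ?e (X u \<omega>)) \<le> C" for \<omega> by (simp add: abs_le_iff)
    moreover have "integrable M (\<lambda>\<omega>. LBINT u:{0..t}. ?d u \<omega> * ?e (X u \<omega>))"
      by (rule bounded_integrable[OF F_M[OF discount_int_adapted[OF cc ec order_refl t]] Ib])
    ultimately show ?thesis using integral_mono[of M "\<lambda>\<omega>. LBINT u:{0..t}. ?d u \<omega> * ?e (X u \<omega>)" "\<lambda>_. C"] by (simp add: prob_space)
  qed
  have fX0: "expectation (\<lambda>\<omega>. g (X 0 \<omega>)) = g x" if "continuous_on UNIV g" for g :: "real \<Rightarrow> real"
  proof -
    have "expectation (\<lambda>\<omega>. g (X 0 \<omega>)) = expectation (\<lambda>\<omega>. g x)"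
    proof (rule integral_cong_AE)
      show "AE \<omega> in M. g (X 0 \<omega>) = g x" using X0 by eventually_elim simp
    qed (use F_M[OF comp_X_ad[OF that order_refl]] in auto)
    then show ?thesis by (simp add: prob_space)
  qed
  have up: "expectation (\<lambda>\<omega>. 1 * (f (X t \<omega>) * ?d t \<omega>)) \<le> expectation (\<lambda>\<omega>. 1 * f (X 0 \<omega>)) + expectation (\<lambda>\<omega>. 1 * (LBINT u:{0..t}. ?d u \<omega> * ?e (X u \<omega>)))"
    by (rule Feynman_Kac_le[OF order_refl t fd f2c fm cc c0 ec eb _ _ _ _, where mZ=1]) (use gen in \<open>auto simp: abs_le_iff\<close>)
  have lo: "expectation (\<lambda>\<omega>. 1 * (- f (X t \<omega>) * ?d t \<omega>)) \<le> expectation (\<lambda>\<omega>. 1 * - f (X 0 \<omega>)) + expectation (\<lambda>\<omega>. 1 * (LBINT u:{0..t}. ?d u \<omega> * ?e (X u \<omega>)))"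
  proof (rule Feynman_Kac_le[OF order_refl t DERIV_minus[OF fd(1)] DERIV_minus[OF fd(2)] _ _ cc c0 ec eb, where mZ=1])
    show "\<bar>- f z\<bar> \<le> 1 + l / \<psi> + 2 * l * Pm * \<epsilon>" for z using fm[of z] by simp
    show "- (l / \<psi> * V1 z) * b z + (a z)\<^sup>2 * - (l / \<psi> * V2 z) / 2 - ?c z * - f z \<le> ?e z" for z
      using gen[of z] by (simp add: abs_le_iff algebra_simps)
    show "continuous_on UNIV (\<lambda>z. - (l / \<psi> * V2 z))" by (intro continuous_intros V)
  qed auto
  have 1: "\<bar>expectation (\<lambda>\<omega>. f (X t \<omega>) * ?d t \<omega>) - f x\<bar> \<le> C"
    using up lo Ie fX0[OF fc] by simp
  have d01: "0 < ?d t \<omega>" "?d t \<omega> \<le> 1" for \<omega> using discount_bounds[of ?c 0 t \<omega>, OF c0] by auto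
  have dM[measurable]: "?d t \<in> borel_measurable M" by (rule F_M[OF discount_adapted[OF cc order_refl t]])
  have vM[measurable]: "(\<lambda>\<omega>. v (X t \<omega>)) \<in> borel_measurable M" "(\<lambda>\<omega>. f (X t \<omega>)) \<in> borel_measurable M"
    using F_M[OF comp_X_ad[OF v_co t]] F_M[OF comp_X_ad[OF fc t]] by auto
  have i1: "integrable M (\<lambda>\<omega>. f (X t \<omega>) * ?d t \<omega>)"
  proof (rule bounded_integrable[where m="(1 + l / \<psi> + 2 * l * Pm * \<epsilon>) * 1"])
    show "\<bar>f (X t \<omega>) * ?d t \<omega>\<bar> \<le> (1 + l / \<psi> + 2 * l * Pm * \<epsilon>) * 1" for \<omega>
      unfolding abs_mult using fm[of "X t \<omega>"] d01[of \<omega>] order_trans[OF abs_ge_zero fm[of "X t \<omega>"]] by (intro mult_mono) auto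
  qed measurable
  have i2: "integrable M (\<lambda>\<omega>. (1 + l / \<psi> * v (X t \<omega>)) * ?d t \<omega>)"
  proof (rule bounded_integrable[where m="(1 + l / \<psi>) * 1"])
    show "\<bar>(1 + l / \<psi> * v (X t \<omega>)) * ?d t \<omega>\<bar> \<le> (1 + l / \<psi>) * 1" for \<omega>
    proof -
      have "0 \<le> l / \<psi> * v (X t \<omega>)" "l / \<psi> * v (X t \<omega>) \<le> l / \<psi> * 1"
        by (rule lv_bounds[OF l])+
      then show ?thesis unfolding abs_mult using d01[of \<omega>] by (intro mult_mono) auto
    qed
  qed measurable
  have "\<bar>expectation (\<lambda>\<omega>. f (X t \<omega>) * ?d t \<omega>) - expectation (\<lambda>\<omega>. (1 + l / \<psi> * v (X t \<omega>)) * ?d t \<omega>)\<bar> \<le> 2 * l * Pm * \<epsilon>"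
  proof -
    have "\<bar>expectation (\<lambda>\<omega>. f (X t \<omega>) * ?d t \<omega> - (1 + l / \<psi> * v (X t \<omega>)) * ?d t \<omega>)\<bar> \<le> expectation (\<lambda>\<omega>. \<bar>f (X t \<omega>) * ?d t \<omega> - (1 + l / \<psi> * v (X t \<omega>)) * ?d t \<omega>\<bar>)"
      by (rule integral_abs_bound)
    also have "\<dots> \<le> expectation (\<lambda>\<omega>. 2 * l * Pm * \<epsilon>)"
    proof (rule integral_mono)
      fix \<omega>
      have "\<bar>f (X t \<omega>) - (1 + l / \<psi> * v (X t \<omega>))\<bar> * \<bar>?d t \<omega>\<bar> \<le> (2 * l * Pm * \<epsilon>) * 1"
        using fb[of "X t \<omega>"] d01[of \<omega>] order_trans[OF abs_ge_zero fb[of "X t \<omega>"]] by (intro mult_mono) auto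
      then show "\<bar>f (X t \<omega>) * ?d t \<omega> - (1 + l / \<psi> * v (X t \<omega>)) * ?d t \<omega>\<bar> \<le> 2 * l * Pm * \<epsilon>"
        by (simp add: abs_mult[symmetric] left_diff_distrib)
    qed (use i1 i2 in auto)
    finally show ?thesis using i1 i2 by (simp add: prob_space)
  qed
  moreover have "\<bar>ev - cx\<bar> \<le> 8 * l * Pm * \<epsilon>"
    if "\<bar>ef - fx\<bar> \<le> 4 * l * Pm * \<epsilon>" "\<bar>fx - cx\<bar> \<le> 2 * l * Pm * \<epsilon>" "\<bar>ef - ev\<bar> \<le> 2 * l * Pm * \<epsilon>" for ef fx ev cx :: real
    using that unfolding mult.assoc by linarith
  ultimately show ?thesis using 1 fb[of x] unfolding C_def by blast
qed

text \<open>The limit runs over integers to be measurable; for a weight the integral is almost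
  surely eventually constant, as \<open>X\<close> leaves the support.\<close>

definition occ :: "(real \<Rightarrow> real) \<Rightarrow> 'w \<Rightarrow> real" where
  "occ k \<omega> = lim (\<lambda>j. LBINT u:{0..real j}. k (X u \<omega>))"

lemma occ_measurable: "continuous_on UNIV k \<Longrightarrow> occ k \<in> borel_measurable M"
  unfolding occ_def
  by (intro borel_measurable_lim_metric F_M[OF prog_set_integral[OF prog_X order_refl order_refl]]) auto

lemma int_X_constant:
  fixes k :: "real \<Rightarrow> real"
  assumes k: "continuous_on UNIV k" and z: "\<And>u. T \<le> u \<Longrightarrow> k (X u \<omega>) = 0" and T: "0 \<le> T" "T \<le> t"
  shows "(LBINT u:{0..t}. k (X u \<omega>)) = (LBINT u:{0..T}. k (X u \<omega>))"
proof -
  have "(LBINT u:{T..t}. k (X u \<omega>)) = 0"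
    unfolding set_lebesgue_integral_def by (rule Bochner_Integration.integral_eq_zero_AE) (use z in \<open>auto simp: indicator_def\<close>)
  then show ?thesis using set_integral_Icc_split[OF T int_X[OF k]] by simp
qed

lemma occ_eq:
  fixes k :: "real \<Rightarrow> real"
  assumes k: "continuous_on UNIV k" and z: "\<And>u. T \<le> u \<Longrightarrow> k (X u \<omega>) = 0" and T: "0 \<le> T" "T \<le> t"
  shows "occ k \<omega> = (LBINT u:{0..t}. k (X u \<omega>))"
proof -
  have "eventually (\<lambda>j. (LBINT u:{0..real j}. k (X u \<omega>)) = (LBINT u:{0..t}. k (X u \<omega>))) sequentially"
    using filterlim_real_sequentially[unfolded filterlim_at_top, rule_format, of T]
  proof eventually_elim
    case (elim j)
    show ?case using int_X_constant[OF k z T(1) elim] int_X_constant[OF assms] by simp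
  qed
  then have "(\<lambda>j. LBINT u:{0..real j}. k (X u \<omega>)) \<longlonglongrightarrow> (LBINT u:{0..t}. k (X u \<omega>))"
    by (rule tendsto_eventually)
  then show ?thesis unfolding occ_def by (rule limI)
qed

lemma weight_vanishes: "weight k \<epsilon> \<Longrightarrow> \<bar>y\<bar> + 1 < \<bar>z\<bar> \<Longrightarrow> k z = 0"
proof -
  assume w: "weight k \<epsilon>" and z: "\<bar>y\<bar> + 1 < \<bar>z\<bar>"
  have "\<epsilon> \<le> \<bar>z - y\<bar>" using w z by (auto simp: weight_def)
  with w show ?thesis by (simp add: weight_def)
qed

lemma occ_limit:
  assumes w: "weight k \<epsilon>"
  shows "AE \<omega> in M. (\<lambda>j. discount (\<lambda>z. l * k z) 0 (real j) \<omega>) \<longlonglongrightarrow> exp (- l * occ k \<omega>)"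
  using X_leaves_compacts
proof eventually_elim
  case (elim \<omega>)
  have k: "continuous_on UNIV k" using w by (simp add: weight_def)
  obtain T where T: "0 \<le> T" "\<And>t. T \<le> t \<Longrightarrow> \<bar>y\<bar> + 1 < \<bar>X t \<omega>\<bar>" using elim by blast
  have z: "k (X u \<omega>) = 0" if "T \<le> u" for u by (rule weight_vanishes[OF w T(2)[OF that]])
  have "eventually (\<lambda>j. discount (\<lambda>z. l * k z) 0 (real j) \<omega> = exp (- l * occ k \<omega>)) sequentially"
    using filterlim_real_sequentially[unfolded filterlim_at_top, rule_format, of T]
  proof eventually_elim
    case (elim j)
    show ?case using occ_eq[OF k z T(1) elim] by (simp add: discount_def)
  qed
  then show ?case by (rule tendsto_eventually)
qed

lemma occ_nonneg:
  assumes w: "weight k \<epsilon>" shows "AE \<omega> in M. 0 \<le> occ k \<omega>"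
  using X_leaves_compacts
proof eventually_elim
  case (elim \<omega>)
  have k: "continuous_on UNIV k" "\<And>z. 0 \<le> k z" using w by (auto simp: weight_def)
  obtain T where T: "0 \<le> T" "\<And>t. T \<le> t \<Longrightarrow> \<bar>y\<bar> + 1 < \<bar>X t \<omega>\<bar>" using elim by blast
  have z: "k (X u \<omega>) = 0" if "T \<le> u" for u by (rule weight_vanishes[OF w T(2)[OF that]])
  have "occ k \<omega> = (LBINT u:{0..T}. k (X u \<omega>))" by (rule occ_eq[OF k(1) z T(1) order_refl])
  also have "0 \<le> \<dots>" unfolding set_lebesgue_integral_def using k(2) by (intro integral_nonneg_AE) auto
  finally show ?case .
qed

text \<open>As \<open>t\<close> grows, \<open>v (X t)\<close> tends to 1 and the factor in front of
  the discount to \<open>1 + l / \<psi>\<close>; the error bound does not depend on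
  \<open>t\<close>.\<close>

lemma laplace_occ:
  assumes w: "weight k \<epsilon>" and l: "0 \<le> l"
  shows "\<bar>(1 + l / \<psi>) * expectation (\<lambda>\<omega>. exp (- l * occ k \<omega>)) - (1 + l / \<psi> * v x)\<bar> \<le> 8 * l * Pm * \<epsilon>"
proof -
  have k: "continuous_on UNIV k" "\<And>z. 0 \<le> k z" using w by (auto simp: weight_def)
  have cc: "continuous_on UNIV (\<lambda>z. l * k z)" by (intro continuous_intros k)
  have c0: "0 \<le> l * k z" for z using k(2) l by simp
  have [measurable]: "occ k \<in> borel_measurable M" by (rule occ_measurable[OF k(1)])
  have "(\<lambda>j. expectation (\<lambda>\<omega>. (1 + l / \<psi> * v (X (real j) \<omega>)) * discount (\<lambda>z. l * k z) 0 (real j) \<omega>))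
     \<longlonglongrightarrow> expectation (\<lambda>\<omega>. (1 + l / \<psi> * 1) * exp (- l * occ k \<omega>))"
  proof (rule integral_dominated_convergence[where w="\<lambda>_. (1 + l / \<psi>) * 1"])
    show "AE \<omega> in M. (\<lambda>j. (1 + l / \<psi> * v (X (real j) \<omega>)) * discount (\<lambda>z. l * k z) 0 (real j) \<omega>) \<longlonglongrightarrow> (1 + l / \<psi> * 1) * exp (- l * occ k \<omega>)"
      using v_tendsto_1 occ_limit[OF w, of l]
      by eventually_elim (intro tendsto_intros, auto intro: filterlim_compose[OF _ filterlim_real_sequentially])
    show "AE \<omega> in M. norm ((1 + l / \<psi> * v (X (real j) \<omega>)) * discount (\<lambda>z. l * k z) 0 (real j) \<omega>) \<le> (1 + l / \<psi>) * 1" for j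
    proof (rule AE_I2)
      fix \<omega>
      have "0 \<le> l / \<psi> * v (X (real j) \<omega>)" "l / \<psi> * v (X (real j) \<omega>) \<le> l / \<psi> * 1"
        by (rule lv_bounds[OF l])+
      then show "norm ((1 + l / \<psi> * v (X (real j) \<omega>)) * discount (\<lambda>z. l * k z) 0 (real j) \<omega>) \<le> (1 + l / \<psi>) * 1"
        unfolding real_norm_def abs_mult using discount_bounds[of "\<lambda>z. l * k z" 0 "real j" \<omega>, OF c0]
        by (intro mult_mono) (auto intro: less_imp_le)
    qed
    show "(\<lambda>\<omega>. (1 + l / \<psi> * v (X (real j) \<omega>)) * discount (\<lambda>z. l * k z) 0 (real j) \<omega>) \<in> borel_measurable M" for j
      using F_M[OF comp_X_ad[OF v_co, of "real j"]] F_M[OF discount_adapted[OF cc order_refl, of "real j"]] by simp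
  qed auto
  then have "(\<lambda>j. expectation (\<lambda>\<omega>. (1 + l / \<psi> * v (X (real j) \<omega>)) * discount (\<lambda>z. l * k z) 0 (real j) \<omega>) - (1 + l / \<psi> * v x))
     \<longlonglongrightarrow> (1 + l / \<psi>) * expectation (\<lambda>\<omega>. exp (- l * occ k \<omega>)) - (1 + l / \<psi> * v x)"
    by (intro tendsto_diff tendsto_const) simp
  from tendsto_rabs[OF this] show ?thesis
    by (rule LIMSEQ_le_const2) (use laplace_finite_time[OF w l] in auto)
qed

text \<open>
  \<open>trap i\<close> lies between the indicators of the balls of radius \<open>eps (Suc i)\<close> and \<open>eps i\<close> around \<open>y\<close>, whose
  occupation times are thus sandwiched between consecutive \<open>mass i * occ (wt i)\<close>. Since
  \<open>eps (Suc i) / eps i \<rightarrow> 1\<close>, the sandwich is asymptotically tight, while \<open>\<Sum> sqrt (eps i)\<close> still converges.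
\<close>

definition eps :: "nat \<Rightarrow> real" where "eps i = 1 / real (i + 2) ^ 4"
definition trap :: "nat \<Rightarrow> real \<Rightarrow> real" where
  "trap i z = max 0 (min 1 ((eps i - \<bar>z - y\<bar>) / (eps i - eps (Suc i))))"
definition mass where "mass i = (LBINT z:{y - 1..y + 1}. trap i z / ((a z)\<^sup>2 * p z))"

lemma eps: "0 < eps i" "eps (Suc i) < eps i" "eps i \<le> 1"
proof -
  show "0 < eps i" by (simp add: eps_def)
  have "real (i + 2) ^ 4 < real (Suc i + 2) ^ 4" by (intro power_strict_mono) auto
  then show "eps (Suc i) < eps i" unfolding eps_def by (intro divide_strict_left_mono) auto
  have "1 \<le> real (i + 2) ^ 4" by (intro one_le_power) auto
  then show "eps i \<le> 1" by (simp add: eps_def divide_le_eq)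
qed

lemma eps_tendsto: "eps \<longlonglongrightarrow> 0"
proof (rule Lim_null_comparison)
  show "eventually (\<lambda>i. norm (eps i) \<le> inverse (real (Suc i))) sequentially"
  proof (intro always_eventually allI)
    fix i
    have "real (Suc i) \<le> real (i + 2) ^ 1" by simp
    also have "\<dots> \<le> real (i + 2) ^ 4" by (rule power_increasing) auto
    finally show "norm (eps i) \<le> inverse (real (Suc i))"
      using eps(1)[of i] by (simp add: eps_def inverse_eq_divide frac_le del: of_nat_Suc of_nat_add)
  qed
qed (rule LIMSEQ_inverse_real_of_nat)

lemma trap: "continuous_on UNIV (trap i)" "0 \<le> trap i z" "trap i z \<le> 1"
  "eps i \<le> \<bar>z - y\<bar> \<Longrightarrow> trap i z = 0" "\<bar>z - y\<bar> \<le> eps (Suc i) \<Longrightarrow> trap i z = 1"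
proof -
  have d: "0 < eps i - eps (Suc i)" using eps(2)[of i] by simp
  show "continuous_on UNIV (trap i)" unfolding trap_def using d by (intro continuous_intros) auto
  show "0 \<le> trap i z" "trap i z \<le> 1" by (auto simp: trap_def)
  show "trap i z = 0" if "eps i \<le> \<bar>z - y\<bar>"
  proof -
    have "(eps i - \<bar>z - y\<bar>) / (eps i - eps (Suc i)) \<le> 0" using that d by (intro divide_nonpos_pos) auto
    then show ?thesis by (simp add: trap_def)
  qed
  show "trap i z = 1" if "\<bar>z - y\<bar> \<le> eps (Suc i)"
  proof -
    have "1 \<le> (eps i - \<bar>z - y\<bar>) / (eps i - eps (Suc i))" using that d by (simp add: le_divide_eq)
    then show ?thesis by (simp add: trap_def)
  qed
qed

lemma density_continuous: "continuous_on UNIV (\<lambda>z. 1 / ((a z)\<^sup>2 * p z))"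
  using a_nz p_pos by (intro continuous_intros a_co p_co) (auto simp: less_imp_neq[symmetric])

lemma mass_bounds:
  assumes "\<And>z. \<bar>z - y\<bar> \<le> eps i \<Longrightarrow> c1 \<le> 1 / ((a z)\<^sup>2 * p z) \<and> 1 / ((a z)\<^sup>2 * p z) \<le> c2" "0 \<le> c1"
  shows "c1 * (2 * eps (Suc i)) \<le> mass i" "mass i \<le> c2 * (2 * eps i)"
proof -
  let ?g = "\<lambda>z. trap i z * (1 / ((a z)\<^sup>2 * p z))"
  have gi: "set_integrable lborel {y - 1..y + 1} ?g"
    by (intro borel_integrable_atLeastAtMost' continuous_on_subset[OF continuous_on_mult[OF trap(1) density_continuous]]) auto
  have m: "mass i = (LBINT z:{y - 1..y + 1}. ?g z)" by (simp add: mass_def)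
  have e: "eps (Suc i) \<le> 1" "eps i \<le> 1" "0 < eps (Suc i)" "0 < eps i" using eps by auto
  have c2: "0 \<le> c2" using assms(1)[of y] assms(2) e(4) by auto
  have ib: "integrable lborel (\<lambda>z. c * indicator {y - r..y + r} z :: real)" for c r
    by (auto intro!: integrable_mult_right simp: integrable_indicator_iff emeasure_lborel_Icc_eq)
  have le: "c1 * indicator {y - eps (Suc i)..y + eps (Suc i)} z \<le> indicator {y - 1..y + 1} z *\<^sub>R ?g z"
    "indicator {y - 1..y + 1} z *\<^sub>R ?g z \<le> c2 * indicator {y - eps i..y + eps i} z" for z
  proof -
    have nn: "0 \<le> 1 / ((a z)\<^sup>2 * p z)" using p_pos[of z] by simp
    show "c1 * indicator {y - eps (Suc i)..y + eps (Suc i)} z \<le> indicator {y - 1..y + 1} z *\<^sub>R ?g z"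
    proof (cases "\<bar>z - y\<bar> \<le> eps (Suc i)")
      case True
      then have "\<bar>z - y\<bar> \<le> eps i" "z \<in> {y - 1..y + 1}" using eps(2)[of i] e by auto
      then show ?thesis using assms(1)[of z] trap(5)[OF True] True by (auto simp: indicator_def)
    next
      case False
      then have "z \<notin> {y - eps (Suc i)..y + eps (Suc i)}" by auto
      then show ?thesis using nn trap(2)[of i z] by (auto simp: indicator_def)
    qed
    show "indicator {y - 1..y + 1} z *\<^sub>R ?g z \<le> c2 * indicator {y - eps i..y + eps i} z"
    proof (cases "\<bar>z - y\<bar> \<le> eps i")
      case True
      have "?g z \<le> 1 * c2" using assms(1)[OF True] nn trap(2,3)[of i z] by (intro mult_mono) auto
      moreover have "z \<in> {y - eps i..y + eps i}" using True by auto
      ultimately show ?thesis using c2 by (auto simp: indicator_def)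
    next
      case False
      then show ?thesis using trap(4)[of i z] c2 by auto
    qed
  qed
  have "c1 * (2 * eps (Suc i)) = (\<integral>z. c1 * indicator {y - eps (Suc i)..y + eps (Suc i)} z \<partial>lborel)" using e by simp
  also have "\<dots> \<le> mass i" unfolding m set_lebesgue_integral_def
    by (rule integral_mono[OF ib]) (use gi le(1) in \<open>auto simp: set_integrable_def\<close>)
  finally show "c1 * (2 * eps (Suc i)) \<le> mass i" .
  have "mass i \<le> (\<integral>z. c2 * indicator {y - eps i..y + eps i} z \<partial>lborel)" unfolding m set_lebesgue_integral_def
    by (rule integral_mono[OF _ ib]) (use gi le(2) in \<open>auto simp: set_integrable_def\<close>)
  then show "mass i \<le> c2 * (2 * eps i)" using e by simp
qed

lemma eps_ratio: "(\<lambda>i. eps (Suc i) / eps i) \<longlonglongrightarrow> 1"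
proof -
  \<comment> \<open>The subtracted term is \<open>1 / (i + 3)\<close>, written with the factor
    \<open>inverse (real (Suc i))\<close> so as to be compared with that null sequence.\<close>
  have "(\<lambda>i. (1 - inverse (real (Suc i)) * (real (Suc i) / real (i + 3))) ^ 4) \<longlonglongrightarrow> (1 - 0) ^ 4"
  proof (intro tendsto_intros)
    show "(\<lambda>i. inverse (real (Suc i)) * (real (Suc i) / real (i + 3))) \<longlonglongrightarrow> 0"
    proof (rule Lim_null_comparison[OF _ LIMSEQ_inverse_real_of_nat])
      show "eventually (\<lambda>i. norm (inverse (real (Suc i)) * (real (Suc i) / real (i + 3))) \<le> inverse (real (Suc i))) sequentially"
        by (intro always_eventually allI) (simp add: field_simps)
    qed
  qed
  moreover have "eps (Suc i) / eps i = (1 - inverse (real (Suc i)) * (real (Suc i) / real (i + 3))) ^ 4" for i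
  proof -
    have "1 - inverse (real (Suc i)) * (real (Suc i) / real (i + 3)) = real (i + 2) / real (i + 3)"
      by (simp add: field_simps)
    moreover have "eps (Suc i) / eps i = (real (i + 2) / real (i + 3)) ^ 4"
      by (simp add: eps_def power_divide add.commute)
    ultimately show ?thesis by simp
  qed
  ultimately show ?thesis by simp
qed

text \<open>The density \<open>1 / (a\<^sup>2 * p)\<close> is continuous with value
  \<open>1 / (a y)\<^sup>2\<close> at \<open>y\<close>, and \<open>trap i\<close> lies between the
  indicators of two balls whose radii have ratio tending to 1.\<close>

lemma mass_asymptotics: "(\<lambda>i. mass i / (2 * eps i)) \<longlonglongrightarrow> 1 / (a y)\<^sup>2"
proof -
  let ?r = "\<lambda>z. 1 / ((a z)\<^sup>2 * p z)"
  have ry: "?r y = 1 / (a y)\<^sup>2" by (simp add: p_y)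
  have pos: "0 < ?r y" using a_nz[of y] p_y by simp
  show ?thesis
  proof (rule LIMSEQ_I)
    fix e :: real assume e: "0 < e"
    define \<eta> where "\<eta> = min (e / 2) (?r y)"
    have \<eta>: "0 < \<eta>" "\<eta> \<le> ?r y" "\<eta> \<le> e / 2" using e pos by (auto simp: \<eta>_def)
    have "isCont ?r y" using density_continuous by (simp add: continuous_on_eq_continuous_at)
    then obtain d where d: "0 < d" "\<And>z. \<bar>z - y\<bar> < d \<Longrightarrow> \<bar>?r z - ?r y\<bar> < \<eta>"
      using \<eta>(1) unfolding isCont_def LIM_eq by (metis abs_zero diff_self real_norm_def)
    have ev: "eventually (\<lambda>i. eps i < d) sequentially" by (rule order_tendstoD(2)[OF eps_tendsto d(1)])
    have "(\<lambda>i. (?r y - \<eta>) * (eps (Suc i) / eps i)) \<longlonglongrightarrow> (?r y - \<eta>) * 1" by (intro tendsto_intros eps_ratio)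
    then have ev2: "eventually (\<lambda>i. ?r y - e < (?r y - \<eta>) * (eps (Suc i) / eps i)) sequentially"
      by (rule order_tendstoD) (use \<eta>(3) e in auto)
    from ev ev2 have "eventually (\<lambda>i. \<bar>mass i / (2 * eps i) - ?r y\<bar> < e) sequentially"
    proof eventually_elim
      case (elim i)
      have "?r y - \<eta> \<le> ?r z \<and> ?r z \<le> ?r y + \<eta>" if "\<bar>z - y\<bar> \<le> eps i" for z
      proof -
        have "\<bar>z - y\<bar> < d" using that elim(1) by linarith
        from d(2)[OF this] show ?thesis by linarith
      qed
      from mass_bounds[OF this] \<eta> have "(?r y - \<eta>) * (2 * eps (Suc i)) \<le> mass i" "mass i \<le> (?r y + \<eta>) * (2 * eps i)" by auto
      then have "(?r y - \<eta>) * (eps (Suc i) / eps i) \<le> mass i / (2 * eps i)" "mass i / (2 * eps i) \<le> ?r y + \<eta>"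
        using eps(1)[of i] divide_right_mono[of "(?r y - \<eta>) * (2 * eps (Suc i))" "mass i" "2 * eps i"]
          divide_right_mono[of "mass i" "(?r y + \<eta>) * (2 * eps i)" "2 * eps i"] by simp_all
      with elim(2) \<eta>(3) e show ?case by (simp add: abs_less_iff)
    qed
    then show "\<exists>N. \<forall>i\<ge>N. norm (mass i / (2 * eps i) - 1 / (a y)\<^sup>2) < e"
      unfolding ry[symmetric] by (simp add: eventually_sequentially)
  qed
qed

lemma mass_pos: "0 < mass i"
proof -
  let ?r = "\<lambda>z. 1 / ((a z)\<^sup>2 * p z)"
  have "\<exists>z0\<in>{y - 1..y + 1}. \<forall>z\<in>{y - 1..y + 1}. ?r z0 \<le> ?r z"
    by (rule continuous_attains_inf) (auto intro: continuous_on_subset[OF density_continuous])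
  moreover have "\<exists>z1\<in>{y - 1..y + 1}. \<forall>z\<in>{y - 1..y + 1}. ?r z \<le> ?r z1"
    by (rule continuous_attains_sup) (auto intro: continuous_on_subset[OF density_continuous])
  ultimately obtain z0 z1 where z: "\<forall>z\<in>{y - 1..y + 1}. ?r z0 \<le> ?r z" "\<forall>z\<in>{y - 1..y + 1}. ?r z \<le> ?r z1" by blast
  have "?r z0 \<le> ?r z \<and> ?r z \<le> ?r z1" if "\<bar>z - y\<bar> \<le> eps i" for z
    using that eps(3)[of i] z by (auto simp: abs_le_iff)
  from mass_bounds(1)[OF this] have "?r z0 * (2 * eps (Suc i)) \<le> mass i" using p_pos[of z0] by simp
  moreover have "0 < ?r z0 * (2 * eps (Suc i))" using eps(1)[of "Suc i"] a_nz[of z0] p_pos[of z0] by simp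
  ultimately show ?thesis by linarith
qed

definition wt where "wt i z = trap i z / mass i"

text \<open>Stated for all radii \<open>eps m\<close> with \<open>m \<le> i\<close>, so that
  consecutive weights share a radius and can be averaged.\<close>

lemma weight_wt: "m \<le> i \<Longrightarrow> weight (wt i) (eps m)"
proof -
  assume mn: "m \<le> i"
  have "eps i \<le> eps m" using mn by (rule lift_Suc_antimono_le[of eps, rotated]) (use eps(2) less_imp_le in blast)
  moreover have "(LBINT z:{y - 1..y + 1}. wt i z / ((a z)\<^sup>2 * p z)) = (LBINT z:{y - 1..y + 1}. (1 / mass i) * (trap i z / ((a z)\<^sup>2 * p z)))"
    by (simp add: wt_def mult_ac)
  then have "(LBINT z:{y - 1..y + 1}. wt i z / ((a z)\<^sup>2 * p z)) = 1"
    unfolding set_integral_mult_right mass_def[symmetric] using mass_pos[of i] by simp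
  moreover have "continuous_on UNIV (wt i)" unfolding wt_def by (intro continuous_intros trap) (use mass_pos[of i] in auto)
  ultimately show ?thesis using eps[of m] mass_pos[of i] trap(2,4)[of i]
    by (auto simp: weight_def wt_def intro: less_imp_le)
qed

lemma wt_continuous: "continuous_on UNIV (wt i)"
  using weight_wt[of i i] by (simp add: weight_def)

lemma occ_wt_measurable [measurable]: "occ (wt i) \<in> borel_measurable M"
  by (rule occ_measurable[OF wt_continuous])

text \<open>Almost surely only: the three limits are additive where the path leaves the supports and
  the integrals become constant.\<close>

lemma occ_average: "AE \<omega> in M. occ (\<lambda>z. (wt i z + wt j z) / 2) \<omega> = (occ (wt i) \<omega> + occ (wt j) \<omega>) / 2"
  using X_leaves_compacts
proof eventually_elim
  case (elim \<omega>)
  obtain T where T: "0 \<le> T" "\<And>t. T \<le> t \<Longrightarrow> \<bar>y\<bar> + 1 < \<bar>X t \<omega>\<bar>" using elim by blast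
  have z: "wt i (X u \<omega>) = 0" if "T \<le> u" for i u
    by (rule weight_vanishes[OF weight_wt[OF order_refl] T(2)[OF that]])
  have c: "continuous_on UNIV (\<lambda>z. (wt i z + wt j z) / 2)" by (intro continuous_intros wt_continuous) auto
  have "occ (\<lambda>z. (wt i z + wt j z) / 2) \<omega> = (LBINT u:{0..T}. (wt i (X u \<omega>) + wt j (X u \<omega>)) / 2)"
    by (rule occ_eq[OF c _ T(1) order_refl]) (simp add: z)
  also have "\<dots> = ((LBINT u:{0..T}. wt i (X u \<omega>)) + (LBINT u:{0..T}. wt j (X u \<omega>))) / 2"
    by (subst set_integral_divide_zero, subst set_integral_add(2)) (auto intro!: int_X wt_continuous)
  also have "\<dots> = (occ (wt i) \<omega> + occ (wt j) \<omega>) / 2"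
    using occ_eq[OF wt_continuous z T(1) order_refl, of i] occ_eq[OF wt_continuous z T(1) order_refl, of j] by simp
  finally show ?case .
qed

lemma exp_occ_le_1: "weight k \<epsilon> \<Longrightarrow> 0 \<le> l \<Longrightarrow> AE \<omega> in M. exp (- l * occ k \<omega>) \<le> 1"
  using occ_nonneg[of k \<epsilon>] by (auto elim!: eventually_mono simp: mult_nonneg_nonneg)

lemma exp_occ_integrable: "weight k \<epsilon> \<Longrightarrow> 0 \<le> l \<Longrightarrow> integrable M (\<lambda>\<omega>. exp (- l * occ k \<omega>))"
proof (rule integrable_const_bound[of _ 1])
  assume w: "weight k \<epsilon>" "0 \<le> l"
  show "AE \<omega> in M. norm (exp (- l * occ k \<omega>)) \<le> 1" using exp_occ_le_1[OF w] by simp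
  show "(\<lambda>\<omega>. exp (- l * occ k \<omega>)) \<in> borel_measurable M"
    using occ_measurable[of k] w by (auto simp: weight_def)
qed

text \<open>
  The cross term \<open>exp (- A) * exp (- B) = exp (- 2 * ((A + B) / 2))\<close> is again a Laplace transform, that of the
  averaged weight.
\<close>

lemma exp_occ_square_diff:
  "expectation (\<lambda>\<omega>. (exp (- occ (wt i) \<omega>) - exp (- occ (wt (Suc i)) \<omega>))\<^sup>2) \<le> 64 * Pm * eps i"
proof -
  let ?av = "\<lambda>z. (wt i z + wt (Suc i) z) / 2"
  have w: "weight (wt i) (eps i)" "weight (wt (Suc i)) (eps i)" by (rule weight_wt; simp)+
  have wa: "weight ?av (eps i)" by (rule weight_average[OF w])
  let ?e = "\<lambda>k. expectation (\<lambda>\<omega>. exp (- 2 * occ k \<omega>))"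
  have L: "\<bar>(1 + 2 / \<psi>) * ?e k - (1 + 2 / \<psi> * v x)\<bar> \<le> 16 * Pm * eps i" if "weight k (eps i)" for k
    using laplace_occ[OF that, of 2] by simp
  have "expectation (\<lambda>\<omega>. (exp (- occ (wt i) \<omega>) - exp (- occ (wt (Suc i)) \<omega>))\<^sup>2) =
    expectation (\<lambda>\<omega>. exp (- 2 * occ (wt i) \<omega>) + exp (- 2 * occ (wt (Suc i)) \<omega>) - 2 * exp (- 2 * occ ?av \<omega>))"
  proof (rule integral_cong_AE)
    show "AE \<omega> in M. (exp (- occ (wt i) \<omega>) - exp (- occ (wt (Suc i)) \<omega>))\<^sup>2 =
      exp (- 2 * occ (wt i) \<omega>) + exp (- 2 * occ (wt (Suc i)) \<omega>) - 2 * exp (- 2 * occ ?av \<omega>)"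
      using occ_average[of i "Suc i"]
    proof eventually_elim
      case (elim \<omega>)
      have 1: "exp (- 2 * u) = (exp (- u))\<^sup>2" for u :: real by (simp add: power2_eq_square exp_add[symmetric])
      have 2: "exp (- 2 * ((u + w) / 2)) = exp (- u) * exp (- w)" for u w :: real
      proof -
        have "- 2 * ((u + w) / 2) = - u + - w" by simp
        then show ?thesis by (simp only: exp_add)
      qed
      show ?case unfolding elim 1[of "occ (wt i) \<omega>"] 1[of "occ (wt (Suc i)) \<omega>"] 2 by (simp add: power2_diff)
    qed
    show "(\<lambda>\<omega>. exp (- 2 * occ (wt i) \<omega>) + exp (- 2 * occ (wt (Suc i)) \<omega>) - 2 * exp (- 2 * occ ?av \<omega>)) \<in> borel_measurable M"
      using occ_measurable[of ?av] wa by (auto simp: weight_def)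
  qed measurable
  also have "\<dots> = ?e (wt i) + ?e (wt (Suc i)) - 2 * ?e ?av"
    using exp_occ_integrable[OF w(1), of 2] exp_occ_integrable[OF w(2), of 2] exp_occ_integrable[OF wa, of 2] by simp
  finally have eq: "expectation (\<lambda>\<omega>. (exp (- occ (wt i) \<omega>) - exp (- occ (wt (Suc i)) \<omega>))\<^sup>2) = ?e (wt i) + ?e (wt (Suc i)) - 2 * ?e ?av" .
  let ?E = "expectation (\<lambda>\<omega>. (exp (- occ (wt i) \<omega>) - exp (- occ (wt (Suc i)) \<omega>))\<^sup>2)"
  have "(1 + 2 / \<psi>) * ?E = (1 + 2 / \<psi>) * ?e (wt i) + (1 + 2 / \<psi>) * ?e (wt (Suc i)) - 2 * ((1 + 2 / \<psi>) * ?e ?av)"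
    unfolding eq by (simp add: algebra_simps)
  have "(1 + 2 / \<psi>) * ?E \<le> 64 * Pm * eps i"
  proof -
    have "p1 + p2 - 2 * p3 \<le> 64 * Pm * eps i"
      if "\<bar>p1 - c\<bar> \<le> 16 * Pm * eps i" "\<bar>p2 - c\<bar> \<le> 16 * Pm * eps i" "\<bar>p3 - c\<bar> \<le> 16 * Pm * eps i" for p1 p2 p3 c
      using that unfolding mult.assoc by linarith
    from this[OF L[OF w(1)] L[OF w(2)] L[OF wa]] \<open>(1 + 2 / \<psi>) * ?E = _\<close> show ?thesis by (simp only:)
  qed
  moreover have "1 * ?E \<le> (1 + 2 / \<psi>) * ?E" using \<psi>_pos by (intro mult_right_mono integral_nonneg_AE) auto
  ultimately show ?thesis by simp
qed

text \<open>With \<open>w = (i + 2)\<^sup>2\<close> one has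
  \<open>\<bar>d i\<bar> \<le> 1 / (2 * w) + w / 2 * (d i)\<^sup>2\<close>, and
  \<open>eps i = 1 / w\<^sup>2\<close> makes the expectation of order \<open>1 / w\<close>. So the
  sum of all \<open>\<bar>d i\<bar>\<close> has finite expectation and is finite almost
  surely.\<close>

lemma exp_occ_convergent: "AE \<omega> in M. convergent (\<lambda>i. exp (- occ (wt i) \<omega>))"
proof -
  define d where "d i \<omega> = exp (- occ (wt i) \<omega>) - exp (- occ (wt (Suc i)) \<omega>)" for i \<omega>
  have dm[measurable]: "d i \<in> borel_measurable M" for i unfolding d_def by measurable
  have i1: "integrable M (\<lambda>\<omega>. exp (- occ (wt i) \<omega>))" for i
    using exp_occ_integrable[OF weight_wt[OF order_refl], of 1] by simp
  have di: "integrable M (d i)" for i unfolding d_def using i1 by auto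
  have ex1: "AE \<omega> in M. exp (- occ (wt i) \<omega>) \<le> 1" for i
    using exp_occ_le_1[OF weight_wt[OF order_refl], of 1 i] by simp
  have d2i: "integrable M (\<lambda>\<omega>. (d i \<omega>)\<^sup>2)" for i
  proof (rule integrable_const_bound[of _ 1])
    show "AE \<omega> in M. norm ((d i \<omega>)\<^sup>2) \<le> 1"
      using ex1[of i] ex1[of "Suc i"]
    proof eventually_elim
      case (elim \<omega>)
      have "\<bar>d i \<omega>\<bar> \<le> 1" using elim exp_gt_zero[of "- occ (wt i) \<omega>"] exp_gt_zero[of "- occ (wt (Suc i)) \<omega>"]
        unfolding d_def by linarith
      then show ?case by (simp add: abs_square_le_1)
    qed
  qed measurable
  have dE: "expectation (\<lambda>\<omega>. \<bar>d i \<omega>\<bar>) \<le> (1 / 2 + 32 * Pm) * (1 / (real (i + 2))\<^sup>2)" for i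
  proof -
    define w where "w = (real (i + 2))\<^sup>2"
    have w: "0 < w" by (simp add: w_def)
    have "expectation (\<lambda>\<omega>. \<bar>d i \<omega>\<bar>) \<le> expectation (\<lambda>\<omega>. 1 / (2 * w) + w / 2 * (d i \<omega>)\<^sup>2)"
    proof (rule integral_mono)
      fix \<omega>
      have "0 \<le> (w * \<bar>d i \<omega>\<bar> - 1)\<^sup>2" by simp
      then have "\<bar>d i \<omega>\<bar> * (2 * w) \<le> 1 + w\<^sup>2 * (d i \<omega>)\<^sup>2" by (simp add: power2_diff power_mult_distrib mult_ac)
      then have "\<bar>d i \<omega>\<bar> \<le> (1 + w\<^sup>2 * (d i \<omega>)\<^sup>2) / (2 * w)" using w by (simp add: pos_le_divide_eq)
      also have "\<dots> = 1 / (2 * w) + w / 2 * (d i \<omega>)\<^sup>2" using w by (simp add: add_divide_distrib power2_eq_square)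
      finally show "\<bar>d i \<omega>\<bar> \<le> 1 / (2 * w) + w / 2 * (d i \<omega>)\<^sup>2" .
    qed (use di d2i in auto)
    also have "\<dots> = 1 / (2 * w) + w / 2 * expectation (\<lambda>\<omega>. (d i \<omega>)\<^sup>2)" using d2i by (simp add: prob_space)
    also have "\<dots> \<le> 1 / (2 * w) + w / 2 * (64 * Pm * eps i)"
      using exp_occ_square_diff[of i] w unfolding d_def by (intro add_left_mono mult_left_mono) auto
    also have "eps i = 1 / (w * w)" by (simp add: eps_def w_def power2_eq_square power4_eq_xxxx)
    also have "1 / (2 * w) + w / 2 * (64 * Pm * (1 / (w * w))) = (1 / 2 + 32 * Pm) * (1 / w)"
      using w by (simp add: field_simps)
    finally show ?thesis by (simp add: w_def)
  qed
  have sm: "summable (\<lambda>i. (1 / 2 + 32 * Pm) * (1 / (real (i + 2))\<^sup>2))"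
  proof (rule summable_mult)
    have "summable (\<lambda>i. inverse (real (i + 2) ^ 2))"
      by (rule summable_ignore_initial_segment[OF inverse_power_summable]) simp
    then show "summable (\<lambda>i. 1 / (real (i + 2))\<^sup>2)" by (simp add: inverse_eq_divide)
  qed
  have C0: "0 \<le> (1 / 2 + 32 * Pm) * (1 / (real (i + 2))\<^sup>2)" for i using Pm_pos by (intro mult_nonneg_nonneg) auto
  have "(\<integral>\<^sup>+\<omega>. (\<Sum>i. ennreal \<bar>d i \<omega>\<bar>) \<partial>M) = (\<Sum>i. \<integral>\<^sup>+\<omega>. ennreal \<bar>d i \<omega>\<bar> \<partial>M)"
    by (rule nn_integral_suminf) measurable
  also have "\<dots> \<le> (\<Sum>i. ennreal ((1 / 2 + 32 * Pm) * (1 / (real (i + 2))\<^sup>2)))"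
  proof (rule suminf_le)
    fix i
    have "(\<integral>\<^sup>+\<omega>. ennreal \<bar>d i \<omega>\<bar> \<partial>M) = ennreal (expectation (\<lambda>\<omega>. \<bar>d i \<omega>\<bar>))"
      by (rule nn_integral_eq_integral) (use di in auto)
    also have "\<dots> \<le> ennreal ((1 / 2 + 32 * Pm) * (1 / (real (i + 2))\<^sup>2))" by (rule ennreal_leI[OF dE])
    finally show "(\<integral>\<^sup>+\<omega>. ennreal \<bar>d i \<omega>\<bar> \<partial>M) \<le> ennreal ((1 / 2 + 32 * Pm) * (1 / (real (i + 2))\<^sup>2))" .
  qed auto
  also have "\<dots> = ennreal (\<Sum>i. (1 / 2 + 32 * Pm) * (1 / (real (i + 2))\<^sup>2))"
    by (rule suminf_ennreal2[OF C0 sm])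
  also have "\<dots> < \<infinity>" by simp
  finally have "(\<integral>\<^sup>+\<omega>. (\<Sum>i. ennreal \<bar>d i \<omega>\<bar>) \<partial>M) \<noteq> \<infinity>" by simp
  then have "AE \<omega> in M. (\<Sum>i. ennreal \<bar>d i \<omega>\<bar>) \<noteq> \<infinity>" by (intro nn_integral_PInf_AE) measurable
  then show ?thesis
  proof eventually_elim
    case (elim \<omega>)
    have "summable (\<lambda>i. \<bar>d i \<omega>\<bar>)"
      by (rule summable_suminf_not_top) (use elim in auto)
    then have "summable (\<lambda>i. d i \<omega>)" by (rule summable_rabs_cancel)
    then have "(\<lambda>n. \<Sum>i<n. d i \<omega>) \<longlonglongrightarrow> (\<Sum>i. d i \<omega>)" by (rule summable_LIMSEQ)
    moreover have "(\<Sum>i<n. d i \<omega>) = exp (- occ (wt 0) \<omega>) - exp (- occ (wt n) \<omega>)" for n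
      unfolding d_def by (rule sum_lessThan_telescope')
    ultimately have "(\<lambda>n. exp (- occ (wt 0) \<omega>) - (exp (- occ (wt 0) \<omega>) - exp (- occ (wt n) \<omega>))) \<longlonglongrightarrow>
      exp (- occ (wt 0) \<omega>) - (\<Sum>i. d i \<omega>)" by (intro tendsto_diff tendsto_const) simp
    then show ?case unfolding convergent_def by auto
  qed
qed

text \<open>The limit is taken for \<open>exp (- occ)\<close>, which stays in \<open>[0, 1]\<close>;
  afterwards the limit \<open>\<xi>\<close> is shown to be positive, so that
  \<open>L = - ln \<xi>\<close> is finite. For \<open>l > 0\<close> the Laplace transform of
  \<open>L\<close> is an expectation of a power of \<open>\<xi>\<close>, to which
  \<open>laplace_occ\<close> passes with an error tending to 0.\<close>

theorem total_local_time:
  obtains L :: "'w \<Rightarrow> real" where "L \<in> borel_measurable M" "AE \<omega> in M. 0 \<le> L \<omega>"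
    "AE \<omega> in M. (\<lambda>i. occ (wt i) \<omega>) \<longlonglongrightarrow> L \<omega>"
    "\<And>l. 0 \<le> l \<Longrightarrow> expectation (\<lambda>\<omega>. exp (- l * L \<omega>)) = (\<psi> + l * v x) / (\<psi> + l)"
proof -
  define \<xi> where "\<xi> \<omega> = lim (\<lambda>i. exp (- occ (wt i) \<omega>))" for \<omega>
  have [measurable]: "\<xi> \<in> borel_measurable M" unfolding \<xi>_def by measurable
  have lim: "AE \<omega> in M. (\<lambda>i. exp (- occ (wt i) \<omega>)) \<longlonglongrightarrow> \<xi> \<omega>"
    using exp_occ_convergent by eventually_elim (simp add: \<xi>_def convergent_LIMSEQ_iff)
  have le1: "AE \<omega> in M. \<forall>i. 0 \<le> occ (wt i) \<omega>"
    by (subst AE_all_countable) (auto intro: occ_nonneg weight_wt[OF order_refl])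
  have \<xi>01: "AE \<omega> in M. 0 \<le> \<xi> \<omega> \<and> \<xi> \<omega> \<le> 1"
    using lim le1
  proof eventually_elim
    case (elim \<omega>)
    have "0 \<le> \<xi> \<omega>" by (rule LIMSEQ_le_const[OF elim(1)]) auto
    moreover have "\<xi> \<omega> \<le> 1" by (rule LIMSEQ_le_const2[OF elim(1)]) (use elim(2) in auto)
    ultimately show ?case ..
  qed
  have E: "expectation (\<lambda>\<omega>. \<xi> \<omega> powr l) = (\<psi> + l * v x) / (\<psi> + l)" if l: "0 < l" for l
  proof -
    have "(\<lambda>i. expectation (\<lambda>\<omega>. exp (- l * occ (wt i) \<omega>))) \<longlonglongrightarrow> expectation (\<lambda>\<omega>. \<xi> \<omega> powr l)"
    proof (rule integral_dominated_convergence[where w="\<lambda>_. 1"])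
      show "AE \<omega> in M. (\<lambda>i. exp (- l * occ (wt i) \<omega>)) \<longlonglongrightarrow> \<xi> \<omega> powr l"
        using lim
      proof eventually_elim
        case (elim \<omega>)
        have "(\<lambda>i. exp (- occ (wt i) \<omega>) powr l) \<longlonglongrightarrow> \<xi> \<omega> powr l"
          by (rule tendsto_powr'[OF elim tendsto_const]) (use l in auto)
        then show ?case by (simp add: powr_def)
      qed
      show "AE \<omega> in M. norm (exp (- l * occ (wt i) \<omega>)) \<le> 1" for i
        using exp_occ_le_1[OF weight_wt[OF order_refl], of l i] l by simp
    qed auto
    then have "(\<lambda>i. (1 + l / \<psi>) * expectation (\<lambda>\<omega>. exp (- l * occ (wt i) \<omega>)) - (1 + l / \<psi> * v x)) \<longlonglongrightarrow>
      (1 + l / \<psi>) * expectation (\<lambda>\<omega>. \<xi> \<omega> powr l) - (1 + l / \<psi> * v x)" by (intro tendsto_intros)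
    moreover have "(\<lambda>i. (1 + l / \<psi>) * expectation (\<lambda>\<omega>. exp (- l * occ (wt i) \<omega>)) - (1 + l / \<psi> * v x)) \<longlonglongrightarrow> 0"
    proof (rule Lim_null_comparison)
      show "eventually (\<lambda>i. norm ((1 + l / \<psi>) * expectation (\<lambda>\<omega>. exp (- l * occ (wt i) \<omega>)) - (1 + l / \<psi> * v x)) \<le> 8 * l * Pm * eps i) sequentially"
        using laplace_occ[OF weight_wt[OF order_refl], of l] l by (intro always_eventually allI) simp
      show "(\<lambda>i. 8 * l * Pm * eps i) \<longlonglongrightarrow> 0" using tendsto_mult_right_zero[OF eps_tendsto] .
    qed
    ultimately have "(1 + l / \<psi>) * expectation (\<lambda>\<omega>. \<xi> \<omega> powr l) - (1 + l / \<psi> * v x) = 0" by (rule LIMSEQ_unique)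
    then have "\<psi> * ((1 + l / \<psi>) * expectation (\<lambda>\<omega>. \<xi> \<omega> powr l)) = \<psi> * (1 + l / \<psi> * v x)" by simp
    moreover have "\<psi> * ((1 + l / \<psi>) * e) = e * (\<psi> + l)" "\<psi> * (1 + l / \<psi> * e) = \<psi> + l * e" for e
      using \<psi>_pos by (simp_all add: field_simps)
    ultimately show ?thesis using \<psi>_pos l by (simp add: eq_divide_eq)
  qed
  \<comment> \<open>\<open>\<xi> powr l\<close> is at most the indicator of
    \<open>0 < \<xi>\<close>, because \<open>0 powr l = 0\<close>; its expectation tends to 1 as
    \<open>l\<close> tends to 0, so the event has probability 1.\<close>
  have pos: "AE \<omega> in M. 0 < \<xi> \<omega>"
  proof -
    let ?A = "{\<omega> \<in> space M. 0 < \<xi> \<omega>}"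
    have AM: "?A \<in> sets M" by measurable
    have ge: "(\<psi> + l * v x) / (\<psi> + l) \<le> prob ?A" if l: "0 < l" for l
    proof -
      have "expectation (\<lambda>\<omega>. \<xi> \<omega> powr l) \<le> expectation (indicator ?A)"
      proof (rule integral_mono_AE)
        show "integrable M (\<lambda>\<omega>. \<xi> \<omega> powr l)"
        proof (rule integrable_const_bound[of _ 1])
          show "AE \<omega> in M. norm (\<xi> \<omega> powr l) \<le> 1" using \<xi>01 by eventually_elim (use l in \<open>simp add: powr_le1\<close>)
        qed measurable
        show "AE \<omega> in M. \<xi> \<omega> powr l \<le> indicator ?A \<omega>" using \<xi>01 AE_space
        proof eventually_elim
          case (elim \<omega>)
          show ?case
          proof (cases "\<xi> \<omega> = 0")
            case False
            then show ?thesis using elim l by (simp add: powr_le1)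
          qed simp
        qed
      qed (use AM in \<open>auto intro!: integrable_real_indicator simp: emeasure_eq_measure\<close>)
      then show ?thesis using E[OF l] AM by simp
    qed
    have "(\<lambda>j. (\<psi> + inverse (real (Suc j)) * v x) / (\<psi> + inverse (real (Suc j)))) \<longlonglongrightarrow> (\<psi> + 0 * v x) / (\<psi> + 0)"
      by (intro tendsto_intros LIMSEQ_inverse_real_of_nat) (use \<psi>_pos in auto)
    then have "(\<psi> + 0 * v x) / (\<psi> + 0) \<le> prob ?A"
      by (rule LIMSEQ_le_const2) (use ge in \<open>auto simp del: of_nat_Suc\<close>)
    then have "prob ?A = 1" using \<psi>_pos prob_le_1[of ?A] by simp
    then show ?thesis using AM by (simp add: prob_eq_1 pred_def)
  qed
  define L where "L \<omega> = - ln (\<xi> \<omega>)" for \<omega>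
  show ?thesis
  proof
    show "L \<in> borel_measurable M" unfolding L_def by measurable
    show "AE \<omega> in M. 0 \<le> L \<omega>" using \<xi>01 pos by eventually_elim (simp add: L_def)
    show "AE \<omega> in M. (\<lambda>i. occ (wt i) \<omega>) \<longlonglongrightarrow> L \<omega>" using lim pos
    proof eventually_elim
      case (elim \<omega>)
      have "(\<lambda>i. - ln (exp (- occ (wt i) \<omega>))) \<longlonglongrightarrow> - ln (\<xi> \<omega>)"
        by (intro tendsto_intros elim) (use elim in auto)
      then show ?case by (simp add: L_def)
    qed
    show "expectation (\<lambda>\<omega>. exp (- l * L \<omega>)) = (\<psi> + l * v x) / (\<psi> + l)" if l: "0 \<le> l" for l
    proof (cases "l = 0")
      case True
      then show ?thesis using \<psi>_pos by (simp add: prob_space)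
    next
      case False
      have "expectation (\<lambda>\<omega>. exp (- l * L \<omega>)) = expectation (\<lambda>\<omega>. \<xi> \<omega> powr l)"
      proof (rule integral_cong_AE)
        show "AE \<omega> in M. exp (- l * L \<omega>) = \<xi> \<omega> powr l" using pos
          by eventually_elim (simp add: L_def powr_def)
      qed (auto simp: L_def)
      then show ?thesis using E[of l] False l by simp
    qed
  qed
qed

section \<open>Identification of the limit with the local time\<close>

lemma eps_antimono: "i \<le> j \<Longrightarrow> eps j \<le> eps i"
  by (rule lift_Suc_antimono_le[of eps]) (use eps(2) less_imp_le in blast)+

text \<open>A pathwise argument. After \<open>T\<close> the path stays away from \<open>y\<close>,
  so every \<open>B i\<close> is a full occupation integral, equal to
  \<open>mass i * occ (wt i)\<close>, and the occupation times of balls are squeezed between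
  consecutive \<open>B i\<close>.\<close>

lemma local_time_eq:
  assumes T: "0 \<le> T" "\<And>t. T \<le> t \<Longrightarrow> \<bar>y\<bar> + 1 < \<bar>X t \<omega>\<bar>" and t: "T \<le> t"
    and L: "(\<lambda>i. occ (wt i) \<omega>) \<longlonglongrightarrow> L"
  shows "local_time a X t y \<omega> = L"
proof -
  define B where "B i = (LBINT u:{0..t}. trap i (X u \<omega>))" for i
  define Oc where "Oc \<epsilon> = (LBINT u:{0..t}. indicator {u. \<bar>X u \<omega> - y\<bar> \<le> \<epsilon>} u :: real)" for \<epsilon>
  have z: "wt i (X u \<omega>) = 0" if "T \<le> u" for i u
    by (rule weight_vanishes[OF weight_wt[OF order_refl] T(2)[OF that]])
  have BA: "B i = mass i * occ (wt i) \<omega>" for i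
  proof -
    have "occ (wt i) \<omega> = (LBINT u:{0..t}. wt i (X u \<omega>))" by (rule occ_eq[OF wt_continuous z T(1) t])
    also have "\<dots> = B i / mass i" unfolding B_def wt_def by (rule set_integral_divide_zero)
    finally show ?thesis using mass_pos[of i] by simp
  qed
  have Bi: "set_integrable lborel {0..t} (\<lambda>u. trap i (X u \<omega>))" for i by (rule int_X[OF trap(1)])
  have cl: "closed {u. \<bar>X u \<omega> - y\<bar> \<le> \<epsilon>}" for \<epsilon>
    by (intro closed_Collect_le continuous_intros X_co)
  have Oi: "set_integrable lborel {0..t} (\<lambda>u. indicator {u. \<bar>X u \<omega> - y\<bar> \<le> \<epsilon>} u :: real)" for \<epsilon>
  proof (rule set_integrable_bounded_Icc[where m=1])
    have "{u. \<bar>X u \<omega> - y\<bar> \<le> \<epsilon>} \<in> sets borel" using cl by (rule borel_closed)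
    then show "set_borel_measurable lborel {0..t} (indicator {u. \<bar>X u \<omega> - y\<bar> \<le> \<epsilon>} :: real \<Rightarrow> real)"
      unfolding set_borel_measurable_def by (intro borel_measurable_scaleR borel_measurable_indicator) auto
  qed (auto simp: indicator_def)
  have Omono: "Oc \<epsilon> \<le> Oc \<epsilon>'" if "\<epsilon> \<le> \<epsilon>'" for \<epsilon> \<epsilon>'
    unfolding Oc_def using that by (intro set_integral_mono Oi) (auto simp: indicator_def)
  have BO: "B i \<le> Oc (eps i)" for i
    unfolding B_def Oc_def
  proof (intro set_integral_mono Bi Oi)
    show "trap i (X u \<omega>) \<le> indicator {u. \<bar>X u \<omega> - y\<bar> \<le> eps i} u" for u
      using trap(3,4)[of i "X u \<omega>"] by (auto simp: indicator_def)
  qed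
  have OB: "Oc (eps (Suc i)) \<le> B i" for i
    unfolding B_def Oc_def
  proof (intro set_integral_mono Bi Oi)
    show "indicator {u. \<bar>X u \<omega> - y\<bar> \<le> eps (Suc i)} u \<le> trap i (X u \<omega>)" for u
      using trap(2)[of i "X u \<omega>"] trap(5)[of "X u \<omega>" i] by (auto simp: indicator_def)
  qed
  \<comment> \<open>For \<open>eps (i + 2) \<le> \<epsilon> \<le> eps (i + 1)\<close> the quotient
    \<open>Oc \<epsilon> / (2 * \<epsilon>)\<close> lies between \<open>lo i\<close> and
    \<open>up i\<close>. Numerators and denominators belong to different indices; the shift
    disappears in the limit by \<open>eps_ratio\<close>.\<close>
  define lo where "lo i = B (Suc (Suc i)) / (2 * eps (Suc i))" for i
  define up where "up i = B i / (2 * eps (Suc (Suc i)))" for i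
  define c where "c = L / (a y)\<^sup>2"
  have r: "(\<lambda>i. eps (Suc i) / eps i) \<longlonglongrightarrow> 1" by (rule eps_ratio)
  have m: "(\<lambda>i. mass i / (2 * eps i)) \<longlonglongrightarrow> 1 / (a y)\<^sup>2" by (rule mass_asymptotics)
  have e0: "eps i \<noteq> 0" for i using eps(1)[of i] by simp
  have lo: "lo \<longlonglongrightarrow> c"
  proof -
    have "(\<lambda>i. occ (wt (Suc (Suc i))) \<omega> * (mass (Suc (Suc i)) / (2 * eps (Suc (Suc i)))) * (eps (Suc (Suc i)) / eps (Suc i))) \<longlonglongrightarrow> L * (1 / (a y)\<^sup>2) * 1"
      by (intro tendsto_mult LIMSEQ_Suc[OF LIMSEQ_Suc[OF L]] LIMSEQ_Suc[OF LIMSEQ_Suc[OF m]] LIMSEQ_Suc[OF r])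
    moreover have "occ (wt (Suc (Suc i))) \<omega> * (mass (Suc (Suc i)) / (2 * eps (Suc (Suc i)))) * (eps (Suc (Suc i)) / eps (Suc i)) = lo i" for i
      using e0[of "Suc (Suc i)"] by (simp add: lo_def BA)
    ultimately show ?thesis by (simp add: c_def)
  qed
  have up: "up \<longlonglongrightarrow> c"
  proof -
    have "(\<lambda>i. occ (wt i) \<omega> * (mass i / (2 * eps i)) / (eps (Suc i) / eps i) / (eps (Suc (Suc i)) / eps (Suc i))) \<longlonglongrightarrow> L * (1 / (a y)\<^sup>2) / 1 / 1"
      by (intro tendsto_mult tendsto_divide L m r LIMSEQ_Suc[OF r]) auto
    moreover have "occ (wt i) \<omega> * (mass i / (2 * eps i)) / (eps (Suc i) / eps i) / (eps (Suc (Suc i)) / eps (Suc i)) = up i" for i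
      using e0[of i] e0[of "Suc i"] by (simp add: up_def BA)
    ultimately show ?thesis by (simp add: c_def)
  qed
  have "((\<lambda>\<epsilon>. 1 / (2 * \<epsilon>) * Oc \<epsilon>) \<longlongrightarrow> c) (at_right 0)"
  proof (rule tendstoI)
    fix e :: real assume e: "0 < e"
    have "eventually (\<lambda>i. dist (lo i) c < e \<and> dist (up i) c < e) sequentially"
      using tendstoD[OF lo e] tendstoD[OF up e] by (rule eventually_conj)
    then obtain N where N: "\<And>i. N \<le> i \<Longrightarrow> dist (lo i) c < e" "\<And>i. N \<le> i \<Longrightarrow> dist (up i) c < e"
      by (auto simp: eventually_sequentially)
    have "dist (1 / (2 * \<epsilon>) * Oc \<epsilon>) c < e" if \<epsilon>: "0 < \<epsilon>" "\<epsilon> < eps (Suc N)" for \<epsilon>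
    proof -
      have "\<exists>j. eps j \<le> \<epsilon>" using order_tendstoD(2)[OF eps_tendsto \<epsilon>(1)] by (auto simp: eventually_sequentially intro: less_imp_le)
      \<comment> \<open>The first radius not exceeding \<open>\<epsilon>\<close>; minimality yields
        the opposite inequality for the preceding radius, and
        \<open>\<epsilon> < eps (Suc N)\<close> forces \<open>j \<ge> N + 2\<close>, so that
        \<open>j - 2\<close> is a genuine index past \<open>N\<close>.\<close>
      define j where "j = (LEAST j. eps j \<le> \<epsilon>)"
      have j: "eps j \<le> \<epsilon>" unfolding j_def by (rule LeastI_ex) fact
      have "Suc N < j"
      proof (rule ccontr)
        assume "\<not> Suc N < j"
        then have "eps (Suc N) \<le> eps j" by (intro eps_antimono) auto
        with j \<epsilon>(2) show False by simp
      qed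
      define i where "i = j - 2"
      have i: "j = Suc (Suc i)" "N \<le> i" using \<open>Suc N < j\<close> by (auto simp: i_def)
      have "\<epsilon> < eps (Suc i)" using not_less_Least[of "Suc i" "\<lambda>j. eps j \<le> \<epsilon>"] i(1) unfolding j_def[symmetric] by auto
      then have \<epsilon>i: "eps (Suc (Suc i)) \<le> \<epsilon>" "\<epsilon> \<le> eps (Suc i)" using j i(1) by auto
      have e1: "0 < eps (Suc (Suc i))" "0 < eps (Suc i)" by (rule eps)+
      have Bn: "0 \<le> B i" for i unfolding B_def set_lebesgue_integral_def using trap(2) by (intro integral_nonneg_AE) auto
      have "B (Suc (Suc i)) \<le> Oc \<epsilon>" using BO[of "Suc (Suc i)"] Omono[OF \<epsilon>i(1)] by linarith
      then have "lo i \<le> Oc \<epsilon> / (2 * \<epsilon>)" unfolding lo_def using \<epsilon>(1) \<epsilon>i(2) Bn[of "Suc (Suc i)"] by (intro frac_le) auto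
      moreover have "Oc \<epsilon> \<le> B i" using OB[of i] Omono[OF \<epsilon>i(2)] by linarith
      then have "Oc \<epsilon> / (2 * \<epsilon>) \<le> up i" unfolding up_def using e1 \<epsilon>i(1) Bn[of i] by (intro frac_le) auto
      ultimately show ?thesis using N(1)[OF i(2)] N(2)[OF i(2)] by (auto simp: dist_real_def abs_less_iff)
    qed
    then show "eventually (\<lambda>\<epsilon>. dist (1 / (2 * \<epsilon>) * Oc \<epsilon>) c < e) (at_right 0)"
      unfolding eventually_at_right_field using eps(1)[of "Suc N"] by blast
  qed
  then have "Lim (at_right 0) (\<lambda>\<epsilon>. 1 / (2 * \<epsilon>) * Oc \<epsilon>) = c"
    by (intro tendsto_Lim trivial_limit_at_right_real)
  then show ?thesis unfolding local_time_def Oc_def using a_nz[of y] by (simp add: c_def)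
qed

theorem local_time_inf_law:
  obtains L :: "'w \<Rightarrow> real" where "L \<in> borel_measurable M" "AE \<omega> in M. 0 \<le> L \<omega>"
    "AE \<omega> in M. local_time_inf a X y \<omega> = ereal (L \<omega>)"
    "\<And>l. 0 \<le> l \<Longrightarrow> expectation (\<lambda>\<omega>. exp (- l * L \<omega>)) = (\<psi> + l * v x) / (\<psi> + l)"
proof (rule total_local_time)
  fix L :: "'w \<Rightarrow> real" assume L: "L \<in> borel_measurable M" "AE \<omega> in M. 0 \<le> L \<omega>"
    "AE \<omega> in M. (\<lambda>i. occ (wt i) \<omega>) \<longlonglongrightarrow> L \<omega>"
    "\<And>l. 0 \<le> l \<Longrightarrow> expectation (\<lambda>\<omega>. exp (- l * L \<omega>)) = (\<psi> + l * v x) / (\<psi> + l)"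
  have "AE \<omega> in M. local_time_inf a X y \<omega> = ereal (L \<omega>)"
    using X_leaves_compacts L(3)
  proof eventually_elim
    case (elim \<omega>)
    obtain T where T: "0 \<le> T" "\<And>t. T \<le> t \<Longrightarrow> \<bar>y\<bar> + 1 < \<bar>X t \<omega>\<bar>" using elim(1) by blast
    have "eventually (\<lambda>t. ereal (local_time a X t y \<omega>) = ereal (L \<omega>)) at_top"
      using eventually_ge_at_top[of T] by eventually_elim (use local_time_eq[OF T _ elim(2)] in simp)
    then have "((\<lambda>t. ereal (local_time a X t y \<omega>)) \<longlongrightarrow> ereal (L \<omega>)) at_top" by (rule tendsto_eventually)
    then show ?case unfolding local_time_inf_def by (intro tendsto_Lim) auto
  qed
  then show thesis by (rule that[OF L(1,2) _ L(4)])
qed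

end

section \<open>From the Laplace transform to the law\<close>

text \<open>Expand the exponential: for a variable in \<open>[0, 1]\<close> the series is dominated
  by that of \<open>exp \<bar>t\<bar>\<close>, so the moments determine the characteristic
  function.\<close>

lemma char_power_series:
  fixes U :: "'c \<Rightarrow> real"
  assumes "prob_space M1" and [measurable]: "U \<in> borel_measurable M1" and U: "AE \<omega> in M1. 0 \<le> U \<omega> \<and> U \<omega> \<le> 1"
  shows "(\<lambda>j. (\<i> * complex_of_real t) ^ j /\<^sub>R fact j * complex_of_real (LINT \<omega>|M1. U \<omega> ^ j)) sums char (distr M1 borel U) t"
proof -
  interpret prob_space M1 by fact
  define f where "f j \<omega> = (\<i> * complex_of_real t) ^ j /\<^sub>R fact j * complex_of_real (U \<omega> ^ j)" for j \<omega>
  have [measurable]: "f j \<in> borel_measurable M1" for j unfolding f_def scaleR_conv_of_real by measurable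
  have nf: "AE \<omega> in M1. \<forall>j. norm (f j \<omega>) \<le> \<bar>t\<bar> ^ j / fact j" using U
  proof eventually_elim
    case (elim \<omega>)
    have "norm (f j \<omega>) \<le> \<bar>t\<bar> ^ j / fact j" for j
    proof -
      have "norm (f j \<omega>) = \<bar>t\<bar> ^ j / fact j * \<bar>U \<omega>\<bar> ^ j"
        by (simp add: f_def norm_mult norm_power power_abs divide_inverse mult.commute)
      also have "\<dots> \<le> \<bar>t\<bar> ^ j / fact j * 1"
        using elim by (intro mult_left_mono power_le_one) auto
      finally show ?thesis by simp
    qed
    then show ?case by blast
  qed
  have sm: "summable (\<lambda>j. \<bar>t\<bar> ^ j / fact j)" using summable_exp[of "\<bar>t\<bar>"] by (simp add: divide_inverse mult.commute)
  have i: "integrable M1 (f j)" for j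
  proof (rule integrable_const_bound[where B = "\<bar>t\<bar> ^ j / fact j"])
    show "AE \<omega> in M1. norm (f j \<omega>) \<le> \<bar>t\<bar> ^ j / fact j" using nf by eventually_elim blast
  qed measurable
  have "(\<lambda>j. integral\<^sup>L M1 (f j)) sums (LINT \<omega>|M1. (\<Sum>j. f j \<omega>))"
  proof (rule sums_integral[OF i])
    show "AE \<omega> in M1. summable (\<lambda>j. norm (f j \<omega>))"
      using nf by eventually_elim (rule summable_comparison_test'[OF sm, of 0], simp)
    show "summable (\<lambda>j. LINT \<omega>|M1. norm (f j \<omega>))"
    proof (rule summable_comparison_test'[OF sm, of 0])
      fix j
      have "(LINT \<omega>|M1. norm (f j \<omega>)) \<le> (LINT \<omega>|M1. \<bar>t\<bar> ^ j / fact j)"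
        by (rule integral_mono_AE) (use i nf in auto)
      then show "norm (LINT \<omega>|M1. norm (f j \<omega>)) \<le> \<bar>t\<bar> ^ j / fact j" by (simp add: prob_space)
    qed
  qed
  moreover have "(\<Sum>j. f j \<omega>) = iexp (t * U \<omega>)" for \<omega>
  proof -
    have "f j \<omega> = (\<i> * complex_of_real (t * U \<omega>)) ^ j /\<^sub>R fact j" for j
      by (simp add: f_def power_mult_distrib)
    then show ?thesis using sums_unique[OF exp_converges[of "\<i> * complex_of_real (t * U \<omega>)"]] by simp
  qed
  moreover have "integral\<^sup>L M1 (f j) = (\<i> * complex_of_real t) ^ j /\<^sub>R fact j * complex_of_real (LINT \<omega>|M1. U \<omega> ^ j)" for j
    unfolding f_def by (subst integral_mult_right_zero) (simp only: integral_complex_of_real)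
  moreover have "char (distr M1 borel U) t = (LINT \<omega>|M1. iexp (t * U \<omega>))"
    unfolding char_def by (subst integral_distr) auto
  ultimately show ?thesis by simp
qed

text \<open>The values at integers are the moments of \<open>exp (- Y)\<close>, which lies in
  \<open>[0, 1]\<close>; its law gives back that of \<open>Y\<close> through
  \<open>- ln\<close>.\<close>

lemma Laplace_transform_unique:
  fixes Y1 :: "'c \<Rightarrow> real" and Y2 :: "'d \<Rightarrow> real"
  assumes M1: "prob_space M1" and M2: "prob_space M2"
    and Y [measurable]: "Y1 \<in> borel_measurable M1" "Y2 \<in> borel_measurable M2"
    and nn: "AE \<omega> in M1. 0 \<le> Y1 \<omega>" "AE \<omega> in M2. 0 \<le> Y2 \<omega>"
    and eq: "\<And>j::nat. (LINT \<omega>|M1. exp (- real j * Y1 \<omega>)) = (LINT \<omega>|M2. exp (- real j * Y2 \<omega>))"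
  shows "distr M1 borel Y1 = distr M2 borel Y2"
proof -
  have pw: "exp (- z) ^ j = exp (- real j * z)" for z :: real and j by (simp add: exp_of_nat_mult[symmetric])
  have "char (distr M1 borel (\<lambda>\<omega>. exp (- Y1 \<omega>))) t = char (distr M2 borel (\<lambda>\<omega>. exp (- Y2 \<omega>))) t" for t
  proof -
    have "(\<lambda>j. (\<i> * complex_of_real t) ^ j /\<^sub>R fact j * complex_of_real (LINT \<omega>|M1. exp (- Y1 \<omega>) ^ j))
        sums char (distr M1 borel (\<lambda>\<omega>. exp (- Y1 \<omega>))) t"
      by (rule char_power_series[OF M1]) (use nn in auto)
    moreover have "(\<lambda>j. (\<i> * complex_of_real t) ^ j /\<^sub>R fact j * complex_of_real (LINT \<omega>|M2. exp (- Y2 \<omega>) ^ j))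
        sums char (distr M2 borel (\<lambda>\<omega>. exp (- Y2 \<omega>))) t"
      by (rule char_power_series[OF M2]) (use nn in auto)
    ultimately show ?thesis unfolding pw eq by (rule sums_unique2)
  qed
  then have "distr M1 borel (\<lambda>\<omega>. exp (- Y1 \<omega>)) = distr M2 borel (\<lambda>\<omega>. exp (- Y2 \<omega>))"
    by (intro Levy_uniqueness real_distribution.intro real_distribution_axioms.intro
        prob_space.prob_space_distr M1 M2) auto
  then have "distr (distr M1 borel (\<lambda>\<omega>. exp (- Y1 \<omega>))) borel (\<lambda>u. - ln u)
      = distr (distr M2 borel (\<lambda>\<omega>. exp (- Y2 \<omega>))) borel (\<lambda>u. - ln u :: real)" by simp
  then show ?thesis by (simp add: distr_distr o_def)
qed

section \<open>A model for the product of independent Bernoulli and exponential variables\<close>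

lemma (in prob_space) distr_pair_snd:
  assumes "sigma_finite_measure N" shows "distr (M \<Otimes>\<^sub>M N) N snd = N"
proof (intro measure_eqI)
  interpret N: sigma_finite_measure N by fact
  fix A assume A: "A \<in> sets (distr (M \<Otimes>\<^sub>M N) N snd)"
  from A have "emeasure (distr (M \<Otimes>\<^sub>M N) N snd) A = emeasure (M \<Otimes>\<^sub>M N) (space M \<times> A)"
    by (auto simp add: emeasure_distr space_pair_measure dest: sets.sets_into_space intro!: arg_cong2[where f=emeasure])
  with A show "emeasure (distr (M \<Otimes>\<^sub>M N) N snd) A = emeasure N A"
    by (simp add: N.emeasure_pair_measure_Times emeasure_space_1)
qed simp

text \<open>Multiplying the density by \<open>exp (- l * z)\<close> gives, up to the factor
  \<open>\<psi> / (\<psi> + l)\<close>, the exponential density with rate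
  \<open>\<psi> + l\<close>.\<close>

lemma Laplace_exponential:
  assumes "0 < \<psi>" "0 \<le> l"
  shows "(LINT z|density lborel (exponential_density \<psi>). exp (- l * z)) = \<psi> / (\<psi> + l)"
proof -
  have "(LINT z|density lborel (exponential_density \<psi>). exp (- l * z))
    = (LINT z|lborel. exponential_density \<psi> z * exp (- l * z))"
    using assms by (subst integral_density) (auto simp: exponential_density_nonneg)
  also have "\<dots> = (LINT z|lborel. \<psi> / (\<psi> + l) * exponential_density (\<psi> + l) z)"
  proof (intro Bochner_Integration.integral_cong refl)
    have "\<psi> / (\<psi> + l) * ((\<psi> + l) * e) = \<psi> * e" for e using assms by simp
    moreover have "exp (- z * (\<psi> + l)) = exp (- z * \<psi>) * exp (- l * z)" for z
      by (simp add: exp_add[symmetric] algebra_simps)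
    ultimately show "exponential_density \<psi> z * exp (- l * z) = \<psi> / (\<psi> + l) * exponential_density (\<psi> + l) z" for z
      by (simp add: exponential_density_def)
  qed
  also have "\<dots> = \<psi> / (\<psi> + l) * (LINT z|lborel. exponential_density (\<psi> + l) z)" by simp
  also have "(LINT z|lborel. exponential_density (\<psi> + l) z) = 1"
  proof -
    interpret E: prob_space "density lborel (exponential_density (\<psi> + l))"
      by (rule prob_space_exponential_density) (use assms in auto)
    have "(LINT z|density lborel (exponential_density (\<psi> + l)). (1::real)) = (LINT z|lborel. exponential_density (\<psi> + l) z * 1)"
      using assms by (subst integral_density) (auto simp: exponential_density_nonneg)
    then show ?thesis using E.prob_space by simp
  qed
  finally show ?thesis by simp
qed

text \<open>The product of a Bernoulli and an exponential law, with the coordinates as variables;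
  the type \<open>real \<times> real\<close> is the one prescribed by
  \<open>distributed_as_bernoulli_times_exponential\<close>.\<close>

lemma bernoulli_times_exponential:
  assumes \<psi>: "0 < \<psi>" and p: "0 \<le> p" "p \<le> 1"
  obtains N :: "(real \<times> real) measure" where "prob_space N" "fst \<in> borel_measurable N" "snd \<in> borel_measurable N"
    "prob_space.indep_var N borel fst borel snd"
    "measure N {\<omega> \<in> space N. fst \<omega> = 0} = p" "measure N {\<omega> \<in> space N. fst \<omega> = 1} = 1 - p"
    "exponentially_distributed N (\<lambda>\<omega>. ereal (snd \<omega>)) \<psi>"
    "AE \<omega> in N. 0 \<le> fst \<omega> * snd \<omega>"
    "\<And>l. 0 \<le> l \<Longrightarrow> (LINT \<omega>|N. exp (- l * (fst \<omega> * snd \<omega>))) = (\<psi> + l * p) / (\<psi> + l)"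
proof -
  define K where "K = distr (measure_pmf (bernoulli_pmf (1 - p))) borel (\<lambda>b. if b then 1 else 0 :: real)"
  define E where "E = density lborel (exponential_density \<psi>)"
  interpret K: prob_space K unfolding K_def by (rule prob_space.prob_space_distr) (auto intro: prob_space_measure_pmf)
  interpret E: prob_space E unfolding E_def by (rule prob_space_exponential_density[OF \<psi>])
  interpret N: pair_prob_space K E ..
  have sK [measurable_cong]: "sets K = sets borel" by (simp add: K_def)
  have sE [measurable_cong]: "sets E = sets borel" by (simp add: E_def)
  have spK [simp]: "space K = UNIV" by (simp add: K_def)
  have spE [simp]: "space E = UNIV" by (simp add: E_def)
  have mf: "fst \<in> borel_measurable (K \<Otimes>\<^sub>M E)" by measurable
  have ms: "snd \<in> borel_measurable (K \<Otimes>\<^sub>M E)" by measurable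
  have df: "distr (K \<Otimes>\<^sub>M E) borel fst = K"
    using E.distr_pair_fst[of K] by (subst distr_cong[OF refl _ refl, of _ K]) (auto simp: sK)
  have ds: "distr (K \<Otimes>\<^sub>M E) borel snd = E"
    using K.distr_pair_snd[OF E.sigma_finite_measure_axioms] by (subst distr_cong[OF refl _ refl, of _ E]) (auto simp: sE)
  have ind: "N.indep_var borel fst borel snd"
    unfolding N.indep_var_distribution_eq df ds using mf ms
    by (auto intro!: sym[OF distr_id2] sets_pair_measure_cong simp: sK sE)
  have P: "measure (K \<Otimes>\<^sub>M E) {\<omega> \<in> space (K \<Otimes>\<^sub>M E). fst \<omega> \<in> A} = measure_pmf.prob (bernoulli_pmf (1 - p)) {b. (if b then 1 else 0::real) \<in> A}"
    if "A \<in> sets borel" for A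
  proof -
    have "measure (K \<Otimes>\<^sub>M E) {\<omega> \<in> space (K \<Otimes>\<^sub>M E). fst \<omega> \<in> A} = measure (distr (K \<Otimes>\<^sub>M E) borel fst) A"
      using that mf by (subst measure_distr) (auto intro!: arg_cong[where f = "measure _"])
    also have "\<dots> = measure K A" by (simp add: df)
    also have "\<dots> = measure_pmf.prob (bernoulli_pmf (1 - p)) {b. (if b then 1 else 0::real) \<in> A}"
      unfolding K_def using that by (subst measure_distr) (auto simp: vimage_def)
    finally show ?thesis .
  qed
  have P0: "measure (K \<Otimes>\<^sub>M E) {\<omega> \<in> space (K \<Otimes>\<^sub>M E). fst \<omega> = 0} = p"
  proof -
    have "{b. (if b then 1 else 0::real) \<in> {0}} = {False}" by auto
    then show ?thesis using P[of "{0}"] p by (simp add: measure_pmf_single)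
  qed
  have P1: "measure (K \<Otimes>\<^sub>M E) {\<omega> \<in> space (K \<Otimes>\<^sub>M E). fst \<omega> = 1} = 1 - p"
  proof -
    have "{b. (if b then 1 else 0::real) \<in> {1}} = {True}" by auto
    then show ?thesis using P[of "{1}"] p by (simp add: measure_pmf_single)
  qed
  have dist: "distributed (K \<Otimes>\<^sub>M E) lborel snd (exponential_density \<psi>)"
    using ms \<psi> ds unfolding distributed_def E_def
    by (auto cong: distr_cong simp: distr_cong[OF refl sets_lborel refl])
  have ex: "exponentially_distributed (K \<Otimes>\<^sub>M E) (\<lambda>\<omega>. ereal (snd \<omega>)) \<psi>"
    unfolding exponentially_distributed_def
    using ms N.exponential_distributedD_gt[OF dist _ \<psi>] by (auto simp: mult.commute)
  have LKE: "(LINT z|K. g z) = g 1 * (1 - p) + g 0 * p" if "g \<in> borel_measurable borel" for g :: "real \<Rightarrow> real"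
    unfolding K_def using p that by (subst integral_distr) auto
  have nn: "AE \<omega> in K \<Otimes>\<^sub>M E. 0 \<le> fst \<omega> * snd \<omega>"
  proof -
    have "AE k in K. 0 \<le> k" unfolding K_def by (subst AE_distr_iff) auto
    then have "AE \<omega> in distr (K \<Otimes>\<^sub>M E) borel fst. 0 \<le> \<omega>" unfolding df .
    then have 1: "AE \<omega> in K \<Otimes>\<^sub>M E. 0 \<le> fst \<omega>" using mf by (simp add: AE_distr_iff)
    have "AE k in E. 0 \<le> k" unfolding E_def by (subst AE_density) (auto simp: exponential_density_def)
    then have "AE \<omega> in distr (K \<Otimes>\<^sub>M E) borel snd. 0 \<le> \<omega>" unfolding ds .
    then have 2: "AE \<omega> in K \<Otimes>\<^sub>M E. 0 \<le> snd \<omega>" using ms by (simp add: AE_distr_iff)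
    from 1 2 show ?thesis by eventually_elim simp
  qed
  have lap: "(LINT \<omega>|(K \<Otimes>\<^sub>M E). exp (- l * (fst \<omega> * snd \<omega>))) = (\<psi> + l * p) / (\<psi> + l)" if l: "0 \<le> l" for l
  proof -
    have m [measurable]: "(\<lambda>\<omega>. exp (- l * (fst \<omega> * snd \<omega>))) \<in> borel_measurable (K \<Otimes>\<^sub>M E)" using mf ms by measurable
    have i: "integrable (K \<Otimes>\<^sub>M E) (\<lambda>\<omega>. exp (- l * (fst \<omega> * snd \<omega>)))"
    proof (rule N.integrable_const_bound[where B = 1])
      show "AE \<omega> in K \<Otimes>\<^sub>M E. norm (exp (- l * (fst \<omega> * snd \<omega>))) \<le> 1"
        using nn by eventually_elim (use l in simp)
    qed (rule m)
    have "(LINT \<omega>|(K \<Otimes>\<^sub>M E). exp (- l * (fst \<omega> * snd \<omega>))) = (LINT k|K. (LINT z|E. exp (- l * (k * z))))"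
      using N.integral_fst'[OF i] by simp
    also have "\<dots> = (LINT z|E. exp (- l * z)) * (1 - p) + p"
      by (subst LKE) (auto intro!: E.borel_measurable_lebesgue_integral simp: E.prob_space[unfolded spE])
    also have "\<dots> = \<psi> / (\<psi> + l) * (1 - p) + p" unfolding E_def by (subst Laplace_exponential[OF \<psi> l]) simp
    also have "\<dots> = (\<psi> + l * p) / (\<psi> + l)" using \<psi> l by (simp add: field_simps)
    finally show ?thesis .
  qed
  show thesis by (rule that[OF N.prob_space_axioms mf ms ind P0 P1 ex nn lap])
qed

text \<open>\<open>L\<close> has the law of the model because the Laplace transforms agree, and
  \<open>Z\<close> inherits it as an \<open>ereal\<close>-valued variable. For \<open>p = 0\<close>
  the Bernoulli factor is almost surely 1, so the model is exponential.\<close>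

lemma (in prob_space) law_of_Laplace_transform:
  fixes L :: "'a \<Rightarrow> real" and Z :: "'a \<Rightarrow> ereal"
  assumes L: "L \<in> borel_measurable M" "AE \<omega> in M. 0 \<le> L \<omega>" and Z: "Z \<in> borel_measurable M"
    and ZL: "AE \<omega> in M. Z \<omega> = ereal (L \<omega>)"
    and lap: "\<And>l. 0 \<le> l \<Longrightarrow> expectation (\<lambda>\<omega>. exp (- l * L \<omega>)) = (\<psi> + l * p) / (\<psi> + l)"
    and \<psi>: "0 < \<psi>" and p: "0 \<le> p" "p \<le> 1"
  shows "distributed_as_bernoulli_times_exponential M Z p \<psi>" "p = 0 \<Longrightarrow> exponentially_distributed M Z \<psi>"
proof -
  note [measurable] = L(1) Z
  obtain N :: "(real \<times> real) measure" where N: "prob_space N" and [measurable]: "fst \<in> borel_measurable N" "snd \<in> borel_measurable N"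
    and ind: "prob_space.indep_var N borel fst borel snd"
    and pr: "measure N {\<omega> \<in> space N. fst \<omega> = 0} = p" "measure N {\<omega> \<in> space N. fst \<omega> = 1} = 1 - p"
    and ex: "exponentially_distributed N (\<lambda>\<omega>. ereal (snd \<omega>)) \<psi>"
    and nn: "AE \<omega> in N. 0 \<le> fst \<omega> * snd \<omega>"
    and lN: "\<And>l. 0 \<le> l \<Longrightarrow> (LINT \<omega>|N. exp (- l * (fst \<omega> * snd \<omega>))) = (\<psi> + l * p) / (\<psi> + l)"
    by (rule bernoulli_times_exponential[OF \<psi> p]) blast
  interpret N: prob_space N by fact
  have "distr M borel L = distr N borel (\<lambda>\<omega>. fst \<omega> * snd \<omega>)"
    by (rule Laplace_transform_unique) (use L nn lap lN N prob_space_axioms in auto)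
  then have "distr (distr M borel L) borel ereal = distr (distr N borel (\<lambda>\<omega>. fst \<omega> * snd \<omega>)) borel ereal" by simp
  then have "distr M borel (\<lambda>\<omega>. ereal (L \<omega>)) = distr N borel (\<lambda>\<omega>. ereal (fst \<omega> * snd \<omega>))"
    by (simp add: distr_distr o_def)
  moreover have "distr M borel Z = distr M borel (\<lambda>\<omega>. ereal (L \<omega>))"
    using ZL by (intro distr_cong_AE) auto
  ultimately have d: "distr M borel Z = distr N borel (\<lambda>\<omega>. ereal (fst \<omega> * snd \<omega>))" by simp
  show "distributed_as_bernoulli_times_exponential M Z p \<psi>"
    unfolding distributed_as_bernoulli_times_exponential_def
    using Z N ind pr ex d by (intro conjI exI[of _ N] exI[of _ fst] exI[of _ snd]) auto
  show "exponentially_distributed M Z \<psi>" if "p = 0"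
    unfolding exponentially_distributed_def
  proof (intro conjI allI impI Z)
    fix l :: real assume l: "0 \<le> l"
    have k: "AE \<omega> in N. fst \<omega> = 1" using pr(2) that by (subst N.prob_Collect_eq_1[symmetric]) auto
    have "measure M {\<omega> \<in> space M. ereal l < Z \<omega>} = measure (distr M borel Z) {ereal l<..}"
      by (subst measure_distr) (auto intro!: arg_cong[where f = "measure _"])
    also have "\<dots> = measure N {\<omega> \<in> space N. ereal l < ereal (fst \<omega> * snd \<omega>)}"
      unfolding d by (subst measure_distr) (auto intro!: arg_cong[where f = "measure _"])
    also have "\<dots> = measure N {\<omega> \<in> space N. ereal l < ereal (snd \<omega>)}"
      by (rule N.finite_measure_eq_AE) (use k in auto)
    also have "\<dots> = exp (- \<psi> * l)" using ex l by (simp add: exponentially_distributed_def)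
    finally show "measure M {\<omega> \<in> space M. ereal l < Z \<omega>} = exp (- \<psi> * l)" .
  qed
qed

section \<open>The scale function\<close>

lemma interval_integral_has_derivative:
  fixes f :: "real \<Rightarrow> real"
  assumes f: "continuous_on UNIV f"
  shows "((\<lambda>z. LBINT u=ereal c..ereal z. f u) has_real_derivative f z) (at z)"
proof -
  define m where "m = min c z - 1"
  define M where "M = max c z + 1"
  have "((\<lambda>z. LBINT u=ereal c..ereal z. f u) has_vector_derivative f z) (at z within {m..M})"
    by (rule interval_integral_FTC2) (auto simp: m_def M_def intro: continuous_on_subset[OF f])
  moreover have "at z within {m..M} = at z"
    by (rule at_within_Icc_at) (auto simp: m_def M_def)
  ultimately show ?thesis by (simp add: has_real_derivative_iff_has_vector_derivative)
qed

text \<open>An increasing function either grows to infinity or tends to its supremum; strict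
  monotonicity shows that the supremum is not attained.\<close>

lemma deriv_pos_limit_at_top:
  fixes s p :: "real \<Rightarrow> real"
  assumes d: "\<And>z. (s has_real_derivative p z) (at z)" and p: "\<And>z. 0 < p z"
  obtains "filterlim s at_top at_top" "((\<lambda>z. ereal (s z)) \<longlongrightarrow> \<infinity>) at_top"
  | S where "(s \<longlongrightarrow> S) at_top" "\<And>z. s z < S"
proof -
  have sm: "s z < s w" if "z < w" for z w using DERIV_pos_imp_increasing[OF that] d p by blast
  then have m: "s z \<le> s w" if "z \<le> w" for z w using that by (metis order.order_iff_strict)
  show thesis
  proof (cases "bdd_above (range s)")
    case True
    define S where "S = (SUP z. s z)"
    have le: "s z \<le> S" for z unfolding S_def by (rule cSUP_upper[OF _ True]) simp
    have "(s \<longlongrightarrow> S) at_top"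
    proof (rule increasing_tendsto)
      show "\<forall>\<^sub>F z in at_top. s z \<le> S" using le by simp
      fix r assume "r < S"
      then obtain z where z: "r < s z" unfolding S_def using less_cSUP_iff[OF _ True, of r] by auto
      then show "\<forall>\<^sub>F w in at_top. r < s w" by (intro eventually_mono[OF eventually_ge_at_top[of z]] less_le_trans[OF z m])
    qed
    moreover have "s z < S" for z using sm[of z "z + 1"] le[of "z + 1"] by simp
    ultimately show ?thesis by (rule that(2))
  next
    case False
    have "filterlim s at_top at_top" unfolding filterlim_at_top
    proof
      fix r
      obtain z where z: "r \<le> s z" using False unfolding bdd_above_def by (metis linear rangeE)
      then show "\<forall>\<^sub>F w in at_top. r \<le> s w" by (intro eventually_mono[OF eventually_ge_at_top[of z]] order_trans[OF z m])
    qed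
    then show ?thesis using that(1) by (simp add: tendsto_PInfty_eq_at_top)
  qed
qed

text \<open>The mirror image: the dichotomy at the right end, applied to
  \<open>- s (- z)\<close>.\<close>

lemma deriv_pos_limit_at_bot:
  fixes s p :: "real \<Rightarrow> real"
  assumes d: "\<And>z. (s has_real_derivative p z) (at z)" and p: "\<And>z. 0 < p z"
  obtains "filterlim s at_bot at_bot" "((\<lambda>z. ereal (s z)) \<longlongrightarrow> - \<infinity>) at_bot"
  | S where "(s \<longlongrightarrow> S) at_bot" "\<And>z. S < s z"
proof -
  have d': "((\<lambda>z. - s (- z)) has_real_derivative p (- z)) (at z)" for z
  proof -
    have "((\<lambda>z. s (- z)) has_real_derivative p (- z) * (- 1)) (at z)"
      by (rule DERIV_chain2[OF d]) (auto intro!: derivative_eq_intros)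
    then show ?thesis using DERIV_minus by fastforce
  qed
  show thesis
  proof (rule deriv_pos_limit_at_top[OF d'])
    show "0 < p (- z)" for z by (rule p)
    assume "filterlim (\<lambda>z. - s (- z)) at_top at_top"
    then have "filterlim (\<lambda>z. s (- z)) at_bot at_top" by (simp add: filterlim_uminus_at_bot)
    then have "filterlim s at_bot at_bot" by (subst filterlim_at_bot_mirror)
    then show thesis by (intro that(1) tendsto_MInfty[THEN iffD2] allI) (auto simp: filterlim_at_bot_dense)
  next
    fix S assume S: "((\<lambda>z. - s (- z)) \<longlongrightarrow> S) at_top" "\<And>z. - s (- z) < S"
    have "((\<lambda>z. s (- z)) \<longlongrightarrow> - S) at_top" using tendsto_minus[OF S(1)] by simp
    then have "(s \<longlongrightarrow> - S) at_bot" by (subst filterlim_at_bot_mirror)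
    moreover have "- S < s z" for z using S(2)[of "- z"] by simp
    ultimately show thesis by (rule that(2))
  qed
qed

text \<open>The scale function depends on the coefficients alone, so it is treated apart from any
  process.\<close>

locale diffusion_coefficients =
  fixes b a :: "real \<Rightarrow> real"
  assumes b_co: "continuous_on UNIV b" and a_co: "continuous_on UNIV a" and a_nz: "\<And>z. a z \<noteq> 0"
begin

lemma scale_density_pos: "0 < scale_density b a c z" by (simp add: scale_density_def)

lemma scale_density_deriv:
  "((\<lambda>z. scale_density b a c z) has_real_derivative - 2 * b z / (a z)\<^sup>2 * scale_density b a c z) (at z)"
proof -
  have "continuous_on UNIV (\<lambda>u. b u / (a u)\<^sup>2)" by (intro continuous_intros b_co a_co) (simp add: a_nz)
  note * = interval_integral_has_derivative[OF this, of c z]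
  show ?thesis unfolding scale_density_def by (auto intro!: derivative_eq_intros *)
qed

lemma Phi_deriv: "((\<lambda>z. Phi b a c z) has_real_derivative scale_density b a c z) (at z)"
proof -
  have "continuous_on UNIV (\<lambda>z. scale_density b a c z)"
    using scale_density_deriv by (intro continuous_at_imp_continuous_on ballI DERIV_isCont)
  then show ?thesis unfolding Phi_def by (rule interval_integral_has_derivative)
qed

section \<open>Change of the base point and the limits of the scale\<close>

lemma scale_self [simp]: "scale_density b a c c = 1" "Phi b a c c = 0"
  by (simp_all add: scale_density_def Phi_def)

text \<open>Both sides solve the same linear first-order equation in \<open>z\<close>, so their
  quotient is constant; its value is read off at \<open>z = d\<close>.\<close>

lemma scale_density_change: "scale_density b a c z = scale_density b a c d * scale_density b a d z"
proof -
  have "((\<lambda>z. scale_density b a c z / scale_density b a d z) has_real_derivative 0) (at z)" for z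
    using scale_density_pos[of d z]
    by (auto intro!: derivative_eq_intros scale_density_deriv simp: divide_simps)
  then have "scale_density b a c z / scale_density b a d z = scale_density b a c d / scale_density b a d d"
    by (intro DERIV_isconst_all) auto
  then show ?thesis using scale_density_pos[of d z] by (simp add: field_simps)
qed

text \<open>Scales with different base points are affine images of each other with positive slope,
  so finiteness of a limit at either end is independent of the base point.\<close>

lemma Phi_change: "Phi b a c z = Phi b a c d + scale_density b a c d * Phi b a d z"
proof -
  have "((\<lambda>z. Phi b a c z - scale_density b a c d * Phi b a d z) has_real_derivative 0) (at z)" for z
    using scale_density_change[of c z d] by (auto intro!: derivative_eq_intros Phi_deriv)
  then have "Phi b a c z - scale_density b a c d * Phi b a d z = Phi b a c d - scale_density b a c d * Phi b a d d"
    by (intro DERIV_isconst_all) auto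
  then show ?thesis by simp
qed

lemma Phi_pinf_cases:
  obtains "filterlim (Phi b a c) at_top at_top" "Phi_pinf b a c = \<infinity>"
  | S where "(Phi b a c \<longlongrightarrow> S) at_top" "\<And>z. Phi b a c z < S" "Phi_pinf b a c = ereal S" "0 < S"
proof (rule deriv_pos_limit_at_top[OF Phi_deriv[of c] scale_density_pos])
  assume 1: "filterlim (Phi b a c) at_top at_top" "((\<lambda>z. ereal (Phi b a c z)) \<longlongrightarrow> \<infinity>) at_top"
  then show thesis by (intro that(1)) (auto simp: Phi_pinf_def intro!: tendsto_Lim)
next
  fix S assume 2: "(Phi b a c \<longlongrightarrow> S) at_top" "\<And>z. Phi b a c z < S"
  moreover have "Phi_pinf b a c = ereal S"
    unfolding Phi_pinf_def using 2(1) by (intro tendsto_Lim) auto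
  ultimately show thesis using 2(2)[of c] by (intro that(2)) auto
qed

lemma Phi_minf_cases:
  obtains "filterlim (Phi b a c) at_bot at_bot" "Phi_minf b a c = - \<infinity>"
  | S where "(Phi b a c \<longlongrightarrow> S) at_bot" "\<And>z. S < Phi b a c z" "Phi_minf b a c = ereal S" "S < 0"
proof (rule deriv_pos_limit_at_bot[OF Phi_deriv[of c] scale_density_pos])
  assume 1: "filterlim (Phi b a c) at_bot at_bot" "((\<lambda>z. ereal (Phi b a c z)) \<longlongrightarrow> - \<infinity>) at_bot"
  then show thesis by (intro that(1)) (auto simp: Phi_minf_def intro!: tendsto_Lim)
next
  fix S assume 2: "(Phi b a c \<longlongrightarrow> S) at_bot" "\<And>z. S < Phi b a c z"
  moreover have "Phi_minf b a c = ereal S"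
    unfolding Phi_minf_def using 2(1) by (intro tendsto_Lim) auto
  ultimately show thesis using 2(2)[of c] by (intro that(2)) auto
qed

text \<open>Bridges the base points: the case distinction of the theorem is made at 0, transience at
  some point, and the parameters of the law at \<open>y\<close>.\<close>

lemma Phi_pinf_infinite: "Phi_pinf b a c = \<infinity> \<longleftrightarrow> Phi_pinf b a d = \<infinity>"
proof -
  have *: "Phi_pinf b a c = \<infinity>" if d: "Phi_pinf b a d = \<infinity>" for c d
  proof (rule Phi_pinf_cases[of c])
    fix S assume S: "\<And>z. Phi b a c z < S"
    have f: "filterlim (Phi b a d) at_top at_top" by (rule Phi_pinf_cases[of d]) (use d in auto)
    obtain z where "(S - Phi b a c d) / scale_density b a c d < Phi b a d z"
      using filterlim_at_top_dense[THEN iffD1, OF f] eventually_happens' trivial_limit_at_top_linorder by blast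
    then have "S < Phi b a c z"
      unfolding Phi_change[of c z d] using scale_density_pos[of c d] by (simp add: field_simps)
    with S[of z] show ?thesis by simp
  qed
  show ?thesis using *[of c d] *[of d c] by blast
qed

lemma Phi_minf_infinite: "Phi_minf b a c = - \<infinity> \<longleftrightarrow> Phi_minf b a d = - \<infinity>"
proof -
  have *: "Phi_minf b a c = - \<infinity>" if d: "Phi_minf b a d = - \<infinity>" for c d
  proof (rule Phi_minf_cases[of c])
    fix S assume S: "\<And>z. S < Phi b a c z"
    have f: "filterlim (Phi b a d) at_bot at_bot" by (rule Phi_minf_cases[of d]) (use d in auto)
    obtain z where "Phi b a d z < (S - Phi b a c d) / scale_density b a c d"
      using filterlim_at_bot_dense[THEN iffD1, OF f] eventually_happens' trivial_limit_at_bot_linorder by blast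
    then have "Phi b a c z < S"
      unfolding Phi_change[of c z d] using scale_density_pos[of c d] by (simp add: field_simps)
    with S[of z] show ?thesis by simp
  qed
  show ?thesis using *[of c d] *[of d c] by blast
qed

text \<open>An infinite limit gives 0, because \<open>1 / \<infinity> = 0\<close> in
  \<open>ereal\<close>; this is the encoding that \<open>scaled_diffusion\<close> expects.\<close>

definition kp where "kp y = real_of_ereal (1 / Phi_pinf b a y)"
definition km where "km y = - real_of_ereal (1 / Phi_minf b a y)"

lemma kp_props:
  "0 \<le> kp y" "kp y * Phi b a y z < 1" "kp y = 0 \<longleftrightarrow> Phi_pinf b a y = \<infinity>"
  "kp y = 0 \<Longrightarrow> filterlim (Phi b a y) at_top at_top"
  "0 < kp y \<Longrightarrow> ((\<lambda>z. kp y * Phi b a y z) \<longlongrightarrow> 1) at_top"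
  "1 / Phi_pinf b a y = ereal (kp y)"
  "ereal u / Phi_pinf b a y = ereal (kp y * u)"
proof -
  have "0 \<le> kp y \<and> kp y * Phi b a y z < 1 \<and> (kp y = 0) = (Phi_pinf b a y = \<infinity>) \<and>
    (kp y = 0 \<longrightarrow> filterlim (Phi b a y) at_top at_top) \<and> (0 < kp y \<longrightarrow> ((\<lambda>z. kp y * Phi b a y z) \<longlongrightarrow> 1) at_top) \<and>
    1 / Phi_pinf b a y = ereal (kp y) \<and> ereal u / Phi_pinf b a y = ereal (kp y * u)"
  proof (rule Phi_pinf_cases[of y])
    assume S: "(filterlim (Phi b a y)) at_top at_top" "Phi_pinf b a y = \<infinity>"
    then have "kp y = 0" by (simp add: kp_def)
    with S show ?thesis
      by (simp add: zero_ereal_def)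
  next
    fix S assume S: "(Phi b a y \<longlongrightarrow> S) at_top" "\<And>z. Phi b a y z < S" "Phi_pinf b a y = ereal S" "0 < S"
    then have k: "kp y = 1 / S" by (simp add: kp_def one_ereal_def)
    have "((\<lambda>z. kp y * Phi b a y z) \<longlongrightarrow> 1 / S * S) at_top" unfolding k by (intro tendsto_intros S(1))
    then have "((\<lambda>z. kp y * Phi b a y z) \<longlongrightarrow> 1) at_top" using S(4) by simp
    with S k show ?thesis
      by (simp add: one_ereal_def)
  qed
  then show "0 \<le> kp y" "kp y * Phi b a y z < 1" "kp y = 0 \<longleftrightarrow> Phi_pinf b a y = \<infinity>"
    "kp y = 0 \<Longrightarrow> filterlim (Phi b a y) at_top at_top"
    "0 < kp y \<Longrightarrow> ((\<lambda>z. kp y * Phi b a y z) \<longlongrightarrow> 1) at_top"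
    "1 / Phi_pinf b a y = ereal (kp y)" "ereal u / Phi_pinf b a y = ereal (kp y * u)"
    by blast+
qed

lemma km_props:
  "0 \<le> km y" "- km y * Phi b a y z < 1" "km y = 0 \<longleftrightarrow> Phi_minf b a y = - \<infinity>"
  "km y = 0 \<Longrightarrow> filterlim (Phi b a y) at_bot at_bot"
  "0 < km y \<Longrightarrow> ((\<lambda>z. - km y * Phi b a y z) \<longlongrightarrow> 1) at_bot"
  "1 / Phi_minf b a y = ereal (- km y)"
  "ereal u / Phi_minf b a y = ereal (- km y * u)"
proof -
  have "0 \<le> km y \<and> - km y * Phi b a y z < 1 \<and> (km y = 0) = (Phi_minf b a y = - \<infinity>) \<and>
    (km y = 0 \<longrightarrow> filterlim (Phi b a y) at_bot at_bot) \<and> (0 < km y \<longrightarrow> ((\<lambda>z. - km y * Phi b a y z) \<longlongrightarrow> 1) at_bot) \<and>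
    1 / Phi_minf b a y = ereal (- km y) \<and> ereal u / Phi_minf b a y = ereal (- km y * u)"
  proof (rule Phi_minf_cases[of y])
    assume S: "(filterlim (Phi b a y)) at_bot at_bot" "Phi_minf b a y = - \<infinity>"
    then have "km y = 0" by (simp add: km_def)
    with S show ?thesis
      by (simp add: zero_ereal_def)
  next
    fix S assume S: "(Phi b a y \<longlongrightarrow> S) at_bot" "\<And>z. S < Phi b a y z" "Phi_minf b a y = ereal S" "S < 0"
    then have k: "km y = - 1 / S" by (simp add: km_def one_ereal_def)
    have "((\<lambda>z. - km y * Phi b a y z) \<longlongrightarrow> - (- 1 / S) * S) at_bot" unfolding k by (intro tendsto_intros S(1))
    then have "((\<lambda>z. - km y * Phi b a y z) \<longlongrightarrow> 1) at_bot" using S(4) by simp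
    moreover have "- km y * Phi b a y z < 1" using S(2)[of z] S(4) k by (simp add: divide_less_eq)
    moreover have "0 < km y" using S(4) k by (simp add: divide_neg_neg)
    ultimately show ?thesis
      using S k by (simp add: one_ereal_def)
  qed
  then show "0 \<le> km y" "- km y * Phi b a y z < 1" "km y = 0 \<longleftrightarrow> Phi_minf b a y = - \<infinity>"
    "km y = 0 \<Longrightarrow> filterlim (Phi b a y) at_bot at_bot"
    "0 < km y \<Longrightarrow> ((\<lambda>z. - km y * Phi b a y z) \<longlongrightarrow> 1) at_bot"
    "1 / Phi_minf b a y = ereal (- km y)" "ereal u / Phi_minf b a y = ereal (- km y * u)"
    by blast+
qed

lemma psi0_eq: "psi0 b a y = (kp y + km y) / 2"
  unfolding psi0_def kp_props(6) km_props(6) by (simp add: one_ereal_def numeral_eq_ereal)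

lemma kpm_pos:
  assumes "transient b a" shows "0 < kp y + km y"
proof -
  obtain c where c: "\<bar>Phi_pinf b a c\<bar> \<noteq> \<infinity> \<or> \<bar>Phi_minf b a c\<bar> \<noteq> \<infinity>" by (rule exE[OF assms[unfolded transient_def]])
  then have "Phi_pinf b a c \<noteq> \<infinity> \<or> Phi_minf b a c \<noteq> - \<infinity>" by auto
  then have "kp y \<noteq> 0 \<or> km y \<noteq> 0"
    using Phi_pinf_infinite[of c y] Phi_minf_infinite[of c y] kp_props(3)[of y] km_props(3)[of y] by blast
  then show ?thesis using kp_props(1)[of y] km_props(1)[of y] by linarith
qed

lemma Phi_sign: "z \<le> y \<Longrightarrow> Phi b a y z \<le> 0" "y \<le> z \<Longrightarrow> 0 \<le> Phi b a y z"
proof -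
  have "Phi b a y u \<le> Phi b a y w" if "u \<le> w" for u w
    using DERIV_nonneg_imp_nondecreasing[OF that, of "Phi b a y"] Phi_deriv scale_density_pos less_imp_le by metis
  from this[of z y] this[of y z] show "z \<le> y \<Longrightarrow> Phi b a y z \<le> 0" "y \<le> z \<Longrightarrow> 0 \<le> Phi b a y z" by simp_all
qed

end

section \<open>Modification to processes with continuous paths everywhere\<close>

context complete_measure
begin

text \<open>Completeness is what makes this true. It is used for \<open>local_time_inf\<close>,
  which is identified with a measurable variable almost surely only.\<close>

lemma borel_measurable_AE_eq:
  assumes f: "f \<in> borel_measurable M" and eq: "AE \<omega> in M. f \<omega> = g \<omega>"
  shows "g \<in> borel_measurable M"
proof (rule measurableI)
  fix A :: "'b set" assume A: "A \<in> sets borel"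
  show "g -` A \<inter> space M \<in> sets M"
    by (rule in_sets_AE[OF _ measurable_sets[OF f A]]) (use eq in auto)
qed simp

lemma tendsto_0_in_prob_AE_eq:
  assumes t: "tendsto_0_in_prob M Y" and eq: "\<And>k. AE \<omega> in M. Y k \<omega> = Y' k \<omega>"
  shows "tendsto_0_in_prob M Y'"
proof -
  have Y [measurable]: "Y k \<in> borel_measurable M" for k using t by (simp add: tendsto_0_in_prob_def)
  then have [measurable]: "Y' k \<in> borel_measurable M" for k by (rule borel_measurable_AE_eq[OF _ eq])
  have "measure M {\<omega> \<in> space M. ennreal e < Y k \<omega>} = measure M {\<omega> \<in> space M. ennreal e < Y' k \<omega>}" for e k
    by (rule measure_eq_AE) (use eq[of k] in auto)
  with t show ?thesis by (simp add: tendsto_0_in_prob_def)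
qed

end

lemma simple_process_nonneg:
  assumes "simple_process F m t z" "i \<le> m" shows "0 \<le> t i"
  using assms(2)
proof (induction i)
  case (Suc i)
  with assms(1) have "t i \<le> t (Suc i)" by (simp add: simple_process_def)
  with Suc show ?case by simp
qed (use assms(1) in \<open>simp add: simple_process_def\<close>)

text \<open>The local time looks at the path at nonnegative times only, so passing to the continuous
  modification leaves it unchanged almost surely.\<close>

lemma local_time_inf_cong:
  assumes "\<And>t. 0 \<le> t \<Longrightarrow> X t \<omega> = X' t \<omega>"
  shows "local_time_inf a X y \<omega> = local_time_inf a X' y \<omega>"
proof -
  have "(LBINT s:{0..t}. indicator {s. \<bar>X s \<omega> - y\<bar> \<le> \<epsilon>} s)
    = (LBINT s:{0..t}. indicator {s. \<bar>X' s \<omega> - y\<bar> \<le> \<epsilon>} s :: real)" for t \<epsilon>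
    unfolding set_lebesgue_integral_def
    by (intro Bochner_Integration.integral_cong) (auto simp: indicator_def assms)
  then show ?thesis by (simp add: local_time_inf_def local_time_def)
qed

text \<open>The exceptional null set lies in \<open>F 0\<close> because the filtration is complete,
  so redefining both processes on it keeps them adapted; laws, independence and convergence in
  probability are insensitive to it. The integral \<open>I\<close> disappears by inserting the
  equation for \<open>X\<close>.\<close>

lemma continuous_modification:
  assumes cfp: "complete_filtered_prob_space M F" and W: "wiener_process M F W"
    and a: "continuous_on UNIV a" and b: "continuous_on UNIV b" and nz: "\<And>z. a z \<noteq> 0"
    and sde: "sde_solution M F W b a x X"
  obtains X' W' n \<tau> \<zeta> where "diffusion M F W' b a x X' n \<tau> \<zeta>" "AE \<omega> in M. \<forall>t\<ge>0. X t \<omega> = X' t \<omega>"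
proof -
  interpret complete_filtered_prob_space M F by fact
  obtain I where X_ad: "adapted_process F X" and X_co: "continuous_paths M X"
    and I: "ito_integral M F W (\<lambda>t \<omega>. a (X t \<omega>)) I"
    and eq: "AE \<omega> in M. \<forall>t\<ge>0. X t \<omega> = x + (LBINT s:{0..t}. b (X s \<omega>)) + I t \<omega>"
    using sde by (auto simp: sde_solution_def)
  obtain n \<tau> \<zeta> where sp: "\<And>k. simple_process F (n k) (\<tau> k) (\<zeta> k)"
    and int: "\<And>T. 0 \<le> T \<Longrightarrow> tendsto_0_in_prob M (\<lambda>k \<omega>. \<integral>\<^sup>+s\<in>{0..T}.
             ennreal ((simple_value (n k) (\<tau> k) (\<zeta> k) s \<omega> - a (X s \<omega>))\<^sup>2) \<partial>lborel)"
    and lim: "\<And>T. 0 \<le> T \<Longrightarrow> tendsto_0_in_prob M (\<lambda>k \<omega>.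
             ennreal \<bar>simple_integral W (n k) (\<tau> k) (\<zeta> k) T \<omega> - I T \<omega>\<bar>)"
    using I unfolding ito_integral_def by (elim conjE exE) blast
  have W_ad: "adapted_process F W" and W_co: "continuous_paths M W"
    and W_dist: "\<And>s t. 0 \<le> s \<Longrightarrow> s < t \<Longrightarrow>
        distributed M lborel (\<lambda>\<omega>. W t \<omega> - W s \<omega>) (normal_density 0 (sqrt (t - s)))"
    and W_indep: "\<And>s t. 0 \<le> s \<Longrightarrow> s < t \<Longrightarrow> indep_set (sets (F s))
          {(\<lambda>\<omega>. W t \<omega> - W s \<omega>) -` B \<inter> space M | B. B \<in> sets borel}"
    using W by (auto simp: wiener_process_def)
  have "AE \<omega> in M. continuous_on {0..} (\<lambda>t. X t \<omega>) \<and> continuous_on {0..} (\<lambda>t. W t \<omega>) \<and>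
      (\<forall>t\<ge>0. X t \<omega> = x + (LBINT s:{0..t}. b (X s \<omega>)) + I t \<omega>)"
    using X_co W_co eq unfolding continuous_paths_def by eventually_elim simp
  then obtain N0 where N0: "N0 \<in> null_sets M" and good: "\<And>\<omega>. \<omega> \<in> space M - N0 \<Longrightarrow>
      continuous_on {0..} (\<lambda>t. X t \<omega>) \<and> continuous_on {0..} (\<lambda>t. W t \<omega>) \<and>
      (\<forall>t\<ge>0. X t \<omega> = x + (LBINT s:{0..t}. b (X s \<omega>)) + I t \<omega>)"
    by (rule AE_E3) blast
  define G where "G = space M - N0"
  \<comment> \<open>Constant on the exceptional set, and frozen at the value of time 0 for negative
    times, so as to be continuous on the whole line.\<close>
  define X' where "X' t \<omega> = (if \<omega> \<in> G then X (max t 0) \<omega> else x)" for t \<omega>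
  define W' where "W' t \<omega> = (if \<omega> \<in> G then W (max t 0) \<omega> else 0)" for t \<omega>
  have AE_G: "AE \<omega> in M. \<omega> \<in> G" using AE_not_in[OF N0] by (auto simp: G_def)
  have X': "X' t \<omega> = X t \<omega>" and W': "W' t \<omega> = W t \<omega>" if "\<omega> \<in> G" "0 \<le> t" for t \<omega>
    using that by (simp_all add: X'_def W'_def max_absorb1)
  have spF: "space (F t) = space M" for t using subalg[of t] by (simp add: subalgebra_def)
  have GF: "G \<in> sets (F t)" if "0 \<le> t" for t
  proof -
    have "N0 \<in> sets (F t)" using N0 null_sets_F0 sets_F_mono[OF that] by blast
    then show ?thesis unfolding G_def using sets.compl_sets[of N0 "F t"] by (simp add: spF)
  qed
  have ad: "X' t \<in> borel_measurable (F t)" "W' t \<in> borel_measurable (F t)" if t: "0 \<le> t" for t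
  proof -
    have "X t \<in> borel_measurable (F t)" "W t \<in> borel_measurable (F t)"
      using X_ad W_ad t by (auto simp: adapted_process_def)
    moreover have "G \<inter> space (F t) \<in> sets (F t)" using GF[OF t] by auto
    ultimately show "X' t \<in> borel_measurable (F t)" "W' t \<in> borel_measurable (F t)"
      unfolding X'_def W'_def using t by (simp_all add: max_absorb1 measurable_If_set)
  qed
  have mM: "f \<in> borel_measurable M" if "f \<in> borel_measurable (F t)" for f :: "'a \<Rightarrow> real" and t
    using that subalg measurable_from_subalg by blast
  have co: "continuous_on UNIV (\<lambda>t. X' t \<omega>)" "continuous_on UNIV (\<lambda>t. W' t \<omega>)" for \<omega>
  proof -
    have *: "continuous_on UNIV (\<lambda>t. g (max t 0))" if "continuous_on {0..} g" for g :: "real \<Rightarrow> real"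
      by (rule continuous_on_compose2[OF that]) (auto intro!: continuous_intros)
    have "continuous_on UNIV (\<lambda>t. X' t \<omega>) \<and> continuous_on UNIV (\<lambda>t. W' t \<omega>)"
    proof (cases "\<omega> \<in> G")
      case True
      then have "continuous_on {0..} (\<lambda>t. X t \<omega>)" "continuous_on {0..} (\<lambda>t. W t \<omega>)"
        using good unfolding G_def by blast+
      from this[THEN *] True show ?thesis by (simp add: X'_def W'_def)
    qed (simp add: X'_def W'_def)
    then show "continuous_on UNIV (\<lambda>t. X' t \<omega>)" "continuous_on UNIV (\<lambda>t. W' t \<omega>)" by blast+
  qed
  have incM [measurable]: "(\<lambda>\<omega>. W t \<omega> - W s \<omega>) \<in> borel_measurable M" "(\<lambda>\<omega>. W' t \<omega> - W' s \<omega>) \<in> borel_measurable M"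
    if "0 \<le> s" "0 \<le> t" for s t
  proof -
    have "W s \<in> borel_measurable M" "W t \<in> borel_measurable M" "W' s \<in> borel_measurable M" "W' t \<in> borel_measurable M"
      using W_ad that mM[OF ad(2)] mM[of "W s" s] mM[of "W t" t] by (simp_all add: adapted_process_def)
    then show "(\<lambda>\<omega>. W t \<omega> - W s \<omega>) \<in> borel_measurable M" "(\<lambda>\<omega>. W' t \<omega> - W' s \<omega>) \<in> borel_measurable M"
      by simp_all
  qed
  have inc: "AE \<omega> in M. W t \<omega> - W s \<omega> = W' t \<omega> - W' s \<omega>" if "0 \<le> s" "0 \<le> t" for s t
    using AE_G by eventually_elim (simp add: W' that)
  have "diffusion M F W' b a x X' n \<tau> \<zeta>"
  proof unfold_locales
    show "subalgebra M (F t)" for t by (rule subalg)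
    show "0 \<le> t \<Longrightarrow> W' t \<in> borel_measurable (F t)" "0 \<le> t \<Longrightarrow> X' t \<in> borel_measurable (F t)" for t by (simp_all add: ad)
    show "continuous_on UNIV (\<lambda>t. W' t \<omega>)" "continuous_on UNIV (\<lambda>t. X' t \<omega>)" for \<omega> by (rule co)+
    show "continuous_on UNIV a" "continuous_on UNIV b" "a z \<noteq> 0" "simple_process F (n k) (\<tau> k) (\<zeta> k)" for z k
      by (fact a b nz sp)+
    show "distributed M lborel (\<lambda>\<omega>. W' t \<omega> - W' s \<omega>) (normal_density 0 (sqrt (t - s)))" if st: "0 \<le> s" "s < t" for s t
    proof -
      have "distr M lborel (\<lambda>\<omega>. W' t \<omega> - W' s \<omega>) = distr M lborel (\<lambda>\<omega>. W t \<omega> - W s \<omega>)"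
        by (rule distr_cong_AE) (use inc[of s t] incM[of s t] st in auto)
      then show ?thesis using W_dist[OF st] incM(2)[of s t] st by (simp add: distributed_def)
    qed
    show "indep_set (sets (F s)) {(\<lambda>\<omega>. W' t \<omega> - W' s \<omega>) -` B \<inter> space M | B. B \<in> sets borel}"
      if st: "0 \<le> s" "s < t" for s t
      unfolding indep_sets2_eq
    proof (intro conjI ballI)
      show F: "sets (F s) \<subseteq> events" using subalg[of s] by (simp add: subalgebra_def)
      show "{(\<lambda>\<omega>. W' t \<omega> - W' s \<omega>) -` B \<inter> space M | B. B \<in> sets borel} \<subseteq> events"
        using measurable_sets[OF incM(2)[of s t]] st by auto
      fix A C assume A: "A \<in> sets (F s)" and "C \<in> {(\<lambda>\<omega>. W' t \<omega> - W' s \<omega>) -` B \<inter> space M | B. B \<in> sets borel}"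
      then obtain B where B: "B \<in> sets borel" "C = (\<lambda>\<omega>. W' t \<omega> - W' s \<omega>) -` B \<inter> space M" by blast
      define C0 where "C0 = (\<lambda>\<omega>. W t \<omega> - W s \<omega>) -` B \<inter> space M"
      have m [measurable]: "A \<in> events" "C \<in> events" "C0 \<in> events"
        using A F B(1) measurable_sets[OF incM(1)[of s t] B(1)] measurable_sets[OF incM(2)[of s t] B(1)] st
        by (auto simp: B(2) C0_def)
      have CC: "AE \<omega> in M. \<omega> \<in> C \<longleftrightarrow> \<omega> \<in> C0"
        using inc[of s t] AE_space st by (auto simp: B(2) C0_def)
      have "prob (A \<inter> C) = prob (A \<inter> C0)" by (rule finite_measure_eq_AE) (use CC in auto)
      also have "\<dots> = prob A * prob C0"
        using W_indep[OF st] A B(1) unfolding indep_sets2_eq C0_def by blast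
      also have "prob C0 = prob C" by (rule finite_measure_eq_AE) (use CC in auto)
      finally show "prob (A \<inter> C) = prob A * prob C" .
    qed
    fix T :: real assume T: "0 \<le> T"
    show "tendsto_0_in_prob M (\<lambda>k \<omega>. \<integral>\<^sup>+s\<in>{0..T}.
             ennreal ((simple_value (n k) (\<tau> k) (\<zeta> k) s \<omega> - a (X' s \<omega>))\<^sup>2) \<partial>lborel)"
    proof (rule tendsto_0_in_prob_AE_eq[OF int[OF T]])
      show "AE \<omega> in M. (\<integral>\<^sup>+s\<in>{0..T}. ennreal ((simple_value (n k) (\<tau> k) (\<zeta> k) s \<omega> - a (X s \<omega>))\<^sup>2) \<partial>lborel)
        = (\<integral>\<^sup>+s\<in>{0..T}. ennreal ((simple_value (n k) (\<tau> k) (\<zeta> k) s \<omega> - a (X' s \<omega>))\<^sup>2) \<partial>lborel)" for k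
        using AE_G by eventually_elim (intro nn_integral_cong, auto simp: X' indicator_def)
    qed
    show "tendsto_0_in_prob M (\<lambda>k \<omega>.
             ennreal \<bar>x + (LBINT s:{0..T}. b (X' s \<omega>)) + simple_integral W' (n k) (\<tau> k) (\<zeta> k) T \<omega> - X' T \<omega>\<bar>)"
    proof (rule tendsto_0_in_prob_AE_eq[OF lim[OF T]])
      show "AE \<omega> in M. ennreal \<bar>simple_integral W (n k) (\<tau> k) (\<zeta> k) T \<omega> - I T \<omega>\<bar>
        = ennreal \<bar>x + (LBINT s:{0..T}. b (X' s \<omega>)) + simple_integral W' (n k) (\<tau> k) (\<zeta> k) T \<omega> - X' T \<omega>\<bar>" for k
        using AE_G
      proof eventually_elim
        case (elim \<omega>)
        have "0 \<le> \<tau> k i" if "i \<le> n k" for i using simple_process_nonneg[OF sp that] .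
        then have 1: "simple_integral W' (n k) (\<tau> k) (\<zeta> k) T \<omega> = simple_integral W (n k) (\<tau> k) (\<zeta> k) T \<omega>"
          unfolding simple_integral_def using elim T by (intro sum.cong) (auto simp: W')
        have 2: "(LBINT s:{0..T}. b (X' s \<omega>)) = (LBINT s:{0..T}. b (X s \<omega>))"
          unfolding set_lebesgue_integral_def
          by (intro Bochner_Integration.integral_cong) (auto simp: X' elim indicator_def)
        have "X' T \<omega> = x + (LBINT s:{0..T}. b (X s \<omega>)) + I T \<omega>"
          unfolding X'[OF elim T] using good[of \<omega>] elim T unfolding G_def by blast
        then show ?case unfolding 1 2 by simp
      qed
    qed
  qed
  moreover have "AE \<omega> in M. \<forall>t\<ge>0. X t \<omega> = X' t \<omega>" using AE_G by eventually_elim (simp add: X')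
  ultimately show thesis by (rule that)
qed

theorem corollary1:
  fixes M :: "'w measure" and F :: "real \<Rightarrow> 'w measure" and W :: "real \<Rightarrow> 'w \<Rightarrow> real"
    and X :: "real \<Rightarrow> real \<Rightarrow> 'w \<Rightarrow> real" and a b :: "real \<Rightarrow> real" and x y :: real
  assumes "complete_filtered_prob_space M F"
    and "wiener_process M F W"
    and "continuous_on UNIV a" and "continuous_on UNIV b" and "\<And>z. a z \<noteq> 0"
    and "\<And>z. sde_solution M F W b a z (X z)"
    and "transient b a"
  shows "((x = y \<or> (x < y \<and> - Phi_minf b a 0 = \<infinity>) \<or> (x > y \<and> Phi_pinf b a 0 = \<infinity>)) \<longrightarrow>
            exponentially_distributed M (local_time_inf a (X x) y) (psi0 b a y)) \<and>
         (x < y \<and> - Phi_minf b a 0 < \<infinity> \<longrightarrow>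
            distributed_as_bernoulli_times_exponential M (local_time_inf a (X x) y)
              (real_of_ereal (ereal (Phi b a y x) / Phi_minf b a y)) (psi0 b a y)) \<and>
         (x > y \<and> Phi_pinf b a 0 < \<infinity> \<longrightarrow>
            distributed_as_bernoulli_times_exponential M (local_time_inf a (X x) y)
              (real_of_ereal (ereal (Phi b a y x) / Phi_pinf b a y)) (psi0 b a y))"
proof -
  interpret complete_filtered_prob_space M F by fact
  obtain X' W' n \<tau> \<zeta> where D: "diffusion M F W' b a x X' n \<tau> \<zeta>" and XX: "AE \<omega> in M. \<forall>t\<ge>0. X x t \<omega> = X' t \<omega>"
    by (rule continuous_modification[OF assms(1-6)])
  interpret D: diffusion M F W' b a x X' n \<tau> \<zeta> by fact
  interpret C: diffusion_coefficients b a by unfold_locales (fact assms(3-5))+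
  \<comment> \<open>The scale is based at \<open>y\<close>, so that \<open>p y = 1\<close> and
    \<open>sc y = 0\<close> as the locale requires.\<close>
  interpret S: scaled_diffusion M F W' b a x X' n \<tau> \<zeta> y "C.kp y" "C.km y" "scale_density b a y" "Phi b a y"
  proof unfold_locales
    show "0 < C.kp y + C.km y" by (rule C.kpm_pos[OF assms(7)])
  qed (fact C.Phi_deriv C.scale_density_deriv C.scale_density_pos C.scale_self C.kp_props C.km_props)+
  obtain L where L: "L \<in> borel_measurable M" "AE \<omega> in M. 0 \<le> L \<omega>" "AE \<omega> in M. local_time_inf a X' y \<omega> = ereal (L \<omega>)"
    "\<And>l. 0 \<le> l \<Longrightarrow> expectation (\<lambda>\<omega>. exp (- l * L \<omega>)) = (S.\<psi> + l * S.v x) / (S.\<psi> + l)"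
    by (rule S.local_time_inf_law) blast
  define Z where "Z = local_time_inf a (X x) y"
  have ZL: "AE \<omega> in M. Z \<omega> = ereal (L \<omega>)"
    using XX L(3) unfolding Z_def by eventually_elim (metis local_time_inf_cong)
  \<comment> \<open>Measurability is not evident from the definition by iterated limits; it is
    inherited from \<open>L\<close> by completeness.\<close>
  have Z: "Z \<in> borel_measurable M"
  proof (rule borel_measurable_AE_eq)
    show "(\<lambda>\<omega>. ereal (L \<omega>)) \<in> borel_measurable M" using L(1) by simp
    show "AE \<omega> in M. ereal (L \<omega>) = Z \<omega>" using ZL by eventually_elim simp
  qed
  have \<psi>: "S.\<psi> = psi0 b a y" by (simp add: S.\<psi>_def C.psi0_eq)
  have law: "distributed_as_bernoulli_times_exponential M Z (S.v x) (psi0 b a y)"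
    "S.v x = 0 \<Longrightarrow> exponentially_distributed M Z (psi0 b a y)"
    by (rule law_of_Laplace_transform[OF L(1,2) Z ZL L(4) S.\<psi>_pos S.v_bounds(1) less_imp_le[OF S.v_bounds(2)], unfolded \<psi>]; assumption)+
  \<comment> \<open>\<open>S.v x\<close> is the atom at 0. It equals \<open>Phi b a y x\<close>
    divided by the limit of the scale at the end on the side of \<open>x\<close>, and is 0 if that
    limit is infinite.\<close>
  have below: "S.v x = - C.km y * Phi b a y x" if "x \<le> y" by (rule S.v_eq(2)[OF C.Phi_sign(1)[OF that]])
  have above: "S.v x = C.kp y * Phi b a y x" if "y \<le> x" by (rule S.v_eq(1)[OF C.Phi_sign(2)[OF that]])
  show ?thesis unfolding Z_def[symmetric]
  proof (intro conjI impI; (elim disjE)?)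
    assume "x = y"
    then have "S.v x = 0" using below by (simp add: C.scale_self)
    then show "exponentially_distributed M Z (psi0 b a y)" by (rule law(2))
  next
    assume "x < y \<and> - Phi_minf b a 0 = \<infinity>"
    then have o: "x \<le> y" and k: "C.km y = 0"
      using C.km_props(3)[of y] C.Phi_minf_infinite[of 0 y] by (auto simp: ereal_uminus_eq_reorder)
    have "S.v x = 0" unfolding below[OF o] unfolding k by simp
    then show "exponentially_distributed M Z (psi0 b a y)" by (rule law(2))
  next
    assume "x > y \<and> Phi_pinf b a 0 = \<infinity>"
    then have o: "y \<le> x" and k: "C.kp y = 0" using C.kp_props(3)[of y] C.Phi_pinf_infinite[of 0 y] by auto
    have "S.v x = 0" unfolding above[OF o] unfolding k by simp
    then show "exponentially_distributed M Z (psi0 b a y)" by (rule law(2))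
  next
    assume "x < y \<and> - Phi_minf b a 0 < \<infinity>"
    then have "real_of_ereal (ereal (Phi b a y x) / Phi_minf b a y) = S.v x" by (simp add: below C.km_props(7))
    then show "distributed_as_bernoulli_times_exponential M Z (real_of_ereal (ereal (Phi b a y x) / Phi_minf b a y)) (psi0 b a y)"
      using law(1) by simp
  next
    assume "x > y \<and> Phi_pinf b a 0 < \<infinity>"
    then have "real_of_ereal (ereal (Phi b a y x) / Phi_pinf b a y) = S.v x" by (simp add: above C.kp_props(7))
    then show "distributed_as_bernoulli_times_exponential M Z (real_of_ereal (ereal (Phi b a y x) / Phi_pinf b a y)) (psi0 b a y)"
      using law(1) by simp
  qed
qed

end
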